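(* Let $w$ be a solution of the variable coefficient thin obstacle problem $$\partial_i a^{ij}\partial_j w=0\ \text{ in }B_1^+,\qquad w\ge0,\ \ -\partial_{n+1}w\ge0,\ \ w\,\partial_{n+1}w=0\ \text{ on }B_1',$$ under the standing assumptions listed in the context. For $x\in B_1'$ let $\kappa_x$ be the vanishing order of $w$ at $x$. Then the mapping $B_1'\ni x\mapsto\kappa_x$ is upper semi-continuous.
   Context: $n\ge1$, Einstein summation. $B_r^+(x_0)=\{x\in\mathbb{R}^{n+1}:x_{n+1}\ge0,\ |x-x_0|<r\}$ for $x_0=(x_0',0)$, $B_r^+=B_r^+(0)$, $B_r'=B_r^+\cap\{x_{n+1}=0\}$, $A_{r,R}^+(x_0)=B_R^+(x_0)\setminus B_r^+(x_0)$. Standing assumptions: (A0) $\|w\|_{L^2(B_1^+)}=1$; (A1) $a^{i,n+1}(x',0)=0$ on $\{x_{n+1}=0\}$ for $i=1,\dots,n$; (A2) $a^{ij}$ is symmetric and uniformly elliptic with eigenvalues in $[1/2,2]$; (A3) $a^{ij}\in W^{1,p}(B_1^+)$ for some $p\in(n+1,\infty]$; (A4) $a^{ij}(0)=\delta^{ij}$; (W) $w\in C^{1,\alpha}$ (locally up to $B_1'$) for some $\alpha\in(0,\frac12]$. The equation is understood weakly. Vanishing order: $$\kappa_{x_0}=\limsup_{r\to0_+}\frac{\ln\Big(\frac{1}{|A^+_{r/2,r}(x_0)|}\int_{A^+_{r/2,r}(x_0)}w^2\Big)^{1/2}}{\ln r}\in[-\infty,\infty].$$ *)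

theory Defs
  imports "HOL-Analysis.Analysis"
begin

text \<open>
  A point \<open>x = (x', x\<^sub>n\<^sub>+\<^sub>1)\<close> of \<open>(n+1)\<close>-dimensional space is an element of \<open>real ^ ('n option)\<close> with
  \<open>n = CARD('n) \<ge> 1\<close>: the indices \<open>Some i\<close> are the tangential directions \<open>1, \<dots>, n\<close>, and \<open>None\<close>
  is the normal direction \<open>n+1\<close>.
\<close>

definition half_ball :: "real ^ ('n::finite option) \<Rightarrow> real \<Rightarrow> (real ^ ('n option)) set"
  where "half_ball x0 r = {x. x $ None \<ge> 0 \<and> dist x x0 < r}"

definition flat_ball :: "real \<Rightarrow> (real ^ ('n::finite option)) set"
  where "flat_ball r = half_ball 0 r \<inter> {x. x $ None = 0}"

definition half_annulus ::
  "real ^ ('n::finite option) \<Rightarrow> real \<Rightarrow> real \<Rightarrow> (real ^ ('n option)) set"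
  where "half_annulus x0 r R = half_ball x0 R - half_ball x0 r"


text \<open>
  Differentiability is relative to \<open>S\<close>; at a point of the flat boundary of a half ball the normal
  derivative is thus the one-sided one.
\<close>

definition partial_deriv :: "(real ^ 'm) set \<Rightarrow> 'm::finite \<Rightarrow> (real ^ 'm \<Rightarrow> real) \<Rightarrow> real ^ 'm \<Rightarrow> real"
  where "partial_deriv S i f x = frechet_derivative f (at x within S) (axis i 1)"

primrec times_differentiable :: "nat \<Rightarrow> (real ^ 'm::finite \<Rightarrow> real) \<Rightarrow> bool"
  where
    "times_differentiable 0 f \<longleftrightarrow> continuous_on UNIV f"
  | "times_differentiable (Suc k) f \<longleftrightarrow>
       f differentiable_on UNIV \<and> (\<forall>i. times_differentiable k (partial_deriv UNIV i f))"

definition test_functions :: "(real ^ 'm::finite) set \<Rightarrow> (real ^ 'm \<Rightarrow> real) set"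
  where "test_functions U =
    {\<phi>. (\<forall>k. times_differentiable k \<phi>) \<and>
         compact (closure {x. \<phi> x \<noteq> 0}) \<and> closure {x. \<phi> x \<noteq> 0} \<subseteq> U}"

definition C1_holder_locally :: "real \<Rightarrow> (real ^ 'm::finite) set \<Rightarrow> (real ^ 'm \<Rightarrow> real) \<Rightarrow> bool"
  where "C1_holder_locally \<alpha> S f \<longleftrightarrow>
    f differentiable_on S \<and>
    (\<forall>K i. compact K \<and> K \<subseteq> S \<longrightarrow>
      (\<exists>C. \<forall>x\<in>K. \<forall>y\<in>K.
        \<bar>partial_deriv S i f x - partial_deriv S i f y\<bar> \<le> C * dist x y powr \<alpha>))"


definition in_Lp :: "ereal \<Rightarrow> (real ^ 'm::finite) set \<Rightarrow> (real ^ 'm \<Rightarrow> real) \<Rightarrow> bool"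
  where "in_Lp p U f \<longleftrightarrow>
    f \<in> borel_measurable (lebesgue_on U) \<and>
    (if p = \<infinity> then \<exists>C. AE x in lebesgue_on U. \<bar>f x\<bar> \<le> C
     else integrable (lebesgue_on U) (\<lambda>x. \<bar>f x\<bar> powr real_of_ereal p))"

definition L2_norm_on :: "(real ^ 'm::finite) set \<Rightarrow> (real ^ 'm \<Rightarrow> real) \<Rightarrow> real"
  where "L2_norm_on U f = sqrt (LINT x|lebesgue_on U. (f x)\<^sup>2)"

definition weak_partial_deriv ::
  "(real ^ 'm::finite) set \<Rightarrow> 'm \<Rightarrow> (real ^ 'm \<Rightarrow> real) \<Rightarrow> (real ^ 'm \<Rightarrow> real) \<Rightarrow> bool"
  where "weak_partial_deriv U i u g \<longleftrightarrow>
    (\<forall>\<phi>\<in>test_functions U.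
      (LINT x|lebesgue_on U. u x * partial_deriv UNIV i \<phi> x) = - (LINT x|lebesgue_on U. g x * \<phi> x))"

text \<open>The set \<open>U\<close> is meant to be open.\<close>

definition in_W1p :: "ereal \<Rightarrow> (real ^ 'm::finite) set \<Rightarrow> (real ^ 'm \<Rightarrow> real) \<Rightarrow> bool"
  where "in_W1p p U u \<longleftrightarrow>
    in_Lp p U u \<and> (\<forall>i. \<exists>g. in_Lp p U g \<and> weak_partial_deriv U i u g)"


definition eigenvalue_of :: "real ^ 'm ^ 'm::finite \<Rightarrow> real \<Rightarrow> bool"
  where "eigenvalue_of A \<mu> \<longleftrightarrow> (\<exists>v. v \<noteq> 0 \<and> A *v v = \<mu> *\<^sub>R v)"

text \<open>
  The weak form of \<open>\<partial>\<^sub>i a\<^sup>i\<^sup>j \<partial>\<^sub>j w = 0\<close> in the interior of \<open>S\<close>. The solutions considered here are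
  differentiable on \<open>S\<close>, so their classical gradient is used.
\<close>

definition weak_solution_on ::
  "(real ^ 'm::finite) set \<Rightarrow> (real ^ 'm \<Rightarrow> real ^ 'm ^ 'm) \<Rightarrow> (real ^ 'm \<Rightarrow> real) \<Rightarrow> bool"
  where "weak_solution_on S a w \<longleftrightarrow>
    (\<forall>\<phi>\<in>test_functions (interior S).
      (LINT x|lebesgue_on (interior S).
        (\<Sum>i\<in>UNIV. \<Sum>j\<in>UNIV. a x $ i $ j * partial_deriv S j w x * partial_deriv UNIV i \<phi> x)) = 0)"

definition thin_obstacle_solution ::
  "(real ^ ('n::finite option) \<Rightarrow> real ^ ('n option) ^ ('n option)) \<Rightarrow>
    (real ^ ('n option) \<Rightarrow> real) \<Rightarrow> bool"
  where "thin_obstacle_solution a w \<longleftrightarrow>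
    weak_solution_on (half_ball 0 1) a w \<and>
    (\<forall>x\<in>flat_ball 1.
      w x \<ge> 0 \<and>
      - partial_deriv (half_ball 0 1) None w x \<ge> 0 \<and>
      w x * partial_deriv (half_ball 0 1) None w x = 0)"


text \<open>
  The logarithm on \<open>[0, \<infinity>)\<close> with \<open>ln 0 = -\<infinity>\<close>, in contrast to the convention \<open>ln 0 = 0\<close> of the
  library; a function vanishing near \<open>x\<close> then has vanishing order \<open>+\<infinity>\<close> at \<open>x\<close>.
\<close>

definition ereal_ln :: "real \<Rightarrow> ereal"
  where "ereal_ln y = (if y = 0 then -\<infinity> else ereal (ln y))"

definition vanishing_order :: "(real ^ ('n::finite option) \<Rightarrow> real) \<Rightarrow> real ^ ('n option) \<Rightarrow> ereal"
  where "vanishing_order w x0 =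
    Limsup (at_right 0) (\<lambda>r.
      ereal_ln (sqrt (1 / measure lebesgue (half_annulus x0 (r / 2) r) *
                      (LINT x|lebesgue_on (half_annulus x0 (r / 2) r). (w x)\<^sup>2)))
      / ereal (ln r))"

definition upper_semicontinuous_on :: "'a::topological_space set \<Rightarrow> ('a \<Rightarrow> ereal) \<Rightarrow> bool"
  where "upper_semicontinuous_on S f \<longleftrightarrow>
    (\<forall>x\<in>S. \<forall>c. f x < c \<longrightarrow> (\<forall>\<^sub>F y in at x within S. f y < c))"

end

theory Submission
  imports Defs
begin

text \<open>
  Fix a flat point \<open>y\<close>, put \<open>z = x - y\<close>, \<open>A = a(y)\<close>, \<open>q(z) = z \<bullet> A\<^sup>-\<^sup>1 z\<close>, \<open>d = n + 1\<close>, and compare \<open>w\<close> with its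
  dilations \<open>w(l z)\<close>. The equation may be tested with \<open>F(q) w\<close>, and for \<open>F \<ge> 0\<close>, \<open>l \<ge> 1\<close> the function
  \<open>F(q) w(l z)\<close> gives an inequality, because \<open>a\<^sup>i\<^sup>,\<^sup>n\<^sup>+\<^sup>1 = 0\<close> turns the conormal derivative into a multiple
  of \<open>\<partial>\<^sub>n\<^sub>+\<^sub>1 w \<le> 0\<close> and \<open>w \<ge> 0\<close>. Take \<open>F(q)\<close> a cutoff of \<open>q\<close> to the power \<open>- (d - 2) / 2 - \<kappa>\<close> and
  \<open>W\<^sub>h(z) = exp(- \<kappa> h) w(exp(h) z)\<close>. Since \<open>A(\<nabla>w - \<nabla>W\<^sub>h) \<bullet> (\<nabla>w - \<nabla>W\<^sub>h) \<ge> 0\<close>, the two relations yield a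
  differential inequality in \<open>h\<close> for the weighted square integral of \<open>W\<^sub>h - w\<close>: up to the ends of the
  cutoff it is bounded by the oscillation of the coefficients, which are Hoelder continuous by
  Morrey's argument, hence small at small scales. By a discrete Hardy inequality this controls \<open>w\<close>
  itself, so that for \<open>r < \<rho>\<close> the integral of \<open>w\<^sup>2\<close> over \<open>r \<le> |z| \<le> \<rho>\<close> is at most
  \<open>C \<rho>\<close> to the power \<open>d + 2 \<kappa> - \<gamma>\<close>, times \<open>1\<close> plus the integral of \<open>w\<^sup>2\<close> over \<open>|z| \<le> r\<close> divided by \<open>r\<close> to
  the power \<open>d + 2 \<kappa>\<close>, with \<open>C\<close> independent of \<open>y\<close>. If the vanishing order at \<open>y\<close> exceeds \<open>\<kappa>\<close>, the
  last quotient is bounded along a sequence \<open>r \<rightarrow> 0\<close>. The decay at rate \<open>\<kappa> - \<gamma> / 2\<close> is therefore uniform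
  in such \<open>y\<close> and passes to their limit points.
\<close>

section \<open>Integrals of continuous functions\<close>

text \<open>Testing with the radial derivative of \<open>w\<close>, as in a Rellich identity or a
  Carleman estimate, would call for second derivatives of \<open>w\<close> or for derivatives of the
  coefficients, whereas \<open>w\<close> is only C1 and the coefficients enter through a Hoelder
  bound. A finite dilation of \<open>w\<close> is as regular as \<open>w\<close> and keeps its sign
  on the flat boundary, so it is an admissible comparison function. The relation it yields is
  one-sided, but the cross term enters the square with a negative sign, so the available side is the
  needed one. The difference \<open>W h - w\<close> measures the deviation of \<open>w\<close> from
  homogeneity of degree \<open>\<kappa>\<close>. The oscillation of \<open>a\<close> gains a factor
  |z| to the power \<open>\<gamma>\<close>; in the weight improved by this gain the dilation is a
  strict contraction, which is why a bound on the increment bounds the function itself. The price is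
  the loss of \<open>\<gamma>\<close> in the decay. As a Hoelder exponent may be lowered at will,
  the loss can be kept below the gap between \<open>\<kappa>\<close> and the order at the limit
  point.\<close>

lemma integrable_on_compact:
  fixes f :: "'a::euclidean_space \<Rightarrow> real"
  assumes "compact K" "continuous_on K f"
  shows "integrable (lebesgue_on K) f"
proof -
  have "integrable lborel (\<lambda>x. indicator K x *\<^sub>R f x)"
    using assms by (rule borel_integrable_compact)
  then have "integrable lebesgue (\<lambda>x. indicator K x *\<^sub>R f x)"
    using integrable_completion borel_measurable_integrable by blast
  then show ?thesis
    using assms(1) by (simp add: integrable_restrict_space borel_compact)
qed

lemma integral_lebesgue_on_lborel:
  fixes f :: "'a::euclidean_space \<Rightarrow> real"
  assumes "compact K" "continuous_on K f"
  shows "(LINT x|lebesgue_on K. f x) = (LINT x|lborel. indicator K x * f x)"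
proof -
  have "(\<lambda>x. indicator K x *\<^sub>R f x) \<in> borel_measurable lborel"
    using borel_integrable_compact[OF assms] by (rule borel_measurable_integrable)
  then show ?thesis
    using assms(1) by (simp add: integral_restrict_space borel_compact integral_completion)
qed

lemma integral_lborel_affine:
  fixes f :: "'a::euclidean_space \<Rightarrow> real"
  assumes "c \<noteq> 0" "f \<in> borel_measurable borel"
  shows "(LINT x|lborel. f x) = \<bar>c\<bar> ^ DIM('a) * (LINT x|lborel. f (t + c *\<^sub>R x))"
proof -
  have "(LINT x|lborel. f x) =
      (LINT x|density (distr lborel borel (\<lambda>x. t + c *\<^sub>R x)) (\<lambda>_. \<bar>c\<bar> ^ DIM('a)). f x)"
    using lborel_affine[OF assms(1), of t] by simp
  also have "\<dots> = \<bar>c\<bar> ^ DIM('a) * (LINT x|lborel. f (t + c *\<^sub>R x))"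
    using assms(2) by (simp add: integral_density integral_distr)
  finally show ?thesis .
qed

text \<open>\<open>K\<close> and \<open>K'\<close> need not correspond under the map; only the
  integrands extended by zero must agree. So one fixed half ball can serve before and after a
  dilation when the integrand vanishes far out.\<close>

lemma integral_affine_compact:
  fixes f :: "'a::euclidean_space \<Rightarrow> real"
  assumes "c \<noteq> 0" "compact K" "compact K'" "continuous_on K f"
    and "continuous_on K' (\<lambda>x. f (t + c *\<^sub>R x))"
    and eq: "\<And>x. indicator K (t + c *\<^sub>R x) * f (t + c *\<^sub>R x) = indicator K' x * f (t + c *\<^sub>R x)"
  shows "(LINT x|lebesgue_on K. f x) = \<bar>c\<bar> ^ DIM('a) * (LINT x|lebesgue_on K'. f (t + c *\<^sub>R x))"
proof -
  have m: "(\<lambda>x. indicator K x * f x) \<in> borel_measurable borel"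
    using borel_measurable_integrable[OF borel_integrable_compact[OF assms(2,4)]] by simp
  show ?thesis
    using integral_lborel_affine[OF assms(1) m, of t]
    unfolding integral_lebesgue_on_lborel[OF assms(2,4)] integral_lebesgue_on_lborel[OF assms(3,5)] eq .
qed

lemma integral_lebesgue_on_superset:
  fixes f :: "'a::euclidean_space \<Rightarrow> real"
  assumes "K \<subseteq> L" "K \<in> sets lebesgue" "L \<in> sets lebesgue" "\<And>x. x \<in> L - K \<Longrightarrow> f x = 0"
  shows "(LINT x|lebesgue_on K. f x) = (LINT x|lebesgue_on L. f x)"
  using assms
  by (auto simp: integral_restrict_space indicator_def intro!: Bochner_Integration.integral_cong)

text \<open>Dominated convergence for the difference quotients, which the mean value theorem bounds
  by \<open>B\<close>. Continuity of \<open>f'\<close> is asked at \<open>t0\<close> only, where it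
  gives the measurability of the limit.\<close>

lemma DERIV_under_integral:
  fixes f :: "real \<Rightarrow> 'a::euclidean_space \<Rightarrow> real"
  assumes K: "compact K" and I: "open I" "t0 \<in> I" "convex I"
    and cont: "\<And>t. t \<in> I \<Longrightarrow> continuous_on K (f t)"
    and cont': "continuous_on K (f' t0)"
    and der: "\<And>t x. t \<in> I \<Longrightarrow> x \<in> K \<Longrightarrow> ((\<lambda>t. f t x) has_real_derivative f' t x) (at t)"
    and bound: "\<And>t x. t \<in> I \<Longrightarrow> x \<in> K \<Longrightarrow> \<bar>f' t x\<bar> \<le> B"
  shows "((\<lambda>t. LINT x|lebesgue_on K. f t x) has_real_derivative (LINT x|lebesgue_on K. f' t0 x)) (at t0)"
proof -
  have Bdiff: "\<bar>f s x - f t0 x\<bar> \<le> B * \<bar>s - t0\<bar>" if "s \<in> I" "x \<in> K" for s x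
  proof -
    have "norm (f s x - f t0 x) \<le> B * norm (s - t0)"
      using field_differentiable_bound[OF I(3), of "\<lambda>t. f t x" "\<lambda>t. f' t x" B s t0]
        der[THEN has_field_derivative_at_within, OF _ that(2)] bound[OF _ that(2)] that I(2) by simp
    then show ?thesis by (simp only: real_norm_def)
  qed
  have seq: "(\<lambda>n. ((LINT x|lebesgue_on K. f (X n) x) - (LINT x|lebesgue_on K. f t0 x)) / (X n - t0))
     \<longlonglongrightarrow> (LINT x|lebesgue_on K. f' t0 x)"
    if X: "\<forall>n. X n \<noteq> t0" "X \<longlonglongrightarrow> t0" for X
  proof -
    obtain N where N: "\<And>n. n \<ge> N \<Longrightarrow> X n \<in> I"
      using topological_tendstoD[OF X(2) I(1,2)] by (auto simp: eventually_sequentially)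
    have "(\<lambda>n. LINT x|lebesgue_on K. (f (X (n+N)) x - f t0 x) / (X (n+N) - t0))
        \<longlonglongrightarrow> (LINT x|lebesgue_on K. f' t0 x)"
    proof (rule integral_dominated_convergence)
      show "f' t0 \<in> borel_measurable (lebesgue_on K)"
        using integrable_on_compact[OF K cont'] by auto
      show "(\<lambda>x. (f (X (n+N)) x - f t0 x) / (X (n+N) - t0)) \<in> borel_measurable (lebesgue_on K)" for n
      proof -
        have "f (X (n+N)) \<in> borel_measurable (lebesgue_on K)" "f t0 \<in> borel_measurable (lebesgue_on K)"
          using integrable_on_compact[OF K cont] N I(2) by auto
        then show ?thesis by measurable
      qed
      show "integrable (lebesgue_on K) (\<lambda>_. B)"
        by (intro integrable_on_compact K continuous_intros)
      show "AE x in lebesgue_on K. (\<lambda>n. (f (X (n+N)) x - f t0 x) / (X (n+N) - t0)) \<longlonglongrightarrow> f' t0 x"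
      proof (rule AE_I2)
        fix x assume "x \<in> space (lebesgue_on K)"
        then have "((\<lambda>t. (f t x - f t0 x) / (t - t0)) \<longlongrightarrow> f' t0 x) (at t0)"
          using der[OF I(2)] by (simp add: has_field_derivative_iff)
        moreover have "filterlim (\<lambda>n. X (n+N)) (at t0) sequentially"
          using X LIMSEQ_ignore_initial_segment[OF X(2), of N] by (auto simp: filterlim_at)
        ultimately show "(\<lambda>n. (f (X (n+N)) x - f t0 x) / (X (n+N) - t0)) \<longlonglongrightarrow> f' t0 x"
          by (rule filterlim_compose)
      qed
      show "AE x in lebesgue_on K. norm ((f (X (n+N)) x - f t0 x) / (X (n+N) - t0)) \<le> B" for n
        using Bdiff[OF N] X(1) by (intro AE_I2) (auto simp: divide_simps abs_mult)
    qed
    moreover have eq: "(LINT x|lebesgue_on K. (f (X (n+N)) x - f t0 x) / (X (n+N) - t0)) =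
       ((LINT x|lebesgue_on K. f (X (n+N)) x) - (LINT x|lebesgue_on K. f t0 x)) / (X (n+N) - t0)" for n
      using integrable_on_compact[OF K cont] N I(2) by (simp add: Bochner_Integration.integral_diff)
    ultimately have "(\<lambda>n. ((LINT x|lebesgue_on K. f (X (n+N)) x) - (LINT x|lebesgue_on K. f t0 x)) / (X (n+N) - t0))
        \<longlonglongrightarrow> (LINT x|lebesgue_on K. f' t0 x)"
      by (simp only: eq)
    then show ?thesis
      by (rule LIMSEQ_offset[where k=N])
  qed
  show ?thesis
    unfolding has_field_derivative_iff
    using seq by (auto simp: tendsto_at_iff_sequentially o_def)
qed

section \<open>Integral identities under dilations\<close>

lemma continuous_on_matrix_vector_mult [continuous_intros]:
  fixes M :: "'a::topological_space \<Rightarrow> real ^ 'n::finite ^ 'm::finite"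
  assumes "continuous_on S M" "continuous_on S x"
  shows "continuous_on S (\<lambda>z. M z *v x z)"
  unfolding matrix_vector_mult_def
  by (intro continuous_on_vec_lambda continuous_on_sum continuous_on_mult continuous_on_component assms)

text \<open>Seen from a flat boundary point a half space is a closed cone, so dilations about that
  point preserve it and integrals over it scale without boundary terms.\<close>

locale cone_setting =
  fixes H :: "(real ^ 'm::finite) set" and R :: real
  assumes closed_H: "closed H" and cone_H: "\<And>z t. z \<in> H \<Longrightarrow> 0 < t \<Longrightarrow> t *\<^sub>R z \<in> H"
    and R_pos: "0 < R"
begin

abbreviation "hb \<equiv> H \<inter> cball 0 R"

lemma compact_hb: "compact hb"
  using closed_H by (simp add: closed_Int_compact)

text \<open>The support radius \<open>R / 2\<close> and the bound \<open>1 / 2 < l\<close> fit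
  together: \<open>norm (l *\<^sub>R z) < R / 2\<close> forces \<open>norm z < R\<close>, so the
  dilated integrand still lives in \<open>hb\<close>.\<close>

lemma scale_integral:
  assumes "1 / 2 < l" "l \<le> 2" and G: "continuous_on hb G" "continuous_on hb (\<lambda>z. G (l *\<^sub>R z))"
    and far: "\<And>z. z \<in> H \<Longrightarrow> norm z \<ge> R / 2 \<Longrightarrow> G z = 0"
  shows "(LINT z|lebesgue_on hb. G (l *\<^sub>R z)) = l powr (- real CARD('m)) * (LINT z|lebesgue_on hb. G z)"
proof -
  have l: "0 < l" using assms(1) by simp
  have "(LINT z|lebesgue_on hb. G z) = \<bar>l\<bar> ^ DIM(real ^ 'm) * (LINT z|lebesgue_on hb. G (0 + l *\<^sub>R z))"
  proof (rule integral_affine_compact)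
    fix z
    have H: "l *\<^sub>R z \<in> H \<longleftrightarrow> z \<in> H"
      using cone_H[of z l] cone_H[of "l *\<^sub>R z" "1/l"] l by auto
    show "indicator hb (0 + l *\<^sub>R z) * G (0 + l *\<^sub>R z) = indicator hb z * G (0 + l *\<^sub>R z)"
    proof (cases "z \<in> H \<and> norm (l *\<^sub>R z) < R / 2")
      case True
      have "norm z \<le> R"
      proof (rule ccontr)
        assume "\<not> norm z \<le> R"
        then have "R/2 < l * norm z" using assms(1) R_pos mult_strict_mono[of "1/2" l R "norm z"] by auto
        then show False using True l by simp
      qed
      then show ?thesis using True H R_pos by (auto simp: indicator_def)
    next
      case False
      then show ?thesis using far[of "l *\<^sub>R z"] H by (cases "z \<in> H") auto
    qed
  qed (use l G compact_hb in auto)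
  then show ?thesis using l by (simp add: powr_minus powr_realpow)
qed

lemma continuous_scaled:
  fixes F :: "real ^ 'm \<Rightarrow> real"
  assumes that: "continuous_on hb F" "\<And>z. z \<in> H \<Longrightarrow> norm z \<ge> R/2 \<Longrightarrow> F z = 0" "0 < t"
  shows "continuous_on hb (\<lambda>z. F (t *\<^sub>R z))"
  proof -
    let ?D1 = "hb \<inter> {z. norm (t *\<^sub>R z) \<le> R}" and ?D2 = "hb \<inter> {z. norm (t *\<^sub>R z) \<ge> R / 2}"
    have "continuous_on (?D1 \<union> ?D2) (\<lambda>z. F (t *\<^sub>R z))"
    proof (rule continuous_on_closed_Un)
      show "closed ?D1" "closed ?D2"
        by (intro closed_Int closed_H closed_cball closed_Collect_le continuous_intros)+
      show "continuous_on ?D1 (\<lambda>z. F (t *\<^sub>R z))"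
        by (rule continuous_on_compose2[OF that(1)], intro continuous_intros) (use that(3) cone_H in auto)
      have "continuous_on ?D2 (\<lambda>z. F (t *\<^sub>R z)) \<longleftrightarrow> continuous_on ?D2 (\<lambda>_. 0 :: real)"
        by (rule continuous_on_cong) (use that cone_H in auto)
      then show "continuous_on ?D2 (\<lambda>z. F (t *\<^sub>R z))" by simp
    qed
    moreover have "?D1 \<union> ?D2 = hb" using R_pos by auto
    ultimately show ?thesis by simp
  qed

text \<open>\<open>\<Gamma>\<close> is the derivative z . grad G along rays, so this is the
  divergence theorem on a cone. It comes from differentiating the scaling law of the integral at
  \<open>t = 1\<close>, which asks for differentiability along rays only.\<close>

lemma euler_identity:
  fixes G \<Gamma> :: "real ^ 'm \<Rightarrow> real"
  assumes cG: "continuous_on hb G" and c\<Gamma>: "continuous_on hb \<Gamma>"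
    and far: "\<And>z. norm z \<ge> R / 2 \<Longrightarrow> G z = 0" "\<And>z. norm z \<ge> R / 2 \<Longrightarrow> \<Gamma> z = 0"
    and derG: "\<And>z t. z \<in> H \<Longrightarrow> 0 < t \<Longrightarrow> ((\<lambda>t. G (t *\<^sub>R z)) has_real_derivative \<Gamma> (t *\<^sub>R z) / t) (at t)"
  shows "(LINT z|lebesgue_on hb. \<Gamma> z) = - real CARD('m) * (LINT z|lebesgue_on hb. G z)"
proof -
  obtain B where B: "\<And>z. z \<in> hb \<Longrightarrow> \<bar>\<Gamma> z\<bar> \<le> B"
    using compact_imp_bounded[OF compact_continuous_image[OF c\<Gamma> compact_hb]]
    unfolding bounded_iff by (metis imageI real_norm_def)
  have B': "\<bar>\<Gamma> z\<bar> \<le> max B 0" if "z \<in> H" for z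
    using that B[of z] far(2)[of z] R_pos by (cases "norm z \<le> R") auto
  have "((\<lambda>t. LINT z|lebesgue_on hb. G (t *\<^sub>R z)) has_real_derivative (LINT z|lebesgue_on hb. \<Gamma> (1 *\<^sub>R z) / 1)) (at 1)"
  proof (rule DERIV_under_integral[where I="{1/2<..<2}" and B="2 * max B 0"])
    show "continuous_on hb (\<lambda>z. G (t *\<^sub>R z))" if "t \<in> {1/2<..<2}" for t
      using that far by (intro continuous_scaled cG) auto
    show "continuous_on hb (\<lambda>z. \<Gamma> (1 *\<^sub>R z) / 1)" using c\<Gamma> by simp
    show "((\<lambda>t. G (t *\<^sub>R x)) has_real_derivative \<Gamma> (t *\<^sub>R x) / t) (at t)" if "t \<in> {1/2<..<2}" "x \<in> hb" for t x
      using derG that by auto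
    show "\<bar>\<Gamma> (t *\<^sub>R x) / t\<bar> \<le> 2 * max B 0" if "t \<in> {1/2<..<2}" "x \<in> hb" for t x
    proof -
      have "\<bar>\<Gamma> (t *\<^sub>R x)\<bar> \<le> max B 0" using that B' cone_H by auto
      moreover have "max B 0 \<le> 2 * max B 0 * t" using that mult_right_mono[of 1 "2*t" "max B 0"]
        by (simp only: mult.assoc mult.commute[of "max B 0"]) auto
      ultimately show ?thesis using that by (auto simp: abs_divide divide_le_eq)
    qed
  qed (use compact_hb in auto)
  then have 1: "((\<lambda>t. LINT z|lebesgue_on hb. G (t *\<^sub>R z)) has_real_derivative (LINT z|lebesgue_on hb. \<Gamma> z)) (at 1)"
    by simp
  have "((\<lambda>t. t powr (- real CARD('m)) * (LINT z|lebesgue_on hb. G z)) has_real_derivative - real CARD('m) * (LINT z|lebesgue_on hb. G z)) (at 1)"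
    by (auto intro!: derivative_eq_intros)
  then have 2: "((\<lambda>t. LINT z|lebesgue_on hb. G (t *\<^sub>R z)) has_real_derivative - real CARD('m) * (LINT z|lebesgue_on hb. G z)) (at 1)"
    by (rule has_field_derivative_transform_within_open[where S="{1/2<..<2}"])
      (use far in \<open>auto intro!: scale_integral[symmetric] cG continuous_scaled\<close>)
  show ?thesis using DERIV_unique[OF 1 2] .
qed

end

text \<open>The origin is a flat point \<open>y\<close> of the obstacle problem, \<open>A = a y\<close> and \<open>P\<close> is the inverse of \<open>A\<close>.
  \<open>outer\<close> is the equation tested with \<open>F(q) w\<close> and \<open>outer_dilated\<close> the variational inequality for
  \<open>F(q) w(l z)\<close>, where \<open>q = z \<bullet> P z\<close>; the gradient of \<open>q\<close> is \<open>2 P z\<close>.\<close>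

locale dilation_setting = cone_setting H R
  for H :: "(real ^ 'm::finite) set" and R :: real +
  fixes w :: "real ^ 'm \<Rightarrow> real" and g :: "real ^ 'm \<Rightarrow> real ^ 'm"
    and a :: "real ^ 'm \<Rightarrow> real ^ 'm ^ 'm" and A P :: "real ^ 'm ^ 'm" and Ca \<gamma> :: real
  assumes gamma: "0 < \<gamma>" "\<gamma> \<le> 1" and Ca_nonneg: "0 \<le> Ca"
    and cont_w: "continuous_on (H \<inter> cball 0 (2 * R)) w"
    and cont_g: "continuous_on (H \<inter> cball 0 (2 * R)) g"
    and cont_a: "continuous_on (H \<inter> cball 0 (2 * R)) a"
    and ray: "\<And>z t. z \<in> H \<Longrightarrow> 0 < t \<Longrightarrow> norm (t *\<^sub>R z) < 2 * R \<Longrightarrow>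
      ((\<lambda>t. w (t *\<^sub>R z)) has_real_derivative g (t *\<^sub>R z) \<bullet> z) (at t)"
    and A_sym: "\<And>x y. (A *v x) \<bullet> y = x \<bullet> (A *v y)"
    and A_nonneg: "\<And>x. 0 \<le> (A *v x) \<bullet> x"
    and AP: "\<And>z. A *v (P *v z) = z"
    and P_lower: "\<And>z. (norm z)\<^sup>2 / 2 \<le> z \<bullet> (P *v z)"
    and P_upper: "\<And>z. norm (P *v z) \<le> 2 * norm z"
    and a_lower: "\<And>z x. z \<in> H \<inter> cball 0 R \<Longrightarrow> (norm x)\<^sup>2 / 2 \<le> (a z *v x) \<bullet> x"
    and a_upper: "\<And>z x. z \<in> H \<inter> cball 0 R \<Longrightarrow> norm (a z *v x) \<le> 2 * norm x"
    and a_holder: "\<And>z x. z \<in> H \<inter> cball 0 R \<Longrightarrow>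
      norm (a z *v x - A *v x) \<le> Ca * norm z powr \<gamma> * norm x"
    and outer: "\<And>F F'. (\<And>q. (F has_real_derivative F' q) (at q)) \<Longrightarrow> continuous_on UNIV F' \<Longrightarrow>
      (\<And>z. norm z \<ge> R / 2 \<Longrightarrow> F (z \<bullet> (P *v z)) = 0 \<and> F' (z \<bullet> (P *v z)) = 0) \<Longrightarrow>
      (LINT z|lebesgue_on (H \<inter> cball 0 R). F (z \<bullet> (P *v z)) * ((a z *v g z) \<bullet> g z)
         + 2 * F' (z \<bullet> (P *v z)) * w z * ((a z *v g z) \<bullet> (P *v z))) = 0"
    and outer_dilated: "\<And>F F' l. (\<And>q. (F has_real_derivative F' q) (at q)) \<Longrightarrow> continuous_on UNIV F' \<Longrightarrow>
      (\<And>q. 0 \<le> F q) \<Longrightarrow>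
      (\<And>z. norm z \<ge> R / 2 \<Longrightarrow> F (z \<bullet> (P *v z)) = 0 \<and> F' (z \<bullet> (P *v z)) = 0) \<Longrightarrow>
      1 \<le> l \<Longrightarrow> l \<le> 2 \<Longrightarrow>
      0 \<le> (LINT z|lebesgue_on (H \<inter> cball 0 R). F (z \<bullet> (P *v z)) * l * ((a z *v g z) \<bullet> g (l *\<^sub>R z))
         + 2 * F' (z \<bullet> (P *v z)) * w (l *\<^sub>R z) * ((a z *v g z) \<bullet> (P *v z)))"
begin

section \<open>Weights that depend on \<open>ln q\<close>\<close>

abbreviation "q z \<equiv> z \<bullet> (P *v z)"

text \<open>Weights are functions of \<open>s = ln q\<close>, so that the dilation by \<open>exp h\<close> becomes the shift by \<open>2 * h\<close>.\<close>

definition rad :: "(real \<Rightarrow> real) \<Rightarrow> real ^ 'm \<Rightarrow> real"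
  where "rad Y z = (if 0 < q z then Y (ln (q z)) else 0)"

text \<open>Since \<open>(norm z)\<^sup>2 \<le> 2 * q z\<close>, the region
  \<open>norm z \<ge> R / 2\<close> lies in \<open>ln (q z) \<ge> smax\<close>; profiles vanish
  there, as \<open>outer\<close> and \<open>scale_integral\<close> require.\<close>

definition smax :: real where "smax = ln (R\<^sup>2 / 8)"

text \<open>Vanishing for very negative \<open>s\<close> keeps the weight away from the origin,
  where \<open>ln q\<close> tends to minus infinity and negative powers of \<open>q\<close> blow
  up.\<close>

definition profile :: "(real \<Rightarrow> real) \<Rightarrow> bool"
  where "profile Y \<longleftrightarrow> continuous_on UNIV Y \<and> (\<exists>s0. \<forall>s\<le>s0. Y s = 0) \<and> (\<forall>s\<ge>smax. Y s = 0)"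

lemma cont_hb: "continuous_on hb w" "continuous_on hb g" "continuous_on hb a"
  using R_pos by (auto intro!: continuous_on_subset[OF cont_w] continuous_on_subset[OF cont_g]
      continuous_on_subset[OF cont_a])

lemma cont_dilated:
  assumes "0 < l" "l \<le> 2" and "continuous_on (H \<inter> cball 0 (2 * R)) f"
  shows "continuous_on hb (\<lambda>z. f (l *\<^sub>R z))"
proof (rule continuous_on_compose2[OF assms(3)])
  show "(\<lambda>z. l *\<^sub>R z) ` hb \<subseteq> H \<inter> cball 0 (2 * R)"
    using assms cone_H R_pos by (auto intro!: mult_mono)
qed (intro continuous_intros)

lemma q_scale: "q (l *\<^sub>R z) = l\<^sup>2 * q z"
  by (simp add: matrix_vector_mult_scaleR power2_eq_square)

lemma q_pos: "0 < q z \<longleftrightarrow> z \<noteq> 0"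
proof (cases "z = 0")
  case False
  then have "0 < (norm z)\<^sup>2 / 2" by simp
  then show ?thesis using P_lower[of z] False by linarith
qed simp

lemma cont_q: "continuous_on S (\<lambda>z. q z)"
  by (intro continuous_intros matrix_vector_mult_linear_continuous_on)

lemma norm_le_q: "(norm z)\<^sup>2 \<le> 2 * q z"
  using P_lower[of z] by simp

lemma rad_nonzero: "z \<noteq> 0 \<Longrightarrow> rad Y z = Y (ln (q z))"
  by (simp add: rad_def q_pos)

lemma rad_zero [simp]: "rad Y 0 = 0"
  by (simp add: rad_def)

lemma rad_scale:
  assumes "0 < l"
  shows "rad Y (l *\<^sub>R z) = rad (\<lambda>s. Y (s + 2 * ln l)) z"
proof (cases "z = 0")
  case False
  then have "ln (q (l *\<^sub>R z)) = ln (q z) + 2 * ln l"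
    unfolding q_scale using assms q_pos[of z] by (simp add: ln_mult ln_realpow)
  moreover have "l *\<^sub>R z \<noteq> 0" using False assms by simp
  ultimately show ?thesis by (simp only: rad_nonzero False not_False_eq_True)
qed simp

lemma profile_far:
  assumes "profile Y" "norm z \<ge> R / 2" shows "rad Y z = 0"
proof -
  have "R\<^sup>2 / 4 \<le> (norm z)\<^sup>2"
    using assms(2) R_pos power_mono[of "R/2" "norm z" 2] by (simp add: power_divide)
  then have "R\<^sup>2 / 8 \<le> q z" using norm_le_q[of z] by simp
  then have "smax \<le> ln (q z)"
    unfolding smax_def using R_pos by (intro ln_mono) auto
  then show ?thesis using assms(1) by (auto simp: rad_def profile_def)
qed

lemma profile_F:
  assumes Y: "profile Y" 
  shows "continuous_on UNIV (\<lambda>x. if 0 < x then Y (ln x) else 0)"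
proof -
  obtain s0 where s0: "\<And>s. s \<le> s0 \<Longrightarrow> Y s = 0" using Y by (auto simp: profile_def)
  have "continuous_on ({..exp s0} \<union> {exp s0..}) (\<lambda>x. if x \<le> exp s0 then 0 else Y (ln x))"
  proof (rule continuous_on_cases)
    show "continuous_on {exp s0..} (\<lambda>x. Y (ln x))"
    proof (rule continuous_on_compose2[of UNIV Y])
      show "continuous_on {exp s0..} ln"
        by (intro continuous_on_ln continuous_on_id ballI) (use exp_gt_zero[of s0] in force)
    qed (use Y in \<open>auto simp: profile_def\<close>)
  qed (use s0 in auto)
  moreover have "(if x \<le> exp s0 then 0 else Y (ln x)) = (if 0 < x then Y (ln x) else 0)" for x
    using s0[of "ln x"] ln_mono[of x "exp s0"] less_trans[OF exp_gt_zero, of s0 x] by auto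
  moreover have "{..exp s0} \<union> {exp s0..} = UNIV" by auto
  ultimately show ?thesis by simp
qed

lemma cont_rad: "profile Y \<Longrightarrow> continuous_on S (rad Y)"
  unfolding rad_def[abs_def]
  by (rule continuous_on_compose2[OF profile_F cont_q]) auto

lemma profile_deriv:
  assumes "profile Y" "\<And>s. (Y has_real_derivative Y' s) (at s)" "continuous_on UNIV Y'"
  shows "profile Y'"
proof -
  obtain s0 where s0: "\<And>s. s \<le> s0 \<Longrightarrow> Y s = 0" using assms(1) by (auto simp: profile_def)
  have "Y' s = 0" if "open U" "s \<in> U" "\<And>t. t \<in> U \<Longrightarrow> Y t = 0" for s U
  proof -
    have "(Y has_real_derivative 0) (at s)"
      by (rule has_field_derivative_transform_within_open[of "\<lambda>_. 0" _ _ U]) (use that in auto)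
    then show ?thesis using assms(2) DERIV_unique by blast
  qed note * = this
  have 1: "Y' s = 0" if "s < s0" for s
    using *[of "{..<s0}" s] s0 that by auto
  have 2: "Y' s = 0" if "s > smax" for s
    using *[of "{smax<..}" s] assms(1) that by (auto simp: profile_def)
  \<comment> \<open>At the end point \<open>smax\<close> the function is known to vanish on one side
    only; continuity of \<open>Y'\<close> settles the value.\<close>
  have 3: "Y' smax = 0"
  proof (rule tendsto_unique[of "at_right smax"])
    show "(Y' \<longlongrightarrow> Y' smax) (at_right smax)"
      using assms(3) by (auto simp: continuous_on_def intro: filterlim_at_split[THEN iffD1, THEN conjunct2])
    show "(Y' \<longlongrightarrow> 0) (at_right smax)"
      by (rule tendsto_eventually) (auto simp: eventually_at_filter 2)
  qed simp
  have "Y' s = 0" if "s \<le> s0 - 1" for s using 1 that by auto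
  moreover have "Y' s = 0" if "s \<ge> smax" for s using 2 3 that by (cases "s = smax") auto
  ultimately show ?thesis using assms(3) by (auto simp: profile_def)
qed

lemma profile_mult:
  assumes "profile Y" "continuous_on UNIV f" shows "profile (\<lambda>s. Y s * f s)" "profile (\<lambda>s. f s * Y s)"
  using assms by (auto simp: profile_def intro!: continuous_intros)

lemma profile_shift:
  assumes "profile Y" "\<And>s. s \<ge> smax - c \<Longrightarrow> Y s = 0" shows "profile (\<lambda>s. Y (s - c))"
proof -
  obtain s0 where "\<And>s. s \<le> s0 \<Longrightarrow> Y s = 0" using assms(1) by (auto simp: profile_def)
  then have "\<forall>s\<le>s0+c. Y (s - c) = 0" by auto
  then show ?thesis
    using assms unfolding profile_def
    by (auto intro!: continuous_on_compose2[of UNIV Y] continuous_intros)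
qed

text \<open>The factor 1 / x of the chain rule is written \<open>exp (- ln x)\<close>, so that the
  derivative is again a function of \<open>ln x\<close> and hence \<open>rad\<close> of a
  profile.\<close>

lemma profile_F_deriv:
  assumes "profile Y" "\<And>s. (Y has_real_derivative Y' s) (at s)"
  shows "((\<lambda>x. if 0 < x then Y (ln x) else 0) has_real_derivative (if 0 < x then Y' (ln x) * exp (- ln x) else 0)) (at x)"
proof -
  obtain s0 where s0: "\<And>s. s \<le> s0 \<Longrightarrow> Y s = 0" using assms(1) by (auto simp: profile_def)
  show ?thesis
  proof (cases "0 < x")
    case True
    have "((\<lambda>x. Y (ln x)) has_real_derivative Y' (ln x) * exp (- ln x)) (at x)"
      using DERIV_chain2[OF assms(2) DERIV_ln_divide[OF True]] True by (simp add: exp_minus divide_inverse)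
    then have "((\<lambda>x. if 0 < x then Y (ln x) else 0) has_real_derivative Y' (ln x) * exp (- ln x)) (at x)"
      by (rule has_field_derivative_transform_within_open[where S="{0<..}"]) (use True in auto)
    then show ?thesis using True by simp
  next
    case False
    have "((\<lambda>x. if 0 < x then Y (ln x) else 0) has_real_derivative 0) (at x)"
      by (rule has_field_derivative_transform_within_open[of "\<lambda>_. 0" _ _ "{..<exp s0}"])
        (use False s0[of "ln _"] ln_mono[of _ "exp s0"] le_less_trans[of x 0 "exp s0"] in auto)
    then show ?thesis using False by simp
  qed
qed

lemma int_rad: "profile Y \<Longrightarrow> continuous_on hb f \<Longrightarrow> integrable (lebesgue_on hb) (\<lambda>z. rad Y z * f z)"
  by (intro integrable_on_compact compact_hb continuous_intros cont_rad)

lemma outer_rad: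
  assumes Y: "profile Y" "\<And>s. (Y has_real_derivative Y' s) (at s)" "continuous_on UNIV Y'"
  shows "(LINT z|lebesgue_on hb. rad Y z * ((a z *v g z) \<bullet> g z)) =
    (LINT z|lebesgue_on hb. rad (\<lambda>s. - 2 * Y' s * exp (- s)) z * (w z * ((a z *v g z) \<bullet> (P *v z))))"
proof -
  have pY': "profile Y'" using profile_deriv[OF Y] .
  have p2: "profile (\<lambda>s. Y' s * exp (- s))" by (intro profile_mult pY' continuous_intros)
  have c: "continuous_on hb (\<lambda>z. (a z *v g z) \<bullet> g z)" "continuous_on hb (\<lambda>z. w z * ((a z *v g z) \<bullet> (P *v z)))"
    by (intro continuous_intros cont_hb)+
  define F where "F x = (if 0 < x then Y (ln x) else 0)" for x
  define F' where "F' x = (if 0 < x then Y' (ln x) * exp (- ln x) else 0)" for x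
  have F: "F (q z) = rad Y z" "F' (q z) = rad (\<lambda>s. Y' s * exp (- s)) z" for z
    by (simp_all add: F_def F'_def rad_def)
  have "(F has_real_derivative F' x) (at x)" for x
    unfolding F_def F'_def by (rule profile_F_deriv[OF Y(1,2)])
  moreover have "continuous_on UNIV F'"
    unfolding F'_def using profile_F[OF p2] .
  ultimately have "(LINT z|lebesgue_on hb. rad Y z * ((a z *v g z) \<bullet> g z)
         + 2 * rad (\<lambda>s. Y' s * exp (- s)) z * w z * ((a z *v g z) \<bullet> (P *v z))) = 0"
    using outer[of F F'] profile_far[OF Y(1)] profile_far[OF p2] unfolding F by auto
  also have "(LINT z|lebesgue_on hb. rad Y z * ((a z *v g z) \<bullet> g z)
         + 2 * rad (\<lambda>s. Y' s * exp (- s)) z * w z * ((a z *v g z) \<bullet> (P *v z))) = 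
     (LINT z|lebesgue_on hb. rad Y z * ((a z *v g z) \<bullet> g z)
         - rad (\<lambda>s. - 2 * Y' s * exp (- s)) z * (w z * ((a z *v g z) \<bullet> (P *v z))))"
    by (intro Bochner_Integration.integral_cong) (auto simp: rad_def)
  also have "\<dots> = (LINT z|lebesgue_on hb. rad Y z * ((a z *v g z) \<bullet> g z)) -
    (LINT z|lebesgue_on hb. rad (\<lambda>s. - 2 * Y' s * exp (- s)) z * (w z * ((a z *v g z) \<bullet> (P *v z))))"
    by (intro Bochner_Integration.integral_diff int_rad Y(1) c profile_mult[OF profile_mult(2)[OF pY']] continuous_intros)
  finally show ?thesis by simp
qed

lemma outer_dilated_rad:
  assumes Y: "profile Y" "\<And>s. (Y has_real_derivative Y' s) (at s)" "continuous_on UNIV Y'"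
    and "\<And>s. 0 \<le> Y s" "1 \<le> l" "l \<le> 2"
  shows "(LINT z|lebesgue_on hb. rad (\<lambda>s. - 2 * Y' s * exp (- s)) z * (w (l *\<^sub>R z) * ((a z *v g z) \<bullet> (P *v z))))
    \<le> (LINT z|lebesgue_on hb. rad Y z * (l * ((a z *v g z) \<bullet> g (l *\<^sub>R z))))"
proof -
  have pY': "profile Y'" using profile_deriv[OF Y] .
  have p2: "profile (\<lambda>s. Y' s * exp (- s))" by (intro profile_mult pY' continuous_intros)
  have c: "continuous_on hb (\<lambda>z. l * ((a z *v g z) \<bullet> g (l *\<^sub>R z)))"
    "continuous_on hb (\<lambda>z. w (l *\<^sub>R z) * ((a z *v g z) \<bullet> (P *v z)))"
    by (intro continuous_intros cont_hb cont_dilated[OF _ assms(6) cont_g] cont_dilated[OF _ assms(6) cont_w] less_le_trans[OF zero_less_one assms(5)])+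
  define F where "F x = (if 0 < x then Y (ln x) else 0)" for x
  define F' where "F' x = (if 0 < x then Y' (ln x) * exp (- ln x) else 0)" for x
  have F: "F (q z) = rad Y z" "F' (q z) = rad (\<lambda>s. Y' s * exp (- s)) z" for z
    by (simp_all add: F_def F'_def rad_def)
  have "(F has_real_derivative F' x) (at x)" for x
    unfolding F_def F'_def by (rule profile_F_deriv[OF Y(1,2)])
  moreover have "continuous_on UNIV F'"
    unfolding F'_def using profile_F[OF p2] .
  moreover have "0 \<le> F x" for x
    using assms(4) by (simp add: F_def)
  ultimately have "0 \<le> (LINT z|lebesgue_on hb. rad Y z * l * ((a z *v g z) \<bullet> g (l *\<^sub>R z))
         + 2 * rad (\<lambda>s. Y' s * exp (- s)) z * w (l *\<^sub>R z) * ((a z *v g z) \<bullet> (P *v z)))"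
    using outer_dilated[of F F' l] assms(5,6) profile_far[OF Y(1)] profile_far[OF p2] unfolding F by auto
  also have "(LINT z|lebesgue_on hb. rad Y z * l * ((a z *v g z) \<bullet> g (l *\<^sub>R z))
         + 2 * rad (\<lambda>s. Y' s * exp (- s)) z * w (l *\<^sub>R z) * ((a z *v g z) \<bullet> (P *v z))) = 
     (LINT z|lebesgue_on hb. rad Y z * (l * ((a z *v g z) \<bullet> g (l *\<^sub>R z)))
         - rad (\<lambda>s. - 2 * Y' s * exp (- s)) z * (w (l *\<^sub>R z) * ((a z *v g z) \<bullet> (P *v z))))"
    by (intro Bochner_Integration.integral_cong) (auto simp: rad_def)
  also have "\<dots> = (LINT z|lebesgue_on hb. rad Y z * (l * ((a z *v g z) \<bullet> g (l *\<^sub>R z)))) -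
    (LINT z|lebesgue_on hb. rad (\<lambda>s. - 2 * Y' s * exp (- s)) z * (w (l *\<^sub>R z) * ((a z *v g z) \<bullet> (P *v z))))"
    by (intro Bochner_Integration.integral_diff int_rad Y(1) c profile_mult[OF profile_mult(2)[OF pY']] continuous_intros)
  finally show ?thesis by simp
qed

text \<open>A dilation by \<open>l\<close> acts on the weight as a shift by \<open>2 * ln l\<close>;
  the additional vanishing below \<open>smax\<close> keeps the shifted weight a profile.\<close>

lemma scale_rad:
  assumes l: "1 \<le> l" "l \<le> 2" and Y: "profile Y" "\<And>s. s \<ge> smax - 2 * ln l \<Longrightarrow> Y s = 0"
    and f: "continuous_on (H \<inter> cball 0 (2 * R)) f"
  shows "(LINT z|lebesgue_on hb. rad Y z * f (l *\<^sub>R z)) =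
    l powr (- real CARD('m)) * (LINT z|lebesgue_on hb. rad (\<lambda>s. Y (s - 2 * ln l)) z * f z)"
proof -
  have p: "profile (\<lambda>s. Y (s - 2 * ln l))" using profile_shift[OF Y] .
  have eq: "rad (\<lambda>s. Y (s - 2 * ln l)) (l *\<^sub>R z) = rad Y z" for z
    using l by (simp add: rad_scale)
  have fd: "continuous_on hb f" by (rule continuous_on_subset[OF f]) (use R_pos in auto)
  have "(LINT z|lebesgue_on hb. rad (\<lambda>s. Y (s - 2 * ln l)) (l *\<^sub>R z) * f (l *\<^sub>R z)) =
    l powr (- real CARD('m)) * (LINT z|lebesgue_on hb. rad (\<lambda>s. Y (s - 2 * ln l)) z * f z)"
  proof (rule scale_integral)
    show "continuous_on hb (\<lambda>z. rad (\<lambda>s. Y (s - 2 * ln l)) z * f z)"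
      by (intro continuous_intros cont_rad p fd)
    show "continuous_on hb (\<lambda>z. rad (\<lambda>s. Y (s - 2 * ln l)) (l *\<^sub>R z) * f (l *\<^sub>R z))"
      unfolding eq by (intro continuous_intros cont_rad Y(1) cont_dilated[OF _ l(2) f]) (use l in auto)
  qed (use l profile_far[OF p] in auto)
  then show ?thesis by (simp only: eq)
qed

text \<open>Along a ray \<open>q\<close> scales like the square of \<open>t\<close>, so the radial
  derivative of \<open>rad Y\<close> is \<open>2 * rad Y'\<close>. With \<open>f'\<close> in the
  role of z . grad f, this is \<open>euler_identity\<close> for the product.\<close>

lemma euler_by_parts:
  fixes Y Y' :: "real \<Rightarrow> real" and f f' :: "real ^ 'm \<Rightarrow> real"
  assumes Y: "profile Y" "\<And>s. (Y has_real_derivative Y' s) (at s)" "continuous_on UNIV Y'"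
    and f: "continuous_on hb f" "continuous_on hb f'"
    and der: "\<And>z t. z \<in> H \<Longrightarrow> 0 < t \<Longrightarrow> norm (t *\<^sub>R z) < R \<Longrightarrow>
      ((\<lambda>t. f (t *\<^sub>R z)) has_real_derivative f' (t *\<^sub>R z) / t) (at t)"
  shows "(LINT z|lebesgue_on hb. rad Y z * f' z) =
    - (LINT z|lebesgue_on hb. rad (\<lambda>s. 2 * Y' s + real CARD('m) * Y s) z * f z)"
proof -
  have pY': "profile Y'" using profile_deriv[OF Y] .
  define G where "G z = rad Y z * f z" for z
  define \<Gamma> where "\<Gamma> z = 2 * rad Y' z * f z + rad Y z * f' z" for z
  have cG: "continuous_on hb G" and c\<Gamma>: "continuous_on hb \<Gamma>"
    unfolding G_def \<Gamma>_def by (intro continuous_intros cont_rad f pY' Y(1))+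
  have far: "G z = 0" "\<Gamma> z = 0" if "norm z \<ge> R / 2" for z
    using that profile_far[OF Y(1)] profile_far[OF pY'] by (auto simp: G_def \<Gamma>_def)
  have derG: "((\<lambda>t. G (t *\<^sub>R z)) has_real_derivative \<Gamma> (t *\<^sub>R z) / t) (at t)" if z: "z \<in> H" "0 < t" for z t
  proof (cases "z = 0")
    case True
    then show ?thesis by (simp add: G_def \<Gamma>_def)
  next
    case nz: False
    show ?thesis
    proof (cases "norm (t *\<^sub>R z) < R")
      case True
      define c where "c = q z"
      have c: "0 < c" using nz q_pos[of z] by (simp add: c_def)
      have radt: "rad Z (s *\<^sub>R z) = Z (ln (s\<^sup>2 * c))" if "0 < s" for Z s
      proof -
        have "s *\<^sub>R z \<noteq> 0" using that nz by simp
        from rad_nonzero[OF this, of Z] show ?thesis unfolding q_scale c_def .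
      qed
      have "((\<lambda>t. ln (t\<^sup>2 * c)) has_real_derivative 2 / t) (at t)"
        using z(2) c by (auto intro!: derivative_eq_intros simp: power2_eq_square)
      from DERIV_chain2[OF Y(2) this]
      have "((\<lambda>t. Y (ln (t\<^sup>2 * c))) has_real_derivative 2 * Y' (ln (t\<^sup>2 * c)) / t) (at t)"
        by (simp add: mult.commute)
      then have "((\<lambda>t. rad Y (t *\<^sub>R z)) has_real_derivative 2 * rad Y' (t *\<^sub>R z) / t) (at t)"
        unfolding radt[OF z(2)]
        by (rule has_field_derivative_transform_within_open[where S="{0<..}"]) (use z radt in auto)
      from DERIV_mult[OF this der[OF z True]] show ?thesis
        unfolding G_def \<Gamma>_def by (rule DERIV_cong) (simp add: add_divide_distrib)
    next
      case False
      have "((\<lambda>t. G (t *\<^sub>R z)) has_real_derivative 0) (at t)"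
      proof (rule has_field_derivative_transform_within_open[of "\<lambda>_. 0" _ _ "{s. R / 2 < norm (s *\<^sub>R z)}"])
        show "open {s. R / 2 < norm (s *\<^sub>R z)}" by (intro open_Collect_less continuous_intros)
      qed (use False R_pos far in auto)
      then show ?thesis using far(2)[of "t *\<^sub>R z"] False R_pos by simp
    qed
  qed
  have "(LINT z|lebesgue_on hb. \<Gamma> z) = - real CARD('m) * (LINT z|lebesgue_on hb. G z)"
    by (rule euler_identity[OF cG c\<Gamma> far derG])
  moreover have "(LINT z|lebesgue_on hb. \<Gamma> z) = (LINT z|lebesgue_on hb. rad (\<lambda>s. 2 * Y' s + real CARD('m) * Y s) z * f z)
      - real CARD('m) * (LINT z|lebesgue_on hb. G z) + (LINT z|lebesgue_on hb. rad Y z * f' z)"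
  proof -
    have "profile (\<lambda>s. 2 * Y' s + real CARD('m) * Y s)"
    proof -
      obtain s0 s1 where "\<And>s. s \<le> s0 \<Longrightarrow> Y s = 0" "\<And>s. s \<le> s1 \<Longrightarrow> Y' s = 0"
        using Y pY' by (auto simp: profile_def)
      then show ?thesis using Y pY' unfolding profile_def 
        by (auto intro!: continuous_intros exI[of _ "min s0 s1"])
    qed
    then have i: "integrable (lebesgue_on hb) (\<lambda>z. rad (\<lambda>s. 2 * Y' s + real CARD('m) * Y s) z * f z)"
      "integrable (lebesgue_on hb) G" "integrable (lebesgue_on hb) (\<lambda>z. rad Y z * f' z)"
      using Y f pY' unfolding G_def by (auto intro!: int_rad)
    have "(LINT z|lebesgue_on hb. \<Gamma> z) = (LINT z|lebesgue_on hb. rad (\<lambda>s. 2 * Y' s + real CARD('m) * Y s) z * f z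
      - real CARD('m) * G z + rad Y z * f' z)"
      by (intro Bochner_Integration.integral_cong) (auto simp: \<Gamma>_def G_def rad_def algebra_simps)
    then show ?thesis using i by simp
  qed
  ultimately show ?thesis by simp
qed

end

text \<open>A trapezoid: one on \<open>[\<alpha>, \<beta>]\<close>, with ramps of unit length
  outside. It only majorises the differentiable cutoffs in error terms and is never differentiated,
  so continuity is enough.\<close>

definition hat :: "real \<Rightarrow> real \<Rightarrow> real \<Rightarrow> real"
  where "hat \<alpha> \<beta> s = max 0 (min 1 (min (s - \<alpha> + 1) (\<beta> + 1 - s)))"

lemma hat_cont [continuous_intros]: "continuous_on S (hat \<alpha> \<beta>)"
  unfolding hat_def[abs_def] by (intro continuous_intros)

lemma hat_nonneg: "0 \<le> hat \<alpha> \<beta> s" and hat_le: "hat \<alpha> \<beta> s \<le> 1"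
  by (auto simp: hat_def)

lemma hat_eq_1: "\<alpha> \<le> s \<Longrightarrow> s \<le> \<beta> \<Longrightarrow> hat \<alpha> \<beta> s = 1"
  by (auto simp: hat_def)

lemma hat_eq_0: "s \<le> \<alpha> - 1 \<or> \<beta> + 1 \<le> s \<Longrightarrow> hat \<alpha> \<beta> s = 0"
  by (auto simp: hat_def)

lemma hat_shift_le: "0 \<le> \<tau> \<Longrightarrow> \<tau> \<le> 1 \<Longrightarrow> hat \<alpha> \<beta> (s - \<tau>) \<le> hat \<alpha> (\<beta> + 1) s"
  by (auto simp: hat_def)

text \<open>The vector \<open>P z\<close> contributes half a power of \<open>q\<close>; it is shared
  between a gradient term with weight \<open>exp (e * s)\<close> and a function term with weight
  \<open>exp ((e - 1) * s)\<close>.\<close>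

lemma exp_amgm:
  fixes x y e s :: real
  assumes "0 \<le> x" "0 \<le> y"
  shows "2 * (exp ((e - 1 / 2) * s) * (x * y)) \<le> exp (e * s) * x\<^sup>2 + exp ((e - 1) * s) * y\<^sup>2"
proof -
  have "exp (e * s) = (exp (e * s / 2))\<^sup>2" "exp ((e - 1) * s) = (exp ((e - 1) * s / 2))\<^sup>2"
    "exp ((e - 1 / 2) * s) = exp (e * s / 2) * exp ((e - 1) * s / 2)"
    by (simp_all add: power2_eq_square exp_add[symmetric] algebra_simps add_divide_distrib diff_divide_distrib)
  then show ?thesis
    using sum_squares_bound[of "exp (e * s / 2) * x" "exp ((e - 1) * s / 2) * y"]
    by (simp add: power_mult_distrib algebra_simps)
qed

section \<open>Error terms from freezing the coefficients\<close>

context dilation_setting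
begin

abbreviation (input) intg :: "(real ^ 'm \<Rightarrow> real) \<Rightarrow> real"
  where "intg f \<equiv> LINT z|lebesgue_on hb. f z"

lemma intg_mono:
  assumes "integrable (lebesgue_on hb) f" "integrable (lebesgue_on hb) f'" "\<And>z. z \<in> hb \<Longrightarrow> f z \<le> f' z"
  shows "intg f \<le> intg f'"
  using assms by (intro integral_mono) auto

lemma intg_abs_le:
  assumes "integrable (lebesgue_on hb) f" "integrable (lebesgue_on hb) f'" "\<And>z. z \<in> hb \<Longrightarrow> \<bar>f z\<bar> \<le> f' z"
  shows "\<bar>intg f\<bar> \<le> intg f'"
proof -
  have "intg f \<le> intg f'" by (intro intg_mono assms) (use assms(3) in force)
  moreover have "intg (\<lambda>z. - f z) \<le> intg f'" by (intro intg_mono assms Bochner_Integration.integrable_minus) (use assms(3) in force)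
  ultimately show ?thesis by simp
qed

lemma intg_add:
  assumes "integrable (lebesgue_on hb) f" "integrable (lebesgue_on hb) f'" "\<And>z. z \<in> hb \<Longrightarrow> h z = f z + f' z"
  shows "intg h = intg f + intg f'"
proof -
  have "intg h = intg (\<lambda>z. f z + f' z)"
    using assms(3) by (intro Bochner_Integration.integral_cong) auto
  then show ?thesis using assms(1,2) by simp
qed

lemma norm_le_exp: "z \<noteq> 0 \<Longrightarrow> norm z \<le> 2 * exp (ln (q z) / 2)"
proof -
  assume z: "z \<noteq> 0"
  have "(norm z)\<^sup>2 \<le> 4 * q z" using norm_le_q[of z] q_pos[of z] z by simp
  also have "\<dots> = (2 * exp (ln (q z) / 2))\<^sup>2"
    using q_pos[of z] z by (simp add: power_mult_distrib exp_double[symmetric] del: exp_double)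
  finally show ?thesis by (rule power2_le_imp_le) simp
qed

lemma norm_powr_le_exp: "z \<noteq> 0 \<Longrightarrow> norm z powr \<gamma> \<le> 2 * exp (\<gamma> / 2 * ln (q z))"
proof -
  assume z: "z \<noteq> 0"
  have "norm z powr \<gamma> \<le> (2 * exp (ln (q z) / 2)) powr \<gamma>"
    using norm_le_exp[OF z] gamma by (intro powr_mono2) auto
  also have "\<dots> = 2 powr \<gamma> * exp (\<gamma> / 2 * ln (q z))"
    by (simp add: powr_mult exp_powr_real)
  also have "\<dots> \<le> 2 powr 1 * exp (\<gamma> / 2 * ln (q z))"
    using gamma by (intro mult_right_mono powr_mono) auto
  finally show ?thesis by simp
qed

lemma rad_le: "(\<And>s. Y s \<le> Y' s) \<Longrightarrow> rad Y z \<le> rad Y' z"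
  by (simp add: rad_def)

lemma rad_nonneg: "(\<And>s. 0 \<le> Y s) \<Longrightarrow> 0 \<le> rad Y z"
  by (simp add: rad_def)

lemma rad_cmult: "rad (\<lambda>s. c * Y s) z = c * rad Y z"
  by (simp add: rad_def)

lemma profile_cutoff:
  assumes "continuous_on UNIV \<xi>" "\<And>s. s < \<alpha> \<or> \<beta> < s \<Longrightarrow> \<xi> s = 0" "\<beta> < smax"
  shows "profile \<xi>"
  using assms unfolding profile_def by (auto intro!: exI[of _ "\<alpha> - 1"])

lemma profile_exp: "profile \<xi> \<Longrightarrow> profile (\<lambda>s. \<xi> s * exp (e * s))"
  by (intro profile_mult continuous_intros)

text \<open>Hoelder continuity supplies \<open>norm z powr \<gamma>\<close>, at most
  \<open>2 * exp (\<gamma> / 2 * s)\<close>; this raises the exponent from \<open>- \<mu>\<close> to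
  \<open>\<gamma> / 2 - \<mu>\<close>, and the 2 is used up by AM-GM. The vector \<open>u\<close>
  will be \<open>g z\<close> or a dilated gradient.\<close>

lemma coeff_error_gradient:
  assumes z: "z \<in> hb" and Y: "\<And>s. \<bar>Y s\<bar> \<le> \<xi> s * exp (- \<mu> * s)"
  shows "\<bar>rad Y z * ((A *v g z - a z *v g z) \<bullet> u)\<bar>
    \<le> Ca * (rad (\<lambda>s. \<xi> s * exp ((\<gamma> / 2 - \<mu>) * s)) z * (g z \<bullet> g z + u \<bullet> u))"
proof (cases "z = 0")
  case False
  define s where "s = ln (q z)"
  have \<xi>: "0 \<le> \<xi> s" using Y[of s] abs_ge_zero[of "Y s"] by (smt (verit) exp_gt_zero zero_le_mult_iff)
  have "\<bar>(A *v g z - a z *v g z) \<bullet> u\<bar> \<le> norm (A *v g z - a z *v g z) * norm u"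
    by (rule Cauchy_Schwarz_ineq2)
  also have "\<dots> \<le> (Ca * (2 * exp (\<gamma> / 2 * s)) * norm (g z)) * norm u"
  proof (intro mult_right_mono)
    have "norm (A *v g z - a z *v g z) \<le> Ca * norm z powr \<gamma> * norm (g z)"
      using a_holder[OF z] by (simp add: norm_minus_commute)
    also have "\<dots> \<le> Ca * (2 * exp (\<gamma> / 2 * s)) * norm (g z)"
      unfolding s_def using norm_powr_le_exp[OF False] Ca_nonneg by (intro mult_right_mono mult_left_mono) auto
    finally show "norm (A *v g z - a z *v g z) \<le> Ca * (2 * exp (\<gamma> / 2 * s)) * norm (g z)" .
  qed auto
  finally have 1: "\<bar>(A *v g z - a z *v g z) \<bullet> u\<bar> \<le> Ca * exp (\<gamma> / 2 * s) * (2 * norm (g z) * norm u)"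
    by (simp add: mult_ac)
  have "2 * norm (g z) * norm u \<le> g z \<bullet> g z + u \<bullet> u"
    using sum_squares_bound[of "norm (g z)" "norm u"] by (simp add: power2_norm_eq_inner)
  then have 2: "\<bar>(A *v g z - a z *v g z) \<bullet> u\<bar> \<le> Ca * exp (\<gamma> / 2 * s) * (g z \<bullet> g z + u \<bullet> u)"
    using 1 Ca_nonneg by (smt (verit) mult_left_mono mult_nonneg_nonneg exp_ge_zero)
  have "\<bar>rad Y z * ((A *v g z - a z *v g z) \<bullet> u)\<bar> = \<bar>Y s\<bar> * \<bar>(A *v g z - a z *v g z) \<bullet> u\<bar>"
    using False by (simp add: rad_nonzero abs_mult s_def)
  also have "\<dots> \<le> (\<xi> s * exp (- \<mu> * s)) * (Ca * exp (\<gamma> / 2 * s) * (g z \<bullet> g z + u \<bullet> u))"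
    using Y 2 \<xi> by (intro mult_mono) auto
  also have "\<dots> = Ca * (\<xi> s * (exp (- \<mu> * s) * exp (\<gamma> / 2 * s)) * (g z \<bullet> g z + u \<bullet> u))"
    by (simp add: mult_ac)
  also have "exp (- \<mu> * s) * exp (\<gamma> / 2 * s) = exp ((\<gamma> / 2 - \<mu>) * s)"
    by (simp add: exp_add[symmetric] algebra_simps)
  finally show ?thesis using False by (simp add: rad_nonzero s_def)
qed simp

text \<open>The bound \<open>norm (P *v z) \<le> 4 * exp (s / 2)\<close> costs half a power of
  \<open>q\<close>, which \<open>exp_amgm\<close> distributes; the constant 4 is half of 2 * 4. The
  number \<open>v\<close> will be \<open>w z\<close> or a dilated value of \<open>w\<close>.\<close>

lemma coeff_error_mixed:
  assumes z: "z \<in> hb" and Y: "\<And>s. \<bar>Y s\<bar> \<le> \<xi> s * exp (- (\<mu> + 1) * s)"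
  shows "\<bar>rad Y z * (v * ((a z *v g z - A *v g z) \<bullet> (P *v z)))\<bar>
    \<le> 4 * Ca * (rad (\<lambda>s. \<xi> s * exp ((\<gamma> / 2 - \<mu>) * s)) z * (g z \<bullet> g z)
        + rad (\<lambda>s. \<xi> s * exp ((\<gamma> / 2 - \<mu> - 1) * s)) z * v\<^sup>2)"
proof (cases "z = 0")
  case False
  define s where "s = ln (q z)"
  define e where "e = \<gamma> / 2 - \<mu>"
  have \<xi>: "0 \<le> \<xi> s" using Y[of s] abs_ge_zero[of "Y s"] by (smt (verit) exp_gt_zero zero_le_mult_iff)
  have "\<bar>(a z *v g z - A *v g z) \<bullet> (P *v z)\<bar> \<le> norm (a z *v g z - A *v g z) * norm (P *v z)"
    by (rule Cauchy_Schwarz_ineq2)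
  also have "\<dots> \<le> (Ca * (2 * exp (\<gamma> / 2 * s)) * norm (g z)) * (4 * exp (s / 2))"
  proof (intro mult_mono)
    have "norm (a z *v g z - A *v g z) \<le> Ca * norm z powr \<gamma> * norm (g z)"
      using a_holder[OF z] .
    also have "\<dots> \<le> Ca * (2 * exp (\<gamma> / 2 * s)) * norm (g z)"
      unfolding s_def using norm_powr_le_exp[OF False] Ca_nonneg by (intro mult_right_mono mult_left_mono) auto
    finally show "norm (a z *v g z - A *v g z) \<le> Ca * (2 * exp (\<gamma> / 2 * s)) * norm (g z)" .
    show "norm (P *v z) \<le> 4 * exp (s / 2)"
      using P_upper[of z] norm_le_exp[OF False] by (simp add: s_def)
  qed (use Ca_nonneg in auto)
  finally have 1: "\<bar>(a z *v g z - A *v g z) \<bullet> (P *v z)\<bar> \<le> 8 * Ca * (exp (\<gamma> / 2 * s) * exp (s / 2)) * norm (g z)"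
    by (simp add: mult_ac)
  have "\<bar>rad Y z * (v * ((a z *v g z - A *v g z) \<bullet> (P *v z)))\<bar>
      = \<bar>Y s\<bar> * (\<bar>v\<bar> * \<bar>(a z *v g z - A *v g z) \<bullet> (P *v z)\<bar>)"
    using False by (simp add: rad_nonzero abs_mult s_def)
  also have "\<dots> \<le> (\<xi> s * exp (- (\<mu> + 1) * s)) * (\<bar>v\<bar> * (8 * Ca * (exp (\<gamma> / 2 * s) * exp (s / 2)) * norm (g z)))"
    using Y 1 \<xi> by (intro mult_mono mult_left_mono) auto
  also have "\<dots> = 4 * Ca * \<xi> s * (2 * ((exp (- (\<mu> + 1) * s) * exp (\<gamma> / 2 * s) * exp (s / 2)) * (norm (g z) * \<bar>v\<bar>)))"
    by (simp add: mult_ac)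
  also have "exp (- (\<mu> + 1) * s) * exp (\<gamma> / 2 * s) * exp (s / 2) = exp ((e - 1 / 2) * s)"
    by (simp add: e_def exp_add[symmetric] algebra_simps)
  also have "4 * Ca * \<xi> s * (2 * (exp ((e - 1 / 2) * s) * (norm (g z) * \<bar>v\<bar>))) \<le>
     4 * Ca * \<xi> s * (exp (e * s) * (norm (g z))\<^sup>2 + exp ((e - 1) * s) * \<bar>v\<bar>\<^sup>2)"
    using \<xi> Ca_nonneg by (intro mult_left_mono exp_amgm) auto
  also have "\<dots> = 4 * Ca * (rad (\<lambda>s. \<xi> s * exp (e * s)) z * (g z \<bullet> g z)
        + rad (\<lambda>s. \<xi> s * exp ((e - 1) * s)) z * v\<^sup>2)"
    using False by (simp add: rad_nonzero s_def power2_norm_eq_inner algebra_simps)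
  finally show ?thesis by (simp add: e_def)
qed simp

definition frozen_error :: "(real \<Rightarrow> real) \<Rightarrow> (real \<Rightarrow> real) \<Rightarrow> real"
  where "frozen_error Y Y' = intg (\<lambda>z. rad Y z * ((A *v g z - a z *v g z) \<bullet> g z))
    + intg (\<lambda>z. rad (\<lambda>s. - 2 * Y' s * exp (- s)) z * (w z * ((a z *v g z - A *v g z) \<bullet> (P *v z))))"

lemma cont_data:
  "continuous_on hb (\<lambda>z. A *v g z)" "continuous_on hb (\<lambda>z. a z *v g z)" "continuous_on hb (\<lambda>z. P *v z)"
  "continuous_on hb (\<lambda>z. g z \<bullet> z)" "continuous_on hb (\<lambda>z. g z \<bullet> g z)" "continuous_on hb (\<lambda>z. (w z)\<^sup>2)"
  "continuous_on hb (\<lambda>z. w z * (g z \<bullet> z))"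
  by (intro continuous_intros cont_hb)+

lemma frozen_outer:
  assumes Y: "profile Y" "\<And>s. (Y has_real_derivative Y' s) (at s)" "continuous_on UNIV Y'"
  shows "intg (\<lambda>z. rad Y z * ((A *v g z) \<bullet> g z)) =
    intg (\<lambda>z. rad (\<lambda>s. - 2 * Y' s * exp (- s)) z * (w z * (g z \<bullet> z))) + frozen_error Y Y'"
proof -
  have p2: "profile (\<lambda>s. - 2 * Y' s * exp (- s))"
    by (intro profile_mult profile_deriv[OF Y] continuous_intros)
  have AgP: "(A *v g z) \<bullet> (P *v z) = g z \<bullet> z" for z
    by (simp add: A_sym AP)
  have "intg (\<lambda>z. rad Y z * ((A *v g z) \<bullet> g z)) = intg (\<lambda>z. rad Y z * ((a z *v g z) \<bullet> g z))
     + intg (\<lambda>z. rad Y z * ((A *v g z - a z *v g z) \<bullet> g z))"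
    by (rule intg_add; (intro int_rad Y(1) continuous_intros cont_data cont_hb)?)
      (simp add: inner_diff_left algebra_simps)
  moreover have "intg (\<lambda>z. rad (\<lambda>s. - 2 * Y' s * exp (- s)) z * (w z * ((a z *v g z) \<bullet> (P *v z)))) =
     intg (\<lambda>z. rad (\<lambda>s. - 2 * Y' s * exp (- s)) z * (w z * (g z \<bullet> z))) +
     intg (\<lambda>z. rad (\<lambda>s. - 2 * Y' s * exp (- s)) z * (w z * ((a z *v g z - A *v g z) \<bullet> (P *v z))))"
    by (rule intg_add; (intro int_rad p2 continuous_intros cont_data cont_hb)?)
      (simp only: inner_diff_left AgP, simp add: algebra_simps)
  ultimately show ?thesis
    using outer_rad[OF Y] by (simp add: frozen_error_def)
qed

text \<open>One majorant \<open>\<xi>\<close> serves both weights. The constant 6 is 2 from the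
  gradient error, taken with \<open>u = g z\<close>, plus 4 from the mixed error.\<close>

lemma frozen_error_le:
  assumes Y: "profile Y" "\<And>s. (Y has_real_derivative Y' s) (at s)" "continuous_on UNIV Y'"
    and \<xi>: "profile \<xi>" "\<And>s. \<bar>Y s\<bar> \<le> \<xi> s * exp (- \<mu> * s)"
      "\<And>s. \<bar>- 2 * Y' s * exp (- s)\<bar> \<le> \<xi> s * exp (- (\<mu> + 1) * s)"
  shows "\<bar>frozen_error Y Y'\<bar> \<le> 6 * Ca * (intg (\<lambda>z. rad (\<lambda>s. \<xi> s * exp ((\<gamma> / 2 - \<mu>) * s)) z * (g z \<bullet> g z))
    + intg (\<lambda>z. rad (\<lambda>s. \<xi> s * exp ((\<gamma> / 2 - \<mu> - 1) * s)) z * (w z)\<^sup>2))"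
    (is "_ \<le> 6 * Ca * (?G + ?W)")
proof -
  have p2: "profile (\<lambda>s. - 2 * Y' s * exp (- s))"
    by (intro profile_mult profile_deriv[OF Y] continuous_intros)
  have iG: "integrable (lebesgue_on hb) (\<lambda>z. rad (\<lambda>s. \<xi> s * exp ((\<gamma> / 2 - \<mu>) * s)) z * (g z \<bullet> g z))"
    and iW: "integrable (lebesgue_on hb) (\<lambda>z. rad (\<lambda>s. \<xi> s * exp ((\<gamma> / 2 - \<mu> - 1) * s)) z * (w z)\<^sup>2)"
    by (intro int_rad profile_exp \<xi> cont_data)+
  have \<xi>0: "0 \<le> \<xi> s" for s
    using \<xi>(2)[of s] abs_ge_zero[of "Y s"] by (smt (verit) exp_gt_zero zero_le_mult_iff)
  have W0: "0 \<le> ?W"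
    by (intro integral_nonneg_AE AE_I2 mult_nonneg_nonneg rad_nonneg) (auto simp: \<xi>0)
  have "\<bar>intg (\<lambda>z. rad Y z * ((A *v g z - a z *v g z) \<bullet> g z))\<bar>
    \<le> intg (\<lambda>z. Ca * (2 * (rad (\<lambda>s. \<xi> s * exp ((\<gamma> / 2 - \<mu>) * s)) z * (g z \<bullet> g z))))"
  proof (rule intg_abs_le)
    fix z assume z: "z \<in> hb"
    show "\<bar>rad Y z * ((A *v g z - a z *v g z) \<bullet> g z)\<bar>
      \<le> Ca * (2 * (rad (\<lambda>s. \<xi> s * exp ((\<gamma> / 2 - \<mu>) * s)) z * (g z \<bullet> g z)))"
      using coeff_error_gradient[OF z \<xi>(2), of "g z"] by (simp add: algebra_simps)
  qed (intro int_rad integrable_mult_right iG Y(1) continuous_intros cont_data cont_hb)+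
  moreover have "\<bar>intg (\<lambda>z. rad (\<lambda>s. - 2 * Y' s * exp (- s)) z * (w z * ((a z *v g z - A *v g z) \<bullet> (P *v z))))\<bar>
    \<le> intg (\<lambda>z. 4 * Ca * (rad (\<lambda>s. \<xi> s * exp ((\<gamma> / 2 - \<mu>) * s)) z * (g z \<bullet> g z)
        + rad (\<lambda>s. \<xi> s * exp ((\<gamma> / 2 - \<mu> - 1) * s)) z * (w z)\<^sup>2))"
  proof (rule intg_abs_le)
  qed (intro int_rad p2 integrable_mult_right Bochner_Integration.integrable_add iG iW continuous_intros
      cont_data cont_hb coeff_error_mixed \<xi>(3); assumption)+
  ultimately have "\<bar>frozen_error Y Y'\<bar> \<le> Ca * (2 * ?G) + 4 * Ca * (?G + ?W)"
    unfolding frozen_error_def using iG iW by simp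
  moreover have "Ca * (2 * u) + 4 * Ca * (u + v) \<le> 6 * Ca * (u + v)" if "0 \<le> v" for u v
    using that Ca_nonneg by (simp add: algebra_simps mult_left_mono)
  ultimately show ?thesis using W0 by (meson order.trans)
qed

end

section \<open>The dilation inequality\<close>

text \<open>\<open>ct\<close> is the cutoff of the main test function; \<open>\<psi>\<close>, equal
  to one on a larger interval, is that of the Caccioppoli estimate. The bound \<open>B\<close> is a
  parameter separate from \<open>sa\<close> and \<open>sb\<close>, so the constants will not depend
  on how close to the origin the cutoff reaches. The gap 6 below \<open>smax\<close> leaves room for
  shifts by \<open>2 * h \<le> 1\<close> and for the widened hats.\<close>

locale dilation_cutoff = dilation_setting H R w g a A P Ca \<gamma>
  for H :: "(real ^ 'm::finite) set" and R w g a A P Ca \<gamma> +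
  fixes \<kappa> B sa sb :: real and ct ct1 ct2 \<psi> \<psi>1 :: "real \<Rightarrow> real"
  assumes kappa: "0 < \<kappa>" and dimension: "2 \<le> CARD('m)" and R_le: "R \<le> 1"
    and sab: "sa + 2 \<le> sb" and sb: "sb + 6 \<le> smax" and B: "0 \<le> B"
    and chi_deriv: "\<And>s. (ct has_real_derivative ct1 s) (at s)" "\<And>s. (ct1 has_real_derivative ct2 s) (at s)"
      "continuous_on UNIV ct2"
    and chi_range: "\<And>s. 0 \<le> ct s" "\<And>s. ct s \<le> 1"
    and chi_bound: "\<And>s. \<bar>ct1 s\<bar> \<le> B" "\<And>s. \<bar>ct2 s\<bar> \<le> B"
    and ct_off: "\<And>s. s < sa \<or> sb < s \<Longrightarrow> ct s = 0 \<and> ct1 s = 0 \<and> ct2 s = 0"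
    and chi_on: "\<And>s. sa + 1 \<le> s \<Longrightarrow> s \<le> sb - 1 \<Longrightarrow> ct s = 1 \<and> ct1 s = 0 \<and> ct2 s = 0"
    and psi_deriv: "\<And>s. (\<psi> has_real_derivative \<psi>1 s) (at s)" "continuous_on UNIV \<psi>1"
    and psi_range: "\<And>s. 0 \<le> \<psi> s" "\<And>s. \<psi> s \<le> 1"
    and psi_bound: "\<And>s. \<bar>\<psi>1 s\<bar> \<le> B"
    and psi_off: "\<And>s. s < sa - 2 \<or> sb + 3 < s \<Longrightarrow> \<psi> s = 0 \<and> \<psi>1 s = 0"
    and psi_on: "\<And>s. sa - 1 \<le> s \<Longrightarrow> s \<le> sb + 2 \<Longrightarrow> \<psi> s = 1"
begin

text \<open>As \<open>q\<close> is quadratic, \<open>exp (- (\<mu> + 1) * s)\<close> is comparable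
  to \<open>norm z\<close> to the power \<open>- CARD('m) - 2 * \<kappa>\<close>: in this weight a
  function homogeneous of degree \<open>\<kappa>\<close> has the same square integral over every
  dyadic shell.\<close>

definition \<mu> :: real where "\<mu> = (real CARD('m) - 2) / 2 + \<kappa>"

text \<open>The \<open>\<gamma> / 2\<close> in the exponents of \<open>grad_energy\<close> and
  \<open>mass\<close> is the Hoelder gain: these are the weights in which coefficient errors appear,
  lighter near the origin than the scale invariant ones.\<close>

definition grad_energy :: "(real \<Rightarrow> real) \<Rightarrow> real"
  where "grad_energy \<xi> = intg (\<lambda>z. rad (\<lambda>s. \<xi> s * exp ((\<gamma> / 2 - \<mu>) * s)) z * (g z \<bullet> g z))"

definition mass :: "(real \<Rightarrow> real) \<Rightarrow> real"
  where "mass \<xi> = intg (\<lambda>z. rad (\<lambda>s. \<xi> s * exp ((\<gamma> / 2 - \<mu> - 1) * s)) z * (w z)\<^sup>2)"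

definition W :: "real \<Rightarrow> real ^ 'm \<Rightarrow> real"
  where "W h z = exp (- \<kappa> * h) * w (exp h *\<^sub>R z)"

text \<open>The derivative of \<open>W h\<close> along rays. The derivative in \<open>h\<close> is
  this minus \<open>\<kappa> * W h z\<close>, see \<open>W_deriv\<close>.\<close>

definition ZW :: "real \<Rightarrow> real ^ 'm \<Rightarrow> real"
  where "ZW h z = exp (- \<kappa> * h) * (exp h * (g (exp h *\<^sub>R z) \<bullet> z))"

text \<open>The main test function has \<open>F(q) = ct s * exp (- \<mu> * s)\<close> with \<open>s = ln q\<close>; then \<open>Om s = - 2 * F'(q)\<close>.\<close>

definition Om :: "real \<Rightarrow> real"
  where "Om s = (2 * \<mu> * ct s - 2 * ct1 s) * exp (- (\<mu> + 1) * s)"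

text \<open>Twice the part of the derivative of \<open>Om\<close> in which the cutoff is
  differentiated. It lives on the two end shells, where \<open>ct\<close> is not constant.\<close>

definition Dom :: "real \<Rightarrow> real"
  where "Dom s = 2 * (2 * \<mu> * ct1 s - 2 * ct2 s) * exp (- (\<mu> + 1) * s)"

lemma mu_pos: "\<mu> > 0" "\<mu> + 1 = real CARD('m) / 2 + \<kappa>"
  using dimension kappa by (auto simp: \<mu>_def field_simps)

lemma cont_chi: "continuous_on S ct" "continuous_on S ct1" "continuous_on S ct2" "continuous_on S \<psi>"
proof -
  show "continuous_on S ct" "continuous_on S ct1" "continuous_on S \<psi>"
    using DERIV_isCont[OF chi_deriv(1)] DERIV_isCont[OF chi_deriv(2)] DERIV_isCont[OF psi_deriv(1)]
    by (auto intro: continuous_at_imp_continuous_on)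
  show "continuous_on S ct2"
    by (rule continuous_on_subset[OF chi_deriv(3)]) simp
qed

lemma prof_chi: "profile ct" "profile ct1" "profile ct2" "profile \<psi>"
proof -
  show "profile ct" "profile ct1" "profile ct2"
    by (rule profile_cutoff[of _ sa sb]; use sb in \<open>simp add: cont_chi ct_off\<close>)+
  show "profile \<psi>"
    by (rule profile_cutoff[of _ "sa - 2" "sb + 3"]; use sb in \<open>simp add: cont_chi psi_off\<close>)
qed

lemma prof_hat: "\<beta> + 1 < smax \<Longrightarrow> profile (hat \<alpha> \<beta>)"
  by (rule profile_cutoff[of _ "\<alpha> - 1" "\<beta> + 1"]) (auto intro!: hat_cont hat_eq_0)

lemma prof_Om: "profile Om" "profile Dom"
proof -
  have "profile (\<lambda>s. 2 * \<mu> * ct s - 2 * ct1 s)" "profile (\<lambda>s. 2 * (2 * \<mu> * ct1 s - 2 * ct2 s))"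
    by (rule profile_cutoff[of _ sa sb]; use sb in \<open>simp add: cont_chi ct_off continuous_intros\<close>)+
  then show "profile Om" "profile Dom"
    unfolding Om_def[abs_def] Dom_def[abs_def] by (auto intro!: profile_exp)
qed

lemma Om_deriv: "(Om has_real_derivative Dom s / 2 - (\<mu> + 1) * Om s) (at s)"
  unfolding Om_def[abs_def] Dom_def
  by (auto intro!: derivative_eq_intros chi_deriv simp: algebra_simps diff_divide_distrib)

lemma exp_le_2: "h \<le> 2 / 3 \<Longrightarrow> exp h \<le> (2::real)"
  using ln2_ge_two_thirds by (metis exp_le_cancel_iff exp_ln order.trans zero_less_numeral)

lemma cont_WZW:
  assumes "h \<le> 2 / 3"
  shows "continuous_on hb (W h)" "continuous_on hb (ZW h)"
    "continuous_on hb (\<lambda>z. g (exp h *\<^sub>R z))" "continuous_on hb (\<lambda>z. w (exp h *\<^sub>R z))"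
proof -
  show *: "continuous_on hb (\<lambda>z. g (exp h *\<^sub>R z))" "continuous_on hb (\<lambda>z. w (exp h *\<^sub>R z))"
    by (rule cont_dilated[OF exp_gt_zero exp_le_2[OF assms] cont_g] cont_dilated[OF exp_gt_zero exp_le_2[OF assms] cont_w])+
  show "continuous_on hb (W h)" "continuous_on hb (ZW h)"
    unfolding W_def[abs_def] ZW_def[abs_def] by (intro continuous_intros *)+
qed

lemma main_inequality:
  assumes h: "0 \<le> h" "h \<le> 1 / 2"
  shows "0 \<le> intg (\<lambda>z. rad Om z * (w z * (g z \<bullet> z) + W h z * ZW h z - 2 * (W h z * (g z \<bullet> z))))
    + 28 * (Ca * (1 + 2 * \<mu> + 2 * B) * exp (\<mu> + 1)) * (grad_energy (hat sa (sb + 1)) + mass (hat sa (sb + 1)))"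
proof -
  define l where "l = exp h"
  define c where "c = exp (- \<kappa> * h)"
  define C0 where "C0 = 1 + 2 * \<mu> + 2 * B"
  define e where "e = \<gamma> / 2 - \<mu>"
  \<comment> \<open>\<open>\<xi>'\<close> majorises the undilated weights. \<open>\<xi>\<close>
    majorises them also after a shift by \<open>2 * h \<le> 1\<close>: the hat is one unit longer on
    the right, and \<open>exp (\<mu> + 1)\<close> pays for the change of the exponential.\<close>
  define \<xi> where "\<xi> s = C0 * exp (\<mu> + 1) * hat sa (sb + 1) s" for s
  define \<xi>' where "\<xi>' s = C0 * hat sa sb s" for s
  have l: "1 \<le> l" "l \<le> 2" "0 < l" "ln l = h" using h exp_le_2[of h] by (auto simp: l_def)
  have c: "0 < c" "c \<le> 1" using h kappa by (auto simp: c_def)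
  have C0: "1 \<le> C0" using mu_pos(1) B by (simp add: C0_def)
  have E1: "exp x \<le> exp (\<mu> + 1)" if "x \<le> \<mu> + 1" for x using that by simp
  have E2: "1 \<le> exp (\<mu> + 1)" using mu_pos(1) by simp
  have p\<xi>: "profile \<xi>" "profile \<xi>'"
    unfolding \<xi>_def[abs_def] \<xi>'_def[abs_def] using sb
    by (auto intro!: profile_mult(2) prof_hat continuous_intros)
  define Y where "Y s = ct s * exp (- \<mu> * s)" for s
  define Y' where "Y' s = (ct1 s - \<mu> * ct s) * exp (- \<mu> * s)" for s
  have Y: "profile Y" "\<And>s. (Y has_real_derivative Y' s) (at s)" "continuous_on UNIV Y'"
  proof -
    show "profile Y" unfolding Y_def[abs_def] by (rule profile_exp[OF prof_chi(1)])
    show "(Y has_real_derivative Y' s) (at s)" for s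
      unfolding Y_def[abs_def] Y'_def
      by (auto intro!: derivative_eq_intros chi_deriv simp: algebra_simps)
    show "continuous_on UNIV Y'"
      unfolding Y'_def[abs_def] by (intro continuous_intros cont_chi)
  qed
  have Om_eq: "(\<lambda>s. - 2 * Y' s * exp (- s)) = Om"
  proof
    fix s
    have "exp (- \<mu> * s) * exp (- s) = exp (- (\<mu> + 1) * s)"
      by (simp add: mult_exp_exp algebra_simps)
    then have "(2 * \<mu> * ct s - 2 * ct1 s) * (exp (- \<mu> * s) * exp (- s)) = Om s"
      by (simp add: Om_def)
    then show "- 2 * Y' s * exp (- s) = Om s"
      unfolding Y'_def by (simp only: mult.assoc[symmetric]) (simp add: algebra_simps)
  qed
  have Y0: "0 \<le> Y s" for s using chi_range by (simp add: Y_def)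
  have hatct: "ct s \<le> hat sa sb s" "\<bar>2 * \<mu> * ct s - 2 * ct1 s\<bar> \<le> C0 * hat sa sb s" for s
  proof -
    have "ct s \<le> hat sa sb s \<and> \<bar>2 * \<mu> * ct s - 2 * ct1 s\<bar> \<le> C0 * hat sa sb s"
    proof (cases "sa \<le> s \<and> s \<le> sb")
      case True
      have "\<bar>2 * \<mu> * ct s - 2 * ct1 s\<bar> \<le> \<bar>2 * \<mu> * ct s\<bar> + \<bar>2 * ct1 s\<bar>" by linarith
      also have "\<dots> \<le> 2 * \<mu> * 1 + 2 * B"
        using chi_range[of s] chi_bound[of s] mu_pos(1) by (auto simp: abs_mult intro!: add_mono mult_left_mono)
      finally show ?thesis using True chi_range[of s] by (simp add: hat_eq_1 C0_def)
    qed (use ct_off[of s] hat_nonneg C0 in auto)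
    then show "ct s \<le> hat sa sb s" "\<bar>2 * \<mu> * ct s - 2 * ct1 s\<bar> \<le> C0 * hat sa sb s" by auto
  qed
  have Yb: "\<bar>Y s\<bar> \<le> \<xi>' s * exp (- \<mu> * s)" for s
  proof -
    have "ct s \<le> C0 * hat sa sb s" using hatct(1)[of s] mult_right_mono[OF C0 hat_nonneg, of sa sb s] by simp
    then show ?thesis using chi_range by (simp add: Y_def \<xi>'_def abs_mult)
  qed
  have Omb: "\<bar>Om s\<bar> \<le> \<xi>' s * exp (- (\<mu> + 1) * s)" for s
    using hatct(2)[of s] by (simp add: Om_def \<xi>'_def abs_mult)
  have shift: "\<xi>' (s - 2 * h) * exp (x * (s - 2 * h)) \<le> \<xi> s * exp (x * s)" if "- x \<le> \<mu> + 1" for s x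
  proof -
    have "- x * (2 * h) \<le> \<mu> + 1"
    proof (cases "0 \<le> - x")
      case True
      then have "- x * (2 * h) \<le> - x * 1" using h by (intro mult_left_mono) auto
      then show ?thesis using that by simp
    next
      case False
      then have "- x * (2 * h) \<le> 0" using h by (intro mult_nonpos_nonneg) auto
      then show ?thesis using mu_pos(1) by linarith
    qed
    then have "hat sa sb (s - 2 * h) * exp (- x * (2 * h)) \<le> hat sa (sb + 1) s * exp (\<mu> + 1)"
      using h by (intro mult_mono hat_shift_le hat_nonneg) auto
    then have "C0 * exp (x * s) * (hat sa sb (s - 2 * h) * exp (- x * (2 * h))) \<le> C0 * exp (x * s) * (hat sa (sb + 1) s * exp (\<mu> + 1))"
      using C0 by (intro mult_left_mono) auto
    then show ?thesis
      by (simp add: \<xi>_def \<xi>'_def right_diff_distrib exp_diff exp_minus field_simps)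
  qed
  have \<xi>\<xi>': "\<xi>' s \<le> \<xi> s" for s
  proof -
    have "hat sa sb s * 1 \<le> hat sa (sb + 1) s * exp (\<mu> + 1)"
      using hat_shift_le[of 0] E2 by (intro mult_mono hat_nonneg) auto
    then show ?thesis using C0 by (simp add: \<xi>_def \<xi>'_def mult_ac mult_left_mono)
  qed
  define GG where "GG = intg (\<lambda>z. rad (\<lambda>s. \<xi> s * exp (e * s)) z * (g z \<bullet> g z))"
  define WW where "WW = intg (\<lambda>z. rad (\<lambda>s. \<xi> s * exp ((e - 1) * s)) z * (w z)\<^sup>2)"
  have \<xi>0: "0 \<le> \<xi> s" "0 \<le> \<xi>' s" for s using C0 hat_nonneg by (auto simp: \<xi>_def \<xi>'_def)
  have GG0: "0 \<le> GG" "0 \<le> WW"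
    unfolding GG_def WW_def by (intro integral_nonneg_AE AE_I2 mult_nonneg_nonneg rad_nonneg; simp add: \<xi>0)+
  have GW: "GG = C0 * exp (\<mu> + 1) * grad_energy (hat sa (sb + 1))" "WW = C0 * exp (\<mu> + 1) * mass (hat sa (sb + 1))"
  proof -
    have *: "rad (\<lambda>s. \<xi> s * exp (x * s)) z = C0 * exp (\<mu> + 1) * rad (\<lambda>s. hat sa (sb + 1) s * exp (x * s)) z" for x z
      by (simp add: rad_def \<xi>_def)
    show "GG = C0 * exp (\<mu> + 1) * grad_energy (hat sa (sb + 1))" "WW = C0 * exp (\<mu> + 1) * mass (hat sa (sb + 1))"
      unfolding GG_def WW_def * grad_energy_def mass_def e_def by (simp_all only: mult.assoc integral_mult_right_zero)
  qed
  note ci = continuous_intros cont_data cont_hb cont_WZW[of h, folded l_def]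
  have h3: "h \<le> 2 / 3" using h by simp
  note cW = cont_WZW[OF h3, folded l_def]
  \<comment> \<open>positivity of the frozen form at \<open>g - c l g(l \<cdot>)\<close>\<close>
  define T1 where "T1 = intg (\<lambda>z. rad Y z * ((A *v g z) \<bullet> g z))"
  define T2 where "T2 = intg (\<lambda>z. rad Y z * ((A *v g (l *\<^sub>R z)) \<bullet> g (l *\<^sub>R z)))"
  define T3 where "T3 = intg (\<lambda>z. rad Y z * ((A *v g z) \<bullet> g (l *\<^sub>R z)))"
  have cAgl: "continuous_on hb (\<lambda>z. A *v g (l *\<^sub>R z))" by (intro continuous_intros cW)
  have iT: "integrable (lebesgue_on hb) (\<lambda>z. rad Y z * ((A *v g z) \<bullet> g z))"
    "integrable (lebesgue_on hb) (\<lambda>z. rad Y z * ((A *v g (l *\<^sub>R z)) \<bullet> g (l *\<^sub>R z)))"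
    "integrable (lebesgue_on hb) (\<lambda>z. rad Y z * ((A *v g z) \<bullet> g (l *\<^sub>R z)))"
    by (intro int_rad Y(1) continuous_intros cont_data cont_hb cAgl cW)+
  have T0: "0 \<le> T1 + (c * l)\<^sup>2 * T2 - 2 * c * l * T3"
  proof -
    have "0 \<le> intg (\<lambda>z. rad Y z * ((A *v (g z - (c * l) *\<^sub>R g (l *\<^sub>R z))) \<bullet> (g z - (c * l) *\<^sub>R g (l *\<^sub>R z))))"
      by (intro integral_nonneg_AE AE_I2 mult_nonneg_nonneg rad_nonneg Y0 A_nonneg)
    also have "\<dots> = intg (\<lambda>z. rad Y z * ((A *v g z) \<bullet> g z) + ((c * l)\<^sup>2 * (rad Y z * ((A *v g (l *\<^sub>R z)) \<bullet> g (l *\<^sub>R z)))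
        - 2 * c * l * (rad Y z * ((A *v g z) \<bullet> g (l *\<^sub>R z)))))"
    proof (rule Bochner_Integration.integral_cong[OF refl])
      fix z
      have "(A *v g (l *\<^sub>R z)) \<bullet> g z = (A *v g z) \<bullet> g (l *\<^sub>R z)"
        by (simp add: A_sym inner_commute)
      then show "rad Y z * ((A *v (g z - (c * l) *\<^sub>R g (l *\<^sub>R z))) \<bullet> (g z - (c * l) *\<^sub>R g (l *\<^sub>R z))) =
        rad Y z * ((A *v g z) \<bullet> g z) + ((c * l)\<^sup>2 * (rad Y z * ((A *v g (l *\<^sub>R z)) \<bullet> g (l *\<^sub>R z)))
        - 2 * c * l * (rad Y z * ((A *v g z) \<bullet> g (l *\<^sub>R z))))"
        by (simp add: matrix_vector_mult_diff_distrib matrix_vector_mult_scaleR inner_diff_left inner_diff_right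
            power2_eq_square algebra_simps)
    qed
    finally show ?thesis using iT by (simp add: T1_def T2_def T3_def)
  qed
  have X1: "\<bar>T1 - intg (\<lambda>z. rad Om z * (w z * (g z \<bullet> z)))\<bar> \<le> 6 * Ca * (GG + WW)"
  proof -
    have "\<bar>frozen_error Y Y'\<bar> \<le> 6 * Ca * (GG + WW)"
      unfolding GG_def WW_def e_def
    proof (rule frozen_error_le[OF Y p\<xi>(1)])
      show "\<bar>Y s\<bar> \<le> \<xi> s * exp (- \<mu> * s)" for s
        using Yb[of s] \<xi>\<xi>'[of s] by (meson order.trans mult_right_mono exp_ge_zero)
      show "\<bar>- 2 * Y' s * exp (- s)\<bar> \<le> \<xi> s * exp (- (\<mu> + 1) * s)" for s
        using Omb[of s] \<xi>\<xi>'[of s] fun_cong[OF Om_eq, of s] by (metis order.trans mult_right_mono exp_ge_zero)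
    qed
    then show ?thesis using frozen_outer[OF Y] unfolding T1_def Om_eq by simp
  qed
  have X2: "\<bar>(c * l)\<^sup>2 * T2 - intg (\<lambda>z. rad Om z * (W h z * ZW h z))\<bar> \<le> 6 * Ca * (GG + WW)"
  proof -
    \<comment> \<open>A change of variables turns the dilated gradient in \<open>T2\<close> into
      \<open>g\<close>, with the weight \<open>Y\<close> shifted by \<open>2 * h\<close>; the
      equation is then used with this shifted weight.\<close>
    define Yh where "Yh s = Y (s - 2 * h)" for s
    define Yh' where "Yh' s = Y' (s - 2 * h)" for s
    have Yz: "Y s = 0" "Om s = 0" if "s \<ge> smax - 2 * ln l" for s
      using that sb h ct_off[of s] l by (auto simp: Y_def Om_def)
    have Yh: "profile Yh" "\<And>s. (Yh has_real_derivative Yh' s) (at s)" "continuous_on UNIV Yh'"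
    proof -
      show "profile Yh" unfolding Yh_def using profile_shift[OF Y(1), of "2 * h"] Yz l by auto
      show "(Yh has_real_derivative Yh' s) (at s)" for s
        unfolding Yh_def[abs_def] Yh'_def
        by (rule DERIV_cong[OF DERIV_chain2[OF Y(2)]]) (auto intro!: derivative_eq_intros)
      show "continuous_on UNIV Yh'"
        unfolding Yh'_def[abs_def] by (rule continuous_on_compose2[OF Y(3)]) (auto intro!: continuous_intros)
    qed
    have cf: "continuous_on (H \<inter> cball 0 (2 * R)) (\<lambda>z. (A *v g z) \<bullet> g z)"
      "continuous_on (H \<inter> cball 0 (2 * R)) (\<lambda>z. w z * (g z \<bullet> z))"
      by (intro continuous_intros cont_g cont_w)+
    have T2: "T2 = l powr (- real CARD('m)) * intg (\<lambda>z. rad Yh z * ((A *v g z) \<bullet> g z))"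
      unfolding T2_def Yh_def[abs_def] using scale_rad[OF l(1,2) Y(1) Yz(1) cf(1)] l(4) by simp
    have Oh: "- 2 * Yh' s * exp (- s) = exp (- 2 * h) * Om (s - 2 * h)" for s
      unfolding Yh'_def fun_cong[OF Om_eq, symmetric] by (simp add: exp_diff exp_minus field_simps)
    have fe: "\<bar>frozen_error Yh Yh'\<bar> \<le> 6 * Ca * (GG + WW)"
      unfolding GG_def WW_def e_def
    proof (rule frozen_error_le[OF Yh p\<xi>(1)])
      show "\<bar>Yh s\<bar> \<le> \<xi> s * exp (- \<mu> * s)" for s
        using Yb[of "s - 2 * h"] shift[of "- \<mu>" s] by (simp add: Yh_def)
      show "\<bar>- 2 * Yh' s * exp (- s)\<bar> \<le> \<xi> s * exp (- (\<mu> + 1) * s)" for s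
      proof -
        have "\<bar>- 2 * Yh' s * exp (- s)\<bar> \<le> 1 * \<bar>Om (s - 2 * h)\<bar>"
          unfolding Oh abs_mult using h by (intro mult_right_mono) auto
        then show ?thesis using Omb[of "s - 2 * h"] shift[of "- (\<mu> + 1)" s] by simp
      qed
    qed
    have sc: "l powr (- real CARD('m)) * intg (\<lambda>z. rad (\<lambda>s. Om (s - 2 * h)) z * (w z * (g z \<bullet> z))) =
      intg (\<lambda>z. rad Om z * (w (l *\<^sub>R z) * (g (l *\<^sub>R z) \<bullet> (l *\<^sub>R z))))"
      using scale_rad[OF l(1,2) prof_Om(1) Yz(2) cf(2)] l(4) by simp
    have i1: "intg (\<lambda>z. rad (\<lambda>s. - 2 * Yh' s * exp (- s)) z * (w z * (g z \<bullet> z))) =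
      exp (- 2 * h) * intg (\<lambda>z. rad (\<lambda>s. Om (s - 2 * h)) z * (w z * (g z \<bullet> z)))"
      unfolding Oh unfolding rad_cmult mult.assoc by simp
    have "T2 = exp (- 2 * h) * (l powr (- real CARD('m)) * intg (\<lambda>z. rad (\<lambda>s. Om (s - 2 * h)) z * (w z * (g z \<bullet> z))))
       + l powr (- real CARD('m)) * frozen_error Yh Yh'"
      unfolding T2 frozen_outer[OF Yh] i1 by algebra
    then have T2': "T2 = exp (- 2 * h) * intg (\<lambda>z. rad Om z * (w (l *\<^sub>R z) * (g (l *\<^sub>R z) \<bullet> (l *\<^sub>R z))))
       + l powr (- real CARD('m)) * frozen_error Yh Yh'"
      unfolding sc .
    have e2: "(c * l)\<^sup>2 * exp (- 2 * h) = c\<^sup>2"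
      by (simp add: l_def power_mult_distrib exp_minus exp_double[symmetric] del: exp_double)
    have "intg (\<lambda>z. rad Om z * (W h z * ZW h z)) = c\<^sup>2 * intg (\<lambda>z. rad Om z * (w (l *\<^sub>R z) * (g (l *\<^sub>R z) \<bullet> (l *\<^sub>R z))))"
      unfolding integral_mult_right_zero[symmetric]
      by (intro Bochner_Integration.integral_cong) (auto simp: W_def ZW_def c_def l_def power2_eq_square)
    then have "(c * l)\<^sup>2 * T2 - intg (\<lambda>z. rad Om z * (W h z * ZW h z)) =
       ((c * l)\<^sup>2 * l powr (- real CARD('m))) * frozen_error Yh Yh'"
      unfolding T2' distrib_left mult.assoc[symmetric] e2 by simp
    moreover have k0: "0 \<le> (c * l)\<^sup>2 * l powr (- real CARD('m))" by simp
    \<comment> \<open>The error is not amplified: the dimension is at least 2, so the Jacobian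
      absorbs the factor \<open>l\<^sup>2\<close>.\<close>
    moreover have k1: "(c * l)\<^sup>2 * l powr (- real CARD('m)) \<le> 1"
    proof -
      have "l powr (- real CARD('m)) \<le> l powr (- 2)" using l dimension by (intro powr_mono) auto
      then have "(c * l)\<^sup>2 * l powr (- real CARD('m)) \<le> (c * l)\<^sup>2 * l powr (- 2)" by (intro mult_left_mono) auto
      also have "\<dots> = c\<^sup>2" using l by (simp add: powr_minus power_mult_distrib)
      also have "\<dots> \<le> 1" using c by (simp add: power_le_one)
      finally show ?thesis .
    qed
    moreover have "\<bar>((c * l)\<^sup>2 * l powr (- real CARD('m))) * frozen_error Yh Yh'\<bar> \<le> 6 * Ca * (GG + WW)"
      unfolding abs_mult[of "(c * l)\<^sup>2 * l powr (- real CARD('m))"] abs_of_nonneg[OF k0]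
      using order.trans[OF mult_right_mono[OF k1 abs_ge_zero]] fe by simp
    ultimately show ?thesis by (simp only:)
  qed
  have X3: "intg (\<lambda>z. rad Om z * (W h z * (g z \<bullet> z))) - 8 * Ca * (GG + WW) \<le> c * l * T3"
  proof -
    let ?E1 = "intg (\<lambda>z. rad Y z * ((A *v g z - a z *v g z) \<bullet> g (l *\<^sub>R z)))"
    let ?E2 = "intg (\<lambda>z. rad Om z * (w (l *\<^sub>R z) * ((a z *v g z - A *v g z) \<bullet> (P *v z))))"
    have AgP: "(A *v g z) \<bullet> (P *v z) = g z \<bullet> z" for z
      by (simp add: A_sym AP)
    have p1: "intg (\<lambda>z. rad Om z * (w (l *\<^sub>R z) * ((a z *v g z) \<bullet> (P *v z))))
      \<le> intg (\<lambda>z. rad Y z * (l * ((a z *v g z) \<bullet> g (l *\<^sub>R z))))"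
      using outer_dilated_rad[OF Y Y0 l(1,2)] unfolding Om_eq .
    have p2: "intg (\<lambda>z. rad Y z * (l * ((a z *v g z) \<bullet> g (l *\<^sub>R z)))) = l * T3 + - l * ?E1"
      unfolding T3_def integral_mult_right_zero[symmetric]
      by (rule intg_add; (intro integrable_mult_right int_rad Y(1) continuous_intros cont_data cont_hb cW)?)
        (simp add: inner_diff_left algebra_simps)
    have p3: "intg (\<lambda>z. rad Om z * (w (l *\<^sub>R z) * ((a z *v g z) \<bullet> (P *v z)))) =
       intg (\<lambda>z. rad Om z * (w (l *\<^sub>R z) * (g z \<bullet> z))) + ?E2"
      by (rule intg_add; (intro int_rad prof_Om continuous_intros cont_data cont_hb cW)?)
        (simp only: inner_diff_left AgP, simp add: algebra_simps)
    have p4: "c * intg (\<lambda>z. rad Om z * (w (l *\<^sub>R z) * (g z \<bullet> z))) = intg (\<lambda>z. rad Om z * (W h z * (g z \<bullet> z)))"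
      unfolding integral_mult_right_zero[symmetric]
      by (intro Bochner_Integration.integral_cong) (auto simp: W_def c_def l_def)
    define G1 where "G1 = intg (\<lambda>z. rad (\<lambda>s. \<xi>' s * exp (e * s)) z * (g z \<bullet> g z))"
    define G2 where "G2 = intg (\<lambda>z. rad (\<lambda>s. \<xi>' s * exp (e * s)) z * (g (l *\<^sub>R z) \<bullet> g (l *\<^sub>R z)))"
    define W2 where "W2 = intg (\<lambda>z. rad (\<lambda>s. \<xi>' s * exp ((e - 1) * s)) z * (w (l *\<^sub>R z))\<^sup>2)"
    have iG: "integrable (lebesgue_on hb) (\<lambda>z. rad (\<lambda>s. \<xi>' s * exp (e * s)) z * (g z \<bullet> g z))"
      "integrable (lebesgue_on hb) (\<lambda>z. rad (\<lambda>s. \<xi>' s * exp (e * s)) z * (g (l *\<^sub>R z) \<bullet> g (l *\<^sub>R z)))"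
      "integrable (lebesgue_on hb) (\<lambda>z. rad (\<lambda>s. \<xi>' s * exp ((e - 1) * s)) z * (w (l *\<^sub>R z))\<^sup>2)"
      by (intro int_rad profile_exp p\<xi> continuous_intros cont_data cont_hb cW)+
    have iGW: "integrable (lebesgue_on hb) (\<lambda>z. rad (\<lambda>s. \<xi> s * exp (e * s)) z * (g z \<bullet> g z))"
      "integrable (lebesgue_on hb) (\<lambda>z. rad (\<lambda>s. \<xi> s * exp ((e - 1) * s)) z * (w z)\<^sup>2)"
      by (intro int_rad profile_exp p\<xi> continuous_intros cont_data cont_hb cW)+
    have G1: "G1 \<le> GG"
      unfolding G1_def GG_def
      by (intro intg_mono iG iGW mult_right_mono rad_le \<xi>\<xi>') auto
    have lp: "l powr (- real CARD('m)) \<le> 1" using l powr_mono[of "- real CARD('m)" 0 l] by simp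
    have shz: "\<xi>' s * exp (x * s) = 0" if "s \<ge> smax - 2 * ln l" for s x
      using that sb h l hat_eq_0[of s sa sb] by (simp add: \<xi>'_def)
    have G2: "G2 \<le> GG"
    proof -
      have "G2 = l powr (- real CARD('m)) * intg (\<lambda>z. rad (\<lambda>s. \<xi>' (s - 2 * h) * exp (e * (s - 2 * h))) z * (g z \<bullet> g z))"
        unfolding G2_def using scale_rad[OF l(1,2) profile_exp[OF p\<xi>(2)] shz, of "\<lambda>z. g z \<bullet> g z" e] l(4) cont_g
        by (auto intro!: continuous_intros)
      also have "\<dots> \<le> 1 * GG"
      proof (intro mult_mono)
        show "intg (\<lambda>z. rad (\<lambda>s. \<xi>' (s - 2 * h) * exp (e * (s - 2 * h))) z * (g z \<bullet> g z)) \<le> GG"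
          unfolding GG_def
        proof (rule intg_mono[OF _ iGW(1)])
          show "integrable (lebesgue_on hb) (\<lambda>z. rad (\<lambda>s. \<xi>' (s - 2 * h) * exp (e * (s - 2 * h))) z * (g z \<bullet> g z))"
            using profile_shift[OF profile_exp[OF p\<xi>(2)] shz, folded l(4)] l(4)
            by (intro int_rad cont_data) auto
          show "rad (\<lambda>s. \<xi>' (s - 2 * h) * exp (e * (s - 2 * h))) z * (g z \<bullet> g z) \<le> rad (\<lambda>s. \<xi> s * exp (e * s)) z * (g z \<bullet> g z)" for z
            using gamma by (intro mult_right_mono rad_le shift) (auto simp: e_def)
        qed
        show "0 \<le> intg (\<lambda>z. rad (\<lambda>s. \<xi>' (s - 2 * h) * exp (e * (s - 2 * h))) z * (g z \<bullet> g z))"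
          by (intro integral_nonneg_AE AE_I2 mult_nonneg_nonneg rad_nonneg; simp add: \<xi>0)
      qed (use lp in auto)
      finally show ?thesis by simp
    qed
    have W2: "W2 \<le> WW"
    proof -
      have "W2 = l powr (- real CARD('m)) * intg (\<lambda>z. rad (\<lambda>s. \<xi>' (s - 2 * h) * exp ((e - 1) * (s - 2 * h))) z * (w z)\<^sup>2)"
        unfolding W2_def using scale_rad[OF l(1,2) profile_exp[OF p\<xi>(2)] shz, of "\<lambda>z. (w z)\<^sup>2" "e - 1"] l(4) cont_w
        by (auto intro!: continuous_intros)
      also have "\<dots> \<le> 1 * WW"
      proof (intro mult_mono)
        show "intg (\<lambda>z. rad (\<lambda>s. \<xi>' (s - 2 * h) * exp ((e - 1) * (s - 2 * h))) z * (w z)\<^sup>2) \<le> WW"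
          unfolding WW_def
        proof (rule intg_mono[OF _ iGW(2)])
          show "integrable (lebesgue_on hb) (\<lambda>z. rad (\<lambda>s. \<xi>' (s - 2 * h) * exp ((e - 1) * (s - 2 * h))) z * (w z)\<^sup>2)"
            using profile_shift[OF profile_exp[OF p\<xi>(2)] shz, folded l(4)] l(4)
            by (intro int_rad cont_data) auto
          show "rad (\<lambda>s. \<xi>' (s - 2 * h) * exp ((e - 1) * (s - 2 * h))) z * (w z)\<^sup>2 \<le> rad (\<lambda>s. \<xi> s * exp ((e - 1) * s)) z * (w z)\<^sup>2" for z
            using gamma by (intro mult_right_mono rad_le shift) (auto simp: e_def)
        qed
        show "0 \<le> intg (\<lambda>z. rad (\<lambda>s. \<xi>' (s - 2 * h) * exp ((e - 1) * (s - 2 * h))) z * (w z)\<^sup>2)"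
          by (intro integral_nonneg_AE AE_I2 mult_nonneg_nonneg rad_nonneg; simp add: \<xi>0)
      qed (use lp in auto)
      finally show ?thesis by simp
    qed
    have E1: "\<bar>?E1\<bar> \<le> Ca * (G1 + G2)"
    proof -
      have "\<bar>?E1\<bar> \<le> intg (\<lambda>z. Ca * (rad (\<lambda>s. \<xi>' s * exp (e * s)) z * (g z \<bullet> g z)
          + rad (\<lambda>s. \<xi>' s * exp (e * s)) z * (g (l *\<^sub>R z) \<bullet> g (l *\<^sub>R z))))"
      proof (rule intg_abs_le)
        fix z assume z: "z \<in> hb"
        show "\<bar>rad Y z * ((A *v g z - a z *v g z) \<bullet> g (l *\<^sub>R z))\<bar> \<le> Ca * (rad (\<lambda>s. \<xi>' s * exp (e * s)) z * (g z \<bullet> g z)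
          + rad (\<lambda>s. \<xi>' s * exp (e * s)) z * (g (l *\<^sub>R z) \<bullet> g (l *\<^sub>R z)))"
          using coeff_error_gradient[OF z Yb, of "g (l *\<^sub>R z)"] by (simp only: e_def distrib_left)
      qed (intro int_rad Y(1) integrable_mult_right Bochner_Integration.integrable_add iG continuous_intros cont_data cont_hb cW)+
      then show ?thesis using iG by (simp add: G1_def G2_def)
    qed
    have E2: "\<bar>?E2\<bar> \<le> 4 * Ca * (G1 + W2)"
    proof -
      have "\<bar>?E2\<bar> \<le> intg (\<lambda>z. 4 * Ca * (rad (\<lambda>s. \<xi>' s * exp (e * s)) z * (g z \<bullet> g z)
          + rad (\<lambda>s. \<xi>' s * exp ((e - 1) * s)) z * (w (l *\<^sub>R z))\<^sup>2))"
      proof (rule intg_abs_le)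
        fix z assume z: "z \<in> hb"
        show "\<bar>rad Om z * (w (l *\<^sub>R z) * ((a z *v g z - A *v g z) \<bullet> (P *v z)))\<bar> \<le> 
          4 * Ca * (rad (\<lambda>s. \<xi>' s * exp (e * s)) z * (g z \<bullet> g z)
          + rad (\<lambda>s. \<xi>' s * exp ((e - 1) * s)) z * (w (l *\<^sub>R z))\<^sup>2)"
          using coeff_error_mixed[OF z Omb] by (simp only: e_def)
      qed (intro int_rad prof_Om integrable_mult_right Bochner_Integration.integrable_add iG continuous_intros cont_data cont_hb cW)+
      then show ?thesis using iG by (simp add: G1_def W2_def)
    qed
    \<comment> \<open>The factor \<open>c * l \<le> 2\<close> doubles the bound
      \<open>2 * (Ca * GG)\<close> of the first error, and \<open>c \<le> 1\<close> leaves the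
      second one at \<open>4 * Ca * (GG + WW)\<close>; the sum stays below 8 times
      \<open>Ca * (GG + WW)\<close>.\<close>
    have p5: "c * l * ?E1 + c * ?E2 \<ge> - 8 * Ca * (GG + WW)"
    proof -
      have "Ca * (G1 + G2) \<le> Ca * (GG + GG)" "4 * Ca * (G1 + W2) \<le> 4 * Ca * (GG + WW)"
        using G1 G2 W2 Ca_nonneg by (intro mult_left_mono; simp)+
      then have "\<bar>?E1\<bar> \<le> 2 * (Ca * GG)" "\<bar>?E2\<bar> \<le> 4 * (Ca * GG) + 4 * (Ca * WW)"
        using E1 E2 by (simp_all add: algebra_simps)
      moreover have "\<bar>c * l * ?E1\<bar> \<le> 2 * \<bar>?E1\<bar>" "\<bar>c * ?E2\<bar> \<le> \<bar>?E2\<bar>"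
        using c l mult_mono[of c 1 l 2] by (auto simp: abs_mult intro!: mult_right_mono mult_left_le_one_le)
      moreover have "0 \<le> Ca * WW" using Ca_nonneg GG0 by simp
      ultimately show ?thesis by (simp add: algebra_simps abs_le_iff) linarith
    qed
    have gen: "S1 - 8 * Ca * (GG + WW) \<le> c * l * T3"
      if "S0 + E2 \<le> l * T3 + - l * E1" "c * S0 = S1" "c * l * E1 + c * E2 \<ge> - 8 * Ca * (GG + WW)" for S0 S1 E1 E2
    proof -
      have "c * (S0 + E2) \<le> c * (l * T3 + - l * E1)" using that c by (intro mult_left_mono) auto
      then show ?thesis using that by (simp add: algebra_simps)
    qed
    show ?thesis
      by (rule gen[OF p1[unfolded p2 p3] p4 p5])
  qed
  have S: "intg (\<lambda>z. rad Om z * (w z * (g z \<bullet> z) + W h z * ZW h z - 2 * (W h z * (g z \<bullet> z)))) =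
     intg (\<lambda>z. rad Om z * (w z * (g z \<bullet> z))) + (intg (\<lambda>z. rad Om z * (W h z * ZW h z))
      - 2 * intg (\<lambda>z. rad Om z * (W h z * (g z \<bullet> z))))"
  proof -
    have i: "integrable (lebesgue_on hb) (\<lambda>z. rad Om z * (w z * (g z \<bullet> z)))"
      "integrable (lebesgue_on hb) (\<lambda>z. rad Om z * (W h z * ZW h z))"
      "integrable (lebesgue_on hb) (\<lambda>z. rad Om z * (W h z * (g z \<bullet> z)))"
      by (intro int_rad prof_Om continuous_intros cont_data cont_hb cW)+
    have "intg (\<lambda>z. rad Om z * (w z * (g z \<bullet> z) + W h z * ZW h z - 2 * (W h z * (g z \<bullet> z)))) =
      intg (\<lambda>z. rad Om z * (w z * (g z \<bullet> z)) + (rad Om z * (W h z * ZW h z) - 2 * (rad Om z * (W h z * (g z \<bullet> z)))))"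
      by (intro Bochner_Integration.integral_cong) (auto simp: algebra_simps)
    then show ?thesis using i by simp
  qed
  have "Ca * C0 * exp (\<mu> + 1) * (grad_energy (hat sa (sb + 1)) + mass (hat sa (sb + 1))) = Ca * (GG + WW)"
    unfolding GW by (simp add: algebra_simps)
  then show ?thesis
    using T0 X1 X2 X3 unfolding S C0_def[symmetric] by (simp add: algebra_simps abs_le_iff)
qed

lemma sum_weight_nonneg: "(\<And>s. 0 \<le> \<xi> s) \<Longrightarrow> (\<And>z. z \<in> hb \<Longrightarrow> 0 \<le> f z) \<Longrightarrow>
  0 \<le> intg (\<lambda>z. rad (\<lambda>s. \<xi> s * exp (x * s)) z * f z)"
  by (rule integral_nonneg_AE, rule AE_I2) (auto intro!: mult_nonneg_nonneg rad_nonneg)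

lemma weighted_mono:
  assumes "profile Y" "profile Z" "\<And>s. Y s \<le> Z s" "continuous_on hb f" "\<And>z. z \<in> hb \<Longrightarrow> 0 \<le> f z"
  shows "intg (\<lambda>z. rad Y z * f z) \<le> intg (\<lambda>z. rad Z z * f z)"
  using assms by (intro intg_mono int_rad mult_right_mono rad_le)

text \<open>32 = 2 * 2 * 8: the inverse of the lower ellipticity constant, the factor 2 from the
  gradient of \<open>q\<close>, and the 8 in the bound on
  \<open>(a z *v g z) \<bullet> (P *v z)\<close>.\<close>

definition M :: real where "M = 32 * (2 * B + \<mu> + 1)"

text \<open>The test weight contains \<open>\<psi>\<close> squared, so its derivative retains one
  factor \<open>\<psi>\<close> for the gradient; AM-GM leaves half of the energy on the right, which
  is absorbed.\<close>

lemma caccioppoli: "grad_energy (hat sa (sb + 1)) \<le> M\<^sup>2 * mass (hat (sa - 2) (sb + 3))"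
proof -
  define e where "e = \<gamma> / 2 - \<mu>"
  define \<eta> where "\<eta> = hat (sa - 2) (sb + 3)"
  define Y where "Y s = (\<psi> s)\<^sup>2 * exp (e * s)" for s
  define Y' where "Y' s = (2 * \<psi> s * \<psi>1 s + e * (\<psi> s)\<^sup>2) * exp (e * s)" for s
  have e: "\<bar>e\<bar> \<le> \<mu> + 1" using gamma mu_pos(1) by (auto simp: e_def)
  have p\<psi>2: "profile (\<lambda>s. (\<psi> s)\<^sup>2)"
    unfolding power2_eq_square by (intro profile_mult prof_chi cont_chi)
  have Y: "profile Y" "\<And>s. (Y has_real_derivative Y' s) (at s)" "continuous_on UNIV Y'"
  proof -
    show "profile Y" unfolding Y_def[abs_def] by (rule profile_exp[OF p\<psi>2])
    show "(Y has_real_derivative Y' s) (at s)" for s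
      unfolding Y_def[abs_def] Y'_def
      by (auto intro!: derivative_eq_intros psi_deriv simp: algebra_simps)
    show "continuous_on UNIV Y'"
      unfolding Y'_def[abs_def] by (intro continuous_intros cont_chi psi_deriv(2))
  qed
  have p\<eta>: "profile \<eta>" unfolding \<eta>_def using sb by (intro prof_hat) simp
  have p2: "profile (\<lambda>s. - 2 * Y' s * exp (- s))"
    by (intro profile_mult profile_deriv[OF Y] continuous_intros)
  define G where "G = intg (\<lambda>z. rad Y z * (g z \<bullet> g z))"
  define N where "N = intg (\<lambda>z. rad (\<lambda>s. \<eta> s * exp ((e - 1) * s)) z * (w z)\<^sup>2)"
  have iG: "integrable (lebesgue_on hb) (\<lambda>z. rad Y z * (g z \<bullet> g z))"
    and iN: "integrable (lebesgue_on hb) (\<lambda>z. rad (\<lambda>s. \<eta> s * exp ((e - 1) * s)) z * (w z)\<^sup>2)"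
    by (intro int_rad Y(1) profile_exp p\<eta> cont_data)+
  have "G \<le> intg (\<lambda>z. 2 * (rad Y z * ((a z *v g z) \<bullet> g z)))"
    unfolding G_def
  proof (rule intg_mono[OF iG])
    fix z assume z: "z \<in> hb"
    have "g z \<bullet> g z \<le> 2 * ((a z *v g z) \<bullet> g z)" using a_lower[OF z, of "g z"] by (simp add: power2_norm_eq_inner)
    moreover have "0 \<le> rad Y z" by (rule rad_nonneg) (simp add: Y_def)
    ultimately show "rad Y z * (g z \<bullet> g z) \<le> 2 * (rad Y z * ((a z *v g z) \<bullet> g z))"
      using mult_left_mono[of "g z \<bullet> g z" "2 * ((a z *v g z) \<bullet> g z)" "rad Y z"] by simp
  qed (intro integrable_mult_right int_rad Y(1) continuous_intros cont_data cont_hb)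
  also have "\<dots> = intg (\<lambda>z. 2 * (rad (\<lambda>s. - 2 * Y' s * exp (- s)) z * (w z * ((a z *v g z) \<bullet> (P *v z)))))"
    unfolding integral_mult_right_zero outer_rad[OF Y] ..
  also have "\<dots> \<le> intg (\<lambda>z. (1 / 2) * (rad Y z * (g z \<bullet> g z) + M\<^sup>2 * (rad (\<lambda>s. \<eta> s * exp ((e - 1) * s)) z * (w z)\<^sup>2)))"
  proof (rule intg_mono)
    fix z assume z: "z \<in> hb"
    show "2 * (rad (\<lambda>s. - 2 * Y' s * exp (- s)) z * (w z * ((a z *v g z) \<bullet> (P *v z))))
      \<le> (1 / 2) * (rad Y z * (g z \<bullet> g z) + M\<^sup>2 * (rad (\<lambda>s. \<eta> s * exp ((e - 1) * s)) z * (w z)\<^sup>2))"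
    proof (cases "z = 0")
      case False
      define s where "s = ln (q z)"
      show ?thesis
      proof (cases "s < sa - 2 \<or> sb + 3 < s")
        case True
        then have "\<psi> s = 0" "\<psi>1 s = 0" using psi_off by auto
        then show ?thesis using False hat_nonneg
          by (simp add: rad_nonzero s_def[symmetric] Y_def Y'_def \<eta>_def)
      next
        case in_s: False
        have M0: "0 \<le> M" using B mu_pos(1) by (simp add: M_def)
        have "\<bar>2 * \<psi> s * \<psi>1 s + e * (\<psi> s)\<^sup>2\<bar> = \<psi> s * \<bar>2 * \<psi>1 s + e * \<psi> s\<bar>"
        proof -
          have "2 * \<psi> s * \<psi>1 s + e * (\<psi> s)\<^sup>2 = \<psi> s * (2 * \<psi>1 s + e * \<psi> s)"
            by (simp add: power2_eq_square algebra_simps)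
          then show ?thesis using psi_range[of s] by (simp only: abs_mult abs_of_nonneg)
        qed
        also have "\<dots> \<le> \<psi> s * (2 * B + (\<mu> + 1))"
        proof (rule mult_left_mono)
          have "\<bar>e * \<psi> s\<bar> \<le> (\<mu> + 1) * 1"
            unfolding abs_mult using e psi_range[of s] by (intro mult_mono) auto
          then show "\<bar>2 * \<psi>1 s + e * \<psi> s\<bar> \<le> 2 * B + (\<mu> + 1)" 
            using psi_bound[of s] abs_triangle_ineq[of "2 * \<psi>1 s" "e * \<psi> s"] by simp
        qed (rule psi_range)
        finally have Yb: "\<bar>- 2 * Y' s * exp (- s)\<bar> \<le> 2 * (\<psi> s * (2 * B + (\<mu> + 1))) * (exp (e * s) * exp (- s))"
          by (simp add: Y'_def abs_mult mult_right_mono)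
        have "\<bar>(a z *v g z) \<bullet> (P *v z)\<bar> \<le> norm (a z *v g z) * norm (P *v z)"
          by (rule Cauchy_Schwarz_ineq2)
        also have "\<dots> \<le> (2 * norm (g z)) * (4 * exp (s / 2))"
          using a_upper[OF z] P_upper[of z] norm_le_exp[OF False] by (intro mult_mono) (auto simp: s_def)
        finally have ag: "\<bar>(a z *v g z) \<bullet> (P *v z)\<bar> \<le> 8 * norm (g z) * exp (s / 2)" by simp
        have "2 * (rad (\<lambda>s. - 2 * Y' s * exp (- s)) z * (w z * ((a z *v g z) \<bullet> (P *v z))))
          \<le> 2 * (\<bar>- 2 * Y' s * exp (- s)\<bar> * (\<bar>w z\<bar> * \<bar>(a z *v g z) \<bullet> (P *v z)\<bar>))"
        proof -
          have "rad (\<lambda>s. - 2 * Y' s * exp (- s)) z = - 2 * Y' s * exp (- s)"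
            using False by (simp add: rad_nonzero s_def)
          moreover have "x * (y * u) \<le> \<bar>x\<bar> * (\<bar>y\<bar> * \<bar>u\<bar>)" for x y u :: real
            using abs_ge_self[of "x * (y * u)"] by (simp only: abs_mult)
          ultimately show ?thesis by (simp only: mult_le_cancel_left_pos zero_less_numeral)
        qed
        also have "\<dots> \<le> 2 * ((2 * (\<psi> s * (2 * B + (\<mu> + 1))) * (exp (e * s) * exp (- s))) * (\<bar>w z\<bar> * (8 * norm (g z) * exp (s / 2))))"
        proof (intro mult_left_mono mult_mono Yb ag abs_ge_zero mult_nonneg_nonneg norm_ge_zero exp_ge_zero)
          show "0 \<le> 2 * B + (\<mu> + 1)" using B mu_pos(1) by simp
        qed (use psi_range in simp_all)
        also have "\<dots> = (exp (e * s) * exp (- s) * exp (s / 2)) * (\<psi> s * norm (g z)) * (M * \<bar>w z\<bar>)"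
          by (simp add: M_def algebra_simps)
        also have "exp (e * s) * exp (- s) * exp (s / 2) = exp ((e - 1 / 2) * s)"
          by (simp add: mult_exp_exp algebra_simps)
        also have "exp ((e - 1 / 2) * s) * (\<psi> s * norm (g z)) * (M * \<bar>w z\<bar>) \<le>
          (exp (e * s) * (\<psi> s * norm (g z))\<^sup>2 + exp ((e - 1) * s) * (M * \<bar>w z\<bar>)\<^sup>2) / 2"
          using exp_amgm[of "\<psi> s * norm (g z)" "M * \<bar>w z\<bar>" e s] psi_range[of s] M0 by (simp add: mult_ac)
        also have "\<dots> = (1 / 2) * (rad Y z * (g z \<bullet> g z) + M\<^sup>2 * (rad (\<lambda>s. \<eta> s * exp ((e - 1) * s)) z * (w z)\<^sup>2))"
          using False in_s by (simp add: rad_nonzero s_def[symmetric] Y_def \<eta>_def hat_eq_1 power_mult_distrib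
              power2_norm_eq_inner algebra_simps)
        finally show ?thesis .
      qed
    qed simp
  qed (intro integrable_mult_right Bochner_Integration.integrable_add iG iN int_rad p2 continuous_intros cont_data cont_hb)+
  also have "\<dots> = (1 / 2) * (G + M\<^sup>2 * N)"
    using iG iN by (simp add: G_def N_def)
  finally have "G \<le> M\<^sup>2 * N" by simp
  moreover have "grad_energy (hat sa (sb + 1)) \<le> G"
    unfolding grad_energy_def G_def e_def[symmetric]
  proof (rule weighted_mono)
    show "profile (\<lambda>s. hat sa (sb + 1) s * exp (e * s))" using sb by (intro profile_exp prof_hat) simp
    show "hat sa (sb + 1) s * exp (e * s) \<le> Y s" for s
    proof (cases "sa - 1 \<le> s \<and> s \<le> sb + 2")
      case True
      then show ?thesis using psi_on hat_le by (simp add: Y_def)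
    next
      case False
      then have "hat sa (sb + 1) s = 0" by (intro hat_eq_0) auto
      then show ?thesis by (simp add: Y_def)
    qed
  qed (auto intro: Y(1) cont_data)
  moreover have "N = mass (hat (sa - 2) (sb + 3))" by (simp add: N_def mass_def e_def \<eta>_def)
  ultimately show ?thesis by simp
qed

section \<open>The differential inequality in the dilation parameter\<close>

definition Q :: "real \<Rightarrow> real" where "Q h = intg (\<lambda>z. rad Om z * (W h z - w z)\<^sup>2)"

text \<open>Neighbourhoods of the two ends of the cutoff. They cover the shells where
  \<open>ct\<close> varies, also after a shift by up to one, and the part of the Caccioppoli cutoff
  on which \<open>ct\<close> falls below one.\<close>

definition \<zeta> :: "real \<Rightarrow> real" where "\<zeta> s = hat (sa - 3) (sa + 3) s + hat (sb - 3) (sb + 4) s"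

definition J :: real where "J = intg (\<lambda>z. rad (\<lambda>s. \<zeta> s * exp (- (\<mu> + 1) * s)) z * (w z)\<^sup>2)"

lemma zeta_nonneg: "0 \<le> \<zeta> s"
  using hat_nonneg by (simp add: \<zeta>_def)

lemma zeta_ge_1: "sa - 3 \<le> s \<and> s \<le> sa + 3 \<or> sb - 3 \<le> s \<and> s \<le> sb + 4 \<Longrightarrow> 1 \<le> \<zeta> s"
  using hat_eq_1[of "sa - 3" s "sa + 3"] hat_eq_1[of "sb - 3" s "sb + 4"]
    hat_nonneg[of "sa - 3" "sa + 3" s] hat_nonneg[of "sb - 3" "sb + 4" s] by (auto simp: \<zeta>_def)

lemma W_deriv:
  assumes "z \<in> hb" "h < 2 / 3"
  shows "((\<lambda>h. W h z) has_real_derivative ZW h z - \<kappa> * W h z) (at h)"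
proof -
  have "exp h < exp (2 / 3)" using assms(2) by simp
  also have "\<dots> \<le> (2::real)" by (rule exp_le_2) simp
  finally have "norm (exp h *\<^sub>R z) < 2 * R"
    using assms(1) R_pos mult_less_le_imp_less[of "exp h" 2 "norm z" R]
    by (cases "z = 0") (auto simp: mult_less_le_imp_less)
  then have "((\<lambda>t. w (t *\<^sub>R z)) has_real_derivative g (exp h *\<^sub>R z) \<bullet> z) (at (exp h))"
    using ray assms(1) by auto
  from DERIV_chain2[where f="\<lambda>t. w (t *\<^sub>R z)" and g=exp, OF this DERIV_exp] have "((\<lambda>h. w (exp h *\<^sub>R z)) has_real_derivative (g (exp h *\<^sub>R z) \<bullet> z) * exp h) (at h)"
    by simp
  then show ?thesis
    unfolding W_def ZW_def by (auto intro!: derivative_eq_intros simp: algebra_simps)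
qed

lemma Q_deriv:
  assumes "0 \<le> h" "h \<le> 1 / 2"
  shows "(Q has_real_derivative intg (\<lambda>z. rad Om z * (2 * (W h z - w z) * (ZW h z - \<kappa> * W h z)))) (at h)"
proof -
  have c2: "compact (H \<inter> cball 0 (2 * R))" using closed_H by (simp add: closed_Int_compact)
  obtain Bw where Bw: "\<And>z. z \<in> H \<inter> cball 0 (2 * R) \<Longrightarrow> \<bar>w z\<bar> \<le> Bw"
    using compact_imp_bounded[OF compact_continuous_image[OF cont_w c2]] unfolding bounded_iff by (metis imageI real_norm_def)
  obtain Bg where Bg: "\<And>z. z \<in> H \<inter> cball 0 (2 * R) \<Longrightarrow> norm (g z) \<le> Bg"
    using compact_imp_bounded[OF compact_continuous_image[OF cont_g c2]] unfolding bounded_iff by (metis imageI)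
  obtain Bo where Bo: "\<And>z. z \<in> hb \<Longrightarrow> \<bar>rad Om z\<bar> \<le> Bo"
    using compact_imp_bounded[OF compact_continuous_image[OF cont_rad[OF prof_Om(1)] compact_hb]]
    unfolding bounded_iff by (metis imageI real_norm_def)
  define C where "C = max 1 (max Bw (max Bg Bo))"
  have CC: "1 \<le> C" "Bw \<le> C" "Bg \<le> C" "Bo \<le> C" by (auto simp: C_def)
  have C: "1 \<le> C" "\<And>z. z \<in> H \<inter> cball 0 (2 * R) \<Longrightarrow> \<bar>w z\<bar> \<le> C" "\<And>z. z \<in> H \<inter> cball 0 (2 * R) \<Longrightarrow> norm (g z) \<le> C"
    "\<And>z. z \<in> hb \<Longrightarrow> \<bar>rad Om z\<bar> \<le> C"
    using CC(1) order.trans[OF Bw CC(2)] order.trans[OF Bg CC(3)] order.trans[OF Bo CC(4)] by blast+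
  define D where "D = exp \<kappa> * C"
  have D: "1 \<le> D" "C \<le> D" using C(1) kappa mult_mono[of 1 "exp \<kappa>" 1 C] mult_right_mono[of 1 "exp \<kappa>" C] by (auto simp: D_def)
  \<comment> \<open>The parameter interval ends at 2/3, below \<open>ln 2\<close>, so
    \<open>exp t *\<^sub>R z\<close> stays in the ball of radius \<open>2 * R\<close> where
    \<open>w\<close> and \<open>g\<close> are continuous; \<open>[0, 1/2]\<close> lies in its
    interior.\<close>
  show ?thesis
    unfolding Q_def[abs_def]
  proof (rule DERIV_under_integral[where I="{-1<..<2/3}" and B="C * (2 * (2 * D) * (2 * D + \<kappa> * D))"])
    fix t z assume t: "t \<in> {-1<..<2/3::real}" and z: "z \<in> hb"
    show "((\<lambda>h. rad Om z * (W h z - w z)\<^sup>2) has_real_derivative rad Om z * (2 * (W t z - w z) * (ZW t z - \<kappa> * W t z))) (at t)"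
      using t by (auto intro!: derivative_eq_intros W_deriv z)
    have l2: "exp t \<le> 2" using t by (intro exp_le_2) auto
    have tz: "exp t *\<^sub>R z \<in> H \<inter> cball 0 (2 * R)"
      using z cone_H[of z "exp t"] mult_mono[OF l2, of "norm z" R] by auto
    have zz: "z \<in> H \<inter> cball 0 (2 * R)" using z R_pos by auto
    have ek: "exp (- \<kappa> * t) \<le> exp \<kappa>" using t kappa mult_left_mono[of "-t" 1 \<kappa>] by auto
    have "\<bar>W t z\<bar> \<le> D"
      unfolding W_def D_def abs_mult using ek C(2)[OF tz] by (intro mult_mono) auto
    moreover have "\<bar>w z\<bar> \<le> D" using C(2)[OF zz] D by simp
    moreover have "\<bar>ZW t z\<bar> \<le> 2 * D"
    proof -
      have "\<bar>g (exp t *\<^sub>R z) \<bullet> z\<bar> \<le> norm (g (exp t *\<^sub>R z)) * norm z" by (rule Cauchy_Schwarz_ineq2)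
      also have "\<dots> \<le> C * 1" using C(1,3) tz z R_le by (intro mult_mono) auto
      finally have "\<bar>exp (- \<kappa> * t)\<bar> * (\<bar>exp t\<bar> * \<bar>g (exp t *\<^sub>R z) \<bullet> z\<bar>) \<le> exp \<kappa> * (2 * (C * 1))"
        using ek l2 by (intro mult_mono) auto
      then show ?thesis unfolding ZW_def D_def abs_mult by simp
    qed
    ultimately have 1: "\<bar>W t z - w z\<bar> \<le> 2 * D" "\<bar>ZW t z - \<kappa> * W t z\<bar> \<le> 2 * D + \<kappa> * D"
    proof -
      assume a: "\<bar>W t z\<bar> \<le> D" "\<bar>w z\<bar> \<le> D" "\<bar>ZW t z\<bar> \<le> 2 * D"
      show "\<bar>W t z - w z\<bar> \<le> 2 * D" using a by linarith
      have "\<bar>\<kappa> * W t z\<bar> \<le> \<kappa> * D" unfolding abs_mult using a kappa by (intro mult_mono) auto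
      then show "\<bar>ZW t z - \<kappa> * W t z\<bar> \<le> 2 * D + \<kappa> * D" using a by linarith
    qed
    have "\<bar>rad Om z\<bar> * (2 * \<bar>W t z - w z\<bar> * \<bar>ZW t z - \<kappa> * W t z\<bar>) \<le> C * (2 * (2 * D) * (2 * D + \<kappa> * D))"
      using C(4)[OF z] 1 C(1) D(1) by (intro mult_mono mult_left_mono mult_nonneg_nonneg) auto
    then show "\<bar>rad Om z * (2 * (W t z - w z) * (ZW t z - \<kappa> * W t z))\<bar> \<le> C * (2 * (2 * D) * (2 * D + \<kappa> * D))"
      by (simp only: abs_mult abs_numeral)
  next
    fix t :: real assume "t \<in> {-1<..<2/3}"
    then have "t \<le> 2/3" by simp
    show "continuous_on hb (\<lambda>z. rad Om z * (W t z - w z)\<^sup>2)"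
      by (intro continuous_intros cont_rad prof_Om cont_hb cont_WZW[OF \<open>t \<le> 2/3\<close>])
  next
    have h: "h \<le> 2/3" using assms by simp
    show "continuous_on hb (\<lambda>z. rad Om z * (2 * (W h z - w z) * (ZW h z - \<kappa> * W h z)))"
      by (intro continuous_intros cont_rad prof_Om cont_hb cont_WZW[OF h])
  qed (use assms compact_hb in auto)
qed

text \<open>The exponent collects \<open>2 * \<kappa>\<close> from the normalisation of
  \<open>W h\<close> and the dimension from the Jacobian, together
  \<open>2 * (\<mu> + 1)\<close>.\<close>

lemma scale_W:
  assumes h: "0 \<le> h" "h \<le> 1 / 2" and Y: "profile Y" "\<And>s. s \<ge> smax - 1 \<Longrightarrow> Y s = 0"
  shows "intg (\<lambda>z. rad Y z * (W h z)\<^sup>2) =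
    exp (- 2 * (\<mu> + 1) * h) * intg (\<lambda>z. rad (\<lambda>s. Y (s - 2 * h)) z * (w z)\<^sup>2)"
proof -
  have l: "1 \<le> exp h" "exp h \<le> 2" using h exp_le_2[of h] by auto
  have "intg (\<lambda>z. rad Y z * (W h z)\<^sup>2) = (exp (- \<kappa> * h))\<^sup>2 * intg (\<lambda>z. rad Y z * (w (exp h *\<^sub>R z))\<^sup>2)"
    unfolding integral_mult_right_zero[symmetric]
    by (intro Bochner_Integration.integral_cong) (auto simp: W_def power_mult_distrib)
  also have "intg (\<lambda>z. rad Y z * (w (exp h *\<^sub>R z))\<^sup>2) =
     exp h powr (- real CARD('m)) * intg (\<lambda>z. rad (\<lambda>s. Y (s - 2 * h)) z * (w z)\<^sup>2)"
  proof -
    have "continuous_on (H \<inter> cball 0 (2 * R)) (\<lambda>z. (w z)\<^sup>2)" by (intro continuous_intros cont_w)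
    moreover have "\<And>s. s \<ge> smax - 2 * ln (exp h) \<Longrightarrow> Y s = 0" using Y(2) h by auto
    ultimately show ?thesis using scale_rad[OF l Y(1)] by simp
  qed
  also have "(exp (- \<kappa> * h))\<^sup>2 * (exp h powr (- real CARD('m)) * intg (\<lambda>z. rad (\<lambda>s. Y (s - 2 * h)) z * (w z)\<^sup>2)) =
     ((exp (- \<kappa> * h))\<^sup>2 * exp h powr (- real CARD('m))) * intg (\<lambda>z. rad (\<lambda>s. Y (s - 2 * h)) z * (w z)\<^sup>2)"
    by simp
  also have "(exp (- \<kappa> * h))\<^sup>2 * exp h powr (- real CARD('m)) = exp (- 2 * (\<mu> + 1) * h)"
    by (simp add: \<mu>_def exp_powr_real exp_double[symmetric] mult_exp_exp field_simps del: exp_double)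
  finally show ?thesis .
qed

text \<open>The weight \<open>exp (- (\<mu> + 1) * s)\<close> cancels the factor of
  \<open>scale_W\<close>, so passing from \<open>w\<close> to \<open>W h\<close> merely shifts the
  cutoff, and \<open>\<zeta>\<close> is wide enough for the shift.\<close>

lemma mass_W_le_J:
  assumes h: "0 \<le> h" "h \<le> 1 / 2" and \<xi>: "continuous_on UNIV \<xi>" "\<And>s. 0 \<le> \<xi> s" "\<And>s. \<xi> (s - 2 * h) \<le> \<zeta> s"
    "\<And>s. s < sa - 4 \<or> sb + 4 < s \<Longrightarrow> \<xi> s = 0"
  shows "intg (\<lambda>z. rad (\<lambda>s. \<xi> s * exp (- (\<mu> + 1) * s)) z * (W h z)\<^sup>2) \<le> J"
proof -
  have p: "profile \<xi>" using sb by (intro profile_cutoff[OF \<xi>(1,4)]) auto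
  have p\<zeta>: "profile \<zeta>"
    by (rule profile_cutoff[of _ "min (sa - 4) (sb - 4)" "max (sa + 4) (sb + 5)"])
      (use sab sb in \<open>auto simp: \<zeta>_def[abs_def] hat_eq_0 intro!: continuous_intros\<close>)
  have z: "\<xi> s * exp (- (\<mu> + 1) * s) = 0" if "s \<ge> smax - 1" for s using that sb \<xi>(4)[of s] by simp
  have "intg (\<lambda>z. rad (\<lambda>s. \<xi> s * exp (- (\<mu> + 1) * s)) z * (W h z)\<^sup>2) =
    intg (\<lambda>z. rad (\<lambda>s. \<xi> (s - 2 * h) * exp (- (\<mu> + 1) * s)) z * (w z)\<^sup>2)"
  proof -
    have "exp (- 2 * (\<mu> + 1) * h) * exp (- (\<mu> + 1) * (s - 2 * h)) = exp (- (\<mu> + 1) * s)" for s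
      by (simp add: mult_exp_exp algebra_simps)
    then have *: "exp (- 2 * (\<mu> + 1) * h) * (\<xi> (s - 2 * h) * exp (- (\<mu> + 1) * (s - 2 * h))) = \<xi> (s - 2 * h) * exp (- (\<mu> + 1) * s)" for s
      by (metis mult.left_commute)
    have "intg (\<lambda>z. rad (\<lambda>s. \<xi> (s - 2 * h) * exp (- (\<mu> + 1) * s)) z * (w z)\<^sup>2) = exp (- 2 * (\<mu> + 1) * h) *
      intg (\<lambda>z. rad (\<lambda>s. \<xi> (s - 2 * h) * exp (- (\<mu> + 1) * (s - 2 * h))) z * (w z)\<^sup>2)"
      unfolding *[symmetric] unfolding rad_cmult mult.assoc[of _ "rad _ _"] by simp
    then show ?thesis
      using scale_W[OF h profile_exp[OF p] z] by (simp only:)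
  qed
  also have "\<dots> \<le> J"
    unfolding J_def
  proof (rule weighted_mono)
    have "profile (\<lambda>s. \<xi> (s - 2 * h))"
      using z h sb \<xi>(4) by (intro profile_shift[OF p]) auto
    then show "profile (\<lambda>s. \<xi> (s - 2 * h) * exp (- (\<mu> + 1) * s))" by (rule profile_exp)
    show "profile (\<lambda>s. \<zeta> s * exp (- (\<mu> + 1) * s))" by (rule profile_exp[OF p\<zeta>])
    show "\<xi> (s - 2 * h) * exp (- (\<mu> + 1) * s) \<le> \<zeta> s * exp (- (\<mu> + 1) * s)" for s
      by (rule mult_right_mono[OF \<xi>(3)]) simp
  qed (simp_all add: cont_data)
  finally show ?thesis .
qed

text \<open>\<open>K1\<close> is the coefficient error of \<open>main_inequality\<close> after the
  Caccioppoli estimate; \<open>K2\<close> adds the end shells, half of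
  \<open>4 * B * (\<mu> + 1)\<close> times 3 + 5. Neither involves \<open>sa\<close> or
  \<open>sb\<close>.\<close>

definition K1 :: real where "K1 = 28 * (Ca * (1 + 2 * \<mu> + 2 * B) * exp (\<mu> + 1)) * (1 + M\<^sup>2)"

definition K2 :: real where "K2 = K1 + 16 * B * (\<mu> + 1)"

lemma prof_zeta: "profile \<zeta>"
  by (rule profile_cutoff[of _ "min (sa - 4) (sb - 4)" "max (sa + 4) (sb + 5)"])
    (use sab sb in \<open>auto simp: \<zeta>_def[abs_def] hat_eq_0 intro!: continuous_intros\<close>)

lemma K_nonneg: "0 \<le> K1" "0 \<le> K2"
  using Ca_nonneg mu_pos(1) B by (auto simp: K1_def K2_def intro!: add_nonneg_nonneg mult_nonneg_nonneg)

lemma mass_nonneg: "(\<And>s. 0 \<le> \<xi> s) \<Longrightarrow> 0 \<le> mass \<xi>"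
  unfolding mass_def by (rule sum_weight_nonneg) auto

lemma J_nonneg: "0 \<le> J"
  unfolding J_def by (rule sum_weight_nonneg) (auto simp: zeta_nonneg)

text \<open>\<open>R \<le> 1\<close> makes \<open>smax\<close> nonpositive, so the additional factor
  \<open>exp (\<gamma> / 2 * s)\<close> is at most one where \<open>\<zeta>\<close> lives.\<close>

lemma mass_zeta_le_J: "mass \<zeta> \<le> J"
  unfolding mass_def J_def
proof (rule weighted_mono)
  fix s
  have smax: "smax \<le> 0"
  proof -
    have "R\<^sup>2 \<le> 1" using R_pos R_le by (simp add: power_le_one)
    then show ?thesis unfolding smax_def using R_pos by (simp add: ln_le_zero_iff)
  qed
  show "\<zeta> s * exp ((\<gamma> / 2 - \<mu> - 1) * s) \<le> \<zeta> s * exp (- (\<mu> + 1) * s)"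
  proof (cases "s \<le> 0")
    case True
    then have "(\<gamma> / 2 - \<mu> - 1) * s \<le> - (\<mu> + 1) * s"
      using gamma mult_nonneg_nonpos[of "\<gamma> / 2" s] by (simp add: algebra_simps)
    then show ?thesis using zeta_nonneg by (intro mult_left_mono) auto
  next
    case False
    then have "\<zeta> s = 0" using prof_zeta smax by (auto simp: profile_def)
    then show ?thesis by simp
  qed
qed (auto intro: profile_exp prof_zeta cont_data)

text \<open>In the middle \<open>ct\<close> equals one and near both ends \<open>\<zeta>\<close> is
  at least one, so enlarging the cutoff costs only an end term.\<close>

lemma mass_hat_le: "mass (hat (sa - 2) (sb + 3)) \<le> mass ct + J"
proof -
  have p: "profile (hat (sa - 2) (sb + 3))" using sb by (intro prof_hat) simp
  have pz: "profile (\<lambda>s. ct s + \<zeta> s)"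
    by (rule profile_cutoff[of _ "min (sa - 4) (sb - 4)" "max (sa + 4) (sb + 5)"])
      (use sab sb in \<open>auto simp: \<zeta>_def[abs_def] hat_eq_0 ct_off intro!: continuous_intros cont_chi\<close>)
  have "mass (hat (sa - 2) (sb + 3)) \<le> mass (\<lambda>s. ct s + \<zeta> s)"
    unfolding mass_def
  proof (rule weighted_mono)
    fix s
    have "hat (sa - 2) (sb + 3) s \<le> ct s + \<zeta> s"
    proof -
      consider "s < sa - 3 \<or> sb + 4 < s" | "sa + 1 \<le> s \<and> s \<le> sb - 1"
        | "sa - 3 \<le> s \<and> s \<le> sa + 3 \<or> sb - 3 \<le> s \<and> s \<le> sb + 4" by linarith
      then show ?thesis
      proof cases
        case 1
        then have "hat (sa - 2) (sb + 3) s = 0" by (intro hat_eq_0) auto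
        then show ?thesis using chi_range zeta_nonneg by simp
      next
        case 2
        then show ?thesis using chi_on hat_le[of "sa - 2" "sb + 3" s] zeta_nonneg[of s] by (simp add: add_increasing2)
      next
        case 3
        then show ?thesis using zeta_ge_1[of s] hat_le[of "sa - 2" "sb + 3" s] chi_range(1)[of s] by linarith
      qed
    qed
    then show "hat (sa - 2) (sb + 3) s * exp ((\<gamma> / 2 - \<mu> - 1) * s) \<le> (ct s + \<zeta> s) * exp ((\<gamma> / 2 - \<mu> - 1) * s)"
      by (rule mult_right_mono) simp
  qed (auto intro!: profile_exp p pz cont_data)
  also have "mass (\<lambda>s. ct s + \<zeta> s) = mass ct + mass \<zeta>"
    unfolding mass_def
    by (rule intg_add; (intro int_rad profile_exp prof_chi prof_zeta cont_data)?) (simp add: rad_def algebra_simps)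
  finally show ?thesis using mass_zeta_le_J by simp
qed

lemma hat_mass_le: "mass (hat sa (sb + 1)) \<le> mass (hat (sa - 2) (sb + 3))"
  unfolding mass_def
proof (rule weighted_mono)
  show "profile (\<lambda>s. hat sa (sb + 1) s * exp ((\<gamma> / 2 - \<mu> - 1) * s))"
    "profile (\<lambda>s. hat (sa - 2) (sb + 3) s * exp ((\<gamma> / 2 - \<mu> - 1) * s))"
    using sb by (intro profile_exp prof_hat; simp)+
  show "hat sa (sb + 1) s * exp ((\<gamma> / 2 - \<mu> - 1) * s) \<le> hat (sa - 2) (sb + 3) s * exp ((\<gamma> / 2 - \<mu> - 1) * s)" for s
    by (rule mult_right_mono) (auto simp: hat_def)
qed (auto intro: cont_data)

text \<open>Twice \<open>\<mu> + 1\<close> is the dimension plus \<open>2 * \<kappa>\<close>; the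
  dimension cancels against the Jacobian, and exactly \<open>2 * \<kappa>\<close> remains apart from
  the derivatives of the cutoff.\<close>

lemma euler_Om:
  assumes "continuous_on hb f" "continuous_on hb f'"
    and "\<And>z t. z \<in> H \<Longrightarrow> 0 < t \<Longrightarrow> norm (t *\<^sub>R z) < R \<Longrightarrow>
      ((\<lambda>t. f (t *\<^sub>R z)) has_real_derivative f' (t *\<^sub>R z) / t) (at t)"
  shows "intg (\<lambda>z. rad Om z * f' z) = 2 * \<kappa> * intg (\<lambda>z. rad Om z * f z) - intg (\<lambda>z. rad Dom z * f z)"
proof -
  have c: "continuous_on UNIV (\<lambda>s. Dom s / 2 - (\<mu> + 1) * Om s)"
    using prof_Om unfolding profile_def by (intro continuous_intros) auto
  have d: "2 * (Dom s / 2 - (\<mu> + 1) * Om s) + real CARD('m) * Om s = Dom s - 2 * \<kappa> * Om s" for s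
    by (simp add: \<mu>_def field_simps)
  have "intg (\<lambda>z. rad Om z * f' z) = - intg (\<lambda>z. rad (\<lambda>s. Dom s - 2 * \<kappa> * Om s) z * f z)"
    using euler_by_parts[OF prof_Om(1) Om_deriv c assms] unfolding d .
  also have "intg (\<lambda>z. rad (\<lambda>s. Dom s - 2 * \<kappa> * Om s) z * f z) =
    intg (\<lambda>z. rad Dom z * f z) + (- 2 * \<kappa>) * intg (\<lambda>z. rad Om z * f z)"
    unfolding integral_mult_right_zero[symmetric]
    by (rule intg_add; (intro integrable_mult_right int_rad prof_Om assms)?) (simp add: rad_def algebra_simps)
  finally show ?thesis by simp
qed

text \<open>The derivative of \<open>Q\<close> contains \<open>x3\<close>, the integral of
  \<open>w\<close> times \<open>ZW h\<close>, whereas \<open>main_inequality\<close> bounds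
  \<open>x4\<close>, that of \<open>W h\<close> times \<open>g z \<bullet> z\<close>. The Euler
  identity for the product of \<open>w\<close> and \<open>W h\<close> trades one for the other, and
  those for the two squares remove \<open>x1\<close> and \<open>x2\<close>. What is left is
  \<open>\<kappa> * Q h\<close>, the end shells and the coefficient error.\<close>

lemma Q_deriv_le:
  assumes h: "0 \<le> h" "h \<le> 1 / 2"
  shows "intg (\<lambda>z. rad Om z * (2 * (W h z - w z) * (ZW h z - \<kappa> * W h z)))
    \<le> \<kappa> * Q h + K2 * (mass ct + J)"
proof -
  have h3: "h \<le> 2 / 3" using h by simp
  note cc = continuous_intros cont_hb cont_data cont_WZW[OF h3]
  have cD: "continuous_on hb (\<lambda>z. (w z)\<^sup>2)" "continuous_on hb (\<lambda>z. (W h z)\<^sup>2)" "continuous_on hb (\<lambda>z. w z * W h z)"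
    "continuous_on hb (\<lambda>z. 2 * (w z * (g z \<bullet> z)))" "continuous_on hb (\<lambda>z. 2 * (W h z * ZW h z))"
    "continuous_on hb (\<lambda>z. w z * ZW h z + W h z * (g z \<bullet> z))"
    "continuous_on hb (\<lambda>z. w z * (g z \<bullet> z))" "continuous_on hb (\<lambda>z. W h z * ZW h z)" 
    "continuous_on hb (\<lambda>z. w z * ZW h z)" "continuous_on hb (\<lambda>z. W h z * (g z \<bullet> z))"
    by (intro cc)+
  have dw: "((\<lambda>t. w (t *\<^sub>R z)) has_real_derivative (g (t *\<^sub>R z) \<bullet> (t *\<^sub>R z)) / t) (at t)"
    if "z \<in> H" "0 < t" "norm (t *\<^sub>R z) < R" for z t
    using ray[of z t] that R_pos by simp
  have dW: "((\<lambda>t. W h (t *\<^sub>R z)) has_real_derivative ZW h (t *\<^sub>R z) / t) (at t)"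
    if z: "z \<in> H" "0 < t" "norm (t *\<^sub>R z) < R" for z t
  proof -
    have n: "norm (t *\<^sub>R (exp h *\<^sub>R z)) < 2 * R"
    proof -
      have "exp h * norm (t *\<^sub>R z) \<le> 2 * norm (t *\<^sub>R z)" using exp_le_2[OF h3] by (rule mult_right_mono) simp
      moreover have "norm (t *\<^sub>R (exp h *\<^sub>R z)) = exp h * norm (t *\<^sub>R z)" by (simp add: abs_mult)
      ultimately show ?thesis using z(3) by linarith
    qed
    have "((\<lambda>t. w (t *\<^sub>R (exp h *\<^sub>R z))) has_real_derivative g (t *\<^sub>R (exp h *\<^sub>R z)) \<bullet> (exp h *\<^sub>R z)) (at t)"
      using ray[OF cone_H[OF z(1) exp_gt_zero] z(2) n] .
    then have D: "((\<lambda>t. exp (- \<kappa> * h) * w (t *\<^sub>R (exp h *\<^sub>R z))) has_real_derivative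
       exp (- \<kappa> * h) * (g (t *\<^sub>R (exp h *\<^sub>R z)) \<bullet> (exp h *\<^sub>R z))) (at t)"
      by (rule DERIV_cmult)
    have comm: "exp h *\<^sub>R (s *\<^sub>R z) = s *\<^sub>R (exp h *\<^sub>R z)" for s
      by (simp add: mult.commute)
    show ?thesis
      unfolding W_def ZW_def comm by (rule DERIV_cong[OF D]) (use z(2) in simp)
  qed
  define a1 where "a1 = intg (\<lambda>z. rad Om z * (w z)\<^sup>2)"
  define a2 where "a2 = intg (\<lambda>z. rad Om z * (W h z)\<^sup>2)"
  define a3 where "a3 = intg (\<lambda>z. rad Om z * (w z * W h z))"
  define d1 where "d1 = intg (\<lambda>z. rad Dom z * (w z)\<^sup>2)"
  define d2 where "d2 = intg (\<lambda>z. rad Dom z * (W h z)\<^sup>2)"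
  define d3 where "d3 = intg (\<lambda>z. rad Dom z * (w z * W h z))"
  define x1 where "x1 = intg (\<lambda>z. rad Om z * (w z * (g z \<bullet> z)))"
  define x2 where "x2 = intg (\<lambda>z. rad Om z * (W h z * ZW h z))"
  define x3 where "x3 = intg (\<lambda>z. rad Om z * (w z * ZW h z))"
  define x4 where "x4 = intg (\<lambda>z. rad Om z * (W h z * (g z \<bullet> z)))"
  have i: "integrable (lebesgue_on hb) (\<lambda>z. rad Om z * (w z)\<^sup>2)"
    "integrable (lebesgue_on hb) (\<lambda>z. rad Om z * (W h z)\<^sup>2)"
    "integrable (lebesgue_on hb) (\<lambda>z. rad Om z * (w z * W h z))"
    "integrable (lebesgue_on hb) (\<lambda>z. rad Dom z * (w z)\<^sup>2)"
    "integrable (lebesgue_on hb) (\<lambda>z. rad Dom z * (W h z)\<^sup>2)"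
    "integrable (lebesgue_on hb) (\<lambda>z. rad Dom z * (w z * W h z))"
    "integrable (lebesgue_on hb) (\<lambda>z. rad Om z * (w z * (g z \<bullet> z)))"
    "integrable (lebesgue_on hb) (\<lambda>z. rad Om z * (W h z * ZW h z))"
    "integrable (lebesgue_on hb) (\<lambda>z. rad Om z * (w z * ZW h z))"
    "integrable (lebesgue_on hb) (\<lambda>z. rad Om z * (W h z * (g z \<bullet> z)))"
    by (intro int_rad prof_Om cD)+
  have e1: "2 * x1 = 2 * \<kappa> * a1 - d1"
  proof -
    have "intg (\<lambda>z. rad Om z * (2 * (w z * (g z \<bullet> z)))) = 2 * x1"
      unfolding x1_def integral_mult_right_zero[symmetric] by (simp add: mult_ac)
    moreover have "intg (\<lambda>z. rad Om z * (2 * (w z * (g z \<bullet> z)))) = 2 * \<kappa> * a1 - d1"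
      unfolding a1_def d1_def
      by (rule euler_Om[OF cD(1,4)]) (auto intro!: DERIV_cong[OF DERIV_power[OF dw]] simp: field_simps)
    ultimately show ?thesis by simp
  qed
  have e2: "2 * x2 = 2 * \<kappa> * a2 - d2"
  proof -
    have "intg (\<lambda>z. rad Om z * (2 * (W h z * ZW h z))) = 2 * x2"
      unfolding x2_def integral_mult_right_zero[symmetric] by (simp add: mult_ac)
    moreover have "intg (\<lambda>z. rad Om z * (2 * (W h z * ZW h z))) = 2 * \<kappa> * a2 - d2"
      unfolding a2_def d2_def
      by (rule euler_Om[OF cD(2,5)]) (auto intro!: DERIV_cong[OF DERIV_power[OF dW]] simp: field_simps)
    ultimately show ?thesis by simp
  qed
  have e3: "x3 + x4 = 2 * \<kappa> * a3 - d3"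
  proof -
    have "intg (\<lambda>z. rad Om z * (w z * ZW h z + W h z * (g z \<bullet> z))) = x3 + x4"
      unfolding x3_def x4_def by (rule intg_add[OF i(9,10)]) (simp add: algebra_simps)
    moreover have "intg (\<lambda>z. rad Om z * (w z * ZW h z + W h z * (g z \<bullet> z))) = 2 * \<kappa> * a3 - d3"
      unfolding a3_def d3_def
    proof (rule euler_Om[OF cD(3,6)])
      fix z t assume zt: "z \<in> H" "0 < (t::real)" "norm (t *\<^sub>R z) < R"
      show "((\<lambda>t. w (t *\<^sub>R z) * W h (t *\<^sub>R z)) has_real_derivative
         (w (t *\<^sub>R z) * ZW h (t *\<^sub>R z) + W h (t *\<^sub>R z) * (g (t *\<^sub>R z) \<bullet> t *\<^sub>R z)) / t) (at t)"
        by (rule DERIV_cong[OF DERIV_mult[OF dw[OF zt] dW[OF zt]]]) (simp add: add_divide_distrib)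
    qed
    ultimately show ?thesis by simp
  qed
  have e4: "intg (\<lambda>z. rad Om z * (2 * (W h z - w z) * (ZW h z - \<kappa> * W h z))) =
     2 * (x2 - \<kappa> * a2 - x3 + \<kappa> * a3)" (is "?Q' = _")
  proof -
    have "?Q' = intg (\<lambda>z. 2 * (rad Om z * (W h z * ZW h z) - \<kappa> * (rad Om z * (W h z)\<^sup>2) - rad Om z * (w z * ZW h z)
        + \<kappa> * (rad Om z * (w z * W h z))))"
      by (intro Bochner_Integration.integral_cong) (auto simp: algebra_simps power2_eq_square)
    then show ?thesis using i by (simp add: x2_def a2_def x3_def a3_def)
  qed
  have e5: "Q h = a1 + a2 - 2 * a3"
  proof -
    have "Q h = intg (\<lambda>z. rad Om z * (w z)\<^sup>2 + rad Om z * (W h z)\<^sup>2 - 2 * (rad Om z * (w z * W h z)))"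
      unfolding Q_def by (intro Bochner_Integration.integral_cong) (auto simp: algebra_simps power2_eq_square)
    then show ?thesis using i by (simp add: a1_def a2_def a3_def)
  qed
  have e6: "intg (\<lambda>z. rad Om z * (w z * (g z \<bullet> z) + W h z * ZW h z - 2 * (W h z * (g z \<bullet> z)))) = x1 + x2 - 2 * x4"
  proof -
    have "intg (\<lambda>z. rad Om z * (w z * (g z \<bullet> z) + W h z * ZW h z - 2 * (W h z * (g z \<bullet> z)))) =
      intg (\<lambda>z. rad Om z * (w z * (g z \<bullet> z)) + rad Om z * (W h z * ZW h z) - 2 * (rad Om z * (W h z * (g z \<bullet> z))))"
      by (intro Bochner_Integration.integral_cong) (auto simp: algebra_simps)
    then show ?thesis using i by (simp add: x1_def x2_def x4_def)
  qed
  define err where "err = 28 * (Ca * (1 + 2 * \<mu> + 2 * B) * exp (\<mu> + 1)) * (grad_energy (hat sa (sb + 1)) + mass (hat sa (sb + 1)))"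
  have main: "0 \<le> x1 + x2 - 2 * x4 + err"
    using main_inequality[OF h] unfolding e6 err_def .
  have err: "err \<le> K1 * (mass ct + J)"
  proof -
    have "grad_energy (hat sa (sb + 1)) + mass (hat sa (sb + 1)) \<le> (1 + M\<^sup>2) * mass (hat (sa - 2) (sb + 3))"
      using caccioppoli hat_mass_le by (simp add: algebra_simps)
    also have "\<dots> \<le> (1 + M\<^sup>2) * (mass ct + J)"
      by (intro mult_left_mono mass_hat_le) simp
    finally show ?thesis
      unfolding err_def K1_def mult.assoc[of _ "1 + M\<^sup>2"] using Ca_nonneg mu_pos(1) B
      by (intro mult_left_mono) auto
  qed
  \<comment> \<open>the terms with the derivative of the cutoff live on two fixed-ratio shells\<close>
  define z0 where "z0 s = hat sa (sa + 1) s + hat (sb - 1) sb s" for s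
  have z0: "continuous_on UNIV z0" "\<And>s. 0 \<le> z0 s" "\<And>s. s < sa - 4 \<or> sb + 4 < s \<Longrightarrow> z0 s = 0"
    using sab by (auto simp: z0_def[abs_def] hat_nonneg hat_eq_0 intro!: continuous_intros)
  have z0z: "z0 (s - 2 * r) \<le> \<zeta> s" if "0 \<le> r" "r \<le> 1 / 2" for s r
  proof -
    have "hat sa (sa + 1) (s - 2 * r) \<le> hat (sa - 3) (sa + 3) s" "hat (sb - 1) sb (s - 2 * r) \<le> hat (sb - 3) (sb + 4) s"
      using that by (auto simp: hat_def)
    then show ?thesis by (simp add: z0_def \<zeta>_def)
  qed
  have Domb: "\<bar>Dom s\<bar> \<le> 4 * B * (\<mu> + 1) * (z0 s * exp (- (\<mu> + 1) * s))" for s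
  proof -
    have "\<bar>2 * (2 * \<mu> * ct1 s - 2 * ct2 s)\<bar> \<le> 4 * B * (\<mu> + 1) * z0 s"
    proof (cases "sa \<le> s \<and> s \<le> sa + 1 \<or> sb - 1 \<le> s \<and> s \<le> sb")
      case True
      then have "1 \<le> z0 s" using hat_eq_1[of sa s "sa + 1"] hat_eq_1[of "sb - 1" s sb] hat_nonneg by (auto simp: z0_def add_increasing add_increasing2)
      moreover have "\<bar>\<mu> * ct1 s\<bar> \<le> \<mu> * B" using chi_bound(1)[of s] mu_pos(1) by (auto simp: abs_mult)
      then have "\<bar>2 * (2 * \<mu> * ct1 s - 2 * ct2 s)\<bar> \<le> 4 * (\<mu> * B) + 4 * B"
        using chi_bound(2)[of s] by (simp add: abs_le_iff)
      moreover have "4 * (\<mu> * B) + 4 * B = 4 * B * (\<mu> + 1) * 1" by (simp add: algebra_simps)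
      moreover have "4 * B * (\<mu> + 1) * 1 \<le> 4 * B * (\<mu> + 1) * z0 s"
        using \<open>1 \<le> z0 s\<close> B mu_pos(1) by (intro mult_left_mono) auto
      ultimately show ?thesis by linarith
    next
      case False
      then have "ct1 s = 0 \<and> ct2 s = 0" using ct_off[of s] chi_on[of s] by linarith
      then show ?thesis using z0(2) B mu_pos(1) by simp
    qed
    then have "\<bar>2 * (2 * \<mu> * ct1 s - 2 * ct2 s)\<bar> * exp (- (\<mu> + 1) * s) \<le> 4 * B * (\<mu> + 1) * z0 s * exp (- (\<mu> + 1) * s)"
      by (rule mult_right_mono) simp
    then show ?thesis unfolding Dom_def abs_mult[of _ "exp _"] by simp
  qed
  have zexp: "profile (\<lambda>s. z0 s * exp (- (\<mu> + 1) * s))"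
    using sb by (intro profile_exp profile_cutoff[OF z0(1,3)]) auto
  have zw: "intg (\<lambda>z. rad (\<lambda>s. z0 s * exp (- (\<mu> + 1) * s)) z * (w z)\<^sup>2) \<le> J"
  proof -
    have "W 0 = w" by (auto simp: W_def fun_eq_iff)
    then show ?thesis using mass_W_le_J[of 0 z0, OF _ _ z0(1,2) _ z0(3)] z0z[of 0] by simp
  qed
  have zW: "intg (\<lambda>z. rad (\<lambda>s. z0 s * exp (- (\<mu> + 1) * s)) z * (W h z)\<^sup>2) \<le> J"
    by (rule mass_W_le_J[OF h z0(1,2) z0z[OF h] z0(3)])
  have dd: "- (d1 + 3 * d2 - 4 * d3) / 2 \<le> 16 * B * (\<mu> + 1) * J"
  proof -
    have "- (d1 + 3 * d2 - 4 * d3) = intg (\<lambda>z. - (rad Dom z * (w z)\<^sup>2 + 3 * (rad Dom z * (W h z)\<^sup>2) - 4 * (rad Dom z * (w z * W h z))))"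
      using i by (simp add: d1_def d2_def d3_def)
    also have "\<dots> \<le> intg (\<lambda>z. 4 * B * (\<mu> + 1) * (3 * (rad (\<lambda>s. z0 s * exp (- (\<mu> + 1) * s)) z * (w z)\<^sup>2)
        + 5 * (rad (\<lambda>s. z0 s * exp (- (\<mu> + 1) * s)) z * (W h z)\<^sup>2)))"
    proof (rule intg_mono)
      fix z assume "z \<in> hb"
      have "- (rad Dom z * (w z)\<^sup>2 + 3 * (rad Dom z * (W h z)\<^sup>2) - 4 * (rad Dom z * (w z * W h z)))
        = rad Dom z * (4 * (w z * W h z) - (w z)\<^sup>2 - 3 * (W h z)\<^sup>2)" by (simp add: algebra_simps)
      also have "\<dots> \<le> \<bar>rad Dom z\<bar> * \<bar>4 * (w z * W h z) - (w z)\<^sup>2 - 3 * (W h z)\<^sup>2\<bar>"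
        by (metis abs_ge_self abs_mult)
      also have "\<dots> \<le> (4 * B * (\<mu> + 1) * rad (\<lambda>s. z0 s * exp (- (\<mu> + 1) * s)) z) * (3 * (w z)\<^sup>2 + 5 * (W h z)\<^sup>2)"
      proof (rule mult_mono)
        show "\<bar>rad Dom z\<bar> \<le> 4 * B * (\<mu> + 1) * rad (\<lambda>s. z0 s * exp (- (\<mu> + 1) * s)) z"
          using Domb by (auto simp: rad_def)
        have "2 * (w z * W h z) \<le> (w z)\<^sup>2 + (W h z)\<^sup>2" "- (2 * (w z * W h z)) \<le> (w z)\<^sup>2 + (W h z)\<^sup>2"
          using sum_squares_bound[of "w z" "W h z"] sum_squares_bound[of "- w z" "W h z"] by simp_all
        then show "\<bar>4 * (w z * W h z) - (w z)\<^sup>2 - 3 * (W h z)\<^sup>2\<bar> \<le> 3 * (w z)\<^sup>2 + 5 * (W h z)\<^sup>2"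
          using zero_le_power2[of "w z"] zero_le_power2[of "W h z"] by (simp only: abs_le_iff) linarith
        show "0 \<le> 4 * B * (\<mu> + 1) * rad (\<lambda>s. z0 s * exp (- (\<mu> + 1) * s)) z"
          using B mu_pos(1) z0(2) by (intro mult_nonneg_nonneg rad_nonneg) auto
      qed simp
      finally show "- (rad Dom z * (w z)\<^sup>2 + 3 * (rad Dom z * (W h z)\<^sup>2) - 4 * (rad Dom z * (w z * W h z))) \<le>
         4 * B * (\<mu> + 1) * (3 * (rad (\<lambda>s. z0 s * exp (- (\<mu> + 1) * s)) z * (w z)\<^sup>2)
        + 5 * (rad (\<lambda>s. z0 s * exp (- (\<mu> + 1) * s)) z * (W h z)\<^sup>2))"
        by (simp only: distrib_left distrib_right mult_ac)
    qed (intro Bochner_Integration.integrable_minus Bochner_Integration.integrable_diff Bochner_Integration.integrable_add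
        integrable_mult_right i int_rad zexp cD)+
    also have "\<dots> = 4 * B * (\<mu> + 1) * (3 * intg (\<lambda>z. rad (\<lambda>s. z0 s * exp (- (\<mu> + 1) * s)) z * (w z)\<^sup>2)
        + 5 * intg (\<lambda>z. rad (\<lambda>s. z0 s * exp (- (\<mu> + 1) * s)) z * (W h z)\<^sup>2))"
      using int_rad[OF zexp cD(1)] int_rad[OF zexp cD(2)] by simp
    also have "\<dots> \<le> 4 * B * (\<mu> + 1) * (3 * J + 5 * J)"
      using zw zW B mu_pos(1) by (intro mult_left_mono add_mono) auto
    finally show ?thesis by simp
  qed
  have "16 * B * (\<mu> + 1) * J \<le> 16 * B * (\<mu> + 1) * (mass ct + J)"
    using B mu_pos(1) mass_nonneg[OF chi_range(1)] by (intro mult_left_mono) auto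
  then have K2: "err + 16 * B * (\<mu> + 1) * J \<le> K2 * (mass ct + J)"
    unfolding K2_def distrib_right[of K1] by (rule add_mono[OF err])
  have \<kappa>Q: "\<kappa> * Q h = \<kappa> * a1 + \<kappa> * a2 - 2 * (\<kappa> * a3)" unfolding e5 by (simp add: algebra_simps)
  have "2 * (x2 - \<kappa> * a2 - x3 + \<kappa> * a3) = \<kappa> * Q h - (d1 + 3 * d2 - 4 * d3) / 2 - (x1 + x2 - 2 * x4)"
    unfolding \<kappa>Q using e1 e2 e3 by (simp add: field_simps)
  then show ?thesis
    unfolding e4 using main dd K2 by linarith
qed

text \<open>Gronwall in \<open>h\<close>, started at \<open>Q 0 = 0\<close> because
  \<open>W 0 = w\<close>. The value \<open>1 / 2\<close> is the shift of \<open>s\<close> by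
  one.\<close>

lemma Q_half_le: "Q (1 / 2) \<le> exp \<kappa> * (K2 * (mass ct + J))"
proof -
  define E where "E = K2 * (mass ct + J)"
  have E0: "0 \<le> E" using K_nonneg mass_nonneg[OF chi_range(1)] J_nonneg by (simp add: E_def)
  have Q0: "Q 0 = 0" by (simp add: Q_def W_def)
  have "Q (1 / 2) * exp (- \<kappa> * (1 / 2)) - E * (1 / 2) \<le> Q 0 * exp (- \<kappa> * 0) - E * 0"
  proof (rule DERIV_nonpos_imp_nonincreasing[where f="\<lambda>h. Q h * exp (- \<kappa> * h) - E * h"])
    fix h :: real assume h: "0 \<le> h" "h \<le> 1 / 2"
    let ?Q' = "intg (\<lambda>z. rad Om z * (2 * (W h z - w z) * (ZW h z - \<kappa> * W h z)))"
    have "((\<lambda>h. Q h * exp (- \<kappa> * h) - E * h) has_real_derivative (?Q' - \<kappa> * Q h) * exp (- \<kappa> * h) - E) (at h)"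
      by (auto intro!: derivative_eq_intros Q_deriv[OF h] simp: algebra_simps)
    moreover have "(?Q' - \<kappa> * Q h) * exp (- \<kappa> * h) - E \<le> 0"
    proof -
      have "(?Q' - \<kappa> * Q h) * exp (- \<kappa> * h) \<le> E * exp (- \<kappa> * h)"
        using Q_deriv_le[OF h] by (intro mult_right_mono) (auto simp: E_def)
      also have "\<dots> \<le> E * 1" using E0 h kappa by (intro mult_left_mono) auto
      finally show ?thesis by simp
    qed
    ultimately show "\<exists>y. ((\<lambda>h. Q h * exp (- \<kappa> * h) - E * h) has_real_derivative y) (at h) \<and> y \<le> 0" by blast
  qed simp
  then have "Q (1 / 2) * exp (- \<kappa> / 2) \<le> E / 2" by (simp add: Q0)
  then have "Q (1 / 2) * exp (- \<kappa> / 2) * exp (\<kappa> / 2) \<le> E / 2 * exp (\<kappa> / 2)" by (rule mult_right_mono) simp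
  also have "Q (1 / 2) * exp (- \<kappa> / 2) * exp (\<kappa> / 2) = Q (1 / 2)" by (simp add: mult.assoc mult_exp_exp)
  also have "E / 2 * exp (\<kappa> / 2) \<le> E * exp \<kappa>"
    using E0 kappa by (intro mult_mono) auto
  finally show ?thesis by (simp add: E_def mult.commute)
qed

definition K3 :: real where "K3 = (exp \<kappa> * K2 + 8 * B) / (2 * \<mu>)"

text \<open>\<open>Om\<close> differs from \<open>2 * \<mu>\<close> times the plain weight by a term
  with \<open>ct1\<close>, which lives on the end shells and is charged to \<open>J\<close>. The
  division by \<open>2 * \<mu>\<close> rests on \<open>mu_pos\<close>.\<close>

lemma increment_le:
  "intg (\<lambda>z. rad (\<lambda>s. ct s * exp (- (\<mu> + 1) * s)) z * (W (1 / 2) z - w z)\<^sup>2) \<le> K3 * (mass ct + J)"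
    (is "?Qc \<le> _")
proof -
  define z0 where "z0 s = hat sa (sa + 1) s + hat (sb - 1) sb s" for s
  have z0: "continuous_on UNIV z0" "\<And>s. 0 \<le> z0 s" "\<And>s. s < sa - 4 \<or> sb + 4 < s \<Longrightarrow> z0 s = 0"
    using sab by (auto simp: z0_def[abs_def] hat_nonneg hat_eq_0 intro!: continuous_intros)
  have z0z: "z0 (s - 2 * r) \<le> \<zeta> s" if "0 \<le> r" "r \<le> 1 / 2" for s r
  proof -
    have "hat sa (sa + 1) (s - 2 * r) \<le> hat (sa - 3) (sa + 3) s" "hat (sb - 1) sb (s - 2 * r) \<le> hat (sb - 3) (sb + 4) s"
      using that by (auto simp: hat_def)
    then show ?thesis by (simp add: z0_def \<zeta>_def)
  qed
  have c1: "\<bar>ct1 s\<bar> \<le> B * z0 s" for s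
  proof (cases "sa \<le> s \<and> s \<le> sa + 1 \<or> sb - 1 \<le> s \<and> s \<le> sb")
    case True
    then have "1 \<le> z0 s" using hat_eq_1[of sa s "sa + 1"] hat_eq_1[of "sb - 1" s sb] hat_nonneg by (auto simp: z0_def add_increasing add_increasing2)
    then show ?thesis using chi_bound(1)[of s] B mult_left_mono[of 1 "z0 s" B] by simp
  next
    case False
    then have "ct1 s = 0" using ct_off[of s] chi_on[of s] by linarith
    then show ?thesis using z0(2) B by simp
  qed
  have zexp: "profile (\<lambda>s. z0 s * exp (- (\<mu> + 1) * s))"
    using sb by (intro profile_exp profile_cutoff[OF z0(1,3)]) auto
  have cW: "continuous_on hb (\<lambda>z. (W (1 / 2) z - w z)\<^sup>2)" "continuous_on hb (\<lambda>z. (W (1 / 2) z)\<^sup>2)"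
    by (intro continuous_intros cont_hb cont_WZW; simp)+
  have zw: "intg (\<lambda>z. rad (\<lambda>s. z0 s * exp (- (\<mu> + 1) * s)) z * (w z)\<^sup>2) \<le> J"
  proof -
    have "W 0 = w" by (auto simp: W_def fun_eq_iff)
    then show ?thesis using mass_W_le_J[of 0 z0, OF _ _ z0(1,2) _ z0(3)] z0z[of 0] by simp
  qed
  have zW: "intg (\<lambda>z. rad (\<lambda>s. z0 s * exp (- (\<mu> + 1) * s)) z * (W (1 / 2) z)\<^sup>2) \<le> J"
    by (rule mass_W_le_J[OF _ _ z0(1,2) z0z z0(3)]) auto
  have iz: "integrable (lebesgue_on hb) (\<lambda>z. rad (\<lambda>s. z0 s * exp (- (\<mu> + 1) * s)) z * (w z)\<^sup>2)"
    "integrable (lebesgue_on hb) (\<lambda>z. rad (\<lambda>s. z0 s * exp (- (\<mu> + 1) * s)) z * (W (1 / 2) z)\<^sup>2)"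
    by (intro int_rad zexp cW cont_data)+
  have ic: "integrable (lebesgue_on hb) (\<lambda>z. rad (\<lambda>s. ct s * exp (- (\<mu> + 1) * s)) z * (W (1 / 2) z - w z)\<^sup>2)"
    "integrable (lebesgue_on hb) (\<lambda>z. rad Om z * (W (1 / 2) z - w z)\<^sup>2)"
    by (intro int_rad prof_Om profile_exp prof_chi cW)+
  have "2 * \<mu> * ?Qc = intg (\<lambda>z. (2 * \<mu>) * (rad (\<lambda>s. ct s * exp (- (\<mu> + 1) * s)) z * (W (1 / 2) z - w z)\<^sup>2))"
    by simp
  also have "\<dots> \<le> intg (\<lambda>z. rad Om z * (W (1 / 2) z - w z)\<^sup>2
     + 4 * B * (rad (\<lambda>s. z0 s * exp (- (\<mu> + 1) * s)) z * (w z)\<^sup>2 + rad (\<lambda>s. z0 s * exp (- (\<mu> + 1) * s)) z * (W (1 / 2) z)\<^sup>2))"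
  proof (rule intg_mono)
    fix z assume "z \<in> hb"
    define u where "u = (W (1 / 2) z - w z)\<^sup>2"
    define r where "r = rad (\<lambda>s. z0 s * exp (- (\<mu> + 1) * s)) z"
    have r0: "0 \<le> r" unfolding r_def by (rule rad_nonneg) (simp add: z0)
    have u: "u \<le> 2 * ((w z)\<^sup>2 + (W (1 / 2) z)\<^sup>2)"
      using sum_squares_bound[of "- w z" "W (1 / 2) z"] by (simp add: u_def power2_diff algebra_simps)
    have "2 * \<mu> * rad (\<lambda>s. ct s * exp (- (\<mu> + 1) * s)) z \<le> rad Om z + 2 * B * r"
    proof (cases "z = 0")
      case False
      define s where "s = ln (q z)"
      have "2 * \<mu> * ct s \<le> (2 * \<mu> * ct s - 2 * ct1 s) + 2 * (B * z0 s)" using c1[of s] by linarith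
      then have "2 * \<mu> * ct s * exp (- (\<mu> + 1) * s) \<le> ((2 * \<mu> * ct s - 2 * ct1 s) + 2 * (B * z0 s)) * exp (- (\<mu> + 1) * s)"
        by (rule mult_right_mono) simp
      then show ?thesis using False by (simp add: rad_nonzero r_def Om_def s_def[symmetric] algebra_simps)
    qed (simp add: r_def)
    then have "2 * \<mu> * rad (\<lambda>s. ct s * exp (- (\<mu> + 1) * s)) z * u \<le> (rad Om z + 2 * B * r) * u"
      by (rule mult_right_mono) (simp add: u_def)
    also have "2 * B * r * u \<le> 2 * B * r * (2 * ((w z)\<^sup>2 + (W (1 / 2) z)\<^sup>2))"
      using u B r0 by (intro mult_left_mono) auto
    then have "(rad Om z + 2 * B * r) * u \<le> rad Om z * u + 2 * B * r * (2 * ((w z)\<^sup>2 + (W (1 / 2) z)\<^sup>2))"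
      by (simp add: distrib_right)
    finally show "(2 * \<mu>) * (rad (\<lambda>s. ct s * exp (- (\<mu> + 1) * s)) z * (W (1 / 2) z - w z)\<^sup>2) \<le> rad Om z * (W (1 / 2) z - w z)\<^sup>2
     + 4 * B * (rad (\<lambda>s. z0 s * exp (- (\<mu> + 1) * s)) z * (w z)\<^sup>2 + rad (\<lambda>s. z0 s * exp (- (\<mu> + 1) * s)) z * (W (1 / 2) z)\<^sup>2)"
      by (simp add: u_def r_def algebra_simps)
  qed (intro Bochner_Integration.integrable_add integrable_mult_right ic iz)+
  also have "\<dots> = Q (1 / 2) + 4 * B * (intg (\<lambda>z. rad (\<lambda>s. z0 s * exp (- (\<mu> + 1) * s)) z * (w z)\<^sup>2)
     + intg (\<lambda>z. rad (\<lambda>s. z0 s * exp (- (\<mu> + 1) * s)) z * (W (1 / 2) z)\<^sup>2))"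
    using ic iz by (simp add: Q_def)
  also have "\<dots> \<le> exp \<kappa> * (K2 * (mass ct + J)) + 4 * B * (J + J)"
    using B by (intro add_mono Q_half_le mult_left_mono zw zW) auto
  also have "\<dots> \<le> exp \<kappa> * (K2 * (mass ct + J)) + 8 * B * (mass ct + J)"
    using B mass_nonneg[OF chi_range(1)] by (simp add: mult_left_mono)
  also have "\<dots> = (exp \<kappa> * K2 + 8 * B) * (mass ct + J)" by (simp add: algebra_simps)
  finally have "?Qc \<le> ((exp \<kappa> * K2 + 8 * B) * (mass ct + J)) / (2 * \<mu>)"
    using mu_pos(1) by (simp add: pos_le_divide_eq mult.commute)
  then show ?thesis by (simp add: K3_def)
qed

text \<open>A discrete Hardy inequality: the dilation contracts the weighted mass by the factor
  \<open>exp (- \<gamma> / 2)\<close>, so the mass is controlled by the increment \<open>W - w\<close> of size \<open>exp (\<gamma> * sb / 2)\<close>.\<close>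

lemma mass_absorption:
  "mass ct \<le> (exp (- \<gamma> / 4) + exp (\<gamma> / 4) / (exp (\<gamma> / 4) - 1) * K3 * exp (\<gamma> / 2 * sb)) * (mass ct + J)"
proof -
  \<comment> \<open>Chosen so that \<open>(1 + \<delta>) * exp (- \<gamma> / 2)\<close> equals
    \<open>exp (- \<gamma> / 4)\<close>: half of the contraction exponent is spent on the weighted
    triangle inequality.\<close>
  define \<delta> where "\<delta> = exp (\<gamma> / 4) - 1"
  have d: "0 < \<delta>" "1 + \<delta> = exp (\<gamma> / 4)" "1 + 1 / \<delta> = exp (\<gamma> / 4) / (exp (\<gamma> / 4) - 1)"
    using gamma by (auto simp: \<delta>_def field_simps)
  define e where "e = \<gamma> / 2 - \<mu> - 1"
  have cW: "continuous_on hb (\<lambda>z. (W (1 / 2) z - w z)\<^sup>2)" "continuous_on hb (\<lambda>z. (W (1 / 2) z)\<^sup>2)"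
    by (intro continuous_intros cont_hb cont_WZW; simp)+
  have i: "integrable (lebesgue_on hb) (\<lambda>z. rad (\<lambda>s. ct s * exp (e * s)) z * (w z)\<^sup>2)"
    "integrable (lebesgue_on hb) (\<lambda>z. rad (\<lambda>s. ct s * exp (e * s)) z * (W (1 / 2) z)\<^sup>2)"
    "integrable (lebesgue_on hb) (\<lambda>z. rad (\<lambda>s. ct s * exp (e * s)) z * (W (1 / 2) z - w z)\<^sup>2)"
    "integrable (lebesgue_on hb) (\<lambda>z. rad (\<lambda>s. ct s * exp (- (\<mu> + 1) * s)) z * (W (1 / 2) z - w z)\<^sup>2)"
    by (intro int_rad profile_exp prof_chi cW cont_data)+
  have "mass ct \<le> intg (\<lambda>z. (1 + \<delta>) * (rad (\<lambda>s. ct s * exp (e * s)) z * (W (1 / 2) z)\<^sup>2)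
      + (1 + 1 / \<delta>) * (rad (\<lambda>s. ct s * exp (e * s)) z * (W (1 / 2) z - w z)\<^sup>2))"
    unfolding mass_def e_def[symmetric]
  proof (rule intg_mono)
    fix z assume "z \<in> hb"
    have *: "x\<^sup>2 \<le> (1 + \<delta>) * y\<^sup>2 + (1 + 1 / \<delta>) * (y - x)\<^sup>2" for x y :: real
    proof -
      have "0 \<le> (\<delta> * y + (y - x))\<^sup>2 / \<delta>" using d by simp
      also have "\<dots> = \<delta> * y\<^sup>2 + 2 * y * (y - x) + (y - x)\<^sup>2 / \<delta>" using d by (simp add: field_simps power2_eq_square)
      finally show ?thesis by (simp add: power2_eq_square algebra_simps add_divide_distrib diff_divide_distrib)
    qed
    have "rad (\<lambda>s. ct s * exp (e * s)) z * (w z)\<^sup>2 \<le> rad (\<lambda>s. ct s * exp (e * s)) z *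
      ((1 + \<delta>) * (W (1 / 2) z)\<^sup>2 + (1 + 1 / \<delta>) * (W (1 / 2) z - w z)\<^sup>2)"
      by (intro mult_left_mono * rad_nonneg) (simp add: chi_range)
    then show "rad (\<lambda>s. ct s * exp (e * s)) z * (w z)\<^sup>2 \<le> (1 + \<delta>) * (rad (\<lambda>s. ct s * exp (e * s)) z * (W (1 / 2) z)\<^sup>2)
      + (1 + 1 / \<delta>) * (rad (\<lambda>s. ct s * exp (e * s)) z * (W (1 / 2) z - w z)\<^sup>2)"
      by (simp only: distrib_left mult_ac)
  qed (intro Bochner_Integration.integrable_add integrable_mult_right i)+
  also have "\<dots> = (1 + \<delta>) * intg (\<lambda>z. rad (\<lambda>s. ct s * exp (e * s)) z * (W (1 / 2) z)\<^sup>2)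
      + (1 + 1 / \<delta>) * intg (\<lambda>z. rad (\<lambda>s. ct s * exp (e * s)) z * (W (1 / 2) z - w z)\<^sup>2)"
    using i by simp
  also have "\<dots> \<le> (1 + \<delta>) * (exp (- \<gamma> / 2) * (mass ct + J)) + (1 + 1 / \<delta>) * (exp (\<gamma> / 2 * sb) * (K3 * (mass ct + J)))"
  proof (intro add_mono mult_left_mono)
    have z: "ct s * exp (e * s) = 0" if "s \<ge> smax - 1" for s using that sb ct_off[of s] by simp
    have p1: "profile (\<lambda>s. ct (s - 1))"
      using sb ct_off by (intro profile_shift prof_chi) auto
    have "intg (\<lambda>z. rad (\<lambda>s. ct s * exp (e * s)) z * (W (1 / 2) z)\<^sup>2) =
      exp (- (\<mu> + 1)) * intg (\<lambda>z. rad (\<lambda>s. ct (s - 1) * exp (e * (s - 1))) z * (w z)\<^sup>2)"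
      using scale_W[of "1 / 2", OF _ _ profile_exp[OF prof_chi(1)] z] by simp
    also have "\<dots> = exp (- \<gamma> / 2) * intg (\<lambda>z. rad (\<lambda>s. ct (s - 1) * exp (e * s)) z * (w z)\<^sup>2)"
    proof -
      have eq: "ct (s - 1) * exp (e * (s - 1)) = exp (- e) * (ct (s - 1) * exp (e * s))" for s
        by (simp add: right_diff_distrib exp_diff exp_minus field_simps)
      have "intg (\<lambda>z. rad (\<lambda>s. ct (s - 1) * exp (e * (s - 1))) z * (w z)\<^sup>2) =
        exp (- e) * intg (\<lambda>z. rad (\<lambda>s. ct (s - 1) * exp (e * s)) z * (w z)\<^sup>2)"
        unfolding eq unfolding rad_cmult mult.assoc[of _ "rad _ _"] by simp
      moreover have "exp (- (\<mu> + 1)) * (exp (- e) * x) = exp (- \<gamma> / 2) * x" for x :: real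
        unfolding mult.assoc[symmetric] mult_exp_exp by (simp add: e_def)
      ultimately show ?thesis by (simp only:)
    qed
    also have "\<dots> \<le> exp (- \<gamma> / 2) * (mass ct + J)"
    proof (rule mult_left_mono)
      have "intg (\<lambda>z. rad (\<lambda>s. ct (s - 1) * exp (e * s)) z * (w z)\<^sup>2) \<le> intg (\<lambda>z. rad (\<lambda>s. (ct s + \<zeta> s) * exp (e * s)) z * (w z)\<^sup>2)"
      proof (rule weighted_mono)
        show "profile (\<lambda>s. ct (s - 1) * exp (e * s))" by (rule profile_exp[OF p1])
        have "profile (\<lambda>s. ct s + \<zeta> s)"
          by (rule profile_cutoff[of _ "min (sa - 4) (sb - 4)" "max (sa + 4) (sb + 5)"])
            (use sab sb in \<open>auto simp: \<zeta>_def[abs_def] hat_eq_0 ct_off intro!: continuous_intros cont_chi\<close>)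
        then show "profile (\<lambda>s. (ct s + \<zeta> s) * exp (e * s))" by (rule profile_exp)
        fix s
        have "ct (s - 1) \<le> ct s + \<zeta> s"
        proof -
          consider "s < sa + 1 \<and> s - 1 < sa" | "sa + 1 \<le> s \<and> s \<le> sb - 1" | "sb - 3 \<le> s \<and> s \<le> sb + 4" | "sb < s - 1" by linarith
          then show ?thesis
          proof cases
            case 1 then show ?thesis using ct_off[of "s - 1"] chi_range(1)[of s] zeta_nonneg[of s] by simp
          next
            case 2 then show ?thesis using chi_on[of s] chi_range(2)[of "s - 1"] zeta_nonneg[of s] by simp
          next
            case 3 then show ?thesis using zeta_ge_1[of s] chi_range(2)[of "s - 1"] chi_range(1)[of s] by simp
          next
            case 4 then show ?thesis using ct_off[of "s - 1"] chi_range(1)[of s] zeta_nonneg[of s] by simp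
          qed
        qed
        then show "ct (s - 1) * exp (e * s) \<le> (ct s + \<zeta> s) * exp (e * s)" by (rule mult_right_mono) simp
      qed (auto intro: cont_data)
      also have "\<dots> = mass ct + mass \<zeta>"
        unfolding mass_def e_def
        by (rule intg_add; (intro int_rad profile_exp prof_chi prof_zeta cont_data)?) (simp add: rad_def algebra_simps)
      finally show "intg (\<lambda>z. rad (\<lambda>s. ct (s - 1) * exp (e * s)) z * (w z)\<^sup>2) \<le> mass ct + J"
        using mass_zeta_le_J by simp
    qed simp
    finally show "intg (\<lambda>z. rad (\<lambda>s. ct s * exp (e * s)) z * (W (1 / 2) z)\<^sup>2) \<le> exp (- \<gamma> / 2) * (mass ct + J)" .
    have "intg (\<lambda>z. rad (\<lambda>s. ct s * exp (e * s)) z * (W (1 / 2) z - w z)\<^sup>2)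
      \<le> intg (\<lambda>z. exp (\<gamma> / 2 * sb) * (rad (\<lambda>s. ct s * exp (- (\<mu> + 1) * s)) z * (W (1 / 2) z - w z)\<^sup>2))"
    proof (rule intg_mono[OF i(3) integrable_mult_right[OF i(4)]])
      fix z
      have "rad (\<lambda>s. ct s * exp (e * s)) z \<le> rad (\<lambda>s. exp (\<gamma> / 2 * sb) * (ct s * exp (- (\<mu> + 1) * s))) z"
      proof (rule rad_le)
        fix s
        show "ct s * exp (e * s) \<le> exp (\<gamma> / 2 * sb) * (ct s * exp (- (\<mu> + 1) * s))"
        proof (cases "sb < s")
          case False
          then have "\<gamma> / 2 * s \<le> \<gamma> / 2 * sb" using gamma by (intro mult_left_mono) auto
          then have "exp (e * s) \<le> exp (\<gamma> / 2 * sb) * exp (- (\<mu> + 1) * s)"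
            by (simp add: e_def mult_exp_exp algebra_simps)
          then have "ct s * exp (e * s) \<le> ct s * (exp (\<gamma> / 2 * sb) * exp (- (\<mu> + 1) * s))"
            using chi_range by (intro mult_left_mono) auto
          then show ?thesis by (simp only: mult_ac)
        qed (simp add: ct_off)
      qed
      then show "rad (\<lambda>s. ct s * exp (e * s)) z * (W (1 / 2) z - w z)\<^sup>2
        \<le> exp (\<gamma> / 2 * sb) * (rad (\<lambda>s. ct s * exp (- (\<mu> + 1) * s)) z * (W (1 / 2) z - w z)\<^sup>2)"
        unfolding rad_cmult mult.assoc[symmetric, of _ "rad _ _"] by (rule mult_right_mono) simp
    qed
    also have "\<dots> \<le> exp (\<gamma> / 2 * sb) * (K3 * (mass ct + J))"
      unfolding integral_mult_right_zero by (intro mult_left_mono increment_le) simp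
    finally show "intg (\<lambda>z. rad (\<lambda>s. ct s * exp (e * s)) z * (W (1 / 2) z - w z)\<^sup>2) \<le> exp (\<gamma> / 2 * sb) * (K3 * (mass ct + J))" .
  qed (use d(1) in auto)
  also have "(1 + \<delta>) * (exp (- \<gamma> / 2) * (mass ct + J)) = exp (- \<gamma> / 4) * (mass ct + J)"
    unfolding d(2) mult.assoc[symmetric] mult_exp_exp by simp
  finally show ?thesis unfolding d(3) by (simp add: algebra_simps add_divide_distrib)
qed

end

section \<open>Cutoff functions\<close>

lemma DERIV_truncated_power:
  fixes t :: real
  shows "((\<lambda>t. (max 0 t) ^ Suc (Suc n)) has_real_derivative real (Suc (Suc n)) * (max 0 t) ^ Suc n) (at t)"
proof -
  consider "t < 0" | "t = 0" | "0 < t" by linarith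
  then show ?thesis
  proof cases
    case 1
    have "((\<lambda>t. (max 0 t) ^ Suc (Suc n)) has_real_derivative 0) (at t)"
      by (rule has_field_derivative_transform_within_open[of "\<lambda>_. 0" _ _ "{..<0}"]) (use 1 in auto)
    then show ?thesis using 1 by simp
  next
    case 2
    have "((\<lambda>h::real. (max 0 h) ^ Suc (Suc n) / h) \<longlongrightarrow> 0) (at 0)"
    proof (rule Lim_null_comparison)
      show "\<forall>\<^sub>F h in at 0. norm ((max 0 h) ^ Suc (Suc n) / h) \<le> (max 0 h) ^ Suc n"
        by (rule always_eventually) (auto simp: max_def)
      have "isCont (\<lambda>h::real. (max 0 h) ^ Suc n) 0" by (intro continuous_intros)
      then show "((\<lambda>h::real. (max 0 h) ^ Suc n) \<longlongrightarrow> 0) (at 0)" by (simp add: isCont_def)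
    qed
    then show ?thesis using 2 by (simp add: has_field_derivative_iff)
  next
    case 3
    have "((\<lambda>t. t ^ Suc (Suc n)) has_real_derivative real (Suc (Suc n)) * t ^ Suc n) (at t)"
      by (rule DERIV_cong[OF DERIV_pow]) simp
    then have "((\<lambda>t. (max 0 t) ^ Suc (Suc n)) has_real_derivative real (Suc (Suc n)) * t ^ Suc n) (at t)"
      by (rule has_field_derivative_transform_within_open[where S="{0<..}"]) (use 3 in auto)
    then show ?thesis using 3 by simp
  qed
qed

text \<open>The integral of the quadratic B-spline with knots \<open>0, 1/3, 2/3, 1\<close>.\<close>

definition step :: "real \<Rightarrow> real"
  where "step s = ((max 0 (3 * s)) ^ 3 - 3 * (max 0 (3 * s - 1)) ^ 3 + 3 * (max 0 (3 * s - 2)) ^ 3 - (max 0 (3 * s - 3)) ^ 3) / 6"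

definition step1 :: "real \<Rightarrow> real"
  where "step1 s = 3 * ((max 0 (3 * s))\<^sup>2 - 3 * (max 0 (3 * s - 1))\<^sup>2 + 3 * (max 0 (3 * s - 2))\<^sup>2 - (max 0 (3 * s - 3))\<^sup>2) / 2"

definition step2 :: "real \<Rightarrow> real"
  where "step2 s = 9 * (max 0 (3 * s) - 3 * max 0 (3 * s - 1) + 3 * max 0 (3 * s - 2) - max 0 (3 * s - 3))"

lemma DERIV_truncated_affine:
  "((\<lambda>s. (max 0 (3 * s - c)) ^ 3) has_real_derivative 9 * (max 0 (3 * s - c))\<^sup>2) (at s)"
  "((\<lambda>s. (max 0 (3 * s - c))\<^sup>2) has_real_derivative 6 * max 0 (3 * s - c)) (at s)"
proof -
  have d: "((\<lambda>s. 3 * s - c) has_real_derivative 3) (at s)" by (auto intro!: derivative_eq_intros)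
  show "((\<lambda>s. (max 0 (3 * s - c)) ^ 3) has_real_derivative 9 * (max 0 (3 * s - c))\<^sup>2) (at s)"
    using DERIV_chain2[OF DERIV_truncated_power[of 1] d] by (simp add: numeral_eq_Suc mult_ac)
  show "((\<lambda>s. (max 0 (3 * s - c))\<^sup>2) has_real_derivative 6 * max 0 (3 * s - c)) (at s)"
    using DERIV_chain2[OF DERIV_truncated_power[of 0] d] by (simp add: numeral_eq_Suc mult_ac)
qed

lemma step_deriv: "(step has_real_derivative step1 s) (at s)"
proof -
  note d = DERIV_truncated_affine(1)[of 0 s, unfolded diff_0_right] DERIV_truncated_affine(1)[of 1 s]
    DERIV_truncated_affine(1)[of 2 s] DERIV_truncated_affine(1)[of 3 s]
  show ?thesis
    unfolding step_def[abs_def] step1_def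
    by (rule DERIV_cong[OF DERIV_cdivide[OF DERIV_diff[OF DERIV_add[OF DERIV_diff[OF d(1) DERIV_cmult[OF d(2)]] DERIV_cmult[OF d(3)]] d(4)]]]) (simp add: field_simps)
qed

lemma step1_deriv: "(step1 has_real_derivative step2 s) (at s)"
proof -
  note d = DERIV_truncated_affine(2)[of 0 s, unfolded diff_0_right] DERIV_truncated_affine(2)[of 1 s]
    DERIV_truncated_affine(2)[of 2 s] DERIV_truncated_affine(2)[of 3 s]
  show ?thesis
    unfolding step1_def[abs_def] step2_def
    by (rule DERIV_cong[OF DERIV_cdivide[OF DERIV_cmult[OF DERIV_diff[OF DERIV_add[OF DERIV_diff[OF d(1) DERIV_cmult[OF d(2)]] DERIV_cmult[OF d(3)]] d(4)]]]]) (simp add: field_simps)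
qed

lemma step_cont: "continuous_on S step2" "continuous_on S step1" "continuous_on S step"
  unfolding step2_def[abs_def] step1_def[abs_def] step_def[abs_def] by (intro continuous_intros; simp)+

lemma step_0: "s \<le> 0 \<Longrightarrow> step s = 0 \<and> step1 s = 0 \<and> step2 s = 0"
  by (simp add: step_def step1_def step2_def)

lemma step_1: "1 \<le> s \<Longrightarrow> step s = 1 \<and> step1 s = 0 \<and> step2 s = 0"
  by (simp add: step_def step1_def step2_def power2_eq_square power3_eq_cube field_simps)

lemma step1_nonneg: "0 \<le> step1 s"
proof -
  consider "s \<le> 0" | "0 \<le> s" "3 * s \<le> 1" | "1 \<le> 3 * s" "3 * s \<le> 2" | "2 \<le> 3 * s" "s \<le> 1" | "1 \<le> s" by linarith
  then show ?thesis
  proof cases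
    case 3
    have "0 \<le> (3 * s - 1) * (2 - 3 * s)" using 3 by (intro mult_nonneg_nonneg) auto
    moreover have "step1 s = 3 * (2 * ((3 * s - 1) * (2 - 3 * s)) + 1) / 2"
      using 3 by (simp add: step1_def power2_eq_square algebra_simps)
    ultimately show ?thesis by simp
  next
    case 4
    have "step1 s = 3 * (3 - 3 * s)\<^sup>2 / 2" using 4 by (simp add: step1_def power2_eq_square algebra_simps)
    moreover have "0 \<le> 3 * (3 - 3 * s)\<^sup>2 / 2" by simp
    ultimately show ?thesis by linarith
  next
    case 2
    then show ?thesis by (simp add: step1_def)
  qed (simp_all add: step_0 step_1)
qed

lemma step_range: "0 \<le> step s" "step s \<le> 1"
proof -
  have m: "step s \<le> step t" if "s \<le> t" for s t
    using DERIV_nonneg_imp_nondecreasing[OF that, of step] step_deriv step1_nonneg by blast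
  show "0 \<le> step s" using m[of "min s 0" s] step_0[of "min s 0"] by simp
  show "step s \<le> 1" using m[of s "max s 1"] step_1[of "max s 1"] by simp
qed

lemma step_bounded: "\<exists>B\<ge>0. \<forall>s. \<bar>step1 s\<bar> \<le> B \<and> \<bar>step2 s\<bar> \<le> B"
proof -
  obtain B1 where B1: "\<And>s. s \<in> {0..1} \<Longrightarrow> \<bar>step1 s\<bar> \<le> B1"
    using compact_imp_bounded[OF compact_continuous_image[OF step_cont(2) compact_Icc]]
    unfolding bounded_iff by (metis imageI real_norm_def)
  obtain B2 where B2: "\<And>s. s \<in> {0..1} \<Longrightarrow> \<bar>step2 s\<bar> \<le> B2"
    using compact_imp_bounded[OF compact_continuous_image[OF step_cont(1) compact_Icc]]
    unfolding bounded_iff by (metis imageI real_norm_def)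
  have "\<bar>step1 s\<bar> \<le> max 0 (max B1 B2) \<and> \<bar>step2 s\<bar> \<le> max 0 (max B1 B2)" for s
    using B1[of s] B2[of s] step_0[of s] step_1[of s] by (cases "s \<le> 0"; cases "1 \<le> s") auto
  then show ?thesis by (intro exI[of _ "max 0 (max B1 B2)"]) auto
qed

definition step_bound :: real where "step_bound = (SOME B. 0 \<le> B \<and> (\<forall>s. \<bar>step1 s\<bar> \<le> B \<and> \<bar>step2 s\<bar> \<le> B))"

lemma step_bound: "0 \<le> step_bound" "\<bar>step1 s\<bar> \<le> step_bound" "\<bar>step2 s\<bar> \<le> step_bound"
  using someI_ex[of "\<lambda>B. 0 \<le> B \<and> (\<forall>s. \<bar>step1 s\<bar> \<le> B \<and> \<bar>step2 s\<bar> \<le> B)"] step_bounded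
  unfolding step_bound_def by auto

definition plateau :: "real \<Rightarrow> real \<Rightarrow> real \<Rightarrow> real"
  where "plateau \<alpha> \<beta> s = step (s - \<alpha>) * step (\<beta> - s)"

definition plateau1 :: "real \<Rightarrow> real \<Rightarrow> real \<Rightarrow> real"
  where "plateau1 \<alpha> \<beta> s = step1 (s - \<alpha>) * step (\<beta> - s) - step (s - \<alpha>) * step1 (\<beta> - s)"

definition plateau2 :: "real \<Rightarrow> real \<Rightarrow> real \<Rightarrow> real"
  where "plateau2 \<alpha> \<beta> s = step2 (s - \<alpha>) * step (\<beta> - s) - 2 * (step1 (s - \<alpha>) * step1 (\<beta> - s)) + step (s - \<alpha>) * step2 (\<beta> - s)"

lemma plateau_deriv:
  "(plateau \<alpha> \<beta> has_real_derivative plateau1 \<alpha> \<beta> s) (at s)"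
  "(plateau1 \<alpha> \<beta> has_real_derivative plateau2 \<alpha> \<beta> s) (at s)"
proof -
  have a: "((\<lambda>s. s - \<alpha>) has_real_derivative 1) (at s)" and b: "((\<lambda>s. \<beta> - s) has_real_derivative -1) (at s)"
    by (auto intro!: derivative_eq_intros)
  note d = DERIV_chain2[OF step_deriv a] DERIV_chain2[OF step_deriv b] DERIV_chain2[OF step1_deriv a] DERIV_chain2[OF step1_deriv b]
  show "(plateau \<alpha> \<beta> has_real_derivative plateau1 \<alpha> \<beta> s) (at s)"
    unfolding plateau_def[abs_def] plateau1_def by (rule DERIV_cong[OF DERIV_mult[OF d(1,2)]]) simp
  show "(plateau1 \<alpha> \<beta> has_real_derivative plateau2 \<alpha> \<beta> s) (at s)"
    unfolding plateau1_def[abs_def] plateau2_def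
    by (rule DERIV_cong[OF DERIV_diff[OF DERIV_mult[OF d(3,2)] DERIV_mult[OF d(1,4)]]]) (simp add: algebra_simps)
qed

lemma plateau_cont: "continuous_on S (plateau1 \<alpha> \<beta>)" "continuous_on S (plateau2 \<alpha> \<beta>)"
  unfolding plateau1_def[abs_def] plateau2_def[abs_def]
  by (intro continuous_intros continuous_on_compose2[OF step_cont(1)[of UNIV]]
      continuous_on_compose2[OF step_cont(2)[of UNIV]] continuous_on_compose2[OF step_cont(3)[of UNIV]]; simp)+

lemma plateau_range: "0 \<le> plateau \<alpha> \<beta> s" "plateau \<alpha> \<beta> s \<le> 1"
  using step_range by (auto simp: plateau_def intro: mult_le_one)

lemma plateau_off: "s \<le> \<alpha> \<or> \<beta> \<le> s \<Longrightarrow> plateau \<alpha> \<beta> s = 0 \<and> plateau1 \<alpha> \<beta> s = 0 \<and> plateau2 \<alpha> \<beta> s = 0"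
  by (auto simp: plateau_def plateau1_def plateau2_def step_0)

lemma plateau_on: "\<alpha> + 1 \<le> s \<Longrightarrow> s \<le> \<beta> - 1 \<Longrightarrow> plateau \<alpha> \<beta> s = 1 \<and> plateau1 \<alpha> \<beta> s = 0 \<and> plateau2 \<alpha> \<beta> s = 0"
  by (simp add: plateau_def plateau1_def plateau2_def step_1)

text \<open>Free of \<open>\<alpha>\<close> and \<open>\<beta>\<close>, since the two steps of a
  plateau have unit width wherever they are placed.\<close>

definition cutoff_bound :: real where "cutoff_bound = 2 * step_bound + 2 * step_bound\<^sup>2"

lemma plateau_bound:
  "\<bar>plateau1 \<alpha> \<beta> s\<bar> \<le> cutoff_bound" "\<bar>plateau2 \<alpha> \<beta> s\<bar> \<le> cutoff_bound" "0 \<le> cutoff_bound"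
proof -
  let ?b = step_bound
  have p: "\<bar>x * y\<bar> \<le> ?b" if "\<bar>x\<bar> \<le> ?b" "0 \<le> y" "y \<le> 1" for x y :: real
    using mult_mono[OF that(1,3)] that step_bound(1) by (simp add: abs_mult)
  have a1: "\<bar>step1 (s - \<alpha>) * step (\<beta> - s)\<bar> \<le> ?b" by (intro p step_bound step_range)
  have a2: "\<bar>step (s - \<alpha>) * step1 (\<beta> - s)\<bar> \<le> ?b" using p[OF step_bound(2) step_range] by (simp add: mult.commute)
  have a3: "\<bar>step2 (s - \<alpha>) * step (\<beta> - s)\<bar> \<le> ?b" by (intro p step_bound step_range)
  have a4: "\<bar>step (s - \<alpha>) * step2 (\<beta> - s)\<bar> \<le> ?b" using p[OF step_bound(3) step_range] by (simp add: mult.commute)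
  have a5: "\<bar>step1 (s - \<alpha>) * step1 (\<beta> - s)\<bar> \<le> ?b\<^sup>2"
    unfolding abs_mult power2_eq_square by (intro mult_mono step_bound) auto
  show "0 \<le> cutoff_bound" using step_bound(1) by (simp add: cutoff_bound_def)
  show "\<bar>plateau1 \<alpha> \<beta> s\<bar> \<le> cutoff_bound"
    using a1 a2 zero_le_power2[of ?b] unfolding plateau1_def cutoff_bound_def by linarith
  show "\<bar>plateau2 \<alpha> \<beta> s\<bar> \<le> cutoff_bound"
    using a3 a4 a5 unfolding plateau2_def cutoff_bound_def by linarith
qed

text \<open>With \<open>x = exp (- \<gamma> / 4)\<close> the assumption brings the factor of
  \<open>mass_absorption\<close> down to \<open>(1 + x) / 2\<close>, which is below one, so
  \<open>mass ct\<close> can be absorbed. The assumption holds once \<open>sb\<close> is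
  sufficiently negative.\<close>

lemma (in dilation_cutoff) mass_le:
  assumes "exp (\<gamma> / 4) / (exp (\<gamma> / 4) - 1) * K3 * exp (\<gamma> / 2 * sb) \<le> (1 - exp (- \<gamma> / 4)) / 2"
  shows "mass ct \<le> 2 / (1 - exp (- \<gamma> / 4)) * J"
proof -
  define x where "x = exp (- \<gamma> / 4)"
  have x: "0 < x" "x < 1" using gamma by (auto simp: x_def)
  have "mass ct \<le> (x + (1 - x) / 2) * (mass ct + J)"
  proof (rule order.trans[OF mass_absorption mult_right_mono])
    show "exp (- \<gamma> / 4) + exp (\<gamma> / 4) / (exp (\<gamma> / 4) - 1) * K3 * exp (\<gamma> / 2 * sb) \<le> x + (1 - x) / 2"
      using assms by (simp add: x_def)
  qed (use J_nonneg mass_nonneg[OF chi_range(1)] in simp)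
  then have "(1 - x) * mass ct \<le> (1 + x) * J" by (simp add: field_simps)
  also have "\<dots> \<le> 2 * J" using x J_nonneg by (intro mult_right_mono) auto
  finally have "mass ct \<le> 2 / (1 - x) * J" using x by (simp add: field_simps)
  then show ?thesis by (simp only: x_def)
qed

lemma (in dilation_setting) dilation_cutoff_plateau:
  assumes "0 < \<kappa>" "2 \<le> CARD('m)" "R \<le> 1" "sa + 2 \<le> sb" "sb + 6 \<le> smax"
  shows "dilation_cutoff H R w g a A P Ca \<gamma> \<kappa> cutoff_bound sa sb (plateau sa sb) (plateau1 sa sb) (plateau2 sa sb)
    (plateau (sa - 2) (sb + 3)) (plateau1 (sa - 2) (sb + 3))"
proof (unfold_locales)
  show "plateau (sa - 2) (sb + 3) s = 1" if "sa - 1 \<le> s" "s \<le> sb + 2" for s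
    using plateau_on[of "sa - 2" s "sb + 3"] that by simp
  show "plateau sa sb s = 0 \<and> plateau1 sa sb s = 0 \<and> plateau2 sa sb s = 0" if "s < sa \<or> sb < s" for s
    using plateau_off[of s sa sb] that by auto
  show "plateau (sa - 2) (sb + 3) s = 0 \<and> plateau1 (sa - 2) (sb + 3) s = 0" if "s < sa - 2 \<or> sb + 3 < s" for s
    using plateau_off[of s "sa - 2" "sb + 3"] that by auto
qed (use assms in \<open>simp_all add: plateau_bound plateau_deriv plateau_cont plateau_range plateau_off plateau_on\<close>)

section \<open>Decay at a flat point\<close>

lemma integral_compact_mono:
  fixes f f' :: "'a::euclidean_space \<Rightarrow> real"
  assumes K: "compact K" "continuous_on K f" and K': "compact K'" "continuous_on K' f'"
    and le: "\<And>x. indicator K x * f x \<le> indicator K' x * f' x"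
  shows "(LINT x|lebesgue_on K. f x) \<le> (LINT x|lebesgue_on K'. f' x)"
  unfolding integral_lebesgue_on_lborel[OF K] integral_lebesgue_on_lborel[OF K']
  using borel_integrable_compact[OF K] borel_integrable_compact[OF K'] le
  by (intro integral_mono) (auto simp: mult.commute)

context dilation_setting
begin

lemma q_upper: "q z \<le> 2 * (norm z)\<^sup>2"
proof -
  have "q z \<le> norm z * norm (P *v z)" by (rule norm_cauchy_schwarz)
  also have "\<dots> \<le> norm z * (2 * norm z)" by (intro mult_left_mono P_upper) simp
  finally show ?thesis by (simp add: power2_eq_square)
qed

lemma s_lower:
  assumes "0 < r" "r \<le> norm z" shows "ln (r\<^sup>2 / 2) \<le> ln (q z)"
proof (rule ln_mono)
  have "r\<^sup>2 \<le> (norm z)\<^sup>2" using assms by (intro power_mono) auto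
  then show "r\<^sup>2 / 2 \<le> q z" using P_lower[of z] by linarith
qed (use assms in simp)

lemma s_upper:
  assumes "z \<noteq> 0" "norm z \<le> r" shows "ln (q z) \<le> ln (2 * r\<^sup>2)"
proof (rule ln_mono)
  have "(norm z)\<^sup>2 \<le> r\<^sup>2" using assms by (intro power_mono) auto
  then show "q z \<le> 2 * r\<^sup>2" using q_upper[of z] by linarith
qed (use assms q_pos in simp)

text \<open>\<open>mass\<close> controls the annulus through a lower bound for its weight there.
  \<open>J\<close> is estimated by the largest values of its weight on its two parts, the inner one
  contained in the ball of radius \<open>r\<close> and the outer one in \<open>hb\<close>.\<close>

lemma annulus_decay:
  assumes kappa: "0 < \<kappa>" and dim: "2 \<le> CARD('m)" and R: "R \<le> 1" and sb: "sb + 6 \<le> smax"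
    and r: "0 < r" "ln (r\<^sup>2 / 2) - 2 \<le> sb" and \<rho>: "0 < \<rho>" "ln (2 * \<rho>\<^sup>2) \<le> sb - 1"
    and m: "m = real CARD('m) / 2 + \<kappa>"
    and mass: "\<And>sa. sa + 2 \<le> sb \<Longrightarrow> dilation_cutoff.mass H R w P \<gamma> \<kappa> (plateau sa sb) \<le> K * dilation_cutoff.J H R w P \<kappa> sa sb"
    and K: "0 \<le> K"
  shows "(LINT z|lebesgue_on (H \<inter> {z. r \<le> norm z \<and> norm z \<le> \<rho>}). (w z)\<^sup>2) \<le>
    (2 * \<rho>\<^sup>2) powr (m - \<gamma> / 2) * K * (exp (8 * m) * (r\<^sup>2 / 2) powr (- m) * (LINT z|lebesgue_on (H \<inter> cball 0 r). (w z)\<^sup>2)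
      + exp (- m * (sb - 4)) * (LINT z|lebesgue_on hb. (w z)\<^sup>2))"
proof -
  \<comment> \<open>The inner part of \<open>\<zeta>\<close> ends at \<open>sa + 4\<close>, hence
    lies in \<open>q z \<le> r\<^sup>2 / 2\<close> and so in the ball of radius \<open>r\<close>.
    Conversely \<open>r \<le> norm z\<close> forces \<open>s \<ge> sa + 4\<close>, past the inner
    step of the cutoff.\<close>
  define sa where "sa = ln (r\<^sup>2 / 2) - 4"
  have sa: "sa + 2 \<le> sb" using r by (simp add: sa_def)
  interpret dilation_cutoff H R w g a A P Ca \<gamma> \<kappa> cutoff_bound sa sb "plateau sa sb" "plateau1 sa sb" "plateau2 sa sb"
    "plateau (sa - 2) (sb + 3)" "plateau1 (sa - 2) (sb + 3)"
    by (rule dilation_cutoff_plateau[OF kappa dim R sa sb])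
  have mu: "\<mu> + 1 = m" using mu_pos(2) m by simp
  have mg: "0 \<le> m - \<gamma> / 2" using gamma mu mu_pos(1) by simp
  have rR: "r \<le> R" "\<rho> \<le> R"
  proof -
    have "ln (r\<^sup>2 / 2) \<le> ln (R\<^sup>2 / 8)" using r(2) sb unfolding smax_def by linarith
    then have "r\<^sup>2 / 2 \<le> R\<^sup>2 / 8" using r(1) R_pos by (subst (asm) ln_le_cancel_iff) auto
    then have le: "r\<^sup>2 \<le> R\<^sup>2" using zero_le_power2[of r] by linarith
    show "r \<le> R" by (rule power2_le_imp_le[OF le]) (use R_pos in simp)
    have "ln (2 * \<rho>\<^sup>2) \<le> ln (R\<^sup>2 / 8)" using \<rho>(2) sb unfolding smax_def by linarith
    then have "2 * \<rho>\<^sup>2 \<le> R\<^sup>2 / 8" using \<rho>(1) R_pos by (subst (asm) ln_le_cancel_iff) auto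
    then have le: "\<rho>\<^sup>2 \<le> R\<^sup>2" using zero_le_power2[of \<rho>] by linarith
    show "\<rho> \<le> R" by (rule power2_le_imp_le[OF le]) (use R_pos in simp)
  qed
  define Dr where "Dr = H \<inter> {z. r \<le> norm z \<and> norm z \<le> \<rho>}"
  have Dr: "compact Dr" "continuous_on Dr (\<lambda>z. (w z)\<^sup>2)"
  proof -
    have "Dr = (H \<inter> {z. r \<le> norm z}) \<inter> cball 0 \<rho>" by (auto simp: Dr_def)
    moreover have "closed {z::real^'m. r \<le> norm z}" by (intro closed_Collect_le continuous_intros)
    ultimately show "compact Dr" using closed_H by (auto intro!: closed_Int_compact closed_Int)
    show "continuous_on Dr (\<lambda>z. (w z)\<^sup>2)"
      by (rule continuous_on_subset[OF cont_data(6)]) (use rR in \<open>auto simp: Dr_def\<close>)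
  qed
  have cb: "compact (H \<inter> cball 0 r)" "continuous_on (H \<inter> cball 0 r) (\<lambda>z. (w z)\<^sup>2)"
    using closed_H rR by (auto intro!: closed_Int_compact continuous_on_subset[OF cont_data(6)])
  \<comment> \<open>The exponent is not positive and \<open>q z \<le> 2 * \<rho>\<^sup>2\<close> on
    the annulus, so this bounds the weight of \<open>mass\<close> from below.\<close>
  let ?c = "(2 * \<rho>\<^sup>2) powr (\<gamma> / 2 - m)"
  have "?c * (LINT z|lebesgue_on Dr. (w z)\<^sup>2) = (LINT z|lebesgue_on Dr. ?c * (w z)\<^sup>2)" by simp
  also have "\<dots> \<le> mass (plateau sa sb)"
    unfolding mass_def
  proof (rule integral_compact_mono[OF Dr(1) continuous_on_mult[OF continuous_on_const Dr(2)] compact_hb])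
    show "continuous_on hb (\<lambda>z. rad (\<lambda>s. plateau sa sb s * exp ((\<gamma> / 2 - \<mu> - 1) * s)) z * (w z)\<^sup>2)"
      by (intro continuous_on_mult cont_rad profile_exp prof_chi cont_data)
    fix z
    have nn: "0 \<le> indicator hb z * (rad (\<lambda>s. plateau sa sb s * exp ((\<gamma> / 2 - \<mu> - 1) * s)) z * (w z)\<^sup>2)"
      by (intro mult_nonneg_nonneg rad_nonneg) (auto simp: plateau_range)
    show "indicator Dr z * (?c * (w z)\<^sup>2) \<le> indicator hb z * (rad (\<lambda>s. plateau sa sb s * exp ((\<gamma> / 2 - \<mu> - 1) * s)) z * (w z)\<^sup>2)"
    proof (cases "z \<in> Dr")
      case True
      then have z: "z \<noteq> 0" "r \<le> norm z" "norm z \<le> \<rho>" "z \<in> hb" using r rR by (auto simp: Dr_def)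
      define s where "s = ln (q z)"
      have s: "sa + 1 \<le> s" "s \<le> sb - 1" "s \<le> ln (2 * \<rho>\<^sup>2)"
        using s_lower[OF r(1) z(2)] s_upper[OF z(1,3)] \<rho>(2) by (auto simp: sa_def s_def)
      have "?c = exp ((\<gamma> / 2 - m) * ln (2 * \<rho>\<^sup>2))" using \<rho>(1) by (simp add: powr_def)
      also have "\<dots> \<le> exp ((\<gamma> / 2 - m) * s)"
        using s(3) mg by (simp add: mult_left_mono_neg)
      finally have "?c \<le> exp ((\<gamma> / 2 - m) * s)" .
      moreover have mm: "\<gamma> / 2 - \<mu> - 1 = \<gamma> / 2 - m" using mu by simp
      have "rad (\<lambda>s. plateau sa sb s * exp ((\<gamma> / 2 - \<mu> - 1) * s)) z = exp ((\<gamma> / 2 - m) * s)"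
        unfolding mm using z(1) plateau_on[OF s(1,2)] by (simp add: rad_nonzero s_def)
      ultimately have "?c \<le> rad (\<lambda>s. plateau sa sb s * exp ((\<gamma> / 2 - \<mu> - 1) * s)) z" by simp
      then show ?thesis using True z(4) by (simp add: mult_right_mono)
    qed (use nn in simp)
  qed
  also have "\<dots> \<le> K * J" by (rule mass[OF sa])
  finally have 1: "?c * (LINT z|lebesgue_on Dr. (w z)\<^sup>2) \<le> K * J" .
  have 2: "J \<le> exp (8 * m) * (r\<^sup>2 / 2) powr (- m) * (LINT z|lebesgue_on (H \<inter> cball 0 r). (w z)\<^sup>2)
      + exp (- m * (sb - 4)) * (LINT z|lebesgue_on hb. (w z)\<^sup>2)"
  proof -
    have p: "profile (hat (sa - 3) (sa + 3))" "profile (hat (sb - 3) (sb + 4))"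
      using sb sa by (auto intro!: prof_hat)
    have m0: "0 \<le> m" using mg gamma by simp
    have "J = intg (\<lambda>z. rad (\<lambda>s. hat (sa - 3) (sa + 3) s * exp (- (\<mu> + 1) * s)) z * (w z)\<^sup>2)
       + intg (\<lambda>z. rad (\<lambda>s. hat (sb - 3) (sb + 4) s * exp (- (\<mu> + 1) * s)) z * (w z)\<^sup>2)"
      unfolding J_def
      by (rule intg_add; (intro int_rad profile_exp p cont_data)?) (simp add: rad_def \<zeta>_def algebra_simps)
    also have "intg (\<lambda>z. rad (\<lambda>s. hat (sa - 3) (sa + 3) s * exp (- (\<mu> + 1) * s)) z * (w z)\<^sup>2) \<le>
      (LINT z|lebesgue_on (H \<inter> cball 0 r). exp (- m * (sa - 4)) * (w z)\<^sup>2)"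
    proof (rule integral_compact_mono[OF compact_hb _ cb(1) continuous_on_mult[OF continuous_on_const cb(2)]])
      show "continuous_on hb (\<lambda>z. rad (\<lambda>s. hat (sa - 3) (sa + 3) s * exp (- (\<mu> + 1) * s)) z * (w z)\<^sup>2)"
        by (intro continuous_on_mult cont_rad profile_exp p cont_data)
      fix z
      show "indicator hb z * (rad (\<lambda>s. hat (sa - 3) (sa + 3) s * exp (- (\<mu> + 1) * s)) z * (w z)\<^sup>2)
        \<le> indicator (H \<inter> cball 0 r) z * (exp (- m * (sa - 4)) * (w z)\<^sup>2)"
      proof (cases "z \<noteq> 0 \<and> sa - 4 \<le> ln (q z) \<and> ln (q z) \<le> sa + 4 \<and> z \<in> hb")
        case True
        define s where "s = ln (q z)"
        have s: "sa - 4 \<le> s" "s \<le> ln (r\<^sup>2 / 2)" using True by (auto simp: sa_def s_def)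
        have "exp (ln (q z)) \<le> exp (ln (r\<^sup>2 / 2))" using s(2) unfolding s_def exp_le_cancel_iff .
        moreover have "exp (ln (q z)) = q z" "exp (ln (r\<^sup>2 / 2)) = r\<^sup>2 / 2"
          using True q_pos[of z] r(1) by simp_all
        ultimately have le: "(norm z)\<^sup>2 \<le> r\<^sup>2" using norm_le_q[of z] by linarith
        have nz: "norm z \<le> r" by (rule power2_le_imp_le[OF le]) (use r(1) in simp)
        have "rad (\<lambda>s. hat (sa - 3) (sa + 3) s * exp (- (\<mu> + 1) * s)) z \<le> 1 * exp (- m * (sa - 4))"
        proof -
          have "exp (- m * s) \<le> exp (- m * (sa - 4))" using s(1) m0 by (simp add: mult_left_mono)
          then have "hat (sa - 3) (sa + 3) s * exp (- m * s) \<le> 1 * exp (- m * (sa - 4))"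
            by (rule mult_mono[OF hat_le]) auto
          then show ?thesis unfolding mu rad_nonzero[OF conjunct1[OF True]] s_def[symmetric] .
        qed
        then show ?thesis using nz True by (simp add: mult_right_mono)
      next
        case False
        then have "indicator hb z * (rad (\<lambda>s. hat (sa - 3) (sa + 3) s * exp (- (\<mu> + 1) * s)) z * (w z)\<^sup>2) = 0"
          using hat_eq_0[of "ln (q z)" "sa - 3" "sa + 3"] by (cases "z = 0") (auto simp: rad_nonzero indicator_def)
        moreover have "0 \<le> indicator (H \<inter> cball 0 r) z * (exp (- m * (sa - 4)) * (w z)\<^sup>2)" by simp
        ultimately show ?thesis by (simp only:)
      qed
    qed
    also have "(LINT z|lebesgue_on (H \<inter> cball 0 r). exp (- m * (sa - 4)) * (w z)\<^sup>2) =
      exp (8 * m) * (r\<^sup>2 / 2) powr (- m) * (LINT z|lebesgue_on (H \<inter> cball 0 r). (w z)\<^sup>2)"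
    proof -
      have "exp (- m * (sa - 4)) = exp (8 * m) * (r\<^sup>2 / 2) powr (- m)"
      proof -
        have "(r\<^sup>2 / 2) powr (- m) = exp (- m * ln (r\<^sup>2 / 2))" using r(1) by (simp add: powr_def)
        moreover have "- m * (sa - 4) = 8 * m + - m * ln (r\<^sup>2 / 2)" unfolding sa_def by algebra
        ultimately show ?thesis by (simp only: mult_exp_exp)
      qed
      then show ?thesis by simp
    qed
    also have "intg (\<lambda>z. rad (\<lambda>s. hat (sb - 3) (sb + 4) s * exp (- (\<mu> + 1) * s)) z * (w z)\<^sup>2) \<le>
      intg (\<lambda>z. exp (- m * (sb - 4)) * (w z)\<^sup>2)"
    proof (rule intg_mono)
      fix z
      have "rad (\<lambda>s. hat (sb - 3) (sb + 4) s * exp (- (\<mu> + 1) * s)) z \<le> exp (- m * (sb - 4))"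
      proof (cases "z \<noteq> 0 \<and> sb - 4 \<le> ln (q z)")
        case True
        then have "exp (- m * ln (q z)) \<le> exp (- m * (sb - 4))" using m0 by (simp add: mult_left_mono)
        then have "hat (sb - 3) (sb + 4) (ln (q z)) * exp (- m * ln (q z)) \<le> 1 * exp (- m * (sb - 4))"
          by (rule mult_mono[OF hat_le]) auto
        then show ?thesis using True by (simp add: rad_nonzero mu)
      next
        case False
        then show ?thesis using hat_eq_0[of "ln (q z)" "sb - 3" "sb + 4"] by (cases "z = 0") (auto simp: rad_nonzero)
      qed
      then show "rad (\<lambda>s. hat (sb - 3) (sb + 4) s * exp (- (\<mu> + 1) * s)) z * (w z)\<^sup>2 \<le> exp (- m * (sb - 4)) * (w z)\<^sup>2"
        by (rule mult_right_mono) simp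
    qed (intro int_rad integrable_mult_right profile_exp p cont_data integrable_on_compact compact_hb)+
    finally show ?thesis by simp
  qed
  have 3: "(2 * \<rho>\<^sup>2) powr (m - \<gamma> / 2) * ?c = 1" using \<rho>(1) by (simp add: powr_add[symmetric])
  have "(LINT z|lebesgue_on Dr. (w z)\<^sup>2) = (2 * \<rho>\<^sup>2) powr (m - \<gamma> / 2) * (?c * (LINT z|lebesgue_on Dr. (w z)\<^sup>2))"
    unfolding mult.assoc[symmetric] 3 by simp
  also have "\<dots> \<le> (2 * \<rho>\<^sup>2) powr (m - \<gamma> / 2) * (K * J)" by (rule mult_left_mono[OF 1]) simp
  also have "\<dots> \<le> (2 * \<rho>\<^sup>2) powr (m - \<gamma> / 2) * (K * (exp (8 * m) * (r\<^sup>2 / 2) powr (- m) * (LINT z|lebesgue_on (H \<inter> cball 0 r). (w z)\<^sup>2)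
      + exp (- m * (sb - 4)) * (LINT z|lebesgue_on hb. (w z)\<^sup>2)))"
    by (intro mult_left_mono 2 K) simp
  finally show ?thesis by (simp only: Dr_def mult.assoc)
qed

end

text \<open>\<open>K\<close> and \<open>b0\<close> precede the quantifiers over the setting: they
  depend on the dimension, \<open>\<kappa>\<close>, \<open>\<gamma>\<close> and \<open>Ca\<close>
  alone. This uniformity in the flat point permits the later passage to a limit point.\<close>

theorem dilation_decay:
  fixes \<kappa> \<gamma> Ca :: real
  assumes "0 < \<kappa>" "2 \<le> CARD('m::finite)" "0 < \<gamma>"
  shows "\<exists>K b0. 0 \<le> K \<and> (\<forall>H R w g a A P sb r \<rho>.
    dilation_setting (H :: (real ^ 'm) set) R w g a A P Ca \<gamma> \<longrightarrow> R \<le> 1 \<longrightarrow> sb + 6 \<le> ln (R\<^sup>2 / 8) \<longrightarrow> sb \<le> b0 \<longrightarrow>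
    0 < r \<longrightarrow> ln (r\<^sup>2 / 2) - 2 \<le> sb \<longrightarrow> 0 < \<rho> \<longrightarrow> ln (2 * \<rho>\<^sup>2) \<le> sb - 1 \<longrightarrow>
    (LINT z|lebesgue_on (H \<inter> {z. r \<le> norm z \<and> norm z \<le> \<rho>}). (w z)\<^sup>2) \<le>
      \<rho> powr (real CARD('m) + 2 * \<kappa> - \<gamma>) * (K * (r powr (- real CARD('m) - 2 * \<kappa>) * (LINT z|lebesgue_on (H \<inter> cball 0 r). (w z)\<^sup>2)
      + exp (- (real CARD('m) / 2 + \<kappa>) * (sb - 4)) * (LINT z|lebesgue_on (H \<inter> cball 0 R). (w z)\<^sup>2))))"
proof -
  define m where "m = real CARD('m) / 2 + \<kappa>"
  define k3 where "k3 = dilation_cutoff.K3 TYPE('m) Ca \<kappa> cutoff_bound"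
  define th where "th = (1 - exp (- \<gamma> / 4)) / 2"
  define cc where "cc = exp (\<gamma> / 4) / (exp (\<gamma> / 4) - 1) * k3"
  \<comment> \<open>For \<open>sb \<le> b0\<close> the product
    \<open>cc * exp (\<gamma> / 2 * sb)\<close> is at most \<open>th\<close>, which is the
    hypothesis of \<open>mass_le\<close>; \<open>max 1 cc\<close> keeps the argument of the
    logarithm positive.\<close>
  define b0 where "b0 = 2 / \<gamma> * ln (th / max 1 cc)"
  define K where "K = 2 / (1 - exp (- \<gamma> / 4))"
  have th: "0 < th" using assms(3) by (simp add: th_def)
  have K: "0 \<le> K" using assms(3) by (simp add: K_def)
  have small: "cc * exp (\<gamma> / 2 * sb) \<le> th" if "sb \<le> b0" for sb
  proof -
    have "\<gamma> / 2 * sb \<le> \<gamma> / 2 * b0" using that assms(3) by (intro mult_left_mono) auto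
    also have "\<dots> = ln (th / max 1 cc)" using assms(3) by (simp add: b0_def)
    finally have "exp (\<gamma> / 2 * sb) \<le> exp (ln (th / max 1 cc))" by simp
    also have "\<dots> = th / max 1 cc" using th by (intro exp_ln divide_pos_pos) auto
    finally have "exp (\<gamma> / 2 * sb) \<le> th / max 1 cc" .
    moreover have "cc * exp (\<gamma> / 2 * sb) \<le> max 1 cc * exp (\<gamma> / 2 * sb)" by (intro mult_right_mono) auto
    moreover have "0 \<le> max 1 cc" by simp
    ultimately have "cc * exp (\<gamma> / 2 * sb) \<le> max 1 cc * (th / max 1 cc)"
      using mult_left_mono[of "exp (\<gamma> / 2 * sb)" "th / max 1 cc" "max 1 cc"] by linarith
    also have "\<dots> = th" by (simp add: max_def)
    finally show ?thesis .
  qed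
  define K' where "K' = 2 powr (m - \<gamma> / 2) * K * max (exp (8 * m) * 2 powr m) 1"
  show ?thesis
  proof (rule exI[of _ K'], rule exI[of _ b0], intro conjI allI impI)
    show "0 \<le> K'" using K by (simp add: K'_def)
    fix H :: "(real ^ 'm) set" and R w g a A P sb r \<rho>
    assume D: "dilation_setting H R w g a A P Ca \<gamma>" and R: "R \<le> 1" and sb6: "sb + 6 \<le> ln (R\<^sup>2 / 8)" and sb0: "sb \<le> b0"
      and r: "0 < r" "ln (r\<^sup>2 / 2) - 2 \<le> sb" and \<rho>: "0 < \<rho>" "ln (2 * \<rho>\<^sup>2) \<le> sb - 1"
    interpret dilation_setting H R w g a A P Ca \<gamma> by (rule D)
    have sb': "sb + 6 \<le> smax" using sb6 by (simp add: smax_def)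
    have mass: "dilation_cutoff.mass H R w P \<gamma> \<kappa> (plateau sa sb) \<le> K * dilation_cutoff.J H R w P \<kappa> sa sb" if "sa + 2 \<le> sb" for sa
    proof -
      interpret dilation_cutoff H R w g a A P Ca \<gamma> \<kappa> cutoff_bound sa sb "plateau sa sb" "plateau1 sa sb" "plateau2 sa sb"
        "plateau (sa - 2) (sb + 3)" "plateau1 (sa - 2) (sb + 3)"
        by (rule dilation_cutoff_plateau[OF assms(1,2) R that sb'])
      show ?thesis
        unfolding K_def by (rule mass_le) (use small[OF sb0] in \<open>simp only: cc_def k3_def th_def\<close>)
    qed
    define I1 where "I1 = (LINT z|lebesgue_on (H \<inter> cball 0 r). (w z)\<^sup>2)"
    define I2 where "I2 = (LINT z|lebesgue_on (H \<inter> cball 0 R). (w z)\<^sup>2)"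
    have I: "0 \<le> I1" "0 \<le> I2" by (auto simp: I1_def I2_def)
    have e1: "(2 * \<rho>\<^sup>2) powr (m - \<gamma> / 2) = 2 powr (m - \<gamma> / 2) * \<rho> powr (real CARD('m) + 2 * \<kappa> - \<gamma>)"
    proof -
      have "(\<rho>\<^sup>2) powr (m - \<gamma> / 2) = \<rho> powr (2 * (m - \<gamma> / 2))"
      proof -
        have "\<rho>\<^sup>2 = \<rho> powr 2" using \<rho>(1) by simp
        then show ?thesis by (simp only: powr_powr)
      qed
      also have "2 * (m - \<gamma> / 2) = real CARD('m) + 2 * \<kappa> - \<gamma>" by (simp add: m_def)
      finally show ?thesis using \<rho>(1) by (simp add: powr_mult)
    qed
    have e2: "(r\<^sup>2 / 2) powr (- m) = 2 powr m * r powr (- real CARD('m) - 2 * \<kappa>)"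
    proof -
      have "(r\<^sup>2) powr (- m) = r powr (2 * (- m))"
      proof -
        have "r\<^sup>2 = r powr 2" using r(1) by simp
        then show ?thesis by (simp only: powr_powr)
      qed
      also have "2 * (- m) = - real CARD('m) - 2 * \<kappa>" by (simp add: m_def)
      finally have "(r\<^sup>2) powr (- m) = r powr (- real CARD('m) - 2 * \<kappa>)" .
      moreover have "(r\<^sup>2 / 2) powr (- m) = (r\<^sup>2) powr (- m) * 2 powr m"
      proof -
        have "(r\<^sup>2 * (1 / 2)) powr (- m) = (r\<^sup>2) powr (- m) * (1 / 2) powr (- m)"
          by (rule powr_mult)
        moreover have "(1 / 2 :: real) powr (- m) = 2 powr m"
          by (simp add: powr_def ln_div)
        ultimately show ?thesis by simp
      qed
      ultimately show ?thesis by (simp only: mult.commute)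
    qed
    have "(LINT z|lebesgue_on (H \<inter> {z. r \<le> norm z \<and> norm z \<le> \<rho>}). (w z)\<^sup>2) \<le>
      (2 * \<rho>\<^sup>2) powr (m - \<gamma> / 2) * K * (exp (8 * m) * (r\<^sup>2 / 2) powr (- m) * I1 + exp (- m * (sb - 4)) * I2)"
      unfolding I1_def I2_def
      by (rule annulus_decay[OF assms(1,2) R sb' r \<rho> m_def mass K])
    also have "\<dots> \<le> (2 * \<rho>\<^sup>2) powr (m - \<gamma> / 2) * K * (max (exp (8 * m) * 2 powr m) 1 * (r powr (- real CARD('m) - 2 * \<kappa>) * I1 + exp (- m * (sb - 4)) * I2))"
    proof (rule mult_left_mono)
      have "exp (8 * m) * 2 powr m * (r powr (- real CARD('m) - 2 * \<kappa>) * I1) \<le> max (exp (8 * m) * 2 powr m) 1 * (r powr (- real CARD('m) - 2 * \<kappa>) * I1)"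
        using I by (intro mult_right_mono) auto
      moreover have "1 * (exp (- m * (sb - 4)) * I2) \<le> max (exp (8 * m) * 2 powr m) 1 * (exp (- m * (sb - 4)) * I2)"
        using I by (intro mult_right_mono) auto
      ultimately show "exp (8 * m) * (r\<^sup>2 / 2) powr (- m) * I1 + exp (- m * (sb - 4)) * I2 \<le>
        max (exp (8 * m) * 2 powr m) 1 * (r powr (- real CARD('m) - 2 * \<kappa>) * I1 + exp (- m * (sb - 4)) * I2)"
        unfolding e2 distrib_left by (simp only: mult.assoc mult_1_left)
    qed (use K in simp)
    finally show "(LINT z|lebesgue_on (H \<inter> {z. r \<le> norm z \<and> norm z \<le> \<rho>}). (w z)\<^sup>2) \<le>
      \<rho> powr (real CARD('m) + 2 * \<kappa> - \<gamma>) * (K' * (r powr (- real CARD('m) - 2 * \<kappa>) * (LINT z|lebesgue_on (H \<inter> cball 0 r). (w z)\<^sup>2)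
      + exp (- (real CARD('m) / 2 + \<kappa>) * (sb - 4)) * (LINT z|lebesgue_on (H \<inter> cball 0 R). (w z)\<^sup>2)))"
      unfolding e1 K'_def I1_def[symmetric] I2_def[symmetric] m_def[symmetric] by (simp only: mult_ac)
  qed
qed

section \<open>Smooth test functions\<close>

text \<open>The one-variable counterpart of \<open>times_differentiable\<close>, with derivatives as
  existential witnesses; test functions are assembled from such functions coordinate by
  coordinate.\<close>

primrec diff_order :: "nat \<Rightarrow> (real \<Rightarrow> real) \<Rightarrow> bool"
  where
    "diff_order 0 f \<longleftrightarrow> continuous_on UNIV f"
  | "diff_order (Suc k) f \<longleftrightarrow> (\<exists>f'. (\<forall>t. (f has_real_derivative f' t) (at t)) \<and> diff_order k f')"

definition smooth :: "(real \<Rightarrow> real) \<Rightarrow> bool" where "smooth f \<longleftrightarrow> (\<forall>k. diff_order k f)"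

lemma diff_order_continuous: "diff_order k f \<Longrightarrow> continuous_on UNIV f"
proof (cases k)
  case (Suc n)
  assume "diff_order k f"
  then obtain f' where "\<And>t. (f has_real_derivative f' t) (at t)" using Suc by auto
  then show ?thesis by (intro continuous_at_imp_continuous_on ballI DERIV_isCont)
qed auto

lemma diff_order_SucI:
  "(\<And>t. (f has_real_derivative f' t) (at t)) \<Longrightarrow> diff_order k f' \<Longrightarrow> diff_order (Suc k) f"
  by auto

lemma diff_order_Suc_imp: "diff_order (Suc k) f \<Longrightarrow> diff_order k f"
proof (induction k arbitrary: f)
  case 0
  then show ?case using diff_order_continuous[of "Suc 0"] by simp
next
  case (Suc k)
  then obtain f' where "\<forall>t. (f has_real_derivative f' t) (at t)" "diff_order (Suc k) f'" by auto
  then show ?case using Suc.IH[of f'] by auto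
qed

lemma diff_order_add: "diff_order k f \<Longrightarrow> diff_order k g \<Longrightarrow> diff_order k (\<lambda>t. f t + g t)"
proof (induction k arbitrary: f g)
  case 0
  then show ?case by (auto intro: continuous_intros)
next
  case (Suc k)
  obtain f' where f': "\<And>t. (f has_real_derivative f' t) (at t)" "diff_order k f'" using Suc.prems(1) by auto
  obtain g' where g': "\<And>t. (g has_real_derivative g' t) (at t)" "diff_order k g'" using Suc.prems(2) by auto
  show ?case
    unfolding diff_order.simps
    by (intro exI[of _ "\<lambda>t. f' t + g' t"] conjI allI DERIV_add f' g' Suc.IH)
qed

lemma diff_order_mult: "diff_order k f \<Longrightarrow> diff_order k g \<Longrightarrow> diff_order k (\<lambda>t. f t * g t)"
proof (induction k arbitrary: f g)
  case 0
  then show ?case by (auto intro: continuous_intros)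
next
  case (Suc k)
  obtain f' where f': "\<And>t. (f has_real_derivative f' t) (at t)" "diff_order k f'" using Suc.prems(1) by auto
  obtain g' where g': "\<And>t. (g has_real_derivative g' t) (at t)" "diff_order k g'" using Suc.prems(2) by auto
  have "diff_order k (\<lambda>t. f' t * g t + g' t * f t)"
    by (rule diff_order_add[OF Suc.IH[OF f'(2) diff_order_Suc_imp[OF Suc.prems(2)]]
          Suc.IH[OF g'(2) diff_order_Suc_imp[OF Suc.prems(1)]]])
  then show ?case
    unfolding diff_order.simps
    by (intro exI[of _ "\<lambda>t. f' t * g t + g' t * f t"] conjI allI DERIV_mult f' g')
qed

lemma diff_order_const: "diff_order k (\<lambda>_. c)"
  by (induction k arbitrary: c) (auto intro!: exI[of _ "\<lambda>_. 0"])

lemma diff_order_affine: "diff_order k f \<Longrightarrow> diff_order k (\<lambda>t. f (m * t + c))"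
proof (induction k arbitrary: f)
  case 0
  then show ?case by (auto intro!: continuous_on_compose2[of UNIV f] continuous_intros)
next
  case (Suc k)
  obtain f' where f': "\<And>t. (f has_real_derivative f' t) (at t)" "diff_order k f'" using Suc.prems by auto
  have "((\<lambda>t. m * t + c) has_real_derivative m) (at t)" for t by (auto intro!: derivative_eq_intros)
  then have "((\<lambda>t. f (m * t + c)) has_real_derivative f' (m * t + c) * m) (at t)" for t
    by (rule DERIV_chain2[OF f'(1)])
  moreover have "diff_order k (\<lambda>t. f' (m * t + c) * m)"
    by (rule diff_order_mult[OF Suc.IH[OF f'(2)] diff_order_const])
  ultimately show ?case by (rule diff_order_SucI)
qed

lemma diff_order_id: "diff_order k (\<lambda>t. t)"
proof (cases k)
  case (Suc n)
  have "((\<lambda>t. t) has_real_derivative 1) (at t)" for t :: real by (rule DERIV_ident)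
  then show ?thesis unfolding Suc by (rule diff_order_SucI) (rule diff_order_const)
qed auto

lemma smooth_mult: "smooth f \<Longrightarrow> smooth g \<Longrightarrow> smooth (\<lambda>t. f t * g t)"
  and smooth_const: "smooth (\<lambda>_. c)" and smooth_id: "smooth (\<lambda>t. t)"
  and smooth_affine: "smooth f \<Longrightarrow> smooth (\<lambda>t. f (m * t + c))"
  by (auto simp: smooth_def diff_order_mult diff_order_const diff_order_id diff_order_affine)

text \<open>Each order supplies its own derivative; by uniqueness they coincide, so one function
  serves all orders.\<close>

lemma smooth_deriv:
  assumes "smooth f"
  obtains f' where "\<And>t. (f has_real_derivative f' t) (at t)" "smooth f'"
proof -
  have "diff_order (Suc k) f" for k using assms unfolding smooth_def by blast
  then have "\<forall>k. \<exists>f'. (\<forall>t. (f has_real_derivative f' t) (at t)) \<and> diff_order k f'" by auto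
  then obtain D where D: "\<And>k t. (f has_real_derivative D k t) (at t)" "\<And>k. diff_order k (D k)" by metis
  have "D k = D 0" for k using D(1) DERIV_unique by blast
  then have "smooth (D 0)" using D(2) unfolding smooth_def by metis
  then show ?thesis using D(1) that by blast
qed

text \<open>The powers of \<open>1 / t\<close> make the family closed under differentiation up to
  linear combinations, so smoothness follows by induction on the order for all \<open>n\<close> at
  once.\<close>

definition flat_exp :: "nat \<Rightarrow> real \<Rightarrow> real"
  where "flat_exp n t = (if 0 < t then exp (- (1 / t)) * (1 / t) ^ n else 0)"

lemma flat_exp_deriv:
  "(flat_exp n has_real_derivative flat_exp (n + 2) t - real n * flat_exp (n + 1) t) (at t)"
proof -
  consider "t < 0" | "t = 0" | "0 < t" by linarith
  then show ?thesis
  proof cases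
    case 1
    have "(flat_exp n has_real_derivative 0) (at t)"
      by (rule has_field_derivative_transform_within_open[of "\<lambda>_. 0" _ _ "{..<0}"]) (use 1 in \<open>auto simp: flat_exp_def\<close>)
    then show ?thesis using 1 by (simp add: flat_exp_def)
  next
    case 2
    have "((\<lambda>h. flat_exp n h / h) \<longlongrightarrow> 0) (at_right 0)"
    proof -
      have "((\<lambda>x::real. x ^ Suc n / exp x) \<longlongrightarrow> 0) at_top" by (rule tendsto_power_div_exp_0)
      then have "((\<lambda>h::real. (inverse h) ^ Suc n / exp (inverse h)) \<longlongrightarrow> 0) (at_right 0)"
        by (rule filterlim_compose[OF _ filterlim_inverse_at_top_right])
      moreover have "\<forall>\<^sub>F h in at_right 0. (inverse h) ^ Suc n / exp (inverse h) = flat_exp n h / h"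
        by (rule eventually_at_right_less[of 0, THEN eventually_mono])
          (simp add: flat_exp_def exp_minus divide_inverse)
      ultimately show ?thesis by (rule Lim_transform_eventually)
    qed
    moreover have "((\<lambda>h. flat_exp n h / h) \<longlongrightarrow> 0) (at_left 0)"
    proof (rule tendsto_eventually)
      show "\<forall>\<^sub>F h in at_left 0. flat_exp n h / h = 0"
        by (auto simp: eventually_at_filter flat_exp_def)
    qed
    ultimately have "((\<lambda>h. flat_exp n h / h) \<longlongrightarrow> 0) (at 0)" by (simp add: filterlim_split_at)
    then show ?thesis using 2 by (simp add: has_field_derivative_iff flat_exp_def)
  next
    case 3
    have d: "((\<lambda>t. 1 / t) has_real_derivative - ((1 / t)\<^sup>2)) (at t)"
      using 3 by (auto intro!: derivative_eq_intros simp: power2_eq_square)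
    have e: "((\<lambda>t. exp (- (1 / t))) has_real_derivative exp (- (1 / t)) * (1 / t)\<^sup>2) (at t)"
      using DERIV_chain2[OF DERIV_exp DERIV_minus[OF d]] by simp
    have p: "real n * (- ((1 / t)\<^sup>2) * (1 / t) ^ (n - Suc 0)) = - (real n * (1 / t) ^ (n + 1))"
      by (cases n) (simp_all add: power2_eq_square)
    have "((\<lambda>t. exp (- (1 / t)) * (1 / t) ^ n) has_real_derivative flat_exp (n + 2) t - real n * flat_exp (n + 1) t) (at t)"
      by (rule DERIV_cong[OF DERIV_mult[OF e DERIV_power[OF d, of n]]])
        (use 3 in \<open>simp only: p, simp add: flat_exp_def power_add power2_eq_square algebra_simps\<close>)
    then have "(flat_exp n has_real_derivative flat_exp (n + 2) t - real n * flat_exp (n + 1) t) (at t)"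
      by (rule has_field_derivative_transform_within_open[where S="{0<..}"]) (use 3 in \<open>auto simp: flat_exp_def\<close>)
    then show ?thesis .
  qed
qed

lemma smooth_flat_exp: "smooth (flat_exp n)"
proof -
  have "diff_order k (flat_exp n)" for k n
  proof (induction k arbitrary: n)
    case 0
    show ?case using DERIV_isCont[OF flat_exp_deriv] by (auto intro: continuous_at_imp_continuous_on)
  next
    case (Suc k)
    have "diff_order k (\<lambda>t. flat_exp (n + 2) t + (- real n) * flat_exp (n + 1) t)"
      by (intro diff_order_add diff_order_mult diff_order_const Suc.IH)
    then have "diff_order k (\<lambda>t. flat_exp (n + 2) t - real n * flat_exp (n + 1) t)" by simp
    then show ?case by (rule diff_order_SucI[OF flat_exp_deriv])
  qed
  then show ?thesis by (simp add: smooth_def)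
qed

text \<open>Both arguments are spelt in the form \<open>m * t + c\<close> of
  \<open>smooth_affine\<close>.\<close>

definition bump :: "real \<Rightarrow> real" where "bump t = flat_exp 0 (1 * t + 1) * flat_exp 0 ((- 1) * t + 1)"

lemma smooth_bump: "smooth bump"
  unfolding bump_def[abs_def] by (intro smooth_mult smooth_affine smooth_flat_exp)

lemma bump_nonneg: "0 \<le> bump t" and bump_pos: "\<bar>t\<bar> < 1 \<Longrightarrow> 0 < bump t" and bump_off: "1 \<le> \<bar>t\<bar> \<Longrightarrow> bump t = 0"
  and bump_le: "bump t \<le> 1"
proof -
  have *: "0 \<le> flat_exp 0 t" "flat_exp 0 t \<le> 1" for t by (auto simp: flat_exp_def)
  show "0 \<le> bump t" using * by (simp add: bump_def)
  show "bump t \<le> 1" unfolding bump_def by (intro mult_le_one *)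
  show "0 < bump t" if "\<bar>t\<bar> < 1" using that by (auto simp: bump_def flat_exp_def)
  show "bump t = 0" if "1 \<le> \<bar>t\<bar>" using that by (auto simp: bump_def flat_exp_def)
qed

text \<open>A partial derivative changes a single factor and leaves a product of the same kind, so
  smoothness in several variables reduces to one variable.\<close>

definition tensor :: "('m::finite \<Rightarrow> real \<Rightarrow> real) \<Rightarrow> real ^ 'm \<Rightarrow> real"
  where "tensor F x = (\<Prod>i\<in>UNIV. F i (x $ i))"

lemma tensor_has_derivative:
  assumes "\<And>i t. (F i has_real_derivative F' i t) (at t)"
  shows "(tensor F has_derivative (\<lambda>h. \<Sum>i\<in>UNIV. h $ i * tensor (F(i := F' i)) x)) (at x)"
proof -
  have 1: "((\<lambda>x. F i (x $ i)) has_derivative (\<lambda>h. F' i (x $ i) * h $ i)) (at x)" for i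
  proof -
    have "((\<lambda>x. x $ i) has_derivative (\<lambda>h. h $ i)) (at x)"
      by (rule bounded_linear_imp_has_derivative[OF bounded_linear_vec_nth])
    from has_derivative_compose[OF this assms[of i, unfolded has_field_derivative_def]] show ?thesis .
  qed
  have "((\<lambda>x. \<Prod>i\<in>UNIV. F i (x $ i)) has_derivative (\<lambda>h. \<Sum>i\<in>UNIV. (F' i (x $ i) * h $ i) * (\<Prod>j\<in>UNIV - {i}. F j (x $ j)))) (at x)"
    by (rule has_derivative_prod[OF 1])
  moreover have "(F' i (x $ i) * h $ i) * (\<Prod>j\<in>UNIV - {i}. F j (x $ j)) = h $ i * tensor (F(i := F' i)) x" for i h
  proof -
    have "tensor (F(i := F' i)) x = F' i (x $ i) * (\<Prod>j\<in>UNIV - {i}. (F(i := F' i)) j (x $ j))"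
      unfolding tensor_def by (subst prod.remove[of _ i]) auto
    also have "(\<Prod>j\<in>UNIV - {i}. (F(i := F' i)) j (x $ j)) = (\<Prod>j\<in>UNIV - {i}. F j (x $ j))"
      by (rule prod.cong) auto
    finally have t: "tensor (F(i := F' i)) x = F' i (x $ i) * (\<Prod>j\<in>UNIV - {i}. F j (x $ j))" .
    show ?thesis unfolding t by simp
  qed
  ultimately show ?thesis by (simp add: tensor_def[abs_def])
qed

lemma partial_deriv_eqI:
  assumes "(f has_derivative f') (at x)" shows "partial_deriv UNIV i f x = f' (axis i 1)"
  using frechet_derivative_at[OF assms] by (simp add: partial_deriv_def)

lemma tensor_partial_deriv:
  assumes "\<And>i t. (F i has_real_derivative F' i t) (at t)"
  shows "partial_deriv UNIV i (tensor F) = tensor (F(i := F' i))"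
proof
  fix x
  have "(\<Sum>j\<in>UNIV. axis i 1 $ j * tensor (F(j := F' j)) x) = (\<Sum>j\<in>UNIV. if j = i then tensor (F(i := F' i)) x else 0)"
    by (rule sum.cong) (auto simp: axis_def)
  then show "partial_deriv UNIV i (tensor F) x = tensor (F(i := F' i)) x"
    unfolding partial_deriv_eqI[OF tensor_has_derivative[of F F', OF assms]] by simp
qed

lemma tensor_times_differentiable:
  assumes "\<And>i. smooth (F i)"
  shows "times_differentiable k (tensor F)"
  using assms
proof (induction k arbitrary: F)
  case 0
  have "continuous_on UNIV (\<lambda>x. F i (x $ i))" for i
  proof (rule continuous_on_compose2[of UNIV "F i"])
    show "continuous_on UNIV (F i)" using 0[of i] diff_order_continuous[of 0] unfolding smooth_def by blast
    show "continuous_on UNIV (\<lambda>x :: real ^ 'a. x $ i)" by (intro continuous_on_component continuous_on_id)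
  qed simp
  then show ?case by (auto simp: tensor_def[abs_def] intro!: continuous_on_prod)
next
  case (Suc k)
  obtain F' where F': "\<And>i t. (F i has_real_derivative F' i t) (at t)" "\<And>i. smooth (F' i)"
  proof -
    have "\<forall>i. \<exists>f'. (\<forall>t. (F i has_real_derivative f' t) (at t)) \<and> smooth f'"
      using smooth_deriv[OF Suc.prems] by blast
    then show ?thesis using that by metis
  qed
  have "times_differentiable k (partial_deriv UNIV i (tensor F))" for i
    unfolding tensor_partial_deriv[of F F', OF F'(1)] using Suc.prems F'(2) by (intro Suc.IH) auto
  moreover have "tensor F differentiable_on UNIV"
    using tensor_has_derivative[of F F', OF F'(1)] by (auto simp: differentiable_on_def differentiable_def)
  ultimately show ?case by simp
qed

lemma test_functionsI:
  assumes "\<And>k. times_differentiable k \<phi>" "compact K" "K \<subseteq> U" "\<And>x. x \<notin> K \<Longrightarrow> \<phi> x = 0"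
  shows "\<phi> \<in> test_functions U"
proof -
  have "closure {x. \<phi> x \<noteq> 0} \<subseteq> K"
    using assms(2,4) by (intro closure_minimal compact_imp_closed) auto
  moreover from this have "compact (closure {x. \<phi> x \<noteq> 0})"
    using compact_Int_closed[OF assms(2) closed_closure[of "{x. \<phi> x \<noteq> 0}"]] by (simp add: Int_absorb1)
  ultimately show ?thesis using assms(1,3) unfolding test_functions_def by blast
qed

section \<open>Continuously differentiable test functions\<close>

lemma has_derivative_integral_inner:
  fixes f :: "real ^ 'm::finite \<Rightarrow> real ^ 'm \<Rightarrow> real" and v :: "real ^ 'm \<Rightarrow> real ^ 'm \<Rightarrow> real ^ 'm"
  assumes der: "\<And>x y. y \<in> cbox a b \<Longrightarrow> ((\<lambda>x. f x y) has_derivative (\<lambda>h. v x y \<bullet> h)) (at x)"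
    and cv: "continuous_on (UNIV \<times> cbox a b) (\<lambda>(x, y). v x y)"
    and cf: "\<And>x. continuous_on (cbox a b) (f x)"
  shows "((\<lambda>x. integral (cbox a b) (f x)) has_derivative (\<lambda>h. integral (cbox a b) (v x) \<bullet> h)) (at x)"
proof -
  have "((\<lambda>x. integral (cbox a b) (f x)) has_derivative
      blinfun_apply (integral (cbox a b) (\<lambda>y. blinfun_inner_right (v x y)))) (at x within UNIV)"
  proof (rule leibniz_rule)
    show "((\<lambda>x. f x t) has_derivative blinfun_apply (blinfun_inner_right (v x t))) (at x within UNIV)"
      if "t \<in> cbox a b" for x t
      using der[OF that] by simp
    have "continuous_on (UNIV \<times> cbox a b) (\<lambda>p. blinfun_inner_right (v (fst p) (snd p)))"
      using cv by (intro bounded_linear.continuous_on[OF bounded_linear_blinfun_inner_right]) (simp add: case_prod_beta)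
    then show "continuous_on (UNIV \<times> cbox a b) (\<lambda>(x, t). blinfun_inner_right (v x t))"
      by (simp add: case_prod_beta)
  qed (auto intro: integrable_continuous cf)
  then have D: "((\<lambda>x. integral (cbox a b) (f x)) has_derivative
      blinfun_apply (integral (cbox a b) (\<lambda>y. blinfun_inner_right (v x y)))) (at x)" by simp
  have cvx: "continuous_on (cbox a b) (v x)"
  proof -
    have "continuous_on (cbox a b) (\<lambda>y. case (x, y) of (x, y) \<Rightarrow> v x y)"
      by (rule continuous_on_compose2[OF cv]) (auto intro!: continuous_intros)
    then show ?thesis by simp
  qed
  have "blinfun_apply (integral (cbox a b) (\<lambda>y. blinfun_inner_right (v x y))) h = integral (cbox a b) (v x) \<bullet> h" for h
  proof -
    have "continuous_on (cbox a b) (\<lambda>y. blinfun_inner_right (v x y))"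
      by (intro bounded_linear.continuous_on[OF bounded_linear_blinfun_inner_right] cvx)
    then have "blinfun_apply (integral (cbox a b) (\<lambda>y. blinfun_inner_right (v x y))) h
        = integral (cbox a b) (\<lambda>y. blinfun_apply (blinfun_inner_right (v x y)) h)"
      by (intro blinfun_apply_integral integrable_continuous)
    also have "\<dots> = integral (cbox a b) (v x) \<bullet> h"
      using integral_linear[OF integrable_continuous[OF cvx] bounded_linear_inner_left[of h]] by (simp add: o_def)
    finally show ?thesis .
  qed
  then show ?thesis by (intro has_derivative_eq_rhs[OF D]) auto
qed

lemma smooth_continuous: "smooth f \<Longrightarrow> continuous_on S f"
  unfolding smooth_def using diff_order_continuous continuous_on_subset by blast

lemma tensor_continuous: "(\<And>i. smooth (F i)) \<Longrightarrow> continuous_on S (tensor F)"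
  using tensor_times_differentiable[of F 0] continuous_on_subset[of UNIV "tensor F" S] by simp

section \<open>Mollification\<close>

definition convolve :: "('m::finite \<Rightarrow> real \<Rightarrow> real) \<Rightarrow> (real ^ 'm \<Rightarrow> real) \<Rightarrow> real ^ 'm \<Rightarrow> real ^ 'm \<Rightarrow> real ^ 'm \<Rightarrow> real"
  where "convolve F u a b x = integral (cbox a b) (\<lambda>y. tensor F (x - y) * u y)"

lemma convolve_has_derivative:
  fixes F F' :: "'m::finite \<Rightarrow> real \<Rightarrow> real" and x :: "real ^ 'm"
  assumes F': "\<And>i t. (F i has_real_derivative F' i t) (at t)" "\<And>i. smooth (F' i)" "\<And>i. smooth (F i)"
    and u: "continuous_on UNIV u"
  shows "((convolve F u a b) has_derivative
      (\<lambda>h. integral (cbox a b) (\<lambda>y. u y *\<^sub>R (\<chi> i. tensor (F(i := F' i)) (x - y))) \<bullet> h)) (at x)"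
  unfolding convolve_def[abs_def]
proof (rule has_derivative_integral_inner)
  fix x y :: "real ^ 'm"
  have s: "((\<lambda>x. x - y) has_derivative (\<lambda>h. h)) (at x)" by (auto intro!: derivative_eq_intros)
  have "((\<lambda>x. tensor F (x - y)) has_derivative (\<lambda>h. \<Sum>i\<in>UNIV. h $ i * tensor (F(i := F' i)) (x - y))) (at x)"
    by (rule has_derivative_compose[OF s]) (rule tensor_has_derivative[of F F', OF F'(1)])
  then have "((\<lambda>x. tensor F (x - y) * u y) has_derivative (\<lambda>h. (\<Sum>i\<in>UNIV. h $ i * tensor (F(i := F' i)) (x - y)) * u y)) (at x)"
    by (rule has_derivative_mult_left)
  then show "((\<lambda>x. tensor F (x - y) * u y) has_derivative (\<lambda>h. (u y *\<^sub>R (\<chi> i. tensor (F(i := F' i)) (x - y))) \<bullet> h)) (at x)"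
    by (rule has_derivative_eq_rhs) (auto simp: fun_eq_iff inner_vec_def sum_distrib_left sum_distrib_right mult_ac)
next
  have "continuous_on (UNIV \<times> cbox a b) (\<lambda>p. tensor (F(i := F' i)) (fst p - snd p))" for i
    by (rule continuous_on_compose2[OF tensor_continuous[of "F(i := F' i)" UNIV]])
      (use F' in \<open>auto intro!: continuous_intros\<close>)
  moreover have "continuous_on (UNIV \<times> cbox a b) (\<lambda>p. u (snd p))"
    by (rule continuous_on_compose2[OF u]) (auto intro!: continuous_intros)
  ultimately have "continuous_on (UNIV \<times> cbox a b) (\<lambda>p. u (snd p) *\<^sub>R (\<chi> i. tensor (F(i := F' i)) (fst p - snd p)))"
    by (intro continuous_on_scaleR continuous_on_vec_lambda)
  then show "continuous_on (UNIV \<times> cbox a b) (\<lambda>(x, y). u y *\<^sub>R (\<chi> i. tensor (F(i := F' i)) (x - y)))"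
    by (simp add: case_prod_beta)
next
  fix x
  have "continuous_on (cbox a b) (\<lambda>y. tensor F (x - y))"
    by (rule continuous_on_compose2[OF tensor_continuous[of F UNIV]]) (use F' in \<open>auto intro!: continuous_intros\<close>)
  then show "continuous_on (cbox a b) (\<lambda>y. tensor F (x - y) * u y)"
    by (intro continuous_on_mult continuous_on_subset[OF u]) auto
qed

lemma smooth_family_deriv:
  assumes "\<And>i. smooth (F i)"
  obtains F' where "\<And>i t. (F i has_real_derivative F' i t) (at t)" "\<And>i. smooth (F' i)"
proof -
  have "\<forall>i. \<exists>f'. (\<forall>t. (F i has_real_derivative f' t) (at t)) \<and> smooth f'"
    using smooth_deriv[OF assms] by blast
  then show ?thesis using that by metis
qed

text \<open>All derivatives fall on the kernel, which stays a tensor product with one factor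
  replaced; of \<open>u\<close> only continuity is used.\<close>

lemma convolve_times_differentiable:
  fixes F :: "'m::finite \<Rightarrow> real \<Rightarrow> real"
  assumes "\<And>i. smooth (F i)" and u: "continuous_on UNIV u"
  shows "times_differentiable k (convolve F u a b)"
  using assms(1)
proof (induction k arbitrary: F)
  case 0
  obtain F' where F': "\<And>i t. (F i has_real_derivative F' i t) (at t)" "\<And>i. smooth (F' i)"
    using smooth_family_deriv[of F] 0 by blast
  have "isCont (convolve F u a b) x" for x
    by (rule has_derivative_continuous[OF convolve_has_derivative[of F F', OF F' 0 u]])
  then show ?case by (simp add: continuous_at_imp_continuous_on)
next
  case (Suc k)
  obtain F' where F': "\<And>i t. (F i has_real_derivative F' i t) (at t)" "\<And>i. smooth (F' i)"
    using smooth_family_deriv[of F] Suc.prems by blast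
  note der = convolve_has_derivative[of F F', OF F' Suc.prems u]
  have "partial_deriv UNIV i (convolve F u a b) = convolve (F(i := F' i)) u a b" for i
  proof
    fix x
    have c: "continuous_on (cbox a b) (\<lambda>y. u y *\<^sub>R (\<chi> i. tensor (F(i := F' i)) (x - y)))"
    proof (intro continuous_on_scaleR continuous_on_vec_lambda)
      show "continuous_on (cbox a b) u" by (rule continuous_on_subset[OF u]) simp
      show "continuous_on (cbox a b) (\<lambda>y. tensor (F(i := F' i)) (x - y))" for i
        by (rule continuous_on_compose2[OF tensor_continuous[of "F(i := F' i)" UNIV]])
          (use F' Suc.prems in \<open>auto intro!: continuous_intros\<close>)
    qed
    have "partial_deriv UNIV i (convolve F u a b) x = integral (cbox a b) (\<lambda>y. u y *\<^sub>R (\<chi> i. tensor (F(i := F' i)) (x - y))) $ i"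
      unfolding partial_deriv_eqI[OF der] by (simp add: inner_axis)
    also have "\<dots> = integral (cbox a b) (\<lambda>y. (u y *\<^sub>R (\<chi> i. tensor (F(i := F' i)) (x - y))) $ i)"
      using integral_linear[OF integrable_continuous[OF c] bounded_linear_vec_nth[of i]] by (simp add: o_def)
    finally show "partial_deriv UNIV i (convolve F u a b) x = convolve (F(i := F' i)) u a b x"
      by (simp add: convolve_def mult.commute)
  qed
  moreover have "times_differentiable k (convolve (F(i := F' i)) u a b)" for i
    by (rule Suc.IH) (use F' Suc.prems in auto)
  moreover have "convolve F u a b differentiable_on UNIV"
    unfolding differentiable_on_def using der differentiableI by blast
  ultimately show ?case by simp
qed

lemma bump_cube_integral_pos:
  "0 < integral (cbox (\<chi> i. -1) (\<chi> i. 1)) (tensor (\<lambda>i::'m::finite. bump))"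
proof -
  let ?Q = "cbox (\<chi> i. -1) (\<chi> i. 1) :: (real ^ 'm) set"
  have c: "continuous_on ?Q (tensor (\<lambda>i::'m. bump))" by (intro tensor_continuous smooth_bump)
  have nn: "0 \<le> tensor (\<lambda>i::'m. bump) x" for x by (simp add: tensor_def prod_nonneg bump_nonneg)
  have i0: "0 \<le> integral ?Q (tensor (\<lambda>i::'m. bump))"
    by (rule integral_nonneg[OF integrable_continuous[OF c]]) (simp add: nn)
  have "integral ?Q (tensor (\<lambda>i::'m. bump)) \<noteq> 0"
  proof
    assume "integral ?Q (tensor (\<lambda>i::'m. bump)) = 0"
    then have "(tensor (\<lambda>i::'m. bump) has_integral 0) ?Q"
      using integrable_integral[OF integrable_continuous[OF c]] by simp
    then have "tensor (\<lambda>i::'m. bump) 0 = 0"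
      by (rule has_integral_0_cbox_imp_0[OF c nn]) (auto simp: mem_box_cart interval_ne_empty_cart)
    moreover have "0 < tensor (\<lambda>i::'m. bump) 0" by (simp add: tensor_def prod_pos bump_pos)
    ultimately show False by simp
  qed
  then show ?thesis using i0 by simp
qed

lemma gradient_zero_off_support:
  fixes u :: "'a::euclidean_space \<Rightarrow> real"
  assumes "(u has_derivative (\<lambda>h. gu \<bullet> h)) (at x)" "closed K" "x \<notin> K" "\<And>y. y \<notin> K \<Longrightarrow> u y = 0"
  shows "gu = 0"
proof -
  have "(u has_derivative (\<lambda>h. 0)) (at x)"
    by (rule has_derivative_transform_within_open[of "\<lambda>_. 0" _ _ _ "- K"]) (use assms in auto)
  then have "(\<lambda>h. gu \<bullet> h) = (\<lambda>h. 0)"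
    using assms(1) has_derivative_unique by blast
  then have "gu \<bullet> gu = 0" by (rule fun_cong)
  then show ?thesis by simp
qed

text \<open>The kernel form on the left shows smoothness. After the substitution the translation
  sits on \<open>u\<close>, so that the gradient is an average of gradients of \<open>u\<close>.
  \<open>weak_form_C1\<close> needs both.\<close>

lemma convolve_bump_eq:
  fixes u :: "real ^ 'm::finite \<Rightarrow> real"
  assumes d: "0 < d" and u: "continuous_on UNIV u" "\<And>y. y \<notin> cbox a b \<Longrightarrow> u y = 0"
  shows "convolve (\<lambda>i t. bump (1 / d * t + 0) * (1 / d)) u a b x =
    integral (cbox (\<chi> i. -1) (\<chi> i. 1)) (\<lambda>z. tensor (\<lambda>i. bump) z * u (x - d *\<^sub>R z))"
proof -
  let ?F = "\<lambda>i t. bump (1 / d * t + 0) * (1 / d)"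
  let ?Q = "cbox (\<chi> i. -1) (\<chi> i. 1) :: (real ^ 'm) set"
  have sF: "smooth (?F i)" for i :: 'm by (rule smooth_mult[OF smooth_affine[OF smooth_bump] smooth_const])
  have F: "tensor ?F y = (1 / d) ^ CARD('m) * tensor (\<lambda>i. bump) ((1 / d) *\<^sub>R y)" for y :: "real ^ 'm"
    by (simp add: tensor_def prod_dividef power_one_over)
  have c1: "continuous_on (cbox a b) (\<lambda>y. tensor ?F (x - y) * u y)"
  proof (intro continuous_on_mult)
    show "continuous_on (cbox a b) (\<lambda>y. tensor ?F (x - y))"
      by (rule continuous_on_compose2[OF tensor_continuous[OF sF, where S = UNIV]]) (auto intro!: continuous_intros)
    show "continuous_on (cbox a b) u" by (rule continuous_on_subset[OF u(1)]) simp
  qed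
  have cu: "continuous_on S (\<lambda>z. u (x + (- d) *\<^sub>R z))" for S
    by (rule continuous_on_compose2[OF u(1)]) (auto intro!: continuous_intros)
  have c2: "continuous_on ?Q (\<lambda>z. tensor ?F (x - (x + (- d) *\<^sub>R z)) * u (x + (- d) *\<^sub>R z))"
  proof (intro continuous_on_mult cu)
    show "continuous_on ?Q (\<lambda>z. tensor ?F (x - (x + (- d) *\<^sub>R z)))"
      by (rule continuous_on_compose2[OF tensor_continuous[OF sF, where S = UNIV]]) (auto intro!: continuous_intros)
  qed
  have c3: "continuous_on ?Q (\<lambda>z. tensor (\<lambda>i. bump) z * u (x - d *\<^sub>R z))"
    using cu[of ?Q] by (intro continuous_on_mult tensor_continuous smooth_bump) simp
  have "convolve ?F u a b x = (LINT y|lebesgue_on (cbox a b). tensor ?F (x - y) * u y)"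
    unfolding convolve_def by (rule lebesgue_integral_eq_integral[symmetric, OF integrable_on_compact[OF compact_cbox c1]]) simp
  also have "\<dots> = \<bar>- d\<bar> ^ DIM(real ^ 'm) * (LINT z|lebesgue_on ?Q. tensor ?F (x - (x + (- d) *\<^sub>R z)) * u (x + (- d) *\<^sub>R z))"
  proof (rule integral_affine_compact[OF _ compact_cbox compact_cbox c1 c2])
    fix z
    show "indicator (cbox a b) (x + (- d) *\<^sub>R z) * (tensor ?F (x - (x + (- d) *\<^sub>R z)) * u (x + (- d) *\<^sub>R z)) =
      indicator ?Q z * (tensor ?F (x - (x + (- d) *\<^sub>R z)) * u (x + (- d) *\<^sub>R z))"
    proof (cases "z \<in> ?Q")
      case False
      then obtain i where "z $ i < -1 \<or> 1 < z $ i" by (auto simp: mem_box_cart not_le)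
      then have "bump (z $ i) = 0" by (intro bump_off) auto
      then have "tensor (\<lambda>i. bump) z = 0" by (auto simp: tensor_def)
      then have "tensor ?F (x - (x + (- d) *\<^sub>R z)) = 0" unfolding F using d by simp
      then show ?thesis by simp
    qed (use u(2)[of "x + (- d) *\<^sub>R z"] in \<open>auto simp: indicator_def\<close>)
  qed (use d in auto)
  also have "\<dots> = (LINT z|lebesgue_on ?Q. tensor (\<lambda>i. bump) z * u (x - d *\<^sub>R z))"
  proof -
    have "\<bar>- d\<bar> ^ DIM(real ^ 'm) * (tensor ?F (x - (x + (- d) *\<^sub>R z)) * u (x + (- d) *\<^sub>R z)) = tensor (\<lambda>i. bump) z * u (x - d *\<^sub>R z)" for z
      unfolding F using d by (simp add: power_one_over field_simps)
    then show ?thesis unfolding integral_mult_right_zero[symmetric] by (simp only:)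
  qed
  also have "\<dots> = integral ?Q (\<lambda>z. tensor (\<lambda>i. bump) z * u (x - d *\<^sub>R z))"
    by (rule lebesgue_integral_eq_integral[OF integrable_on_compact[OF compact_cbox c3]]) simp
  finally show ?thesis .
qed

text \<open>Mollifying \<open>u\<close> gives an admissible test function whose gradient is the
  mollified \<open>gu\<close>, hence uniformly close to \<open>gu\<close>. As \<open>V\<close> is
  bounded on a compact neighbourhood of the support, the integral is arbitrarily small.\<close>

theorem weak_form_C1:
  fixes V :: "real ^ 'm::finite \<Rightarrow> real ^ 'm"
  assumes U: "open U" and cV: "continuous_on U V"
    and weak: "\<And>\<phi>. \<phi> \<in> test_functions U \<Longrightarrow> (LINT x|lebesgue_on U. (\<Sum>i\<in>UNIV. V x $ i * partial_deriv UNIV i \<phi> x)) = 0"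
    and u: "\<And>x. (u has_derivative (\<lambda>h. gu x \<bullet> h)) (at x)" and cgu: "continuous_on UNIV gu"
    and K: "compact K" "K \<subseteq> U" "\<And>x. x \<notin> K \<Longrightarrow> u x = 0"
  shows "(LINT x|lebesgue_on U. V x \<bullet> gu x) = 0"
proof -
  let ?Q = "cbox (\<chi> i. -1) (\<chi> i. 1) :: (real ^ 'm) set"
  let ?b = "tensor (\<lambda>i::'m. bump)"
  define c0 where "c0 = 1 / integral ?Q ?b"
  have c0: "0 < c0" "c0 * integral ?Q ?b = 1" using bump_cube_integral_pos[where 'm='m] by (auto simp: c0_def)
  have cb: "continuous_on ?Q ?b" by (intro tensor_continuous smooth_bump)
  have b0: "0 \<le> ?b z" for z by (simp add: tensor_def prod_nonneg bump_nonneg)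
  have cu: "continuous_on UNIV u" using has_derivative_continuous[OF u] by (simp add: continuous_at_imp_continuous_on)
  have guK: "gu x = 0" if "x \<notin> K" for x
    using gradient_zero_off_support[OF u compact_imp_closed[OF K(1)] that K(3)] .
  obtain e where e: "0 < e" "(\<Union>x\<in>K. ball x e) \<subseteq> U"
    using compact_subset_open_imp_ball_epsilon_subset[OF K(1) U K(2)] .
  obtain A where A: "K \<subseteq> cbox (- A) A" using bounded_subset_cbox_symmetric[OF compact_imp_bounded[OF K(1)]] by metis
  \<comment> \<open>\<open>K1\<close> contains the supports of the mollified functions and stays in
    \<open>U\<close>; \<open>K2\<close> contains all points at which values of \<open>gu\<close> are
    compared and provides the uniform continuity.\<close>
  define K1 where "K1 = {x + y | x y. x \<in> K \<and> y \<in> cball 0 (e / 2)}"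
  define K2 where "K2 = {x + y | x y. x \<in> K1 \<and> y \<in> cball 0 (e / 2)}"
  have K1: "compact K1" unfolding K1_def by (intro compact_sums K(1) compact_cball)
  have K2: "compact K2" unfolding K2_def by (intro compact_sums K1 compact_cball)
  have K1U: "K1 \<subseteq> U"
  proof
    fix z assume "z \<in> K1"
    then obtain x y where z: "z = x + y" "x \<in> K" "norm y \<le> e / 2" by (auto simp: K1_def)
    then have "z \<in> ball x e" using e(1) by (simp add: dist_norm)
    then show "z \<in> U" using e(2) z(2) by blast
  qed
  have KK1: "K \<subseteq> K1"
  proof
    fix x assume "x \<in> K"
    moreover have "x = x + 0" "0 \<in> cball (0 :: real ^ 'm) (e / 2)" using e(1) by simp_all
    ultimately show "x \<in> K1" unfolding K1_def by blast
  qed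
  obtain C where C: "\<And>x. x \<in> K1 \<Longrightarrow> norm (V x) \<le> C" "0 \<le> C"
  proof -
    have "bounded (V ` K1)"
      by (intro compact_imp_bounded compact_continuous_image K1 continuous_on_subset[OF cV K1U])
    then obtain C where "\<And>x. x \<in> K1 \<Longrightarrow> norm (V x) \<le> C" unfolding bounded_iff by blast
    then have "\<And>x. x \<in> K1 \<Longrightarrow> norm (V x) \<le> max C 0" by (auto simp: le_max_iff_disj)
    then show ?thesis using that[of "max C 0"] by auto
  qed
  have Usets: "U \<in> sets lebesgue" "K1 \<in> sets lebesgue" using U K1 by (auto simp: borel_compact)
  have cVK: "continuous_on K1 V" by (rule continuous_on_subset[OF cV K1U])
  have toK1: "(LINT x|lebesgue_on U. V x \<bullet> f x) = (LINT x|lebesgue_on K1. V x \<bullet> f x)" if "\<And>x. x \<notin> K1 \<Longrightarrow> f x = 0" for f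
    using integral_lebesgue_on_superset[OF K1U Usets(2,1), of "\<lambda>x. V x \<bullet> f x"] that by simp
  have small: "\<bar>LINT x|lebesgue_on K1. V x \<bullet> gu x\<bar> \<le> C * \<eta> * measure lebesgue K1" if \<eta>: "0 < \<eta>" for \<eta>
  proof -
    have "uniformly_continuous_on K2 gu"
      by (intro compact_uniformly_continuous K2 continuous_on_subset[OF cgu]) simp
    then obtain r where r: "0 < r" "\<And>x y. x \<in> K2 \<Longrightarrow> y \<in> K2 \<Longrightarrow> dist y x < r \<Longrightarrow> dist (gu y) (gu x) < \<eta>"
      unfolding uniformly_continuous_on_def using \<eta> by metis
    \<comment> \<open>A point of the cube has norm at most \<open>CARD('m)\<close> by the l1 bound,
      hence the divisor.\<close>
    define d where "d = min (e / 2) (r / 2) / CARD('m)"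
    have d: "0 < d" "d * CARD('m) \<le> e / 2" "d * CARD('m) < r" using e(1) r(1) by (auto simp: d_def)
    have zQ: "norm (d *\<^sub>R z) \<le> d * CARD('m)" if "z \<in> ?Q" for z
    proof -
      have "norm z \<le> (\<Sum>i\<in>UNIV. \<bar>z $ i\<bar>)" by (rule norm_le_l1_cart)
      also have "\<dots> \<le> (\<Sum>i\<in>(UNIV::'m set). 1)" using that by (intro sum_mono) (auto simp: mem_box_cart abs_le_iff minus_le_iff)
      finally show ?thesis using d(1) by simp
    qed
    define \<phi> where "\<phi> = convolve (\<lambda>i::'m. \<lambda>t. bump (1 / d * t + 0) * (1 / d)) (\<lambda>y. c0 * u y) (- A) A"
    define g\<phi> where "g\<phi> x = integral ?Q (\<lambda>z. (?b z * c0) *\<^sub>R gu (x - d *\<^sub>R z))" for x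
    have \<phi>: "\<phi> x = integral ?Q (\<lambda>z. ?b z * (c0 * u (x - d *\<^sub>R z)))" for x
      unfolding \<phi>_def
      by (rule convolve_bump_eq[OF d(1)]) (use cu A K(3) in \<open>auto intro!: continuous_intros\<close>)
    have shift: "((\<lambda>x. x - d *\<^sub>R z) has_derivative (\<lambda>h. h)) (at x)" for x z :: "real ^ 'm"
      by (auto intro!: derivative_eq_intros)
    have cgs: "continuous_on S (\<lambda>z. gu (x - d *\<^sub>R z))" for S x
      by (rule continuous_on_compose2[OF cgu]) (auto intro!: continuous_intros)
    have der: "(\<phi> has_derivative (\<lambda>h. g\<phi> x \<bullet> h)) (at x)" for x
      unfolding \<phi>[abs_def] g\<phi>_def
    proof (rule has_derivative_integral_inner)
      fix x z
      have "((\<lambda>x. u (x - d *\<^sub>R z)) has_derivative (\<lambda>h. gu (x - d *\<^sub>R z) \<bullet> h)) (at x)"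
        by (rule has_derivative_compose[OF shift u])
      then have "((\<lambda>x. (?b z * c0) * u (x - d *\<^sub>R z)) has_derivative (\<lambda>h. (?b z * c0) * (gu (x - d *\<^sub>R z) \<bullet> h))) (at x)"
        by (rule has_derivative_mult_right)
      then show "((\<lambda>x. ?b z * (c0 * u (x - d *\<^sub>R z))) has_derivative (\<lambda>h. ((?b z * c0) *\<^sub>R gu (x - d *\<^sub>R z)) \<bullet> h)) (at x)"
        by (simp add: mult.assoc)
    next
      have "continuous_on (UNIV \<times> ?Q) (\<lambda>p. gu (fst p - d *\<^sub>R snd p))"
        by (rule continuous_on_compose2[OF cgu]) (auto intro!: continuous_intros)
      moreover have "continuous_on (UNIV \<times> ?Q) (\<lambda>p. ?b (snd p))"
        by (rule continuous_on_compose2[OF tensor_continuous[OF smooth_bump, where S = UNIV]]) (auto intro!: continuous_intros)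
      ultimately have "continuous_on (UNIV \<times> ?Q) (\<lambda>p. (?b (snd p) * c0) *\<^sub>R gu (fst p - d *\<^sub>R snd p))"
        by (intro continuous_on_scaleR continuous_on_mult continuous_on_const)
      then show "continuous_on (UNIV \<times> ?Q) (\<lambda>(x, z). (?b z * c0) *\<^sub>R gu (x - d *\<^sub>R z))"
        by (simp add: case_prod_beta)
    next
      fix x
      have "continuous_on ?Q (\<lambda>z. u (x - d *\<^sub>R z))"
        by (rule continuous_on_compose2[OF cu]) (auto intro!: continuous_intros)
      then show "continuous_on ?Q (\<lambda>z. ?b z * (c0 * u (x - d *\<^sub>R z)))"
        by (intro continuous_on_mult cb continuous_on_const)
    qed
    have notK: "x - d *\<^sub>R z \<notin> K" if "x \<notin> K1" "z \<in> ?Q" for x z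
    proof
      assume "x - d *\<^sub>R z \<in> K"
      moreover have "x = (x - d *\<^sub>R z) + d *\<^sub>R z" by simp
      moreover have "d *\<^sub>R z \<in> cball 0 (e / 2)" using zQ[OF that(2)] d(2) by simp
      ultimately have "x \<in> K1" unfolding K1_def by blast
      then show False using that(1) by simp
    qed
    have off: "\<phi> x = 0" "g\<phi> x = 0" if "x \<notin> K1" for x
    proof -
      have "integral ?Q (\<lambda>z. ?b z * (c0 * u (x - d *\<^sub>R z))) = integral ?Q (\<lambda>z. 0)"
        by (rule Henstock_Kurzweil_Integration.integral_cong) (simp add: K(3) notK[OF that])
      then show "\<phi> x = 0" by (simp add: \<phi>)
      have "integral ?Q (\<lambda>z. (?b z * c0) *\<^sub>R gu (x - d *\<^sub>R z)) = integral ?Q (\<lambda>z. 0)"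
        by (rule Henstock_Kurzweil_Integration.integral_cong) (simp add: guK notK[OF that])
      then show "g\<phi> x = 0" by (simp add: g\<phi>_def)
    qed
    have "\<phi> \<in> test_functions U"
    proof (rule test_functionsI[OF _ K1 K1U off(1)])
      have "smooth (\<lambda>t. bump (1 / d * t + 0) * (1 / d))" by (rule smooth_mult[OF smooth_affine[OF smooth_bump] smooth_const])
      then show "times_differentiable k \<phi>" for k
        unfolding \<phi>_def by (intro convolve_times_differentiable continuous_on_mult continuous_on_const cu)
    qed
    moreover have "(\<Sum>i\<in>UNIV. V x $ i * partial_deriv UNIV i \<phi> x) = V x \<bullet> g\<phi> x" for x
      unfolding partial_deriv_eqI[OF der] inner_axis by (simp add: inner_vec_def)
    ultimately have "(LINT x|lebesgue_on U. V x \<bullet> g\<phi> x) = 0"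
      using weak[of \<phi>] by simp
    then have zero: "(LINT x|lebesgue_on K1. V x \<bullet> g\<phi> x) = 0" using toK1[of g\<phi>] off(2) by simp
    have cg\<phi>: "continuous_on K1 g\<phi>"
    proof -
      have "continuous_on (UNIV \<times> ?Q) (\<lambda>p. gu (fst p - d *\<^sub>R snd p))"
        by (rule continuous_on_compose2[OF cgu]) (auto intro!: continuous_intros)
      moreover have "continuous_on (UNIV \<times> ?Q) (\<lambda>p. ?b (snd p))"
        by (rule continuous_on_compose2[OF tensor_continuous[OF smooth_bump, where S = UNIV]]) (auto intro!: continuous_intros)
      ultimately have "continuous_on (UNIV \<times> ?Q) (\<lambda>p. (?b (snd p) * c0) *\<^sub>R gu (fst p - d *\<^sub>R snd p))"
        by (intro continuous_on_scaleR continuous_on_mult continuous_on_const)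
      then have "continuous_on UNIV (\<lambda>x. integral ?Q (\<lambda>z. (?b z * c0) *\<^sub>R gu (x - d *\<^sub>R z)))"
        by (intro integral_continuous_on_param) (simp add: case_prod_beta)
      then show ?thesis unfolding g\<phi>_def[abs_def] using continuous_on_subset by blast
    qed
    have close: "norm (gu x - g\<phi> x) \<le> \<eta>" if x: "x \<in> K1" for x
    proof -
      have i1: "(\<lambda>z. (?b z * c0) *\<^sub>R gu x) integrable_on ?Q" "(\<lambda>z. (?b z * c0) *\<^sub>R gu (x - d *\<^sub>R z)) integrable_on ?Q"
        by (intro integrable_continuous continuous_on_scaleR continuous_on_mult continuous_on_const cb cgs)+
      have ib: "(\<lambda>z. ?b z * c0 * \<eta>) integrable_on ?Q"
        by (intro integrable_continuous continuous_on_mult continuous_on_const cb)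
      have "integral ?Q (\<lambda>z. (?b z * c0) *\<^sub>R gu x) = (integral ?Q (\<lambda>z. ?b z * c0)) *\<^sub>R gu x"
        using integral_linear[OF _ bounded_linear_scaleR_left[of "gu x"], of "\<lambda>z. ?b z * c0" ?Q]
        by (simp add: o_def integrable_continuous[OF continuous_on_mult[OF cb continuous_on_const]])
      also have "integral ?Q (\<lambda>z. ?b z * c0) = 1" using c0(2) by (simp add: mult.commute)
      finally have one: "integral ?Q (\<lambda>z. (?b z * c0) *\<^sub>R gu x) = gu x" by simp
      have "gu x - g\<phi> x = integral ?Q (\<lambda>z. (?b z * c0) *\<^sub>R gu x - (?b z * c0) *\<^sub>R gu (x - d *\<^sub>R z))"
        unfolding g\<phi>_def Henstock_Kurzweil_Integration.integral_diff[OF i1] one ..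
      also have "norm \<dots> \<le> integral ?Q (\<lambda>z. ?b z * c0 * \<eta>)"
      proof (rule integral_norm_bound_integral[OF integrable_diff[OF i1] ib])
        fix z assume z: "z \<in> ?Q"
        have x2: "x \<in> K2" "x - d *\<^sub>R z \<in> K2"
        proof -
          have "x = x + 0" "x - d *\<^sub>R z = x + (- (d *\<^sub>R z))" by simp_all
          moreover have "- (d *\<^sub>R z) \<in> cball 0 (e / 2)" "0 \<in> cball (0 :: real ^ 'm) (e / 2)"
            using zQ[OF z] d(2) e(1) by simp_all
          ultimately show "x \<in> K2" "x - d *\<^sub>R z \<in> K2" using x unfolding K2_def by blast+
        qed
        have "dist (x - d *\<^sub>R z) x < r" using zQ[OF z] d(3) by (simp add: dist_norm)
        then have "norm (gu x - gu (x - d *\<^sub>R z)) \<le> \<eta>"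
          using r(2)[OF x2] by (simp add: dist_norm norm_minus_commute)
        then have "norm ((?b z * c0) *\<^sub>R (gu x - gu (x - d *\<^sub>R z))) \<le> (?b z * c0) * \<eta>"
          unfolding norm_scaleR using b0[of z] c0(1) by (simp add: mult_left_mono)
        then show "norm ((?b z * c0) *\<^sub>R gu x - (?b z * c0) *\<^sub>R gu (x - d *\<^sub>R z)) \<le> ?b z * c0 * \<eta>"
          by (simp only: scaleR_right_diff_distrib)
      qed
      also have "\<dots> = \<eta>" using c0(2) by (simp add: mult_ac)
      finally show ?thesis .
    qed
    have i: "integrable (lebesgue_on K1) (\<lambda>x. V x \<bullet> gu x)" "integrable (lebesgue_on K1) (\<lambda>x. V x \<bullet> g\<phi> x)"
      by (intro integrable_on_compact[OF K1] continuous_on_inner cVK cg\<phi> continuous_on_subset[OF cgu]; simp)+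
    have "(LINT x|lebesgue_on K1. V x \<bullet> gu x) = (LINT x|lebesgue_on K1. V x \<bullet> (gu x - g\<phi> x))"
      using i zero by (simp add: inner_diff_right)
    also have "\<bar>\<dots>\<bar> \<le> (LINT x|lebesgue_on K1. C * \<eta>)"
    proof (rule order.trans[OF integral_abs_bound integral_mono])
      show "\<bar>V x \<bullet> (gu x - g\<phi> x)\<bar> \<le> C * \<eta>" if "x \<in> space (lebesgue_on K1)" for x
      proof -
        have "\<bar>V x \<bullet> (gu x - g\<phi> x)\<bar> \<le> norm (V x) * norm (gu x - g\<phi> x)" by (rule Cauchy_Schwarz_ineq2)
        also have "\<dots> \<le> C * \<eta>" using C close that by (intro mult_mono) auto
        finally show ?thesis .
      qed
      show "integrable (lebesgue_on K1) (\<lambda>x. C * \<eta>)" by (intro integrable_on_compact[OF K1] continuous_on_const)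
      show "integrable (lebesgue_on K1) (\<lambda>x. \<bar>V x \<bullet> (gu x - g\<phi> x)\<bar>)"
        using i by (auto simp: inner_diff_right)
    qed
    also have "(LINT x|lebesgue_on K1. C * \<eta>) = C * \<eta> * measure lebesgue K1"
      using K1 by (simp add: measure_restrict_space borel_compact)
    finally show ?thesis .
  qed
  have "\<bar>LINT x|lebesgue_on K1. V x \<bullet> gu x\<bar> \<le> 0"
  proof (rule field_le_epsilon)
    fix \<epsilon> :: real assume \<epsilon>: "0 < \<epsilon>"
    define \<eta> where "\<eta> = \<epsilon> / (C * measure lebesgue K1 + 1)"
    have m: "0 \<le> C * measure lebesgue K1" using C(2) by simp
    then have "0 < \<eta>" using \<epsilon> by (simp add: \<eta>_def add_nonneg_pos)
    from small[OF this] have "\<bar>LINT x|lebesgue_on K1. V x \<bullet> gu x\<bar> \<le> (C * measure lebesgue K1) * \<eta>" by (simp add: mult_ac)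
    also have "\<dots> \<le> (C * measure lebesgue K1 + 1) * \<eta>" using \<open>0 < \<eta>\<close> by (intro mult_right_mono) auto
    also have "\<dots> = \<epsilon>" using m by (simp add: \<eta>_def)
    finally show "\<bar>LINT x|lebesgue_on K1. V x \<bullet> gu x\<bar> \<le> 0 + \<epsilon>" by simp
  qed
  moreover have "(LINT x|lebesgue_on U. V x \<bullet> gu x) = (LINT x|lebesgue_on K1. V x \<bullet> gu x)"
    using guK KK1 by (intro toK1) auto
  ultimately show ?thesis by simp
qed

section \<open>Hoelder continuity of Sobolev functions\<close>

definition bump' :: "real \<Rightarrow> real" where "bump' = (SOME f. (\<forall>t. (bump has_real_derivative f t) (at t)) \<and> smooth f)"

lemma bump'_deriv: "(bump has_real_derivative bump' t) (at t)" and smooth_bump': "smooth bump'"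
proof -
  have "\<exists>f. (\<forall>t. (bump has_real_derivative f t) (at t)) \<and> smooth f" using smooth_deriv[OF smooth_bump] by blast
  from someI_ex[OF this] show "(bump has_real_derivative bump' t) (at t)" "smooth bump'" by (simp_all add: bump'_def)
qed

lemma bump'_off: assumes "1 < \<bar>t\<bar>" shows "bump' t = 0"
proof -
  have "(bump has_real_derivative 0) (at t)"
  proof (rule has_field_derivative_transform_within_open[of "\<lambda>_. 0" _ _ "{t. 1 < \<bar>t\<bar>}"])
    show "open {t::real. 1 < \<bar>t\<bar>}" by (intro open_Collect_less continuous_intros)
  qed (use assms bump_off in auto)
  then show ?thesis using bump'_deriv DERIV_unique by blast
qed

definition cube_mass :: "'m::finite itself \<Rightarrow> real"
  where "cube_mass _ = integral (cbox (\<chi> i. -1) (\<chi> i. 1)) (tensor (\<lambda>i::'m. bump))"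

lemma cube_mass_pos: "0 < cube_mass TYPE('m::finite)"
  unfolding cube_mass_def by (rule bump_cube_integral_pos)

definition kernel :: "real ^ 'm::finite \<Rightarrow> real \<Rightarrow> real ^ 'm \<Rightarrow> real"
  where "kernel c \<rho> z = tensor (\<lambda>i \<tau>. bump (1 / \<rho> * \<tau> + (- c $ i / \<rho>))) z / (cube_mass TYPE('m) * \<rho> ^ CARD('m))"

lemma kernel_cont: "continuous_on S (kernel c \<rho>)"
  unfolding kernel_def[abs_def] divide_inverse
  by (intro continuous_on_mult continuous_on_const tensor_continuous smooth_affine[OF smooth_bump])

lemma kernel_nonneg: "0 < \<rho> \<Longrightarrow> 0 \<le> kernel c \<rho> z"
  using cube_mass_pos[where 'm='a] by (simp add: kernel_def tensor_def prod_nonneg bump_nonneg)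

lemma kernel_le: "0 < \<rho> \<Longrightarrow> kernel c \<rho> (z :: real ^ 'm::finite) \<le> 1 / (cube_mass TYPE('m) * \<rho> ^ CARD('m))"
  unfolding kernel_def using cube_mass_pos[where 'm='m]
  by (intro divide_right_mono) (auto simp: tensor_def bump_nonneg bump_le intro!: prod_le_1)

lemma kernel_off: "0 < \<rho> \<Longrightarrow> \<rho> \<le> \<bar>z $ i - c $ i\<bar> \<Longrightarrow> kernel c \<rho> z = 0"
proof -
  assume r: "0 < \<rho>" "\<rho> \<le> \<bar>z $ i - c $ i\<bar>"
  have "1 / \<rho> * z $ i + (- c $ i / \<rho>) = (z $ i - c $ i) / \<rho>" by (simp add: diff_divide_distrib)
  then have "bump (1 / \<rho> * z $ i + (- c $ i / \<rho>)) = 0" using r by (intro bump_off) (simp add: abs_divide)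
  then show ?thesis unfolding kernel_def tensor_def by (subst prod_zero) auto
qed

lemma kernel_integral:
  fixes c :: "real ^ 'm::finite"
  assumes "0 < \<rho>" "compact K" "\<And>z. (\<And>i. \<bar>z $ i - c $ i\<bar> < \<rho>) \<Longrightarrow> z \<in> K"
  shows "(LINT z|lebesgue_on K. kernel c \<rho> z) = 1"
proof -
  let ?Q = "cbox (\<chi> i. -1) (\<chi> i. 1) :: (real ^ 'm) set"
  let ?k = "1 / (cube_mass TYPE('m) * \<rho> ^ CARD('m))"
  have e: "kernel c \<rho> (c + \<rho> *\<^sub>R x) = ?k * tensor (\<lambda>i. bump) x" for x
    using assms(1) by (simp add: kernel_def tensor_def add_divide_distrib)
  have cb: "continuous_on ?Q (tensor (\<lambda>i::'m. bump))" by (intro tensor_continuous smooth_bump)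
  have "(LINT z|lebesgue_on K. kernel c \<rho> z) = \<bar>\<rho>\<bar> ^ DIM(real ^ 'm) * (LINT x|lebesgue_on ?Q. kernel c \<rho> (c + \<rho> *\<^sub>R x))"
  proof (rule integral_affine_compact[OF _ assms(2) compact_cbox kernel_cont])
    show "continuous_on ?Q (\<lambda>x. kernel c \<rho> (c + \<rho> *\<^sub>R x))"
      by (rule continuous_on_compose2[OF kernel_cont[of UNIV]]) (auto intro!: continuous_intros)
    fix x
    show "indicator K (c + \<rho> *\<^sub>R x) * kernel c \<rho> (c + \<rho> *\<^sub>R x) = indicator ?Q x * kernel c \<rho> (c + \<rho> *\<^sub>R x)"
    proof (cases "\<forall>i. \<bar>x $ i\<bar> < 1")
      case True
      then have "c + \<rho> *\<^sub>R x \<in> K" using assms(1) by (intro assms(3)) (simp add: abs_mult)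
      moreover have "x \<in> ?Q" using True by (auto simp: mem_box_cart abs_less_iff less_imp_le minus_less_iff)
      ultimately show ?thesis by simp
    next
      case False
      then obtain i where "1 \<le> \<bar>x $ i\<bar>" by (auto simp: not_less)
      then have "kernel c \<rho> (c + \<rho> *\<^sub>R x) = 0" using assms(1) by (intro kernel_off[of _ _ i]) (auto simp: abs_mult)
      then show ?thesis by simp
    qed
  qed (use assms in simp)
  also have "(LINT x|lebesgue_on ?Q. kernel c \<rho> (c + \<rho> *\<^sub>R x)) = ?k * cube_mass TYPE('m)"
    unfolding e cube_mass_def using lebesgue_integral_eq_integral[OF integrable_on_compact[OF compact_cbox cb]] by simp
  finally show ?thesis using assms(1) cube_mass_pos[where 'm='m] by simp
qed

text \<open>The one-variable factors of the kernel times \<open>(z $ i - x $ i) / t\<close>. Placing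
  the linear factor and the normalisation in coordinate \<open>i\<close> keeps the flux a tensor
  product, hence a test function.\<close>

definition flux_factor :: "real ^ 'm::finite \<Rightarrow> real \<Rightarrow> real ^ 'm \<Rightarrow> real \<Rightarrow> 'm \<Rightarrow> 'm \<Rightarrow> real \<Rightarrow> real"
  where "flux_factor c \<rho> x t i j \<tau> = bump (1 / \<rho> * \<tau> + (- c $ j / \<rho>)) *
    (if j = i then (1 * \<tau> + (- x $ i)) * (1 / (t * (cube_mass TYPE('m) * \<rho> ^ CARD('m)))) else 1)"

definition flux :: "real ^ 'm::finite \<Rightarrow> real \<Rightarrow> real ^ 'm \<Rightarrow> real \<Rightarrow> 'm \<Rightarrow> real ^ 'm \<Rightarrow> real"
  where "flux c \<rho> x t i = tensor (flux_factor c \<rho> x t i)"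

lemma flux_eq: "flux c \<rho> x t i z = kernel c \<rho> z * ((z $ i - x $ i) / t)"
proof -
  have "flux c \<rho> x t i z = (\<Prod>j\<in>UNIV. bump (1 / \<rho> * z $ j + (- c $ j / \<rho>))) *
    (\<Prod>j\<in>UNIV. if j = i then (1 * z $ i + (- x $ i)) * (1 / (t * (cube_mass TYPE('a) * \<rho> ^ CARD('a)))) else 1)"
    unfolding flux_def tensor_def flux_factor_def by (simp add: prod.distrib cong: if_cong)
  also have "\<dots> = kernel c \<rho> z * ((z $ i - x $ i) / t)"
    by (simp add: kernel_def tensor_def)
  finally show ?thesis .
qed

lemma flux_factor_smooth: "smooth (flux_factor c \<rho> x t i j)"
proof (cases "j = i")
  case True
  have "smooth (\<lambda>\<tau>. bump (1 / \<rho> * \<tau> + (- c $ j / \<rho>)) * ((1 * \<tau> + (- x $ i)) * (1 / (t * (cube_mass TYPE('a) * \<rho> ^ CARD('a))))))"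
    by (rule smooth_mult[OF smooth_affine[OF smooth_bump] smooth_mult[OF smooth_affine[OF smooth_id] smooth_const]])
  then show ?thesis using True by (simp add: flux_factor_def[abs_def])
next
  case False
  then show ?thesis using smooth_affine[OF smooth_bump, of "1 / \<rho>" "- c $ j / \<rho>"] by (simp add: flux_factor_def[abs_def])
qed

lemma flux_test:
  assumes "0 < \<rho>" "\<And>z. (\<And>i. \<bar>z $ i - c $ i\<bar> \<le> \<rho>) \<Longrightarrow> z \<in> U"
  shows "flux c \<rho> x t i \<in> test_functions U"
proof (rule test_functionsI)
  show "times_differentiable k (flux c \<rho> x t i)" for k
    unfolding flux_def by (intro tensor_times_differentiable flux_factor_smooth)
  show "compact (cbox (c - (\<chi> i. \<rho>)) (c + (\<chi> i. \<rho>)))" by (rule compact_cbox)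
  show "cbox (c - (\<chi> i. \<rho>)) (c + (\<chi> i. \<rho>)) \<subseteq> U"
  proof
    fix z assume z: "z \<in> cbox (c - (\<chi> i. \<rho>)) (c + (\<chi> i. \<rho>))"
    show "z \<in> U"
    proof (rule assms(2))
      fix i
      have "c $ i - \<rho> \<le> z $ i \<and> z $ i \<le> c $ i + \<rho>" using z by (simp add: mem_box_cart)
      then show "\<bar>z $ i - c $ i\<bar> \<le> \<rho>" by linarith
    qed
  qed
  fix z assume "z \<notin> cbox (c - (\<chi> i. \<rho>)) (c + (\<chi> i. \<rho>))"
  then obtain j where "\<not> (c $ j - \<rho> \<le> z $ j \<and> z $ j \<le> c $ j + \<rho>)" by (auto simp: mem_box_cart)
  then have "\<rho> \<le> \<bar>z $ j - c $ j\<bar>" by linarith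
  from kernel_off[OF assms(1) this] show "flux c \<rho> x t i z = 0" unfolding flux_eq by simp
qed

lemma flux_partial_deriv:
  fixes c x z :: "real ^ 'm::finite"
  assumes "\<rho> \<noteq> 0" "t \<noteq> 0"
  shows "partial_deriv UNIV i (flux c \<rho> x t i) z =
    (bump' (1 / \<rho> * z $ i + (- c $ i / \<rho>)) * ((z $ i - x $ i) / \<rho>) + bump (1 / \<rho> * z $ i + (- c $ i / \<rho>))) *
    (\<Prod>j\<in>UNIV - {i}. bump (1 / \<rho> * z $ j + (- c $ j / \<rho>))) * (1 / (t * (cube_mass TYPE('m) * \<rho> ^ CARD('m))))"
proof -
  let ?F = "flux_factor c \<rho> x t i"
  define k where "k = 1 / (t * (cube_mass TYPE('m) * \<rho> ^ CARD('m)))"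
  define v where "v j = 1 / \<rho> * z $ j + (- c $ j / \<rho>)" for j
  obtain F' where F': "\<And>j \<tau>. (?F j has_real_derivative F' j \<tau>) (at \<tau>)"
    using smooth_family_deriv[of ?F] flux_factor_smooth by metis
  have "partial_deriv UNIV i (flux c \<rho> x t i) z = tensor (?F(i := F' i)) z"
    unfolding flux_def tensor_partial_deriv[of ?F F', OF F'] ..
  also have "\<dots> = F' i (z $ i) * (\<Prod>j\<in>UNIV - {i}. ?F j (z $ j))"
    unfolding tensor_def by (subst prod.remove[of _ i]) (auto intro!: prod.cong)
  also have "(\<Prod>j\<in>UNIV - {i}. ?F j (z $ j)) = (\<Prod>j\<in>UNIV - {i}. bump (v j))"
    unfolding flux_factor_def v_def by (rule prod.cong) auto
  also have "F' i (z $ i) = (bump' (v i) * ((z $ i - x $ i) / \<rho>) + bump (v i)) * k"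
  proof (rule DERIV_unique[OF F'])
    have "((\<lambda>\<tau>. bump (1 / \<rho> * \<tau> + (- c $ i / \<rho>))) has_real_derivative bump' (v i) * (1 / \<rho>)) (at (z $ i))"
    proof -
      have "((\<lambda>\<tau>. 1 / \<rho> * \<tau> + (- c $ i / \<rho>)) has_real_derivative 1 / \<rho>) (at (z $ i))"
        using assms by (auto intro!: derivative_eq_intros)
      from DERIV_chain2[OF bump'_deriv this] show ?thesis unfolding v_def .
    qed
    moreover have "((\<lambda>\<tau>. (1 * \<tau> + (- x $ i)) * k) has_real_derivative k) (at (z $ i))"
      by (auto intro!: derivative_eq_intros)
    ultimately have D: "((\<lambda>\<tau>. bump (1 / \<rho> * \<tau> + (- c $ i / \<rho>)) * ((1 * \<tau> + (- x $ i)) * k)) has_real_derivative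
        bump' (v i) * (1 / \<rho>) * ((1 * z $ i + (- x $ i)) * k) + k * bump (1 / \<rho> * z $ i + (- c $ i / \<rho>))) (at (z $ i))"
      by (rule DERIV_mult)
    have Fi: "?F i = (\<lambda>\<tau>. bump (1 / \<rho> * \<tau> + (- c $ i / \<rho>)) * ((1 * \<tau> + (- x $ i)) * k))"
      unfolding flux_factor_def k_def by simp
    have yy: "1 * z $ i + - x $ i = z $ i - x $ i" by simp
    have gen: "b1 * (1 / r) * (y * k) + k * b2 = (b1 * (y / r) + b2) * k" for b1 b2 r y k :: real
      by (simp add: distrib_right)
    show "(?F i has_real_derivative (bump' (v i) * ((z $ i - x $ i) / \<rho>) + bump (v i)) * k) (at (z $ i))"
      unfolding Fi by (rule DERIV_cong[OF D]) (simp only: v_def[symmetric] yy gen)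
  qed
  finally show ?thesis by (simp only: mult_ac k_def v_def)
qed

lemma bump'_bounded: "\<exists>B\<ge>0. \<forall>\<tau>. \<bar>bump' \<tau>\<bar> \<le> B"
proof -
  have "continuous_on {-1..1} bump'" using smooth_bump' by (rule smooth_continuous)
  from compact_imp_bounded[OF compact_continuous_image[OF this compact_Icc]]
  obtain B where B: "\<And>\<tau>. \<tau> \<in> {-1..1} \<Longrightarrow> \<bar>bump' \<tau>\<bar> \<le> B"
    unfolding bounded_iff by (metis imageI real_norm_def)
  have "0 \<le> B" using B[of 0] by simp
  moreover have "\<bar>bump' \<tau>\<bar> \<le> B" for \<tau>
  proof (cases "1 < \<bar>\<tau>\<bar>")
    case False
    then show ?thesis by (intro B) auto
  qed (use bump'_off[of \<tau>] \<open>0 \<le> B\<close> in simp)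
  ultimately show ?thesis by blast
qed

lemma flux_partial_deriv_le:
  fixes c x z :: "real ^ 'm::finite"
  assumes "0 < \<rho>" "0 < t" "\<And>\<tau>. \<bar>bump' \<tau>\<bar> \<le> B"
  shows "\<bar>partial_deriv UNIV i (flux c \<rho> x t i) z\<bar> \<le>
    (B * (\<bar>z $ i - x $ i\<bar> / \<rho>) + 1) * (1 / (t * (cube_mass TYPE('m) * \<rho> ^ CARD('m))))"
proof -
  define v where "v j = 1 / \<rho> * z $ j + (- c $ j / \<rho>)" for j
  have B: "0 \<le> B" using order.trans[OF abs_ge_zero assms(3)] by blast
  have "\<bar>bump' (v i) * ((z $ i - x $ i) / \<rho>) + bump (v i)\<bar> \<le> \<bar>bump' (v i) * ((z $ i - x $ i) / \<rho>)\<bar> + \<bar>bump (v i)\<bar>"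
    by (rule abs_triangle_ineq)
  also have "\<bar>bump' (v i) * ((z $ i - x $ i) / \<rho>)\<bar> \<le> B * (\<bar>z $ i - x $ i\<bar> / \<rho>)"
    unfolding abs_mult using assms B by (intro mult_mono) auto
  also have "\<bar>bump (v i)\<bar> \<le> 1" using bump_nonneg bump_le by (simp add: abs_le_iff)
  finally have 1: "\<bar>bump' (v i) * ((z $ i - x $ i) / \<rho>) + bump (v i)\<bar> \<le> B * (\<bar>z $ i - x $ i\<bar> / \<rho>) + 1" by simp
  have 2: "\<bar>\<Prod>j\<in>UNIV - {i}. bump (v j)\<bar> \<le> 1"
    unfolding abs_prod by (rule prod_le_1) (simp add: bump_nonneg bump_le)
  have k: "0 \<le> 1 / (t * (cube_mass TYPE('m) * \<rho> ^ CARD('m)))" using assms cube_mass_pos[where 'm='m] by simp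
  have "\<bar>(bump' (v i) * ((z $ i - x $ i) / \<rho>) + bump (v i)) * (\<Prod>j\<in>UNIV - {i}. bump (v j))\<bar> \<le> (B * (\<bar>z $ i - x $ i\<bar> / \<rho>) + 1) * 1"
    unfolding abs_mult using assms B by (intro mult_mono 1 2) auto
  from mult_right_mono[OF this k] show ?thesis
    using k assms flux_partial_deriv[of \<rho> t i c x z] by (simp only: abs_mult abs_of_nonneg v_def[symmetric] mult_1_right)
qed

text \<open>Moving the bump along the segment from \<open>x\<close> to \<open>\<xi>\<close> with radius \<open>t * s\<close> is transport along the
  field \<open>(z - x) / t\<close>, so the kernel solves the corresponding continuity equation.\<close>

lemma continuity_equation:
  fixes x \<xi> z :: "real ^ 'm::finite"
  assumes s: "0 < s" and t: "0 < t"
  shows "((\<lambda>t. kernel (x + t *\<^sub>R (\<xi> - x)) (t * s) z) has_real_derivative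
    - (\<Sum>i\<in>UNIV. partial_deriv UNIV i (flux (x + t *\<^sub>R (\<xi> - x)) (t * s) x t i) z)) (at t)"
proof -
  define A where "A i t = (z $ i - x $ i) / (t * s) - (\<xi> $ i - x $ i) / s" for i t
  define m where "m = cube_mass TYPE('m)"
  define d where "d = CARD('m)"
  have m: "m \<noteq> 0" using cube_mass_pos[where 'm='m] by (simp add: m_def)
  have arg: "1 / (t * s) * \<tau> + (- (x + t *\<^sub>R (\<xi> - x)) $ i / (t * s)) = (\<tau> - x $ i) / (t * s) - (\<xi> $ i - x $ i) / s"
    if "0 < t" for t \<tau> i using that s by (simp add: field_simps)
  have k: "kernel (x + t *\<^sub>R (\<xi> - x)) (t * s) z = (\<Prod>i\<in>UNIV. bump (A i t)) * (1 / (m * (t * s) ^ d))" if "0 < t" for t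
    unfolding kernel_def tensor_def arg[OF that] A_def m_def d_def by simp
  have dA: "(A i has_real_derivative - (z $ i - x $ i) / (t\<^sup>2 * s)) (at t)" for i
    unfolding A_def[abs_def] using s t by (auto intro!: derivative_eq_intros simp: power2_eq_square field_simps)
  define P where "P i = (\<Prod>j\<in>UNIV - {i}. bump (A j t))" for i
  have dP: "((\<lambda>t. \<Prod>i\<in>UNIV. bump (A i t)) has_real_derivative (\<Sum>i\<in>UNIV. bump' (A i t) * (- (z $ i - x $ i) / (t\<^sup>2 * s)) * P i)) (at t)"
  proof -
    have "((\<lambda>t. bump (A i t)) has_derivative (*) (bump' (A i t) * (- (z $ i - x $ i) / (t\<^sup>2 * s)))) (at t)" for i
      using DERIV_chain2[OF bump'_deriv dA] unfolding has_field_derivative_def .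
    then have "((\<lambda>t. \<Prod>i\<in>UNIV. bump (A i t)) has_derivative
       (\<lambda>y. \<Sum>i\<in>UNIV. bump' (A i t) * (- (z $ i - x $ i) / (t\<^sup>2 * s)) * y * P i)) (at t)"
      unfolding P_def by (rule has_derivative_prod)
    then show ?thesis
      unfolding has_field_derivative_def
      by (rule has_derivative_eq_rhs) (auto simp: fun_eq_iff sum_distrib_left sum_distrib_right mult_ac)
  qed
  \<comment> \<open>The factor \<open>- d / t\<close> comes from the normalisation; it is the
    contribution of minus the divergence of the field \<open>(z - x) / t\<close> in the continuity
    equation.\<close>
  have dM: "((\<lambda>t. 1 / (m * (t * s) ^ d)) has_real_derivative - real d / t * (1 / (m * (t * s) ^ d))) (at t)"
  proof -
    have "d = Suc (d - 1)" by (simp add: d_def)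
    then obtain e where e: "d = Suc e" by metis
    have "((\<lambda>t. t * s) has_real_derivative s) (at t)" by (auto intro!: derivative_eq_intros)
    from DERIV_cmult[OF DERIV_power_Suc[OF this, of e], of m]
    have "((\<lambda>t. m * (t * s) ^ Suc e) has_real_derivative m * ((1 + real e) * (s * (t * s) ^ e))) (at t)" by simp
    from DERIV_inverse_fun[OF this] have "((\<lambda>t. inverse (m * (t * s) ^ Suc e)) has_real_derivative
      - (m * ((1 + real e) * (s * (t * s) ^ e)) * inverse ((m * (t * s) ^ Suc e) ^ Suc (Suc 0)))) (at t)"
      using s t m by simp
    moreover have "- (m * ((1 + real e) * (s * (t * s) ^ e)) * inverse ((m * (t * s) ^ Suc e) ^ Suc (Suc 0))) =
      - real (Suc e) / t * (1 / (m * (t * s) ^ Suc e))"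
      using s t m by (simp add: field_simps)
    ultimately show ?thesis unfolding e inverse_eq_divide by simp
  qed
  have B: "(\<Prod>i\<in>UNIV. bump (A i t)) = bump (A i t) * P i" for i
    unfolding P_def by (subst prod.remove[of _ i]) auto
  have pf: "partial_deriv UNIV i (flux (x + t *\<^sub>R (\<xi> - x)) (t * s) x t i) z =
    (bump' (A i t) * ((z $ i - x $ i) / (t * s)) + bump (A i t)) * P i * (1 / (t * (m * (t * s) ^ d)))" for i
    using flux_partial_deriv[of "t * s" t i "x + t *\<^sub>R (\<xi> - x)" x z] s t unfolding arg[OF t] A_def[symmetric] P_def[symmetric] m_def[symmetric] d_def[symmetric] by simp
  have "((\<lambda>t. (\<Prod>i\<in>UNIV. bump (A i t)) * (1 / (m * (t * s) ^ d))) has_real_derivative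
     (\<Sum>i\<in>UNIV. bump' (A i t) * (- (z $ i - x $ i) / (t\<^sup>2 * s)) * P i) * (1 / (m * (t * s) ^ d)) +
     - real d / t * (1 / (m * (t * s) ^ d)) * (\<Prod>i\<in>UNIV. bump (A i t))) (at t)"
    by (rule DERIV_mult[OF dP dM])
  moreover have "(\<Sum>i\<in>UNIV. bump' (A i t) * (- (z $ i - x $ i) / (t\<^sup>2 * s)) * P i) * (1 / (m * (t * s) ^ d)) +
     - real d / t * (1 / (m * (t * s) ^ d)) * (\<Prod>i\<in>UNIV. bump (A i t)) =
     - (\<Sum>i\<in>UNIV. partial_deriv UNIV i (flux (x + t *\<^sub>R (\<xi> - x)) (t * s) x t i) z)"
  proof -
    define B0 where "B0 = (\<Prod>i\<in>UNIV. bump (A i t))"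
    have "real d * B0 = (\<Sum>i\<in>(UNIV::'m set). B0)" by (simp add: d_def)
    also have "\<dots> = (\<Sum>i\<in>UNIV. bump (A i t) * P i)" unfolding B0_def by (rule sum.cong[OF refl B])
    finally have d: "real d * B0 = (\<Sum>i\<in>UNIV. bump (A i t) * P i)" .
    have "(\<Sum>i\<in>UNIV. partial_deriv UNIV i (flux (x + t *\<^sub>R (\<xi> - x)) (t * s) x t i) z) =
      (\<Sum>i\<in>UNIV. bump' (A i t) * ((z $ i - x $ i) / (t * s)) * P i + bump (A i t) * P i) * (1 / (t * (m * (t * s) ^ d)))"
      unfolding pf sum_distrib_right by (rule sum.cong) (auto simp: algebra_simps)
    also have "\<dots> = ((\<Sum>i\<in>UNIV. bump' (A i t) * ((z $ i - x $ i) / (t * s)) * P i) + real d * B0) * (1 / (t * (m * (t * s) ^ d)))"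
      by (simp add: sum.distrib d)
    also have "(\<Sum>i\<in>UNIV. bump' (A i t) * ((z $ i - x $ i) / (t * s)) * P i) =
      - t * (\<Sum>i\<in>UNIV. bump' (A i t) * (- (z $ i - x $ i) / (t\<^sup>2 * s)) * P i)"
      unfolding sum_distrib_left using t s by (intro sum.cong) (auto simp: power2_eq_square field_simps)
    also have "1 / (t * (m * (t * s) ^ d)) = 1 / (m * (t * s) ^ d) / t" by simp
    finally have E: "(\<Sum>i\<in>UNIV. partial_deriv UNIV i (flux (x + t *\<^sub>R (\<xi> - x)) (t * s) x t i) z) =
      (- t * (\<Sum>i\<in>UNIV. bump' (A i t) * (- (z $ i - x $ i) / (t\<^sup>2 * s)) * P i) + real d * B0) * (1 / (m * (t * s) ^ d) / t)" .
    have "S * k + - real d / t * k * B0 = - ((- t * S + real d * B0) * (k / t))" for S k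
      using t by (simp add: field_simps)
    then show ?thesis unfolding E B0_def[symmetric] .
  qed
  ultimately have "((\<lambda>t. (\<Prod>i\<in>UNIV. bump (A i t)) * (1 / (m * (t * s) ^ d))) has_real_derivative
    - (\<Sum>i\<in>UNIV. partial_deriv UNIV i (flux (x + t *\<^sub>R (\<xi> - x)) (t * s) x t i) z)) (at t)" by simp
  then show ?thesis
    by (rule has_field_derivative_transform_within_open[where S="{0<..}"]) (use t k in auto)
qed

text \<open>A pointwise substitute for the inequality of Hoelder: split at the level \<open>N\<close>.\<close>

lemma integral_mult_kernel_le:
  fixes g k :: "'a \<Rightarrow> real"
  assumes g: "g \<in> borel_measurable M" "integrable M (\<lambda>x. \<bar>g x\<bar> powr p)"
    and k: "integrable M k" "\<And>x. x \<in> space M \<Longrightarrow> 0 \<le> k x" "\<And>x. x \<in> space M \<Longrightarrow> k x \<le> B"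
    and v: "v \<in> borel_measurable M" "\<And>x. x \<in> space M \<Longrightarrow> \<bar>v x\<bar> \<le> D * k x"
    and N: "0 < N" "1 < p" "0 \<le> D"
  shows "\<bar>LINT x|M. g x * v x\<bar> \<le> D * (N * (LINT x|M. k x) + N powr (1 - p) * B * (LINT x|M. \<bar>g x\<bar> powr p))"
proof -
  have pt: "\<bar>g x * v x\<bar> \<le> D * (N * k x + N powr (1 - p) * B * \<bar>g x\<bar> powr p)" if x: "x \<in> space M" for x
  proof -
    have B0: "0 \<le> B" using k(2,3)[OF x] by linarith
    have "\<bar>g x\<bar> * k x \<le> N * k x + N powr (1 - p) * B * \<bar>g x\<bar> powr p"
    proof (cases "\<bar>g x\<bar> \<le> N")
      case True
      then have "\<bar>g x\<bar> * k x \<le> N * k x" using k(2)[OF x] by (rule mult_right_mono)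
      moreover have "0 \<le> N powr (1 - p) * B * \<bar>g x\<bar> powr p" using B0 by simp
      ultimately show ?thesis by linarith
    next
      case False
      then have gx: "N < \<bar>g x\<bar>" by simp
      have "N powr (p - 1) \<le> \<bar>g x\<bar> powr (p - 1)" using gx N by (intro powr_mono2) auto
      then have "1 \<le> N powr (1 - p) * \<bar>g x\<bar> powr (p - 1)"
        using N mult_left_mono[of "N powr (p - 1)" "\<bar>g x\<bar> powr (p - 1)" "N powr (1 - p)"] by (simp add: powr_add[symmetric])
      then have "\<bar>g x\<bar> * 1 \<le> \<bar>g x\<bar> * (N powr (1 - p) * \<bar>g x\<bar> powr (p - 1))" by (rule mult_left_mono) simp
      also have "\<dots> = N powr (1 - p) * \<bar>g x\<bar> powr p"
        using gx N powr_add[of "\<bar>g x\<bar>" 1 "p - 1"] by simp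
      finally have "\<bar>g x\<bar> * k x \<le> (N powr (1 - p) * \<bar>g x\<bar> powr p) * B"
        using k(2,3)[OF x] by (intro mult_mono) auto
      moreover have "0 \<le> N * k x" using N k(2)[OF x] by simp
      ultimately show ?thesis by (simp add: mult_ac)
    qed
    then have "D * (\<bar>g x\<bar> * k x) \<le> D * (N * k x + N powr (1 - p) * B * \<bar>g x\<bar> powr p)"
      using N(3) by (rule mult_left_mono)
    moreover have "\<bar>g x * v x\<bar> \<le> \<bar>g x\<bar> * (D * k x)" unfolding abs_mult using v(2)[OF x] by (intro mult_left_mono) auto
    ultimately show ?thesis by (simp add: mult_ac)
  qed
  have i: "integrable M (\<lambda>x. D * (N * k x + N powr (1 - p) * B * \<bar>g x\<bar> powr p))"
    by (intro integrable_mult_right Bochner_Integration.integrable_add k g)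
  have i2: "integrable M (\<lambda>x. g x * v x)"
  proof (rule Bochner_Integration.integrable_bound[OF i])
    show "(\<lambda>x. g x * v x) \<in> borel_measurable M" by (intro borel_measurable_times g v)
    show "AE x in M. norm (g x * v x) \<le> norm (D * (N * k x + N powr (1 - p) * B * \<bar>g x\<bar> powr p))"
    proof (rule AE_I2)
      fix x assume "x \<in> space M"
      from pt[OF this] show "norm (g x * v x) \<le> norm (D * (N * k x + N powr (1 - p) * B * \<bar>g x\<bar> powr p))"
        unfolding real_norm_def by linarith
    qed
  qed
  have "\<bar>LINT x|M. g x * v x\<bar> \<le> (LINT x|M. \<bar>g x * v x\<bar>)" by (rule integral_abs_bound)
  also have "\<dots> \<le> (LINT x|M. D * (N * k x + N powr (1 - p) * B * \<bar>g x\<bar> powr p))"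
    by (rule integral_mono[OF integrable_abs[OF i2] i pt])
  also have "\<dots> = D * (N * (LINT x|M. k x) + N powr (1 - p) * B * (LINT x|M. \<bar>g x\<bar> powr p))"
    using k g by simp
  finally show ?thesis .
qed

text \<open>Adding or subtracting a primitive of the bound makes \<open>I\<close> monotone; the
  primitive stays bounded near 0 because \<open>\<theta> < 1\<close>.\<close>

lemma power_primitive_bound:
  fixes I :: "real \<Rightarrow> real"
  assumes der: "\<And>t. 0 < t \<Longrightarrow> t \<le> 1 \<Longrightarrow> \<exists>D. (I has_real_derivative D) (at t) \<and> \<bar>D\<bar> \<le> C * t powr (- \<theta>)"
    and lim: "(I \<longlongrightarrow> L) (at_right 0)" and \<theta>: "\<theta> < 1" and C: "0 \<le> C"
  shows "\<bar>I 1 - L\<bar> \<le> C / (1 - \<theta>)"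
proof -
  have pr: "((\<lambda>t. C / (1 - \<theta>) * t powr (1 - \<theta>)) has_real_derivative C * t powr (- \<theta>)) (at t)" if "0 < t" for t
    using that \<theta> by (auto intro!: derivative_eq_intros)
  have step: "\<bar>I 1 - I e\<bar> \<le> C / (1 - \<theta>)" if e: "0 < e" "e \<le> 1" for e
  proof -
    have "I e - C / (1 - \<theta>) * e powr (1 - \<theta>) \<ge> I 1 - C / (1 - \<theta>) * 1 powr (1 - \<theta>)"
    proof (rule DERIV_nonpos_imp_nonincreasing[OF e(2), where f="\<lambda>t. I t - C / (1 - \<theta>) * t powr (1 - \<theta>)"])
      fix t assume t: "e \<le> t" "t \<le> 1"
      then obtain D where D: "(I has_real_derivative D) (at t)" "\<bar>D\<bar> \<le> C * t powr (- \<theta>)" using der[of t] e by auto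
      have "0 < t" using t e by simp
      from DERIV_diff[OF D(1) pr[OF this]] D(2)
      show "\<exists>y. ((\<lambda>t. I t - C / (1 - \<theta>) * t powr (1 - \<theta>)) has_real_derivative y) (at t) \<and> y \<le> 0"
        by (intro exI[of _ "D - C * t powr (- \<theta>)"]) auto
    qed
    moreover have "I e + C / (1 - \<theta>) * e powr (1 - \<theta>) \<le> I 1 + C / (1 - \<theta>) * 1 powr (1 - \<theta>)"
    proof (rule DERIV_nonneg_imp_nondecreasing[OF e(2), where f="\<lambda>t. I t + C / (1 - \<theta>) * t powr (1 - \<theta>)"])
      fix t assume t: "e \<le> t" "t \<le> 1"
      then obtain D where D: "(I has_real_derivative D) (at t)" "\<bar>D\<bar> \<le> C * t powr (- \<theta>)" using der[of t] e by auto
      have "0 < t" using t e by simp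
      from DERIV_add[OF D(1) pr[OF this]] D(2)
      show "\<exists>y. ((\<lambda>t. I t + C / (1 - \<theta>) * t powr (1 - \<theta>)) has_real_derivative y) (at t) \<and> 0 \<le> y"
        by (intro exI[of _ "D + C * t powr (- \<theta>)"]) auto
    qed
    moreover have "0 \<le> C / (1 - \<theta>) * e powr (1 - \<theta>)" using C \<theta> by simp
    ultimately show ?thesis by (simp add: abs_le_iff)
  qed
  have "((\<lambda>e. \<bar>I 1 - I e\<bar>) \<longlongrightarrow> \<bar>I 1 - L\<bar>) (at_right 0)" by (intro tendsto_intros lim)
  moreover have "\<forall>\<^sub>F e in at_right 0. \<bar>I 1 - I e\<bar> \<le> C / (1 - \<theta>)"
    by (rule eventually_at_rightI[of 0 1]) (auto intro: step)
  ultimately show ?thesis by (intro tendsto_upperbound[of _ "\<bar>I 1 - L\<bar>" "at_right (0::real)"]) auto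
qed

lemma integrable_lebesgue_on_superset:
  fixes f :: "'a::euclidean_space \<Rightarrow> real"
  assumes "compact K" "continuous_on K f" "K \<subseteq> L" "L \<in> sets lebesgue" "\<And>x. x \<in> L - K \<Longrightarrow> f x = 0"
  shows "integrable (lebesgue_on L) f"
proof -
  have "integrable lebesgue (\<lambda>x. indicator K x *\<^sub>R f x)"
    using integrable_on_compact[OF assms(1,2)] assms(1) by (simp add: integrable_restrict_space borel_compact)
  moreover have "(\<lambda>x. indicator K x *\<^sub>R f x) = (\<lambda>x. indicator L x *\<^sub>R f x)"
    using assms(3,5) by (auto simp: indicator_def fun_eq_iff)
  ultimately show ?thesis using assms(4) by (simp add: integrable_restrict_space)
qed

text \<open>Morrey's estimate along bumps that shrink to \<open>x\<close>: \<open>I t\<close> tends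
  to \<open>a x\<close> for \<open>t\<close> tending to 0, and by \<open>continuity_equation\<close>
  its derivative pairs the weak gradient with the flux. The condition
  \<open>2 * s \<le> \<xi> $ k\<close> keeps the bumps off the flat boundary even if
  \<open>x\<close> lies on it.\<close>

lemma average_close:
  fixes a :: "real ^ 'm::finite \<Rightarrow> real" and g :: "'m \<Rightarrow> real ^ 'm \<Rightarrow> real" and x \<xi> :: "real ^ 'm" and s p G r0 :: real
  assumes U: "U \<in> sets lebesgue" "\<And>z. 0 < z $ k \<Longrightarrow> norm z < 1 \<Longrightarrow> z \<in> U"
    and ca: "continuous_on {z. 0 \<le> z $ k \<and> norm z < 1} a"
    and g: "\<And>i. g i \<in> borel_measurable (lebesgue_on U)" "\<And>i. integrable (lebesgue_on U) (\<lambda>x. \<bar>g i x\<bar> powr p)"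
      "\<And>i. weak_partial_deriv U i a (g i)"
    and p: "real CARD('m) < p"
    and G: "\<And>i. (LINT x|lebesgue_on U. \<bar>g i x\<bar> powr p) \<le> G"
    and x: "0 \<le> x $ k" "norm x \<le> r0" and r0: "r0 < 1" and s: "0 < s"
    and \<xi>: "2 * s \<le> \<xi> $ k" "\<And>i. \<bar>\<xi> $ i - x $ i\<bar> \<le> 3 * s" and small: "4 * CARD('m) * s \<le> (1 - r0) / 2"
  shows "\<bar>(LINT z|lebesgue_on {z :: real ^ 'm. 0 \<le> z $ k \<and> norm z \<le> (1 + r0) / 2}. a z * kernel \<xi> s z) - a x\<bar>
    \<le> (real CARD('m) * 4 * (1 + G / cube_mass TYPE('m)) * s powr (1 - CARD('m) / p)) / (1 - CARD('m) / p)"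
proof -
  define d where "d = real CARD('m)"
  define m where "m = cube_mass TYPE('m)"
  define \<theta> where "\<theta> = d / p"
  define K where "K = {z :: real ^ 'm. 0 \<le> z $ k \<and> norm z \<le> (1 + r0) / 2}"
  define c where "c t = x + t *\<^sub>R (\<xi> - x)" for t
  define I where "I t = (LINT z|lebesgue_on K. a z * kernel (c t) (t * s) z)" for t
  have d1: "1 \<le> d" by (simp add: d_def Suc_leI)
  have p1: "1 < p" using p d1 unfolding d_def by linarith
  have \<theta>: "\<theta> < 1" using p p1 by (simp add: \<theta>_def d_def)
  have m: "0 < m" using cube_mass_pos[where 'm='m] by (simp add: m_def)
  have G0: "0 \<le> G" using order.trans[OF Bochner_Integration.integral_nonneg G] by simp
  have K: "compact K"
  proof -
    have "K = {z. 0 \<le> z $ k} \<inter> cball 0 ((1 + r0) / 2)" by (auto simp: K_def)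
    moreover have "closed {z::real^'m. 0 \<le> z $ k}" by (intro closed_Collect_le continuous_intros)
    ultimately show ?thesis by (simp add: closed_Int_compact)
  qed
  have KS: "K \<subseteq> {z. 0 \<le> z $ k \<and> norm z < 1}" using r0 by (auto simp: K_def)
  have caK: "continuous_on K a" by (rule continuous_on_subset[OF ca KS])
  have box: "\<bar>z $ i - x $ i\<bar> \<le> 4 * s * t" "norm (z - x) \<le> d * (4 * s * t)" "norm z \<le> (1 + r0) / 2" "t * s \<le> z $ k" "z \<in> K" "z \<in> U"
    if t: "0 < t" "t \<le> 1" and z: "\<And>j. \<bar>z $ j - c t $ j\<bar> \<le> t * s" for t :: real and z i
  proof -
    have 1: "\<bar>z $ j - x $ j\<bar> \<le> 4 * s * t" for j
    proof -
      have "\<bar>c t $ j - x $ j\<bar> \<le> t * (3 * s)" using \<xi>(2)[of j] t by (simp add: c_def abs_mult)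
      moreover have "\<bar>z $ j - x $ j\<bar> \<le> \<bar>z $ j - c t $ j\<bar> + \<bar>c t $ j - x $ j\<bar>" by linarith
      ultimately show ?thesis using z[of j] by (simp add: mult_ac)
    qed
    then show "\<bar>z $ i - x $ i\<bar> \<le> 4 * s * t" .
    have "norm (z - x) \<le> (\<Sum>j\<in>UNIV. \<bar>(z - x) $ j\<bar>)" by (rule norm_le_l1_cart)
    also have "\<dots> \<le> (\<Sum>j\<in>(UNIV::'m set). 4 * s * t)" using 1 by (intro sum_mono) simp
    finally show 2: "norm (z - x) \<le> d * (4 * s * t)" by (simp add: d_def)
    also have "\<dots> \<le> d * (4 * s * 1)" using t s d1 by (intro mult_left_mono) auto
    also have "\<dots> \<le> (1 - r0) / 2" using small by (simp add: d_def mult_ac)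
    finally have "norm (z - x) \<le> (1 - r0) / 2" .
    then show 3: "norm z \<le> (1 + r0) / 2" using x(2) norm_triangle_ineq[of x "z - x"] by (simp add: field_simps)
    have "t * (2 * s) \<le> t * \<xi> $ k" using \<xi>(1) t by (intro mult_left_mono) auto
    moreover have "0 \<le> (1 - t) * x $ k" using t x(1) by (intro mult_nonneg_nonneg) auto
    moreover have "c t $ k = (1 - t) * x $ k + t * \<xi> $ k" by (simp add: c_def algebra_simps)
    ultimately show 4: "t * s \<le> z $ k" using z[of k] by (simp add: abs_le_iff)
    have 5: "0 < t * s" using t s by simp
    show "z \<in> K" using 3 4 5 by (simp add: K_def)
    show "z \<in> U" using 3 4 5 r0 by (intro U(2)) auto
  qed
  have derI: "\<exists>D. (I has_real_derivative D) (at t) \<and> \<bar>D\<bar> \<le> (d * 4 * (1 + G / m) * s powr (1 - \<theta>)) * t powr (- \<theta>)"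
    if t: "0 < t" "t \<le> 1" for t :: real
  proof -
    have \<rho>: "0 < t * s" using t s by simp
    define dk where "dk t z = - (\<Sum>i\<in>UNIV. partial_deriv UNIV i (flux (c t) (t * s) x t i) z)" for t z
    have cf: "continuous_on UNIV (partial_deriv UNIV i (flux (c t) (t * s) x t i))" for t i
    proof -
      have "times_differentiable (Suc 0) (flux (c t) (t * s) x t i)"
        unfolding flux_def by (intro tensor_times_differentiable flux_factor_smooth)
      then show ?thesis by simp
    qed
    let ?Q = "cbox (c t - (\<chi> i. t * s)) (c t + (\<chi> i. t * s))"
    have Qz: "\<bar>z $ j - c t $ j\<bar> \<le> t * s" if "z \<in> ?Q" for z j
    proof -
      have "c t $ j - t * s \<le> z $ j \<and> z $ j \<le> c t $ j + t * s" using that by (simp add: mem_box_cart)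
      then show ?thesis by linarith
    qed
    have Qnot: "\<exists>j. t * s < \<bar>z $ j - c t $ j\<bar>" if "z \<notin> ?Q" for z
    proof -
      have "\<not> (\<forall>j. c t $ j - t * s \<le> z $ j \<and> z $ j \<le> c t $ j + t * s)" using that by (simp add: mem_box_cart)
      then obtain j where "\<not> (c t $ j - t * s \<le> z $ j \<and> z $ j \<le> c t $ j + t * s)" by blast
      then have "t * s < \<bar>z $ j - c t $ j\<bar>" by linarith
      then show ?thesis ..
    qed
    have QK: "?Q \<subseteq> K" "?Q \<subseteq> U" using box(5,6)[OF t Qz] by blast+
    have ftest: "flux (c t) (t * s) x t i \<in> test_functions U" for i
      by (rule flux_test[OF \<rho>]) (rule box(6)[OF t])
    have pd_off: "partial_deriv UNIV i (flux (c t) (t * s) x t i) z = 0" if "z \<notin> ?Q" for i z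
    proof -
      have "(flux (c t) (t * s) x t i has_derivative (\<lambda>h. 0)) (at z)"
      proof (rule has_derivative_transform_within_open[of "\<lambda>_. 0" _ _ _ "- ?Q"])
        fix y assume "y \<in> - ?Q"
        then obtain j where "t * s < \<bar>y $ j - c t $ j\<bar>" using Qnot by blast
        then show "0 = flux (c t) (t * s) x t i y"
          unfolding flux_eq using kernel_off[OF \<rho>, of y j "c t"] by simp
      qed (use that in auto)
      then show ?thesis by (rule partial_deriv_eqI)
    qed
    have D: "(I has_real_derivative (LINT z|lebesgue_on K. a z * dk t z)) (at t)"
    proof -
      obtain Ba where Ba: "\<And>z. z \<in> K \<Longrightarrow> \<bar>a z\<bar> \<le> Ba"
        using compact_imp_bounded[OF compact_continuous_image[OF caK K]] unfolding bounded_iff by (metis imageI real_norm_def)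
      define J where "J = {t / 2<..<2 * t}"
      obtain Bb where Bb: "0 \<le> Bb" "\<And>\<tau>. \<bar>bump' \<tau>\<bar> \<le> Bb" using bump'_bounded by blast
      define B where "B = (\<Sum>i\<in>(UNIV::'m set). (Bb * (2 / (t / 2 * s)) + 1) * (1 / (t / 2 * (m * (t / 2 * s) ^ CARD('m)))))"
      have B: "\<bar>dk \<tau> z\<bar> \<le> B" if \<tau>: "\<tau> \<in> J" and z: "z \<in> K" for \<tau> z
      proof -
        have \<tau>t: "t / 2 \<le> \<tau>" "0 < \<tau>" using \<tau> t by (auto simp: J_def)
        have le: "t / 2 * s \<le> \<tau> * s" and pos: "0 < t / 2 * s" "0 < \<tau> * s" using \<tau>t s t by (auto intro: mult_right_mono)
        have "\<bar>dk \<tau> z\<bar> \<le> (\<Sum>i\<in>UNIV. \<bar>partial_deriv UNIV i (flux (c \<tau>) (\<tau> * s) x \<tau> i) z\<bar>)"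
          unfolding dk_def abs_minus_cancel by (rule sum_abs)
        also have "\<dots> \<le> B" unfolding B_def
        proof (rule sum_mono)
          fix i
          have "\<bar>z $ i - x $ i\<bar> \<le> norm z + norm x"
            using component_le_norm_cart[of "z - x" i] norm_triangle_ineq4[of z x] by simp
          also have "\<dots> \<le> 2" using z x r0 by (simp add: K_def)
          finally have zx: "\<bar>z $ i - x $ i\<bar> / (\<tau> * s) \<le> 2 / (t / 2 * s)" using le pos by (intro frac_le) auto
          have "\<bar>partial_deriv UNIV i (flux (c \<tau>) (\<tau> * s) x \<tau> i) z\<bar> \<le>
              (Bb * (\<bar>z $ i - x $ i\<bar> / (\<tau> * s)) + 1) * (1 / (\<tau> * (m * (\<tau> * s) ^ CARD('m))))"
            unfolding m_def by (rule flux_partial_deriv_le[OF pos(2) \<tau>t(2) Bb(2)])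
          also have "\<dots> \<le> (Bb * (2 / (t / 2 * s)) + 1) * (1 / (t / 2 * (m * (t / 2 * s) ^ CARD('m))))"
          proof (rule mult_mono)
            show "Bb * (\<bar>z $ i - x $ i\<bar> / (\<tau> * s)) + 1 \<le> Bb * (2 / (t / 2 * s)) + 1"
              using zx Bb(1) by (intro add_right_mono mult_left_mono)
            have "(t / 2 * s) ^ CARD('m) \<le> (\<tau> * s) ^ CARD('m)" using le pos by (intro power_mono) auto
            then have "t / 2 * (m * (t / 2 * s) ^ CARD('m)) \<le> \<tau> * (m * (\<tau> * s) ^ CARD('m))"
              using \<tau>t t m pos by (intro mult_mono) auto
            then show "1 / (\<tau> * (m * (\<tau> * s) ^ CARD('m))) \<le> 1 / (t / 2 * (m * (t / 2 * s) ^ CARD('m)))"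
              using t m pos \<tau>t s by (intro divide_left_mono mult_pos_pos zero_less_power) auto
            show "0 \<le> Bb * (2 / (t / 2 * s)) + 1" using Bb pos by (intro add_nonneg_nonneg mult_nonneg_nonneg) auto
            show "0 \<le> 1 / (\<tau> * (m * (\<tau> * s) ^ CARD('m)))" using \<tau>t m pos by simp
          qed
          finally show "\<bar>partial_deriv UNIV i (flux (c \<tau>) (\<tau> * s) x \<tau> i) z\<bar> \<le> \<dots>" .
        qed
        finally show ?thesis .
      qed
      show ?thesis
        unfolding I_def[abs_def]
      proof (rule DERIV_under_integral[where I=J and B="Ba * B"])
        show "((\<lambda>t. a z * kernel (c t) (t * s) z) has_real_derivative a z * dk \<tau> z) (at \<tau>)" if "\<tau> \<in> J" "z \<in> K" for \<tau> z
          unfolding dk_def c_def using that t s by (intro DERIV_cmult continuity_equation) (auto simp: J_def)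
        show "\<bar>a z * dk \<tau> z\<bar> \<le> Ba * B" if "\<tau> \<in> J" "z \<in> K" for \<tau> z
          unfolding abs_mult using Ba[OF that(2)] B[OF that] by (intro mult_mono) auto
        show "continuous_on K (\<lambda>z. a z * kernel (c \<tau>) (\<tau> * s) z)" for \<tau>
          by (intro continuous_on_mult caK kernel_cont)
        show "continuous_on K (\<lambda>z. a z * dk t z)"
          unfolding dk_def by (intro continuous_on_mult caK continuous_on_minus continuous_on_sum continuous_on_subset[OF cf]) simp
      qed (use K t in \<open>auto simp: J_def\<close>)
    qed
    have kU: "integrable (lebesgue_on U) (kernel (c t) (t * s))" "(LINT z|lebesgue_on U. kernel (c t) (t * s) z) = 1"
    proof -
      have off: "kernel (c t) (t * s) z = 0" if "z \<notin> ?Q" for z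
        using Qnot[OF that] kernel_off[OF \<rho>] less_imp_le by blast
      show "integrable (lebesgue_on U) (kernel (c t) (t * s))"
        by (rule integrable_lebesgue_on_superset[OF compact_cbox kernel_cont QK(2) U(1)]) (use off in auto)
      have "(LINT z|lebesgue_on U. kernel (c t) (t * s) z) = (LINT z|lebesgue_on ?Q. kernel (c t) (t * s) z)"
        by (rule integral_lebesgue_on_superset[symmetric, OF QK(2) _ U(1)]) (use off in auto)
      also have "\<dots> = 1"
      proof (rule kernel_integral[OF \<rho> compact_cbox])
        fix z assume z: "\<And>i. \<bar>z $ i - c t $ i\<bar> < t * s"
        show "z \<in> ?Q"
        proof (rule ccontr)
          assume "z \<notin> ?Q"
          from Qnot[OF this] z show False by (meson less_asym)
        qed
      qed
      finally show "(LINT z|lebesgue_on U. kernel (c t) (t * s) z) = 1" .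
    qed
    \<comment> \<open>This level balances the two terms: as \<open>\<theta> * p = d\<close>, one has
      \<open>N powr (1 - p) = N * (t * s) ^ CARD('m)\<close>, which cancels the power in the maximum
      of the kernel.\<close>
    define N where "N = (t * s) powr (- \<theta>)"
    have bound: "\<bar>LINT z|lebesgue_on U. g i z * flux (c t) (t * s) x t i z\<bar> \<le> 4 * s * (N * (1 + G / m))" for i
    proof -
      have "\<bar>LINT z|lebesgue_on U. g i z * flux (c t) (t * s) x t i z\<bar> \<le>
        4 * s * (N * (LINT z|lebesgue_on U. kernel (c t) (t * s) z) + N powr (1 - p) * (1 / (m * (t * s) ^ CARD('m))) * (LINT z|lebesgue_on U. \<bar>g i z\<bar> powr p))"
      proof (rule integral_mult_kernel_le[OF g(1,2) kU(1)])
        show "0 \<le> kernel (c t) (t * s) z" for z by (rule kernel_nonneg[OF \<rho>])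
        show "kernel (c t) (t * s) z \<le> 1 / (m * (t * s) ^ CARD('m))" for z unfolding m_def by (rule kernel_le[OF \<rho>])
        show "flux (c t) (t * s) x t i \<in> borel_measurable (lebesgue_on U)"
          unfolding flux_def by (intro continuous_imp_measurable_on_sets_lebesgue[OF _ U(1)] tensor_continuous flux_factor_smooth)
        show "\<bar>flux (c t) (t * s) x t i z\<bar> \<le> 4 * s * kernel (c t) (t * s) z" for z
        proof (cases "z \<in> ?Q")
          case True
          have "\<bar>(z $ i - x $ i) / t\<bar> \<le> 4 * s" using box(1)[OF t Qz[OF True]] t by (simp add: abs_divide divide_le_eq)
          then have "kernel (c t) (t * s) z * \<bar>(z $ i - x $ i) / t\<bar> \<le> kernel (c t) (t * s) z * (4 * s)"
            using kernel_nonneg[OF \<rho>] by (rule mult_left_mono)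
          then show ?thesis unfolding flux_eq abs_mult
            using kernel_nonneg[OF \<rho>, of "c t" z] by (simp only: abs_of_nonneg mult.commute)
        next
          case False
          then obtain j where "t * s \<le> \<bar>z $ j - c t $ j\<bar>" using Qnot less_imp_le by blast
          then show ?thesis unfolding flux_eq using kernel_off[OF \<rho>, of z j "c t"] by simp
        qed
      qed (use p1 s \<rho> in \<open>auto simp: N_def\<close>)
      also have "\<dots> \<le> 4 * s * (N * 1 + N powr (1 - p) * (1 / (m * (t * s) ^ CARD('m))) * G)"
        unfolding kU(2) using s m \<rho> G by (intro mult_left_mono add_left_mono) auto
      also have "N powr (1 - p) * (1 / (m * (t * s) ^ CARD('m))) = N / m"
      proof -
        have "(t * s) ^ CARD('m) = (t * s) powr d" using \<rho> by (simp add: d_def powr_realpow)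
        moreover have "N powr (1 - p) = (t * s) powr (- \<theta> + d)"
        proof -
          have "\<theta> * p = d" using p1 by (simp add: \<theta>_def)
          then have "- \<theta> * (1 - p) = - \<theta> + d" by (simp add: algebra_simps)
          then show ?thesis by (simp only: N_def powr_powr)
        qed
        ultimately have "N powr (1 - p) = N * (t * s) ^ CARD('m)" by (simp only: N_def powr_add)
        then show ?thesis using t s by simp
      qed
      finally show ?thesis by (simp add: distrib_left)
    qed
    have "(LINT z|lebesgue_on K. a z * dk t z) = (\<Sum>i\<in>UNIV. LINT z|lebesgue_on U. g i z * flux (c t) (t * s) x t i z)"
    proof -
      have i: "integrable (lebesgue_on K) (\<lambda>z. a z * partial_deriv UNIV i (flux (c t) (t * s) x t i) z)" for i
        by (intro integrable_on_compact[OF K] continuous_on_mult caK continuous_on_subset[OF cf]) simp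
      have "(LINT z|lebesgue_on K. a z * dk t z) = (LINT z|lebesgue_on K. - (\<Sum>i\<in>UNIV. a z * partial_deriv UNIV i (flux (c t) (t * s) x t i) z))"
        by (simp add: dk_def sum_distrib_left)
      also have "\<dots> = - (\<Sum>i\<in>UNIV. LINT z|lebesgue_on K. a z * partial_deriv UNIV i (flux (c t) (t * s) x t i) z)"
        using i by simp
      also have "\<dots> = (\<Sum>i\<in>UNIV. LINT z|lebesgue_on U. g i z * flux (c t) (t * s) x t i z)"
        unfolding sum_negf[symmetric]
      proof (rule sum.cong[OF refl])
        fix i
        have Ks: "K \<in> sets lebesgue" using K by (simp add: borel_compact)
        have "(LINT z|lebesgue_on ?Q. a z * partial_deriv UNIV i (flux (c t) (t * s) x t i) z) =
          (LINT z|lebesgue_on K. a z * partial_deriv UNIV i (flux (c t) (t * s) x t i) z)"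
          by (rule integral_lebesgue_on_superset[OF QK(1) _ Ks]) (use pd_off in auto)
        moreover have "(LINT z|lebesgue_on ?Q. a z * partial_deriv UNIV i (flux (c t) (t * s) x t i) z) =
          (LINT z|lebesgue_on U. a z * partial_deriv UNIV i (flux (c t) (t * s) x t i) z)"
          by (rule integral_lebesgue_on_superset[OF QK(2) _ U(1)]) (use pd_off in auto)
        moreover have "(LINT z|lebesgue_on U. a z * partial_deriv UNIV i (flux (c t) (t * s) x t i) z) =
           - (LINT z|lebesgue_on U. g i z * flux (c t) (t * s) x t i z)"
          using g(3)[of i] ftest[of i] unfolding weak_partial_deriv_def by blast
        ultimately show "- (LINT z|lebesgue_on K. a z * partial_deriv UNIV i (flux (c t) (t * s) x t i) z) =
           (LINT z|lebesgue_on U. g i z * flux (c t) (t * s) x t i z)" by simp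
      qed
      finally show ?thesis .
    qed
    moreover have "\<bar>\<Sum>i\<in>UNIV. LINT z|lebesgue_on U. g i z * flux (c t) (t * s) x t i z\<bar> \<le> (\<Sum>i\<in>(UNIV::'m set). 4 * s * (N * (1 + G / m)))"
      by (rule order.trans[OF sum_abs sum_mono[OF bound]])
    moreover have "(\<Sum>i\<in>(UNIV::'m set). 4 * s * (N * (1 + G / m))) = (d * 4 * (1 + G / m) * s powr (1 - \<theta>)) * t powr (- \<theta>)"
    proof -
      have "s * N = s powr (1 - \<theta>) * t powr (- \<theta>)"
        using s t powr_add[of s 1 "- \<theta>"] by (simp add: N_def powr_mult)
      then have "d * 4 * (1 + G / m) * (s * N) = d * 4 * (1 + G / m) * (s powr (1 - \<theta>) * t powr (- \<theta>))" by (simp only:)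
      moreover have "(\<Sum>i\<in>(UNIV::'m set). 4 * s * (N * (1 + G / m))) = d * 4 * (1 + G / m) * (s * N)"
        by (simp add: d_def)
      ultimately show ?thesis by (simp only: mult.assoc)
    qed
    ultimately have "\<bar>LINT z|lebesgue_on K. a z * dk t z\<bar> \<le> (d * 4 * (1 + G / m) * s powr (1 - \<theta>)) * t powr (- \<theta>)"
      by (simp only:)
    with D show ?thesis by blast
  qed
  have lim: "(I \<longlongrightarrow> a x) (at_right 0)"
  proof (rule tendstoI)
    fix \<epsilon> :: real assume \<epsilon>: "0 < \<epsilon>"
    have xK: "x \<in> K" using x r0 by (simp add: K_def)
    obtain \<delta> where \<delta>: "0 < \<delta>" "\<And>z. z \<in> K \<Longrightarrow> dist z x < \<delta> \<Longrightarrow> dist (a z) (a x) < \<epsilon> / 2"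
      using caK xK \<epsilon> unfolding continuous_on_iff by (metis half_gt_zero)
    define t0 where "t0 = min 1 (\<delta> / (d * (4 * s)))"
    have t0: "0 < t0" using \<delta> s d1 by (simp add: t0_def)
    have "dist (I t) (a x) < \<epsilon>" if t: "0 < t" "t < t0" for t
    proof -
      have t1: "t \<le> 1" and tt: "d * (4 * s * t) < \<delta>"
        using t s d1 by (auto simp: t0_def pos_less_divide_eq mult_ac)
      have \<rho>: "0 < t * s" using t s by simp
      have ik: "integrable (lebesgue_on K) (kernel (c t) (t * s))" by (intro integrable_on_compact[OF K] kernel_cont)
      have iak: "integrable (lebesgue_on K) (\<lambda>z. a z * kernel (c t) (t * s) z)" by (intro integrable_on_compact[OF K] continuous_on_mult caK kernel_cont)
      have one: "(LINT z|lebesgue_on K. kernel (c t) (t * s) z) = 1"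
        by (rule kernel_integral[OF \<rho> K]) (rule box(5)[OF t(1) t1], rule less_imp_le)
      have "I t - a x = (LINT z|lebesgue_on K. (a z - a x) * kernel (c t) (t * s) z)"
        using ik iak one by (simp add: I_def left_diff_distrib)
      also have "\<bar>\<dots>\<bar> \<le> (LINT z|lebesgue_on K. \<epsilon> / 2 * kernel (c t) (t * s) z)"
      proof (rule order.trans[OF integral_abs_bound integral_mono])
        show "integrable (lebesgue_on K) (\<lambda>z. \<bar>(a z - a x) * kernel (c t) (t * s) z\<bar>)"
          by (intro integrable_on_compact[OF K] continuous_intros caK kernel_cont)
        show "integrable (lebesgue_on K) (\<lambda>z. \<epsilon> / 2 * kernel (c t) (t * s) z)" using ik by simp
        fix z assume "z \<in> space (lebesgue_on K)"
        then have z: "z \<in> K" by simp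
        show "\<bar>(a z - a x) * kernel (c t) (t * s) z\<bar> \<le> \<epsilon> / 2 * kernel (c t) (t * s) z"
        proof (cases "\<forall>j. \<bar>z $ j - c t $ j\<bar> \<le> t * s")
          case True
          then have "norm (z - x) \<le> d * (4 * s * t)" using box(2)[OF t(1) t1] by blast
          then have "dist (a z) (a x) < \<epsilon> / 2" using tt by (intro \<delta>(2)[OF z]) (simp add: dist_norm)
          then have "\<bar>a z - a x\<bar> * kernel (c t) (t * s) z \<le> \<epsilon> / 2 * kernel (c t) (t * s) z"
            using kernel_nonneg[OF \<rho>] by (intro mult_right_mono) (simp_all add: dist_real_def)
          then show ?thesis using kernel_nonneg[OF \<rho>, of "c t" z] by (simp only: abs_mult abs_of_nonneg)
        next
          case False
          then obtain j where "t * s \<le> \<bar>z $ j - c t $ j\<bar>" by (auto simp: not_le intro: less_imp_le)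
          then show ?thesis using kernel_off[OF \<rho>, of z j "c t"] by simp
        qed
      qed
      also have "\<dots> = \<epsilon> / 2" using one by simp
      finally show ?thesis using \<epsilon> by (simp add: dist_real_def)
    qed
    then show "\<forall>\<^sub>F t in at_right 0. dist (I t) (a x) < \<epsilon>"
      using t0 by (intro eventually_at_rightI[of 0 t0]) auto
  qed
  have "\<bar>I 1 - a x\<bar> \<le> (d * 4 * (1 + G / m) * s powr (1 - \<theta>)) / (1 - \<theta>)"
    by (rule power_primitive_bound[OF derI lim \<theta>]) (use d1 G0 m in auto)
  moreover have "I 1 = (LINT z|lebesgue_on K. a z * kernel \<xi> s z)" by (simp add: I_def c_def)
  ultimately show ?thesis by (simp add: d_def m_def \<theta>_def K_def)
qed

text \<open>For \<open>p = \<infinity>\<close> a finite exponent above the dimension is taken; on a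
  set of finite measure an essentially bounded function has this power integrable.\<close>

definition real_exponent :: "real \<Rightarrow> ereal \<Rightarrow> real"
  where "real_exponent d p = (if p = \<infinity> then d + 1 else real_of_ereal p)"

lemma less_real_exponent: "ereal d < p \<Longrightarrow> d < real_exponent d p"
  by (cases p) (auto simp: real_exponent_def)

lemma in_Lp_real_exponent:
  assumes "in_Lp p U f" "U \<in> lmeasurable" "0 \<le> d"
  shows "integrable (lebesgue_on U) (\<lambda>x. \<bar>f x\<bar> powr real_exponent d p)"
proof (cases "p = \<infinity>")
  case True
  then obtain C where m: "f \<in> borel_measurable (lebesgue_on U)" and C: "AE x in lebesgue_on U. \<bar>f x\<bar> \<le> C"
    using assms(1) by (auto simp: in_Lp_def)
  have "finite_measure (lebesgue_on U)" using assms(2) by (rule finite_measure_lebesgue_on)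
  then have "integrable (lebesgue_on U) (\<lambda>x. \<bar>C\<bar> powr (d + 1))" by (simp add: finite_measure.integrable_const)
  then show ?thesis unfolding real_exponent_def if_P[OF True]
  proof (rule Bochner_Integration.integrable_bound)
    show "(\<lambda>x. \<bar>f x\<bar> powr (d + 1)) \<in> borel_measurable (lebesgue_on U)" using m by measurable
    show "AE x in lebesgue_on U. norm (\<bar>f x\<bar> powr (d + 1)) \<le> norm (\<bar>C\<bar> powr (d + 1))"
      using C by eventually_elim (use assms(3) in \<open>auto intro!: powr_mono2\<close>)
  qed
next
  case False
  then show ?thesis using assms(1) by (simp add: in_Lp_def real_exponent_def)
qed

text \<open>Both values are compared with the average over one common bump whose radius is the
  distance of the points. Points far apart are covered by the boundedness of
  \<open>a\<close>.\<close>

theorem W1p_holder: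
  fixes a :: "real ^ 'm::finite \<Rightarrow> real" and r0 :: real
  assumes U: "U \<in> lmeasurable" "\<And>z. 0 < z $ k \<Longrightarrow> norm z < 1 \<Longrightarrow> z \<in> U"
    and ca: "continuous_on {z. 0 \<le> z $ k \<and> norm z < 1} a"
    and a: "in_W1p p U a" and p: "ereal (real CARD('m)) < p" and r0: "r0 < 1"
  shows "\<exists>C\<ge>0. \<forall>x y. 0 \<le> x $ k \<longrightarrow> norm x \<le> r0 \<longrightarrow> 0 \<le> y $ k \<longrightarrow> norm y \<le> r0 \<longrightarrow>
    \<bar>a x - a y\<bar> \<le> C * dist x y powr (1 - CARD('m) / real_exponent CARD('m) p)"
proof -
  define q where "q = real_exponent CARD('m) p"
  have q: "real CARD('m) < q" using p by (simp add: q_def less_real_exponent)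
  define \<gamma> where "\<gamma> = 1 - CARD('m) / q"
  have \<gamma>: "0 < \<gamma>" using q by (simp add: \<gamma>_def)
  have "\<forall>i. \<exists>g. in_Lp p U g \<and> weak_partial_deriv U i a g" using a by (simp add: in_W1p_def)
  then obtain g where g: "\<And>i. in_Lp p U (g i)" "\<And>i. weak_partial_deriv U i a (g i)" by metis
  have gm: "g i \<in> borel_measurable (lebesgue_on U)" for i using g(1) by (simp add: in_Lp_def)
  have gi: "integrable (lebesgue_on U) (\<lambda>x. \<bar>g i x\<bar> powr q)" for i
    unfolding q_def by (rule in_Lp_real_exponent[OF g(1) U(1)]) simp
  have Us: "U \<in> sets lebesgue" using U(1) by (simp add: fmeasurableD)
  define G where "G = (\<Sum>i\<in>UNIV. LINT x|lebesgue_on U. \<bar>g i x\<bar> powr q)"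
  have G: "(LINT x|lebesgue_on U. \<bar>g i x\<bar> powr q) \<le> G" for i
    unfolding G_def by (rule member_le_sum) auto
  have G0: "0 \<le> G" unfolding G_def by (intro sum_nonneg Bochner_Integration.integral_nonneg) simp
  define C1 where "C1 = (real CARD('m) * 4 * (1 + G / cube_mass TYPE('m))) / \<gamma>"
  \<comment> \<open>For \<open>s \<le> \<delta>\<close> this gives the room
    \<open>4 * CARD('m) * s \<le> (1 - r0) / 2\<close> demanded by
    \<open>average_close\<close>.\<close>
  define \<delta> where "\<delta> = (1 - r0) / (8 * CARD('m))"
  have \<delta>: "0 < \<delta>" using r0 by (simp add: \<delta>_def)
  define K where "K = {z :: real ^ 'm. 0 \<le> z $ k \<and> norm z \<le> r0}"
  have K: "compact K"
  proof -
    have "K = {z. 0 \<le> z $ k} \<inter> cball 0 r0" by (auto simp: K_def)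
    moreover have "closed {z::real^'m. 0 \<le> z $ k}" by (intro closed_Collect_le continuous_intros)
    ultimately show ?thesis by (simp add: closed_Int_compact)
  qed
  have "continuous_on K a" by (rule continuous_on_subset[OF ca]) (use r0 in \<open>auto simp: K_def\<close>)
  from compact_imp_bounded[OF compact_continuous_image[OF this K]]
  obtain B where B: "\<And>z. z \<in> K \<Longrightarrow> \<bar>a z\<bar> \<le> B" unfolding bounded_iff by (metis imageI real_norm_def)
  define C where "C = 2 * C1 + 2 * \<bar>B\<bar> / \<delta> powr \<gamma>"
  have C1: "0 \<le> C1" using G0 \<gamma> cube_mass_pos[where 'm='m] by (simp add: C1_def)
  have le: "\<bar>a x - a y\<bar> \<le> C * dist x y powr \<gamma>" if x: "x \<in> K" and y: "y \<in> K" for x y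
  proof -
    define s where "s = dist x y"
    consider "s = 0" | "0 < s" "s \<le> \<delta>" | "\<delta> < s" by (fastforce simp: s_def)
    then show ?thesis
    proof cases
      case 1
      then show ?thesis by (simp add: s_def)
    next
      case 2
      \<comment> \<open>Raised by \<open>2 * s\<close> in the normal direction, so that the bump of
        radius \<open>s\<close> lies above the flat boundary while its centre is within
        \<open>3 * s\<close> of both points in each coordinate.\<close>
      define \<xi> where "\<xi> = y + (2 * s) *\<^sub>R axis k 1"
      have \<xi>i: "\<xi> $ i = y $ i + (if i = k then 2 * s else 0)" for i by (simp add: \<xi>_def axis_def)
      have yx: "\<bar>y $ i - x $ i\<bar> \<le> s" for i
        using component_le_norm_cart[of "y - x" i] by (simp add: s_def dist_norm norm_minus_commute)
      have sm: "4 * CARD('m) * s \<le> (1 - r0) / 2" using 2(2) by (simp add: \<delta>_def field_simps)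
      have close: "\<bar>(LINT z|lebesgue_on {z. 0 \<le> z $ k \<and> norm z \<le> (1 + r0) / 2}. a z * kernel \<xi> s z) - a v\<bar> \<le> C1 * s powr \<gamma>"
        if v: "v \<in> K" "\<And>i. \<bar>y $ i - v $ i\<bar> \<le> s" for v
      proof -
        have e: "C1 * s powr \<gamma> = (real CARD('m) * 4 * (1 + G / cube_mass TYPE('m)) * s powr (1 - CARD('m) / q)) / (1 - CARD('m) / q)"
          by (simp add: C1_def \<gamma>_def)
        show ?thesis unfolding e
        proof (rule average_close[OF Us U(2) ca gm gi g(2) q G _ _ r0 2(1) _ _ sm])
          show "0 \<le> v $ k" "norm v \<le> r0" using v(1) by (auto simp: K_def)
          show "2 * s \<le> \<xi> $ k" using y by (simp add: \<xi>i K_def)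
          show "\<bar>\<xi> $ i - v $ i\<bar> \<le> 3 * s" for i using v(2)[of i] 2(1) unfolding \<xi>i by (cases "i = k") auto
        qed
      qed
      have "\<bar>a x - a y\<bar> \<le> C1 * s powr \<gamma> + C1 * s powr \<gamma>"
        using close[OF x yx] close[OF y] 2(1) by simp
      also have "\<dots> \<le> C * s powr \<gamma>"
        using \<delta> by (simp add: C_def distrib_right)
      finally show ?thesis by (simp add: s_def)
    next
      case 3
      have "\<bar>a x - a y\<bar> \<le> 2 * \<bar>B\<bar>" using B[OF x] B[OF y] by linarith
      also have "\<dots> = 2 * \<bar>B\<bar> / \<delta> powr \<gamma> * \<delta> powr \<gamma>" using \<delta> by simp
      also have "\<dots> \<le> C * s powr \<gamma>"
        using 3 \<delta> \<gamma> C1 by (intro mult_mono powr_mono2) (auto simp: C_def)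
      finally show ?thesis by (simp add: s_def)
    qed
  qed
  have "0 \<le> C" using C1 \<delta> by (simp add: C_def)
  then show ?thesis using le unfolding K_def \<gamma>_def q_def by blast
qed

section \<open>The variational inequality at the flat boundary\<close>

definition upper_half :: "'m::finite \<Rightarrow> (real ^ 'm) set"
  where "upper_half k = {z. 0 \<le> z $ k}"

lemma closed_upper_half: "closed (upper_half k)"
  unfolding upper_half_def by (intro closed_Collect_le continuous_intros)

lemma interior_upper_half_ball:
  "interior (upper_half k \<inter> ball 0 1) = {z. 0 < z $ k \<and> norm z < 1}"
proof -
  have "upper_half k = {z. axis k 1 \<bullet> z \<ge> 0}" by (simp add: upper_half_def inner_axis')
  moreover have "interior {z :: real ^ 'a. axis k 1 \<bullet> z \<ge> 0} = {z. axis k 1 \<bullet> z > 0}"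
    by (rule interior_halfspace_ge) (simp add: axis_eq_0_iff)
  ultimately show ?thesis by (auto simp: interior_Int inner_axis')
qed

lemma strip_measure:
  assumes "0 < \<epsilon>"
  shows "measure lebesgue {z :: real ^ 'm::finite \<in> upper_half k \<inter> cball 0 1. z $ k \<le> 2 * \<epsilon>} \<le> 2 ^ CARD('m) * \<epsilon>"
proof -
  let ?a = "\<chi> i. if i = k then 0 else -1" and ?b = "\<chi> i. if i = k then 2 * \<epsilon> else 1"
  have sub: "{z :: real ^ 'm \<in> upper_half k \<inter> cball 0 1. z $ k \<le> 2 * \<epsilon>} \<subseteq> cbox ?a ?b"
  proof
    fix z :: "real ^ 'm" assume z: "z \<in> {z \<in> upper_half k \<inter> cball 0 1. z $ k \<le> 2 * \<epsilon>}"
    have "\<bar>z $ i\<bar> \<le> 1" for i using z component_le_norm_cart[of z i] by simp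
    then have "-1 \<le> z $ i \<and> z $ i \<le> 1" for i by (meson abs_le_iff minus_le_iff)
    then show "z \<in> cbox ?a ?b" using z by (auto simp: mem_box_cart upper_half_def)
  qed
  have cl: "closed {z :: real ^ 'm \<in> upper_half k \<inter> cball 0 1. z $ k \<le> 2 * \<epsilon>}"
  proof -
    have "{z :: real ^ 'm \<in> upper_half k \<inter> cball 0 1. z $ k \<le> 2 * \<epsilon>} = upper_half k \<inter> cball 0 1 \<inter> {z. z $ k \<le> 2 * \<epsilon>}" by auto
    then show ?thesis by (auto intro!: closed_Int closed_upper_half closed_Collect_le continuous_intros)
  qed
  have "measure lebesgue {z :: real ^ 'm \<in> upper_half k \<inter> cball 0 1. z $ k \<le> 2 * \<epsilon>} \<le> measure lebesgue (cbox ?a ?b)"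
    using cl by (intro measure_mono_fmeasurable[OF sub] lmeasurable_cbox) (simp add: borel_closed)
  also have "\<dots> = (\<Prod>i\<in>UNIV. ?b $ i - ?a $ i)"
  proof -
    have "cbox ?a ?b \<noteq> {}" using assms by (auto simp: interval_ne_empty_cart)
    then show ?thesis by (simp add: content_cbox_cart)
  qed
  also have "\<dots> = 2 * \<epsilon> * (\<Prod>i\<in>UNIV - {k}. 2)"
    by (subst prod.remove[of _ k]) (auto intro!: arg_cong2[where f="(*)"] prod.cong)
  also have "\<dots> = 2 ^ CARD('m) * \<epsilon>"
  proof -
    have "2 ^ CARD('m) = (\<Prod>i\<in>(UNIV :: 'm set). (2::real))" by simp
    also have "\<dots> = 2 * (\<Prod>i\<in>UNIV - {k}. 2)" by (subst prod.remove[of _ k]) auto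
    finally show ?thesis by simp
  qed
  finally show ?thesis .
qed

text \<open>The test functions have to vanish near the flat boundary, so \<open>\<phi>\<close> is multiplied by a step in
  \<open>x $ k / \<epsilon>\<close>. The derivative of the step is of size \<open>1 / \<epsilon>\<close> on a strip of measure \<open>O(\<epsilon>)\<close>, where
  \<open>\<phi> * V $ k\<close> exceeds its nonpositive boundary values by \<open>o(1)\<close> only.\<close>

lemma flat_variational_inequality:
  fixes V :: "real ^ 'm::finite \<Rightarrow> real ^ 'm" and \<rho> :: real and k :: 'm
  defines "S \<equiv> upper_half k \<inter> ball 0 1"
  assumes cV: "continuous_on S V"
    and weak: "\<And>\<phi>. \<phi> \<in> test_functions (interior S) \<Longrightarrow>
      (LINT x|lebesgue_on (interior S). (\<Sum>i\<in>UNIV. V x $ i * partial_deriv UNIV i \<phi> x)) = 0"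
    and \<phi>: "\<And>x. x \<in> S \<Longrightarrow> (\<phi> has_derivative (\<lambda>h. g\<phi> x \<bullet> h)) (at x within S)" and cg: "continuous_on S g\<phi>"
    and \<rho>: "\<rho> < 1" "\<And>x. x \<in> S \<Longrightarrow> \<rho> \<le> norm x \<Longrightarrow> \<phi> x = 0" "\<And>x. x \<in> S \<Longrightarrow> \<rho> \<le> norm x \<Longrightarrow> g\<phi> x = 0"
    and sign: "\<And>x. x \<in> S \<Longrightarrow> x $ k = 0 \<Longrightarrow> \<phi> x * V x $ k \<le> 0"
  shows "0 \<le> (LINT x|lebesgue_on (upper_half k \<inter> cball 0 \<rho>). V x \<bullet> g\<phi> x)"
proof -
  define K where "K = upper_half k \<inter> cball 0 \<rho>"
  have K: "compact K" unfolding K_def by (simp add: closed_upper_half closed_Int_compact)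
  have KS: "K \<subseteq> S" using \<rho>(1) by (auto simp: K_def S_def)
  have iS: "interior S = {z. 0 < z $ k \<and> norm z < 1}" unfolding S_def by (rule interior_upper_half_ball)
  have c\<phi>: "continuous_on S \<phi>"
    unfolding continuous_on_eq_continuous_within using has_derivative_continuous[OF \<phi>] by blast
  have Ks: "K \<in> sets lebesgue" using K by (simp add: borel_compact)
  have cK: "continuous_on K V" "continuous_on K \<phi>" "continuous_on K g\<phi>"
    by (rule continuous_on_subset[OF cV KS] continuous_on_subset[OF c\<phi> KS] continuous_on_subset[OF cg KS])+
  \<comment> \<open>The shift by one makes the cutoff vanish for
    \<open>x $ k \<le> \<epsilon>\<close>, which gives compact support in the interior; it equals
    one for \<open>x $ k \<ge> 2 * \<epsilon>\<close>, which confines the derivative to a thin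
    strip.\<close>
  define \<theta> where "\<theta> \<epsilon> x = step (x $ k / \<epsilon> - 1)" for \<epsilon> and x :: "real ^ 'm"
  define \<theta>' where "\<theta>' \<epsilon> x = step1 (x $ k / \<epsilon> - 1) / \<epsilon>" for \<epsilon> and x :: "real ^ 'm"
  have c\<theta>: "continuous_on T (\<theta> \<epsilon>)" "continuous_on T (\<theta>' \<epsilon>)" for \<epsilon> T
  proof -
    have "continuous_on T (\<lambda>x::real^'m. x $ k * inverse \<epsilon> - 1)" by (intro continuous_intros)
    then have "continuous_on T (\<lambda>x::real^'m. x $ k / \<epsilon> - 1)" by (simp add: divide_inverse)
    from continuous_on_compose2[OF step_cont(3)[of UNIV] this] continuous_on_compose2[OF step_cont(2)[of UNIV] this]
    show "continuous_on T (\<theta> \<epsilon>)" "continuous_on T (\<theta>' \<epsilon>)"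
      unfolding \<theta>_def[abs_def] \<theta>'_def[abs_def] divide_inverse by (auto intro!: continuous_on_mult)
  qed
  have eq: "(LINT x|lebesgue_on K. \<theta> \<epsilon> x * (V x \<bullet> g\<phi> x)) = - (LINT x|lebesgue_on K. \<theta>' \<epsilon> x * (\<phi> x * V x $ k))"
    if \<epsilon>: "0 < \<epsilon>" for \<epsilon>
  proof -
    define u where "u x = (if x \<in> S then \<phi> x * \<theta> \<epsilon> x else 0)" for x
    define gu where "gu x = (if x \<in> S then \<theta> \<epsilon> x *\<^sub>R g\<phi> x + (\<phi> x * \<theta>' \<epsilon> x) *\<^sub>R axis k 1 else 0)" for x
    define K' where "K' = {x. \<epsilon> \<le> x $ k} \<inter> cball 0 \<rho>"
    have K': "compact K'" unfolding K'_def
      by (intro closed_Int_compact compact_cball closed_Collect_le continuous_intros)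
    have K's: "K' \<subseteq> interior S" "K' \<subseteq> K" using \<rho>(1) \<epsilon> by (auto simp: K'_def iS K_def upper_half_def)
    have \<theta>0: "\<theta> \<epsilon> x = 0" "\<theta>' \<epsilon> x = 0" if "x $ k \<le> \<epsilon>" for x
      using that \<epsilon> step_0[of "x $ k / \<epsilon> - 1"] by (auto simp: \<theta>_def \<theta>'_def)
    have off: "u x = 0" "gu x = 0" if "x \<notin> K'" for x
      using that \<theta>0[of x] \<rho>(2,3)[of x] by (auto simp: u_def gu_def K'_def not_le)
    have du: "(u has_derivative (\<lambda>h. gu x \<bullet> h)) (at x)" and cgu: "continuous (at x) gu" for x
    proof -
      consider "x \<in> interior S" | "x \<in> - K'" using K's by blast
      then have "(u has_derivative (\<lambda>h. gu x \<bullet> h)) (at x) \<and> continuous (at x) gu"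
      proof cases
        case 1
        have xS: "x \<in> S" and at: "at x within S = at x" using 1 interior_subset at_within_interior by auto
        have "((\<lambda>x::real^'m. x $ k / \<epsilon> - 1) has_derivative (\<lambda>h. h $ k / \<epsilon>)) (at x)"
        proof -
          have "((\<lambda>x::real^'m. x $ k) has_derivative (\<lambda>h. h $ k)) (at x)"
            by (intro bounded_linear.has_derivative[OF bounded_linear_vec_nth] has_derivative_ident)
          from has_derivative_diff[OF has_derivative_mult_right[OF this, of "inverse \<epsilon>"] has_derivative_const[of 1]]
          show ?thesis by (simp add: divide_inverse mult.commute)
        qed
        from has_derivative_compose[OF this step_deriv[THEN has_field_derivative_imp_has_derivative]]
        have d\<theta>: "(\<theta> \<epsilon> has_derivative (\<lambda>h. \<theta>' \<epsilon> x * h $ k)) (at x)"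
          unfolding \<theta>_def[abs_def] \<theta>'_def by simp
        have "((\<lambda>x. \<phi> x * \<theta> \<epsilon> x) has_derivative (\<lambda>h. gu x \<bullet> h)) (at x)"
          using has_derivative_mult[OF \<phi>[OF xS, unfolded at] d\<theta>] xS
          by (rule_tac has_derivative_eq_rhs) (auto simp: gu_def fun_eq_iff inner_add_left inner_axis' algebra_simps)
        then have 2: "(u has_derivative (\<lambda>h. gu x \<bullet> h)) (at x)"
          by (rule has_derivative_transform_within_open[OF _ open_interior 1]) (use interior_subset in \<open>auto simp: u_def\<close>)
        have "continuous_on (interior S) (\<lambda>x. \<theta> \<epsilon> x *\<^sub>R g\<phi> x + (\<phi> x * \<theta>' \<epsilon> x) *\<^sub>R axis k 1)"
          by (intro continuous_intros c\<theta> continuous_on_subset[OF c\<phi>] continuous_on_subset[OF cg] interior_subset)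
        then have "continuous_on (interior S) gu"
          by (rule continuous_on_eq) (use interior_subset in \<open>auto simp: gu_def\<close>)
        then have "continuous (at x) gu" using 1 continuous_on_eq_continuous_at[OF open_interior] by blast
        with 2 show ?thesis ..
      next
        case 2
        have op: "open (- K')" using compact_imp_closed[OF K'] by (rule open_Compl)
        have "(u has_derivative (\<lambda>h. 0)) (at x)"
          by (rule has_derivative_transform_within_open[of "\<lambda>_. 0", OF _ op 2]) (use off in auto)
        moreover have "gu x = 0" using 2 off by simp
        moreover have "continuous_on (- K') gu" by (rule continuous_on_eq[of _ "\<lambda>_. 0"]) (use off in auto)
        then have "continuous (at x) gu" using 2 continuous_on_eq_continuous_at[OF op] by blast
        ultimately show ?thesis by simp
      qed
      then show "(u has_derivative (\<lambda>h. gu x \<bullet> h)) (at x)" "continuous (at x) gu" by auto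
    qed
    have "(LINT x|lebesgue_on (interior S). V x \<bullet> gu x) = 0"
      by (rule weak_form_C1[OF open_interior continuous_on_subset[OF cV interior_subset] weak du _ K' K's(1) off(1)])
        (use cgu in \<open>auto intro: continuous_at_imp_continuous_on\<close>)
    moreover have "(LINT x|lebesgue_on K'. V x \<bullet> gu x) = (LINT x|lebesgue_on (interior S). V x \<bullet> gu x)"
      by (rule integral_lebesgue_on_superset[OF K's(1)]) (use K' off in \<open>auto simp: borel_compact\<close>)
    moreover have "(LINT x|lebesgue_on K'. V x \<bullet> gu x) = (LINT x|lebesgue_on K. V x \<bullet> gu x)"
      by (rule integral_lebesgue_on_superset[OF K's(2) _ Ks]) (use K' off in \<open>auto simp: borel_compact\<close>)
    moreover have "(LINT x|lebesgue_on K. V x \<bullet> gu x) = (LINT x|lebesgue_on K. \<theta> \<epsilon> x * (V x \<bullet> g\<phi> x) + \<theta>' \<epsilon> x * (\<phi> x * V x $ k))"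
      by (rule Bochner_Integration.integral_cong) (use KS in \<open>auto simp: gu_def inner_add_right inner_axis mult_ac\<close>)
    moreover have "integrable (lebesgue_on K) (\<lambda>x. \<theta> \<epsilon> x * (V x \<bullet> g\<phi> x))" "integrable (lebesgue_on K) (\<lambda>x. \<theta>' \<epsilon> x * (\<phi> x * V x $ k))"
      by (intro integrable_on_compact[OF K] continuous_intros c\<theta> cK continuous_on_component)+
    ultimately show ?thesis by simp
  qed
  define I where "I = (LINT x|lebesgue_on K. V x \<bullet> g\<phi> x)"
  have cG: "continuous_on K (\<lambda>x. \<phi> x * V x $ k)" by (intro continuous_intros cK)
  have lim: "(\<lambda>n. LINT x|lebesgue_on K. \<theta> (1 / Suc n) x * (V x \<bullet> g\<phi> x)) \<longlonglongrightarrow> I"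
    unfolding I_def
  proof (rule integral_dominated_convergence)
    show "(\<lambda>x. V x \<bullet> g\<phi> x) \<in> borel_measurable (lebesgue_on K)" "(\<lambda>x. \<theta> (1 / Suc n) x * (V x \<bullet> g\<phi> x)) \<in> borel_measurable (lebesgue_on K)" for n
      by (intro borel_measurable_integrable integrable_on_compact[OF K] continuous_intros cK c\<theta>)+
    show "integrable (lebesgue_on K) (\<lambda>x. \<bar>V x \<bullet> g\<phi> x\<bar>)"
      by (intro integrable_on_compact[OF K] continuous_intros cK)
    show "AE x in lebesgue_on K. norm (\<theta> (1 / Suc n) x * (V x \<bullet> g\<phi> x)) \<le> \<bar>V x \<bullet> g\<phi> x\<bar>" for n
      using step_range by (auto simp: \<theta>_def abs_mult mult_left_le_one_le)
    have "negligible {x :: real ^ 'm. x $ k = 0}" by (rule negligible_standard_hyperplane_cart)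
    then have "AE x in lebesgue. x \<notin> {x :: real ^ 'm. x $ k = 0}" by (intro AE_not_in) (simp add: negligible_iff_null_sets)
    then have ae: "AE x in lebesgue_on K. x $ k \<noteq> 0"
      using Ks by (auto simp: AE_restrict_space_iff elim: eventually_mono)
    show "AE x in lebesgue_on K. (\<lambda>n. \<theta> (1 / Suc n) x * (V x \<bullet> g\<phi> x)) \<longlonglongrightarrow> V x \<bullet> g\<phi> x"
      using ae AE_space
    proof eventually_elim
      case (elim x)
      then have x: "0 < x $ k" by (auto simp: K_def upper_half_def)
      obtain n0 where n0: "2 / x $ k < real n0" using reals_Archimedean2 by blast
      have "\<theta> (1 / Suc n) x = 1" if "n0 \<le> n" for n
      proof -
        have "2 \<le> real n0 * x $ k" using n0 x by (simp add: field_simps)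
        also have "\<dots> \<le> real (Suc n) * x $ k" using that x by (intro mult_right_mono) auto
        finally show ?thesis using step_1[of "x $ k / (1 / Suc n) - 1"] by (simp add: \<theta>_def mult.commute)
      qed
      then have "\<forall>\<^sub>F n in sequentially. V x \<bullet> g\<phi> x = \<theta> (1 / Suc n) x * (V x \<bullet> g\<phi> x)"
        by (auto intro!: eventually_sequentiallyI[of n0])
      then show ?case by (rule Lim_transform_eventually[OF tendsto_const])
    qed
  qed
  have "- (\<eta> * (step_bound * 2 ^ CARD('m))) \<le> I" if \<eta>: "0 < \<eta>" for \<eta>
  proof -
    have "uniformly_continuous_on K (\<lambda>x. \<phi> x * V x $ k)" using compact_uniformly_continuous[OF cG K] .
    then obtain \<delta> where \<delta>: "0 < \<delta>" "\<And>x y. x \<in> K \<Longrightarrow> y \<in> K \<Longrightarrow> dist y x < \<delta> \<Longrightarrow> dist (\<phi> y * V y $ k) (\<phi> x * V x $ k) < \<eta>"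
      unfolding uniformly_continuous_on_def using \<eta> by blast
    have small: "\<phi> x * V x $ k \<le> \<eta>" if x: "x \<in> K" "x $ k < \<delta>" for x
    proof -
      \<comment> \<open>The projection to the flat boundary. It does not increase the norm, so it
        stays in \<open>K\<close>, and the sign condition there is carried back to \<open>x\<close>
        by uniform continuity.\<close>
      define y where "y = x - (x $ k) *\<^sub>R axis k 1"
      have xk: "0 \<le> x $ k" using x by (simp add: K_def upper_half_def)
      have yi: "y $ i = (if i = k then 0 else x $ i)" for i by (simp add: y_def axis_def)
      have "norm y \<le> norm x" by (rule norm_le_componentwise_cart) (simp add: yi)
      then have yK: "y \<in> K" using x by (simp add: K_def upper_half_def yi)
      have "dist x y < \<delta>" using x xk by (simp add: y_def dist_norm norm_axis_1)
      from \<delta>(2)[OF yK x(1) this] have "\<phi> x * V x $ k < \<phi> y * V y $ k + \<eta>" by (simp add: dist_real_def abs_less_iff)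
      moreover have "\<phi> y * V y $ k \<le> 0" using yK KS by (intro sign) (auto simp: yi)
      ultimately show ?thesis by linarith
    qed
    have bound: "- (\<eta> * (step_bound * 2 ^ CARD('m))) \<le> (LINT x|lebesgue_on K. \<theta> \<epsilon> x * (V x \<bullet> g\<phi> x))"
      if \<epsilon>: "0 < \<epsilon>" "2 * \<epsilon> < \<delta>" for \<epsilon>
    proof -
      define T where "T = {z \<in> K. z $ k \<le> 2 * \<epsilon>}"
      define c where "c = \<eta> * (step_bound / \<epsilon>)"
      have c0: "0 \<le> c" using \<eta> \<epsilon> step_bound(1) by (simp add: c_def)
      have "T = K \<inter> {z. z $ k \<le> 2 * \<epsilon>}" by (auto simp: T_def)
      then have Tc: "compact T" using K by (auto intro!: compact_Int_closed closed_Collect_le continuous_intros)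
      have Ts: "T \<in> sets lebesgue" "T \<subseteq> K" using Tc by (auto simp: borel_compact T_def)
      have ik: "integrable (lebesgue_on K) (\<lambda>x. indicator T x * c)"
        by (rule integrable_lebesgue_on_superset[OF Tc _ Ts(2) Ks], rule continuous_on_eq[of _ "\<lambda>_. c"]) auto
      have "(LINT x|lebesgue_on K. \<theta>' \<epsilon> x * (\<phi> x * V x $ k)) \<le> (LINT x|lebesgue_on K. indicator T x * c)"
      proof (rule integral_mono[OF _ ik])
        show "integrable (lebesgue_on K) (\<lambda>x. \<theta>' \<epsilon> x * (\<phi> x * V x $ k))"
          by (intro integrable_on_compact[OF K] continuous_intros c\<theta> cK)
        fix x assume "x \<in> space (lebesgue_on K)"
        then have x: "x \<in> K" by simp
        show "\<theta>' \<epsilon> x * (\<phi> x * V x $ k) \<le> indicator T x * c"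
        proof (cases "x \<in> T")
          case True
          have 1: "0 \<le> \<theta>' \<epsilon> x" "\<theta>' \<epsilon> x \<le> step_bound / \<epsilon>"
            using step1_nonneg step_bound(2) \<epsilon>(1) by (auto simp: \<theta>'_def abs_le_iff intro!: divide_right_mono)
          have "\<theta>' \<epsilon> x * (\<phi> x * V x $ k) \<le> \<theta>' \<epsilon> x * \<eta>"
            using True \<epsilon>(2) by (intro mult_left_mono 1 small[OF x]) (auto simp: T_def)
          also have "\<dots> \<le> step_bound / \<epsilon> * \<eta>" using 1 \<eta> by (intro mult_right_mono) auto
          finally show ?thesis using True by (simp add: c_def mult.commute)
        next
          case False
          then have "2 \<le> x $ k / \<epsilon>" using x \<epsilon>(1) by (simp add: T_def field_simps)
          then have "\<theta>' \<epsilon> x = 0" using step_1[of "x $ k / \<epsilon> - 1"] by (simp add: \<theta>'_def)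
          then show ?thesis using False by simp
        qed
      qed
      also have "\<dots> = (LINT x|lebesgue_on T. c)"
      proof -
        have "(LINT x|lebesgue_on T. indicator T x * c) = (LINT x|lebesgue_on K. indicator T x * c)"
          by (rule integral_lebesgue_on_superset[OF Ts(2,1) Ks]) auto
        moreover have "(LINT x|lebesgue_on T. indicator T x * c) = (LINT x|lebesgue_on T. c)"
          by (rule Bochner_Integration.integral_cong) auto
        ultimately show ?thesis by (rule trans[OF sym])
      qed
      also have "\<dots> = measure lebesgue T * c"
        using Ts(1) by (simp add: measure_restrict_space)
      also have "\<dots> \<le> (2 ^ CARD('m) * \<epsilon>) * c"
      proof (rule mult_right_mono[OF _ c0])
        have "T \<subseteq> {z \<in> upper_half k \<inter> cball 0 1. z $ k \<le> 2 * \<epsilon>}" using \<rho>(1) by (auto simp: T_def K_def)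
        moreover have "{z \<in> upper_half k \<inter> cball 0 1. z $ k \<le> 2 * \<epsilon>} \<in> lmeasurable"
        proof -
          have "{z \<in> upper_half k \<inter> cball 0 1. z $ k \<le> 2 * \<epsilon>} = (upper_half k \<inter> {z. z $ k \<le> 2 * \<epsilon>}) \<inter> cball 0 1" by auto
          moreover have "compact \<dots>" by (intro closed_Int_compact closed_Int compact_cball closed_upper_half closed_Collect_le continuous_intros)
          ultimately show ?thesis by (simp add: lmeasurable_compact)
        qed
        ultimately have "measure lebesgue T \<le> measure lebesgue {z \<in> upper_half k \<inter> cball 0 1. z $ k \<le> 2 * \<epsilon>}"
          using Ts(1) by (intro measure_mono_fmeasurable)
        then show "measure lebesgue T \<le> 2 ^ CARD('m) * \<epsilon>" using strip_measure[OF \<epsilon>(1), of k] by linarith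
      qed
      also have "\<dots> = \<eta> * (step_bound * 2 ^ CARD('m))" using \<epsilon>(1) by (simp add: c_def)
      finally show ?thesis unfolding eq[OF \<epsilon>(1)] by simp
    qed
    obtain n0 where n0: "2 / \<delta> < real n0" using reals_Archimedean2 by blast
    have "2 * (1 / real (Suc n)) < \<delta>" if "n0 \<le> n" for n
    proof -
      have "2 < real n0 * \<delta>" using n0 \<delta>(1) by (simp add: field_simps)
      also have "\<dots> \<le> real (Suc n) * \<delta>" using that \<delta>(1) by (intro mult_right_mono) auto
      finally show ?thesis by (simp add: pos_divide_less_eq mult.commute)
    qed
    then show ?thesis
      by (intro LIMSEQ_le_const[OF lim] exI[of _ n0] allI impI bound) auto
  qed
  note I = this
  have "0 \<le> I"
  proof (rule ccontr)
    assume "\<not> 0 \<le> I"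
    then have I0: "I < 0" by simp
    define M where "M = step_bound * 2 ^ CARD('m)"
    have M: "0 \<le> M" using step_bound(1) by (simp add: M_def)
    define c where "c = - I / (2 * (M + 1))"
    have c: "0 < c" using I0 M by (auto simp: c_def intro!: divide_neg_pos)
    have "c * (2 * (M + 1)) = - I" using M by (simp add: c_def)
    then have "2 * (c * M) + 2 * c = - I" by (simp add: algebra_simps)
    moreover have "- (c * M) \<le> I" using I[OF c] by (simp add: M_def)
    ultimately show False using I0 c by linarith
  qed
  then show ?thesis by (simp add: I_def K_def)
qed

text \<open>The test function is \<open>F(q)\<close> times \<open>v\<close>, centred at
  \<open>y\<close>. Differentiability of \<open>v\<close> is asked only near \<open>y\<close>,
  because a dilated \<open>w\<close> is controlled only there; the vanishing of \<open>F\<close>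
  allows the extension by zero.\<close>

lemma radial_variational_inequality:
  fixes V :: "real ^ 'm::finite \<Rightarrow> real ^ 'm" and k :: 'm and y :: "real ^ 'm" and P :: "real ^ 'm ^ 'm"
    and F F' :: "real \<Rightarrow> real" and R :: real
  defines "S \<equiv> upper_half k \<inter> ball 0 1"
  assumes cV: "continuous_on S V"
    and weak: "\<And>\<phi>. \<phi> \<in> test_functions (interior S) \<Longrightarrow>
      (LINT x|lebesgue_on (interior S). (\<Sum>i\<in>UNIV. V x $ i * partial_deriv UNIV i \<phi> x)) = 0"
    and y: "y $ k = 0" and R: "0 < R" "norm y + R < 1"
    and P: "\<And>x z. x \<bullet> (P *v z) = (P *v x) \<bullet> z"
    and F: "\<And>q. (F has_real_derivative F' q) (at q)" "continuous_on UNIV F'"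
      "\<And>z. norm z \<ge> R / 2 \<Longrightarrow> F (z \<bullet> (P *v z)) = 0 \<and> F' (z \<bullet> (P *v z)) = 0"
    and v: "\<And>x. x \<in> S \<Longrightarrow> dist x y < R \<Longrightarrow> (v has_derivative (\<lambda>h. gv x \<bullet> h)) (at x within S)"
      "continuous_on (S \<inter> ball y R) gv"
    and sign: "\<And>x. x \<in> S \<Longrightarrow> x $ k = 0 \<Longrightarrow> dist x y < R \<Longrightarrow> F ((x - y) \<bullet> (P *v (x - y))) * v x * V x $ k \<le> 0"
  shows "0 \<le> (LINT z|lebesgue_on (upper_half k \<inter> cball 0 R). F (z \<bullet> (P *v z)) * (V (y + z) \<bullet> gv (y + z))
    + 2 * F' (z \<bullet> (P *v z)) * v (y + z) * (V (y + z) \<bullet> (P *v z)))"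
proof -
  define q where "q x = (x - y) \<bullet> (P *v (x - y))" for x
  define \<phi> where "\<phi> x = (if dist x y < R then F (q x) * v x else 0)" for x
  define g\<phi> where "g\<phi> x = (if dist x y < R then F (q x) *\<^sub>R gv x + (2 * F' (q x) * v x) *\<^sub>R (P *v (x - y)) else 0)" for x
  let ?K = "upper_half k \<inter> cball 0 (norm y + R)" and ?K' = "upper_half k \<inter> cball 0 R"
  have far: "F (q x) = 0" "F' (q x) = 0" if "R / 2 \<le> dist x y" for x
    using F(3)[of "x - y"] that by (auto simp: q_def dist_norm)
  have far': "\<phi> x = 0" "g\<phi> x = 0" if "R / 2 \<le> dist x y" for x
    using far[OF that] by (auto simp: \<phi>_def g\<phi>_def)
  have dq: "(q has_derivative (\<lambda>h. 2 * ((P *v (x - y)) \<bullet> h))) (at x within S)" for x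
  proof -
    have "((\<lambda>x. P *v (x - y)) has_derivative (\<lambda>h. P *v h)) (at x within S)"
      by (rule bounded_linear.has_derivative[OF matrix_vector_mul_bounded_linear, THEN has_derivative_eq_rhs])
        (auto intro!: derivative_eq_intros)
    moreover have "((\<lambda>x. x - y) has_derivative (\<lambda>h. h)) (at x within S)"
      by (auto intro!: derivative_eq_intros)
    ultimately
    have "(q has_derivative (\<lambda>h. (x - y) \<bullet> (P *v h) + h \<bullet> (P *v (x - y)))) (at x within S)"
      unfolding q_def[abs_def] by (intro has_derivative_inner)
    then show ?thesis by (rule has_derivative_eq_rhs) (auto simp: fun_eq_iff P inner_commute)
  qed
  have cq: "continuous_on T q" for T
    unfolding q_def[abs_def] by (intro continuous_intros)
  have cF: "continuous_on T (\<lambda>x. F (q x))" "continuous_on T (\<lambda>x. F' (q x))" for T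
    using continuous_on_compose2[of UNIV F T q] continuous_on_compose2[OF F(2) cq] cq
      DERIV_isCont[OF F(1)] by (auto intro: continuous_at_imp_continuous_on)
  have cg: "continuous_on S g\<phi>"
  proof -
    let ?A = "S \<inter> ball y R" and ?B = "S \<inter> - cball y (R / 2)"
    have AB: "?A \<union> ?B = S" using R(1) by auto
    have cv: "continuous_on ?A v"
      unfolding continuous_on_eq_continuous_within
    proof
      fix x assume x: "x \<in> ?A"
      have "continuous (at x within S) v" by (rule has_derivative_continuous[OF v(1)]) (use x in \<open>auto simp: dist_commute\<close>)
      then show "continuous (at x within ?A) v" by (rule continuous_within_subset) simp
    qed
    have "continuous_on (?A \<union> ?B) g\<phi>"
    proof (rule continuous_on_Un_local_open)
      show "openin (top_of_set (?A \<union> ?B)) ?A" "openin (top_of_set (?A \<union> ?B)) ?B"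
        unfolding AB by (auto intro!: openin_open_Int)
      have "continuous_on ?A (\<lambda>x. F (q x) *\<^sub>R gv x + (2 * F' (q x) * v x) *\<^sub>R (P *v (x - y)))"
        by (intro continuous_intros cF v cv)
      then show "continuous_on ?A g\<phi>"
        by (rule continuous_on_eq) (auto simp: g\<phi>_def dist_commute)
      show "continuous_on ?B g\<phi>"
        by (rule continuous_on_eq[of _ "\<lambda>_. 0"]) (auto simp: far' dist_commute)
    qed
    then show ?thesis unfolding AB .
  qed
  have "0 \<le> (LINT x|lebesgue_on ?K. V x \<bullet> g\<phi> x)"
  proof (rule flat_variational_inequality[OF cV[unfolded S_def] weak[unfolded S_def]])
    show "(\<phi> has_derivative (\<lambda>h. g\<phi> x \<bullet> h)) (at x within upper_half k \<inter> ball 0 1)" if "x \<in> upper_half k \<inter> ball 0 1" for x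
      unfolding S_def[symmetric]
    proof (cases "dist x y < R")
      case True
      have xS: "x \<in> S" using that by (simp add: S_def)
      have "((\<lambda>x. F (q x)) has_derivative (\<lambda>h. F' (q x) * (2 * ((P *v (x - y)) \<bullet> h)))) (at x within S)"
        using has_derivative_compose[OF dq F(1)[THEN has_field_derivative_imp_has_derivative]] by simp
      from has_derivative_mult[OF this v(1)[OF xS True]]
      have "((\<lambda>x. F (q x) * v x) has_derivative (\<lambda>h. g\<phi> x \<bullet> h)) (at x within S)"
        by (rule has_derivative_eq_rhs) (use True in \<open>auto simp: g\<phi>_def fun_eq_iff inner_add_left algebra_simps\<close>)
      then show "(\<phi> has_derivative (\<lambda>h. g\<phi> x \<bullet> h)) (at x within S)"
      proof (rule has_derivative_transform_within[where d="R - dist x y"])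
        fix x' assume "dist x' x < R - dist x y"
        then have "dist x' y < R" using dist_triangle[of x' y x] by linarith
        then show "F (q x') * v x' = \<phi> x'" by (simp add: \<phi>_def)
      qed (use True xS in auto)
    next
      case False
      have xS: "x \<in> S" using that by (simp add: S_def)
      have "((\<lambda>x. 0) has_derivative (\<lambda>h. g\<phi> x \<bullet> h)) (at x within S)"
        using False by (simp add: g\<phi>_def)
      then show "(\<phi> has_derivative (\<lambda>h. g\<phi> x \<bullet> h)) (at x within S)"
      proof (rule has_derivative_transform_within[where d="R / 2"])
        fix x' assume "dist x' x < R / 2"
        then have "R / 2 \<le> dist x' y" using False dist_triangle[of x y x'] by (simp add: dist_commute)
        then show "0 = \<phi> x'" by (simp add: far')
      qed (use R xS in auto)
    qed
    show "continuous_on (upper_half k \<inter> ball 0 1) g\<phi>" using cg by (simp only: S_def)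
    show "norm y + R < 1" by (rule R)
    have *: "R / 2 \<le> dist x y" if "norm y + R \<le> norm x" for x
      using that R(1) norm_triangle_ineq2[of x y] by (simp add: dist_norm)
    show "\<phi> x = 0" "g\<phi> x = 0" if "norm y + R \<le> norm x" for x using far'[OF *[OF that]] .
    show "\<phi> x * V x $ k \<le> 0" if "x \<in> upper_half k \<inter> ball 0 1" "x $ k = 0" for x
      using sign[of x] that by (auto simp: \<phi>_def q_def S_def)
  qed
  moreover have "(LINT x|lebesgue_on ?K. V x \<bullet> g\<phi> x) = \<bar>1\<bar> ^ DIM(real ^ 'm) * (LINT z|lebesgue_on ?K'. V (y + 1 *\<^sub>R z) \<bullet> g\<phi> (y + 1 *\<^sub>R z))"
  proof (rule integral_affine_compact)
    have KS: "?K \<subseteq> S" using R by (auto simp: S_def)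
    show "compact ?K" "compact ?K'" by (auto intro!: closed_Int_compact closed_upper_half)
    show "continuous_on ?K (\<lambda>x. V x \<bullet> g\<phi> x)"
      by (intro continuous_intros continuous_on_subset[OF cV KS] continuous_on_subset[OF cg KS])
    then show "continuous_on ?K' (\<lambda>z. V (y + 1 *\<^sub>R z) \<bullet> g\<phi> (y + 1 *\<^sub>R z))"
    proof (rule continuous_on_compose2)
      show "(\<lambda>z. y + 1 *\<^sub>R z) ` ?K' \<subseteq> ?K"
        using y by (auto simp: upper_half_def intro!: order.trans[OF norm_triangle_ineq])
    qed (intro continuous_intros)
    show "indicator ?K (y + 1 *\<^sub>R z) * (V (y + 1 *\<^sub>R z) \<bullet> g\<phi> (y + 1 *\<^sub>R z)) = indicator ?K' z * (V (y + 1 *\<^sub>R z) \<bullet> g\<phi> (y + 1 *\<^sub>R z))" for z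
    proof (cases "norm z < R")
      case True
      then have "norm (y + z) \<le> norm y + R" using norm_triangle_ineq[of y z] by linarith
      then show ?thesis using True y by (auto simp: indicator_def upper_half_def)
    next
      case False
      then show ?thesis using far'(2)[of "y + z"] R(1) by (simp add: dist_norm)
    qed
  qed simp
  moreover have "(LINT z|lebesgue_on ?K'. V (y + 1 *\<^sub>R z) \<bullet> g\<phi> (y + 1 *\<^sub>R z)) =
    (LINT z|lebesgue_on ?K'. F (z \<bullet> (P *v z)) * (V (y + z) \<bullet> gv (y + z)) + 2 * F' (z \<bullet> (P *v z)) * v (y + z) * (V (y + z) \<bullet> (P *v z)))"
  proof (rule Bochner_Integration.integral_cong[OF refl])
    fix z :: "real ^ 'm"
    show "V (y + 1 *\<^sub>R z) \<bullet> g\<phi> (y + 1 *\<^sub>R z) =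
      F (z \<bullet> (P *v z)) * (V (y + z) \<bullet> gv (y + z)) + 2 * F' (z \<bullet> (P *v z)) * v (y + z) * (V (y + z) \<bullet> (P *v z))"
      using F(3)[of z] R(1) by (cases "norm z < R") (auto simp: g\<phi>_def q_def dist_norm inner_add_right)
  qed
  ultimately show ?thesis by simp
qed

section \<open>Ellipticity\<close>

lemma quadratic_nonneg_linear_zero:
  fixes b c :: real
  assumes "\<And>t. 0 \<le> 2 * t * b + t\<^sup>2 * c"
  shows "b = 0"
proof (rule ccontr)
  assume b: "b \<noteq> 0"
  define t where "t = - b / (\<bar>c\<bar> + 1)"
  have "t * (\<bar>c\<bar> + 1) = - b" by (simp add: t_def)
  then have "b = - (t * (\<bar>c\<bar> + 1))" by simp
  then have tb: "t * b = - (t\<^sup>2 * (\<bar>c\<bar> + 1))" by (simp add: power2_eq_square)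
  have "t \<noteq> 0" using b by (simp add: t_def add_nonneg_eq_0_iff)
  then have t: "0 < t\<^sup>2" by simp
  have "t\<^sup>2 * c \<le> t\<^sup>2 * \<bar>c\<bar>" by (intro mult_left_mono) auto
  moreover have "0 \<le> 2 * (t * b) + t\<^sup>2 * c" using assms[of t] by (simp add: mult.assoc)
  ultimately have "0 \<le> - (t\<^sup>2 * \<bar>c\<bar>) - 2 * t\<^sup>2" unfolding tb by (simp add: algebra_simps)
  moreover have "0 \<le> t\<^sup>2 * \<bar>c\<bar>" by simp
  ultimately show False using t by linarith
qed

text \<open>A maximiser of the quadratic form on the unit sphere is an eigenvector, since the first
  variation vanishes there. Applied to \<open>- A\<close> this also yields the lower ellipticity
  bound.\<close>

lemma symmetric_max_eigenvalue:
  fixes A :: "real ^ 'm ^ 'm::finite"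
  assumes sym: "\<And>x y. (A *v x) \<bullet> y = x \<bullet> (A *v y)"
  shows "\<exists>\<mu>. eigenvalue_of A \<mu> \<and> (\<forall>x. (A *v x) \<bullet> x \<le> \<mu> * (norm x)\<^sup>2)"
proof -
  have ne: "sphere (0 :: real ^ 'm) 1 \<noteq> {}" by simp
  have "continuous_on (sphere (0 :: real ^ 'm) 1) (\<lambda>x. (A *v x) \<bullet> x)" by (intro continuous_intros)
  from continuous_attains_sup[OF compact_sphere ne this]
  obtain v where v: "norm v = 1" "\<And>x. norm x = 1 \<Longrightarrow> (A *v x) \<bullet> x \<le> (A *v v) \<bullet> v" by auto
  define \<mu> where "\<mu> = (A *v v) \<bullet> v"
  have le: "(A *v x) \<bullet> x \<le> \<mu> * (norm x)\<^sup>2" for x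
  proof (cases "x = 0")
    case False
    have "(A *v (x /\<^sub>R norm x)) \<bullet> (x /\<^sub>R norm x) \<le> \<mu>" unfolding \<mu>_def by (rule v(2)) (use False in simp)
    then have "((A *v x) \<bullet> x) / (norm x)\<^sup>2 \<le> \<mu>" by (simp add: matrix_vector_mult_scaleR power2_eq_square divide_inverse mult_ac)
    then show ?thesis using False by (simp add: divide_le_eq)
  qed simp
  have "(\<mu> *\<^sub>R v - A *v v) \<bullet> h = 0" for h
  proof (rule quadratic_nonneg_linear_zero)
    fix t :: real
    have "0 \<le> \<mu> * (norm (v + t *\<^sub>R h))\<^sup>2 - (A *v (v + t *\<^sub>R h)) \<bullet> (v + t *\<^sub>R h)" using le by simp
    also have nv: "(norm (v + t *\<^sub>R h))\<^sup>2 = (norm v)\<^sup>2 + 2 * t * (v \<bullet> h) + t\<^sup>2 * (norm h)\<^sup>2"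
      unfolding power2_norm_eq_inner by (simp add: inner_add_left inner_add_right power2_eq_square inner_commute algebra_simps)
    also have "\<mu> * ((norm v)\<^sup>2 + 2 * t * (v \<bullet> h) + t\<^sup>2 * (norm h)\<^sup>2) - (A *v (v + t *\<^sub>R h)) \<bullet> (v + t *\<^sub>R h) = \<mu> * ((norm v)\<^sup>2 + 2 * t * (v \<bullet> h) + t\<^sup>2 * (norm h)\<^sup>2)
        - (\<mu> + 2 * t * ((A *v v) \<bullet> h) + t\<^sup>2 * ((A *v h) \<bullet> h))"
      using sym[of h v]
      by (simp add: \<mu>_def inner_add_left inner_add_right matrix_vector_right_distrib
          matrix_vector_mult_scaleR power2_eq_square inner_commute algebra_simps)
    also have "\<dots> = 2 * t * ((\<mu> *\<^sub>R v - A *v v) \<bullet> h) + t\<^sup>2 * (\<mu> * (norm h)\<^sup>2 - (A *v h) \<bullet> h)"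
      using v(1) by (simp add: inner_diff_left algebra_simps)
    finally show "0 \<le> 2 * t * ((\<mu> *\<^sub>R v - A *v v) \<bullet> h) + t\<^sup>2 * (\<mu> * (norm h)\<^sup>2 - (A *v h) \<bullet> h)" .
  qed
  then have "(\<mu> *\<^sub>R v - A *v v) \<bullet> (\<mu> *\<^sub>R v - A *v v) = 0" .
  then have "A *v v = \<mu> *\<^sub>R v" by simp
  moreover have "v \<noteq> 0" using v(1) by auto
  ultimately show ?thesis using le unfolding eigenvalue_of_def by blast
qed

locale elliptic_matrix =
  fixes A :: "real ^ 'm ^ 'm::finite"
  assumes transpose: "transpose A = A"
    and eigen: "\<And>\<mu>. eigenvalue_of A \<mu> \<Longrightarrow> 1 / 2 \<le> \<mu> \<and> \<mu> \<le> 2"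
begin

lemma sym: "(A *v x) \<bullet> y = x \<bullet> (A *v y)"
  using dot_lmul_matrix[of x A y] transpose_matrix_vector[of A x] by (simp add: transpose)

lemma upper: "(A *v x) \<bullet> x \<le> 2 * (norm x)\<^sup>2"
proof -
  obtain \<mu> where \<mu>: "eigenvalue_of A \<mu>" "(A *v x) \<bullet> x \<le> \<mu> * (norm x)\<^sup>2"
    using symmetric_max_eigenvalue[OF sym] by blast
  have "\<mu> * (norm x)\<^sup>2 \<le> 2 * (norm x)\<^sup>2" using eigen[OF \<mu>(1)] by (intro mult_right_mono) auto
  with \<mu>(2) show ?thesis by linarith
qed

lemma lower: "(norm x)\<^sup>2 / 2 \<le> (A *v x) \<bullet> x"
proof -
  have m: "(- A) *v x = - (A *v x)" for x
    by (simp add: vec_eq_iff matrix_vector_mult_def sum_negf)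
  obtain \<mu> where \<mu>: "eigenvalue_of (- A) \<mu>" "((- A) *v x) \<bullet> x \<le> \<mu> * (norm x)\<^sup>2"
    using symmetric_max_eigenvalue[of "- A"] sym by (auto simp: m)
  have "eigenvalue_of A (- \<mu>)" using \<mu>(1) by (auto simp: eigenvalue_of_def m minus_equation_iff[of "A *v _"])
  from eigen[OF this] have "\<mu> * (norm x)\<^sup>2 \<le> - (1 / 2) * (norm x)\<^sup>2" by (intro mult_right_mono) auto
  with \<mu>(2) show ?thesis by (simp add: m)
qed

text \<open>Evaluating the nonnegative form at x - A x / 2 and using \<open>upper\<close> for A x
  replaces an argument with the square root of \<open>A\<close>. It also yields the lower bound for
  the inverse.\<close>

lemma norm_sq_le: "(norm (A *v x))\<^sup>2 \<le> 2 * ((A *v x) \<bullet> x)"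
proof -
  define z where "z = x - (1 / 2) *\<^sub>R (A *v x)"
  have "0 \<le> (A *v z) \<bullet> z" using lower[of z] by (rule order.trans[rotated]) simp
  also have "\<dots> = (A *v x) \<bullet> x - (norm (A *v x))\<^sup>2 + (1 / 4) * ((A *v (A *v x)) \<bullet> (A *v x))"
    using sym[of "A *v x" x]
    by (simp add: z_def power2_norm_eq_inner inner_diff_left inner_diff_right matrix_vector_mult_diff_distrib
        matrix_vector_mult_scaleR inner_commute algebra_simps)
  finally show ?thesis using upper[of "A *v x"] by simp
qed

lemma norm_le: "norm (A *v x) \<le> 2 * norm x"
proof (rule power2_le_imp_le)
  show "(norm (A *v x))\<^sup>2 \<le> (2 * norm x)\<^sup>2"
    using norm_sq_le[of x] upper[of x] by (simp add: power_mult_distrib)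
qed simp

lemma inverse_mult: "A *v (matrix_inv A *v z) = z"
proof -
  have "x = 0" if "A *v x = 0" for x using lower[of x] that by simp
  then have "invertible A"
    by (simp add: invertible_left_inverse matrix_left_invertible_ker)
  then have "\<exists>B. A ** B = mat 1 \<and> B ** A = mat 1" by (simp add: invertible_def)
  from someI_ex[OF this] have "A ** matrix_inv A = mat 1" by (simp add: matrix_inv_def)
  then show ?thesis by (simp add: matrix_vector_mul_assoc)
qed

lemma inverse_sym: "x \<bullet> (matrix_inv A *v z) = (matrix_inv A *v x) \<bullet> z"
  using sym[of "matrix_inv A *v x" "matrix_inv A *v z"] by (simp add: inverse_mult)

lemma inverse_lower: "(norm z)\<^sup>2 / 2 \<le> z \<bullet> (matrix_inv A *v z)"
  using norm_sq_le[of "matrix_inv A *v z"] by (simp add: inverse_mult)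

lemma inverse_norm_le: "norm (matrix_inv A *v z) \<le> 2 * norm z"
proof (cases "matrix_inv A *v z = 0")
  case False
  define u where "u = matrix_inv A *v z"
  have "(norm u)\<^sup>2 / 2 \<le> z \<bullet> u" using lower[of u] by (simp add: u_def inverse_mult)
  also have "\<dots> \<le> norm z * norm u" by (rule norm_cauchy_schwarz)
  finally have "norm u * norm u \<le> (2 * norm z) * norm u" by (simp add: power2_eq_square)
  then show ?thesis using False by (simp add: u_def)
qed simp

end

section \<open>The thin obstacle problem\<close>

locale thin_obstacle_problem =
  fixes a :: "real ^ ('n::finite option) \<Rightarrow> real ^ ('n option) ^ ('n option)"
    and w :: "real ^ ('n option) \<Rightarrow> real"
    and p :: ereal
    and \<alpha> :: real
  assumes A1: "\<forall>x\<in>flat_ball 1. \<forall>i. a x $ Some i $ None = 0"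
    and A2: "\<forall>x\<in>half_ball 0 1. transpose (a x) = a x"
      "\<forall>x\<in>half_ball 0 1. \<forall>\<mu>. eigenvalue_of (a x) \<mu> \<longrightarrow> 1 / 2 \<le> \<mu> \<and> \<mu> \<le> 2"
    and p: "ereal (real CARD('n) + 1) < p"
    and A3: "\<forall>i j. in_W1p p (interior (half_ball 0 1)) (\<lambda>x. a x $ i $ j)"
      "continuous_on (half_ball 0 1) a"
    and W: "0 < \<alpha>" "C1_holder_locally \<alpha> (half_ball 0 1) w"
    and solution: "thin_obstacle_solution a w"
begin

abbreviation N :: "'n option" where "N \<equiv> None"

definition gw :: "real ^ ('n option) \<Rightarrow> real ^ ('n option)"
  where "gw x = (\<chi> j. partial_deriv (half_ball 0 1) j w x)"

definition V :: "real ^ ('n option) \<Rightarrow> real ^ ('n option)"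
  where "V x = a x *v gw x"

lemma half_ball_eq: "half_ball 0 1 = upper_half N \<inter> ball 0 1"
  by (auto simp: half_ball_def upper_half_def)

lemma mem_half: "x \<in> half_ball 0 1 \<longleftrightarrow> 0 \<le> x $ N \<and> norm x < 1"
  by (simp add: half_ball_def)

lemma w_deriv: "x \<in> half_ball 0 1 \<Longrightarrow> (w has_derivative (\<lambda>h. gw x \<bullet> h)) (at x within half_ball 0 1)"
proof -
  assume x: "x \<in> half_ball 0 1"
  define f where "f = frechet_derivative w (at x within half_ball 0 1)"
  have "w differentiable (at x within half_ball 0 1)"
    using W(2) x by (simp add: C1_holder_locally_def differentiable_on_def)
  then have d: "(w has_derivative f) (at x within half_ball 0 1)"
    unfolding f_def by (rule frechet_derivative_works[THEN iffD1])
  have "f h = gw x \<bullet> h" for h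
  proof -
    have l: "linear f" using d by (rule has_derivative_linear)
    have "f h = f (\<Sum>i\<in>UNIV. h $ i *\<^sub>R axis i 1)" 
      using basis_expansion[of h] by (simp add: scalar_mult_eq_scaleR)
    also have "\<dots> = (\<Sum>i\<in>UNIV. h $ i * f (axis i 1))"
      using l by (simp add: linear_sum linear_scale)
    finally show ?thesis by (simp add: inner_vec_def gw_def partial_deriv_def f_def mult.commute)
  qed
  then have "f = (\<lambda>h. gw x \<bullet> h)" by blast
  with d show ?thesis by simp
qed

text \<open>The Hoelder bound is available on compact sets only; a small closed half ball around the
  point, still inside the domain, carries the argument.\<close>

lemma cont_gw: "continuous_on (half_ball 0 1) gw"
proof -
  have "continuous_on (half_ball 0 1) (partial_deriv (half_ball 0 1) j w)" for j
    unfolding continuous_on_eq_continuous_within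
  proof
    fix x :: "real ^ ('n option)" assume x: "x \<in> half_ball 0 1"
    define r where "r = (1 - norm x) / 2"
    have r: "0 < r" using x by (simp add: r_def mem_half)
    define K where "K = upper_half N \<inter> cball x r"
    have "compact K" by (simp add: K_def closed_Int_compact closed_upper_half)
    moreover have KS: "K \<subseteq> half_ball 0 1"
    proof
      fix z assume z: "z \<in> K"
      then have "norm z \<le> norm x + r" using norm_triangle_ineq2[of z x] by (simp add: K_def dist_norm norm_minus_commute)
      also have "\<dots> < 1" using x by (simp add: r_def mem_half field_simps)
      finally show "z \<in> half_ball 0 1" using z by (simp add: K_def mem_half upper_half_def)
    qed
    ultimately have cK: "compact K \<and> K \<subseteq> half_ball 0 1" ..
    have "\<forall>K i. compact K \<and> K \<subseteq> half_ball 0 1 \<longrightarrow> (\<exists>C. \<forall>x\<in>K. \<forall>y\<in>K.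
        \<bar>partial_deriv (half_ball 0 1) i w x - partial_deriv (half_ball 0 1) i w y\<bar> \<le> C * dist x y powr \<alpha>)"
      using W(2) unfolding C1_holder_locally_def by (rule conjunct2)
    from this[rule_format, OF cK, of j] obtain C where C: "\<And>z z'. z \<in> K \<Longrightarrow> z' \<in> K \<Longrightarrow>
        \<bar>partial_deriv (half_ball 0 1) j w z - partial_deriv (half_ball 0 1) j w z'\<bar> \<le> C * dist z z' powr \<alpha>"
      by metis
    have xK: "x \<in> K" using x r by (simp add: K_def upper_half_def mem_half)
    show "continuous (at x within half_ball 0 1) (partial_deriv (half_ball 0 1) j w)"
      unfolding continuous_within
    proof -
      have "at x within half_ball 0 1 = at x within K"
        by (rule at_within_nhd[of x "ball x r"]) (use KS r in \<open>auto simp: K_def mem_half upper_half_def\<close>)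
      moreover have "(partial_deriv (half_ball 0 1) j w \<longlongrightarrow> partial_deriv (half_ball 0 1) j w x) (at x within K)"
      proof (rule LIM_zero_cancel, rule tendsto_rabs_zero_cancel, rule tendsto_sandwich[OF _ _ tendsto_const])
        show "\<forall>\<^sub>F z in at x within K. 0 \<le> \<bar>partial_deriv (half_ball 0 1) j w z - partial_deriv (half_ball 0 1) j w x\<bar>" by simp
        show "\<forall>\<^sub>F z in at x within K. \<bar>partial_deriv (half_ball 0 1) j w z - partial_deriv (half_ball 0 1) j w x\<bar> \<le> C * dist z x powr \<alpha>"
          using C[OF _ xK] by (auto simp: eventually_at_topological)
        have "((\<lambda>z. C * dist z x powr \<alpha>) \<longlongrightarrow> C * (0 powr \<alpha>)) (at x within K)"
        proof (intro tendsto_mult tendsto_const tendsto_powr2)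
          show "((\<lambda>z. dist z x) \<longlongrightarrow> 0) (at x within K)"
            using tendsto_dist[OF tendsto_ident_at tendsto_const[of x], of x K] by simp
        qed (use W in auto)
        then show "((\<lambda>z. C * dist z x powr \<alpha>) \<longlongrightarrow> 0) (at x within K)" by simp
      qed
      ultimately show "(partial_deriv (half_ball 0 1) j w \<longlongrightarrow> partial_deriv (half_ball 0 1) j w x) (at x within half_ball 0 1)"
        by simp
    qed
  qed
  then show ?thesis unfolding gw_def[abs_def] by (intro continuous_on_vec_lambda) auto
qed

lemma cont_w: "continuous_on (half_ball 0 1) w"
  unfolding continuous_on_eq_continuous_within using has_derivative_continuous[OF w_deriv] by blast

lemma cont_V: "continuous_on (half_ball 0 1) V"
  unfolding V_def[abs_def] by (intro continuous_intros A3 cont_gw)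

lemma weak:
  assumes "\<phi> \<in> test_functions (interior (half_ball 0 1))"
  shows "(LINT x|lebesgue_on (interior (half_ball 0 1)). (\<Sum>i\<in>UNIV. V x $ i * partial_deriv UNIV i \<phi> x)) = 0"
proof -
  have "(\<Sum>i\<in>UNIV. V x $ i * partial_deriv UNIV i \<phi> x) =
    (\<Sum>i\<in>UNIV. \<Sum>j\<in>UNIV. a x $ i $ j * partial_deriv (half_ball 0 1) j w x * partial_deriv UNIV i \<phi> x)" for x
    by (simp add: V_def matrix_vector_mult_def gw_def sum_distrib_right)
  then show ?thesis using solution assms by (simp add: thin_obstacle_solution_def weak_solution_on_def)
qed

lemma elliptic: "x \<in> half_ball 0 1 \<Longrightarrow> elliptic_matrix (a x)"
  by unfold_locales (use A2 in auto)

lemma flat: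
  assumes "x \<in> half_ball 0 1" "x $ N = 0"
  shows "0 \<le> w x" "V x $ N \<le> 0" "w x * V x $ N = 0"
proof -
  have xf: "x \<in> flat_ball 1" using assms by (simp add: flat_ball_def)
  interpret elliptic_matrix "a x" by (rule elliptic[OF assms(1)])
  \<comment> \<open>The assumption concerns column \<open>N\<close>; symmetry turns it into row
    \<open>N\<close>, the one that enters \<open>V x $ N\<close>.\<close>
  have off: "a x $ N $ Some i = 0" for i
  proof -
    have "a x $ N $ Some i = transpose (a x) $ Some i $ N" by (simp add: transpose_def)
    then show ?thesis using A1 xf by (simp add: transpose)
  qed
  have VN: "V x $ N = a x $ N $ N * gw x $ N"
  proof -
    have "V x $ N = (\<Sum>j\<in>UNIV. a x $ N $ j * gw x $ j)" by (simp add: V_def matrix_vector_mult_def)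
    also have "\<dots> = (\<Sum>j\<in>{N}. a x $ N $ j * gw x $ j)"
    proof (rule sum.mono_neutral_right)
      show "\<forall>j\<in>UNIV - {N}. a x $ N $ j * gw x $ j = 0"
      proof
        fix j assume "j \<in> UNIV - {N}"
        then obtain i where "j = Some i" by auto
        then show "a x $ N $ j * gw x $ j = 0" by (simp add: off)
      qed
    qed auto
    finally show ?thesis by simp
  qed
  have "1 / 2 \<le> a x $ N $ N"
    using lower[of "axis N 1"] by (simp add: norm_axis_1 matrix_vector_mult_basis inner_axis column_def)
  moreover have s: "0 \<le> w x" "gw x $ N \<le> 0" "w x * gw x $ N = 0"
    using solution xf by (auto simp: thin_obstacle_solution_def gw_def)
  ultimately show "0 \<le> w x" "V x $ N \<le> 0" "w x * V x $ N = 0"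
    unfolding VN by (auto simp: mult_nonneg_nonpos)
qed

text \<open>Differentiability relative to the half ball is local, so it may be checked within the
  ball around \<open>y\<close>, which the dilation maps into the domain of \<open>w\<close>.\<close>

lemma dilated_deriv:
  assumes y: "y $ N = 0" and R: "0 < R" "norm y + 2 * R < 1" and l: "1 \<le> l" "l \<le> 2"
    and x: "x \<in> half_ball 0 1" "dist x y < R"
  shows "((\<lambda>x. w (y + l *\<^sub>R (x - y))) has_derivative (\<lambda>h. (l *\<^sub>R gw (y + l *\<^sub>R (x - y))) \<bullet> h)) (at x within half_ball 0 1)"
    and "y + l *\<^sub>R (x - y) \<in> half_ball 0 1"
proof -
  have inS: "y + l *\<^sub>R (z - y) \<in> half_ball 0 1" if "z \<in> half_ball 0 1" "dist z y < R" for z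
  proof -
    have "norm (y + l *\<^sub>R (z - y)) \<le> norm y + l * dist z y"
      using norm_triangle_ineq[of y "l *\<^sub>R (z - y)"] l by (simp add: dist_norm)
    also have "\<dots> \<le> norm y + 2 * R" using that l R by (intro add_left_mono mult_mono) auto
    also have "\<dots> < 1" by (rule R)
    finally show ?thesis using that y l by (simp add: mem_half)
  qed
  show xS: "y + l *\<^sub>R (x - y) \<in> half_ball 0 1" by (rule inS[OF x])
  let ?B = "half_ball 0 1 \<inter> ball y R"
  have at: "at x within half_ball 0 1 = at x within ?B"
    by (rule at_within_nhd[of x "ball y R"]) (use x in \<open>auto simp: dist_commute\<close>)
  have "((\<lambda>x. y + l *\<^sub>R (x - y)) has_derivative (\<lambda>h. l *\<^sub>R h)) (at x within ?B)"
    by (auto intro!: derivative_eq_intros simp: fun_eq_iff)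
  moreover have "(\<lambda>x. y + l *\<^sub>R (x - y)) ` ?B \<subseteq> half_ball 0 1" using inS by (auto simp: dist_commute)
  moreover have "x \<in> ?B" using x by (simp add: dist_commute)
  ultimately have "((\<lambda>x. w (y + l *\<^sub>R (x - y))) has_derivative (\<lambda>h. gw (y + l *\<^sub>R (x - y)) \<bullet> (l *\<^sub>R h))) (at x within ?B)"
    by (intro has_derivative_in_compose2[OF w_deriv])
  then show "((\<lambda>x. w (y + l *\<^sub>R (x - y))) has_derivative (\<lambda>h. (l *\<^sub>R gw (y + l *\<^sub>R (x - y))) \<bullet> h)) (at x within half_ball 0 1)"
    unfolding at by simp
qed

text \<open>As \<open>y\<close> is flat, the dilation about it maps flat points to flat points,
  where \<open>w\<close> is nonnegative; with \<open>F\<close> nonnegative and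
  \<open>V x $ N \<le> 0\<close> the boundary term has the required sign.\<close>

lemma outer_variation_dilated:
  assumes y: "y $ N = 0" and R: "0 < R" "norm y + 2 * R < 1"
    and P: "\<And>x z. x \<bullet> (P *v z) = (P *v x) \<bullet> z"
    and F: "\<And>q. (F has_real_derivative F' q) (at q)" "continuous_on UNIV F'" "\<And>q. 0 \<le> F q"
      "\<And>z. norm z \<ge> R / 2 \<Longrightarrow> F (z \<bullet> (P *v z)) = 0 \<and> F' (z \<bullet> (P *v z)) = 0"
    and l: "1 \<le> l" "l \<le> 2"
  shows "0 \<le> (LINT z|lebesgue_on (upper_half N \<inter> cball 0 R). F (z \<bullet> (P *v z)) * l * ((a (y + z) *v gw (y + z)) \<bullet> gw (y + l *\<^sub>R z))
    + 2 * F' (z \<bullet> (P *v z)) * w (y + l *\<^sub>R z) * ((a (y + z) *v gw (y + z)) \<bullet> (P *v z)))"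
proof -
  have "0 \<le> (LINT z|lebesgue_on (upper_half N \<inter> cball 0 R). F (z \<bullet> (P *v z)) * (V (y + z) \<bullet> (l *\<^sub>R gw (y + l *\<^sub>R ((y + z) - y))))
    + 2 * F' (z \<bullet> (P *v z)) * w (y + l *\<^sub>R ((y + z) - y)) * (V (y + z) \<bullet> (P *v z)))"
  proof (rule radial_variational_inequality[OF cont_V[unfolded half_ball_eq] weak[unfolded half_ball_eq] y R(1) _ P F(1,2,4)],
      unfold half_ball_eq[symmetric])
    show "norm y + R < 1" using R by simp
    show "((\<lambda>x. w (y + l *\<^sub>R (x - y))) has_derivative (\<lambda>h. (l *\<^sub>R gw (y + l *\<^sub>R (x - y))) \<bullet> h)) (at x within half_ball 0 1)"
      if "x \<in> half_ball 0 1" "dist x y < R" for x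
      by (rule dilated_deriv[OF y R l that])
    have "continuous_on (half_ball 0 1 \<inter> ball y R) (\<lambda>x. gw (y + l *\<^sub>R (x - y)))"
    proof (rule continuous_on_compose2[OF cont_gw])
      show "(\<lambda>x. y + l *\<^sub>R (x - y)) ` (half_ball 0 1 \<inter> ball y R) \<subseteq> half_ball 0 1"
        using dilated_deriv(2)[OF y R l] by (auto simp: dist_commute)
    qed (intro continuous_intros)
    then show "continuous_on (half_ball 0 1 \<inter> ball y R) (\<lambda>x. l *\<^sub>R gw (y + l *\<^sub>R (x - y)))"
      by (intro continuous_intros)
    fix x assume x: "x \<in> half_ball 0 1" "x $ N = 0" "dist x y < R"
    have "y + l *\<^sub>R (x - y) \<in> half_ball 0 1" by (rule dilated_deriv(2)[OF y R l x(1,3)])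
    then have "0 \<le> w (y + l *\<^sub>R (x - y))" using x y by (intro flat) auto
    then show "F ((x - y) \<bullet> (P *v (x - y))) * w (y + l *\<^sub>R (x - y)) * V x $ N \<le> 0"
      using F(3) flat(2)[OF x(1,2)] by (intro mult_nonneg_nonpos mult_nonneg_nonneg)
  qed
  then show ?thesis by (simp add: V_def mult_ac)
qed

text \<open>On the flat boundary the product of \<open>w\<close> and \<open>V x $ N\<close>
  vanishes, so both \<open>w\<close> and \<open>- w\<close> satisfy the sign condition and the
  inequality becomes an equality.\<close>

lemma outer_variation:
  assumes y: "y $ N = 0" and R: "0 < R" "norm y + R < 1"
    and P: "\<And>x z. x \<bullet> (P *v z) = (P *v x) \<bullet> z"
    and F: "\<And>q. (F has_real_derivative F' q) (at q)" "continuous_on UNIV F'"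
      "\<And>z. norm z \<ge> R / 2 \<Longrightarrow> F (z \<bullet> (P *v z)) = 0 \<and> F' (z \<bullet> (P *v z)) = 0"
  shows "(LINT z|lebesgue_on (upper_half N \<inter> cball 0 R). F (z \<bullet> (P *v z)) * ((a (y + z) *v gw (y + z)) \<bullet> gw (y + z))
    + 2 * F' (z \<bullet> (P *v z)) * w (y + z) * ((a (y + z) *v gw (y + z)) \<bullet> (P *v z))) = 0"
proof -
  let ?I = "\<lambda>c. LINT z|lebesgue_on (upper_half N \<inter> cball 0 R). F (z \<bullet> (P *v z)) * (V (y + z) \<bullet> (c *\<^sub>R gw (y + z)))
    + 2 * F' (z \<bullet> (P *v z)) * (c * w (y + z)) * (V (y + z) \<bullet> (P *v z))"
  have "0 \<le> ?I c" for c :: real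
  proof (rule radial_variational_inequality[OF cont_V[unfolded half_ball_eq] weak[unfolded half_ball_eq] y R P F],
      unfold half_ball_eq[symmetric])
    show "((\<lambda>x. c * w x) has_derivative (\<lambda>h. (c *\<^sub>R gw x) \<bullet> h)) (at x within half_ball 0 1)"
      if "x \<in> half_ball 0 1" for x
      using has_derivative_mult_right[OF w_deriv[OF that], of c] by simp
    show "continuous_on (half_ball 0 1 \<inter> ball y R) (\<lambda>x. c *\<^sub>R gw x)"
      by (intro continuous_intros continuous_on_subset[OF cont_gw]) auto
    show "F ((x - y) \<bullet> (P *v (x - y))) * (c * w x) * V x $ N \<le> 0" if "x \<in> half_ball 0 1" "x $ N = 0" for x
      using flat(3)[OF that] by (auto simp: mult.assoc)
  qed
  note nonneg = this
  define f where "f z = F (z \<bullet> (P *v z)) * (V (y + z) \<bullet> gw (y + z)) + 2 * F' (z \<bullet> (P *v z)) * w (y + z) * (V (y + z) \<bullet> (P *v z))" for z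
  have I: "?I c = (LINT z|lebesgue_on (upper_half N \<inter> cball 0 R). c * f z)" for c
    by (rule Bochner_Integration.integral_cong[OF refl]) (simp add: f_def algebra_simps)
  have "0 \<le> (LINT z|lebesgue_on (upper_half N \<inter> cball 0 R). f z)" "0 \<le> - (LINT z|lebesgue_on (upper_half N \<inter> cball 0 R). f z)"
    using nonneg[of 1] nonneg[of "-1"] unfolding I by simp_all
  then have "(LINT z|lebesgue_on (upper_half N \<inter> cball 0 R). f z) = 0" by simp
  then show ?thesis by (simp only: f_def V_def)
qed

lemma translate_half: "z \<in> upper_half N \<inter> cball 0 \<rho> \<Longrightarrow> y $ N = 0 \<Longrightarrow> norm y + \<rho> < 1 \<Longrightarrow> y + z \<in> half_ball 0 1"
  using norm_triangle_ineq[of y z] by (simp add: mem_half upper_half_def)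

lemma cont_translate:
  assumes "continuous_on (half_ball 0 1) f" "y $ N = 0" "norm y + \<rho> < 1"
  shows "continuous_on (upper_half N \<inter> cball 0 \<rho>) (\<lambda>z. f (y + z))"
  by (rule continuous_on_compose2[OF assms(1)], intro continuous_intros) (use translate_half assms(2,3) in blast)

lemma cone_upper_half: "0 < R \<Longrightarrow> cone_setting (upper_half N) R"
  by unfold_locales (use closed_upper_half in \<open>auto simp: upper_half_def\<close>)

lemma ray_deriv:
  assumes y: "y $ N = 0" and z: "z \<in> upper_half N" and t: "0 < t" "norm y + norm (t *\<^sub>R z) < 1"
  shows "((\<lambda>t. w (y + t *\<^sub>R z)) has_real_derivative gw (y + t *\<^sub>R z) \<bullet> z) (at t)"
proof -
  let ?I = "{s. 0 < s \<and> norm (y + s *\<^sub>R z) < 1}"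
  have op: "open ?I"
  proof -
    have "?I = {0<..} \<inter> {s. norm (y + s *\<^sub>R z) < 1}" by auto
    then show ?thesis by (auto intro!: open_Int open_Collect_less continuous_intros)
  qed
  have tI: "t \<in> ?I" using t norm_triangle_ineq[of y "t *\<^sub>R z"] by auto
  have inS: "y + s *\<^sub>R z \<in> half_ball 0 1" if "s \<in> ?I" for s
    using that y z by (auto simp: mem_half upper_half_def)
  have "((\<lambda>s. y + s *\<^sub>R z) has_derivative (\<lambda>h. h *\<^sub>R z)) (at t within ?I)"
    by (auto intro!: derivative_eq_intros)
  moreover have "(\<lambda>s. y + s *\<^sub>R z) ` ?I \<subseteq> half_ball 0 1" using inS by blast
  ultimately have "((\<lambda>s. w (y + s *\<^sub>R z)) has_derivative (\<lambda>h. gw (y + t *\<^sub>R z) \<bullet> (h *\<^sub>R z))) (at t within ?I)"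
    using tI by (intro has_derivative_in_compose2[OF w_deriv])
  then show ?thesis
    unfolding has_field_derivative_def at_within_open[OF tI op] by (rule has_derivative_eq_rhs) (auto simp: fun_eq_iff)
qed

definition \<gamma>0 :: real where "\<gamma>0 = 1 - (CARD('n) + 1) / real_exponent (CARD('n) + 1) p"

lemma gamma0: "0 < \<gamma>0" "\<gamma>0 \<le> 1"
proof -
  have "real CARD('n) + 1 < real_exponent (CARD('n) + 1) p" using less_real_exponent[OF p] by (simp add: add.commute)
  then show "0 < \<gamma>0" "\<gamma>0 \<le> 1" by (simp_all add: \<gamma>0_def)
qed

lemma coefficient_holder:
  assumes "r0 < 1"
  shows "\<exists>C\<ge>0. \<forall>x y v. x \<in> upper_half N \<longrightarrow> norm x \<le> r0 \<longrightarrow> y \<in> upper_half N \<longrightarrow> norm y \<le> r0 \<longrightarrow>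
    norm (a x *v v - a y *v v) \<le> C * dist x y powr \<gamma>0 * norm v"
proof -
  have "\<exists>C\<ge>0. \<forall>x y. 0 \<le> x $ N \<longrightarrow> norm x \<le> r0 \<longrightarrow> 0 \<le> y $ N \<longrightarrow> norm y \<le> r0 \<longrightarrow>
    \<bar>a x $ i $ j - a y $ i $ j\<bar> \<le> C * dist x y powr (1 - CARD('n option) / real_exponent CARD('n option) p)" for i j
  proof (rule W1p_holder)
    have hb: "half_ball 0 1 = {z :: real ^ ('n option). 0 \<le> z $ N \<and> norm z < 1}" by (auto simp: half_ball_def)
    show "interior (half_ball 0 1 :: (real ^ ('n option)) set) \<in> lmeasurable"
      by (intro lmeasurable_open open_interior bounded_subset[OF bounded_ball[of 0 1]])
        (use mem_half in \<open>auto dest!: subsetD[OF interior_subset]\<close>)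
    show "z \<in> interior (half_ball 0 1)" if "0 < z $ N" "norm z < 1" for z
      using that unfolding half_ball_eq interior_upper_half_ball by simp
    show "continuous_on {z. 0 \<le> z $ N \<and> norm z < 1} (\<lambda>x. a x $ i $ j)"
      using A3(2) unfolding hb by (intro continuous_on_component)
    show "in_W1p p (interior (half_ball 0 1)) (\<lambda>x. a x $ i $ j)" using A3(1) by blast
    show "ereal (real CARD('n option)) < p" using p by (simp add: add.commute)
  qed (rule assms)
  then have "\<forall>i j. \<exists>C\<ge>0. \<forall>x y. 0 \<le> x $ N \<longrightarrow> norm x \<le> r0 \<longrightarrow> 0 \<le> y $ N \<longrightarrow> norm y \<le> r0 \<longrightarrow>
    \<bar>a x $ i $ j - a y $ i $ j\<bar> \<le> C * dist x y powr \<gamma>0"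
    by (simp add: \<gamma>0_def add.commute)
  then obtain C where C: "\<And>i j. 0 \<le> C i j" "\<And>i j x y. 0 \<le> x $ N \<Longrightarrow> norm x \<le> r0 \<Longrightarrow> 0 \<le> y $ N \<Longrightarrow> norm y \<le> r0 \<Longrightarrow>
    \<bar>a x $ i $ j - a y $ i $ j\<bar> \<le> C i j * dist x y powr \<gamma>0"
    by metis
  define B where "B = (\<Sum>i\<in>UNIV. \<Sum>j\<in>UNIV. C i j)"
  have "norm (a x *v v - a y *v v) \<le> B * dist x y powr \<gamma>0 * norm v"
    if x: "x \<in> upper_half N" "norm x \<le> r0" "y \<in> upper_half N" "norm y \<le> r0" for x y v
  proof -
    have "norm (a x *v v - a y *v v) \<le> (\<Sum>i\<in>UNIV. \<bar>(a x *v v - a y *v v) $ i\<bar>)" by (rule norm_le_l1_cart)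
    also have "\<dots> \<le> (\<Sum>i\<in>UNIV. \<Sum>j\<in>UNIV. C i j * dist x y powr \<gamma>0 * norm v)"
    proof (rule sum_mono)
      fix i
      have "(a x *v v - a y *v v) $ i = (\<Sum>j\<in>UNIV. (a x $ i $ j - a y $ i $ j) * v $ j)"
        by (simp add: matrix_vector_mult_def sum_subtractf left_diff_distrib)
      also have "\<bar>\<dots>\<bar> \<le> (\<Sum>j\<in>UNIV. \<bar>(a x $ i $ j - a y $ i $ j) * v $ j\<bar>)" by (rule sum_abs)
      also have "\<dots> \<le> (\<Sum>j\<in>UNIV. C i j * dist x y powr \<gamma>0 * norm v)"
        unfolding abs_mult using x C
        by (intro sum_mono mult_mono component_le_norm_cart) (auto simp: upper_half_def)
      finally show "\<bar>(a x *v v - a y *v v) $ i\<bar> \<le> \<dots>" .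
    qed
    also have "\<dots> = B * dist x y powr \<gamma>0 * norm v" by (simp add: B_def sum_distrib_right)
    finally show ?thesis .
  qed
  moreover have "0 \<le> B" unfolding B_def by (intro sum_nonneg C)
  ultimately show ?thesis by blast
qed

text \<open>One \<open>Ca\<close> serves all flat centres inside the radius \<open>r0\<close>. The
  exponent may be lowered to any \<open>\<gamma> \<le> \<gamma>0\<close> because
  \<open>norm z \<le> 1\<close>; this freedom makes the loss in the decay as small as
  needed.\<close>

lemma dilation_settings:
  assumes r0: "r0 < 1" and \<gamma>: "0 < \<gamma>" "\<gamma> \<le> \<gamma>0"
  shows "\<exists>Ca. \<forall>y R. y $ N = 0 \<longrightarrow> 0 < R \<longrightarrow> norm y + 2 * R \<le> r0 \<longrightarrow>
    dilation_setting (upper_half N) R (\<lambda>z. w (y + z)) (\<lambda>z. gw (y + z)) (\<lambda>z. a (y + z)) (a y) (matrix_inv (a y)) Ca \<gamma>"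
proof -
  obtain C where C: "0 \<le> C" "\<And>x y v. x \<in> upper_half N \<Longrightarrow> norm x \<le> r0 \<Longrightarrow> y \<in> upper_half N \<Longrightarrow> norm y \<le> r0 \<Longrightarrow>
    norm (a x *v v - a y *v v) \<le> C * dist x y powr \<gamma>0 * norm v"
    using coefficient_holder[OF r0] by metis
  have "dilation_setting (upper_half N) R (\<lambda>z. w (y + z)) (\<lambda>z. gw (y + z)) (\<lambda>z. a (y + z)) (a y) (matrix_inv (a y)) C \<gamma>"
    if y: "y $ N = 0" and R: "0 < R" "norm y + 2 * R \<le> r0" for y R
  proof -
    interpret cone_setting "upper_half N" R by (rule cone_upper_half[OF R(1)])
    have yS: "y \<in> half_ball 0 1" using y R r0 by (simp add: mem_half)
    interpret A: elliptic_matrix "a y" by (rule elliptic[OF yS])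
    have R1: "norm y + 2 * R < 1" "norm y + R < 1" using R r0 by auto
    have ell: "elliptic_matrix (a (y + z))" if "z \<in> upper_half N \<inter> cball 0 R" for z
      using translate_half[OF that y R1(2)] by (rule elliptic)
    show ?thesis
    proof unfold_locales
      show "0 < \<gamma>" "\<gamma> \<le> 1" using \<gamma> gamma0 by auto
      show "0 \<le> C" by (rule C)
      show "continuous_on (upper_half N \<inter> cball 0 (2 * R)) (\<lambda>z. w (y + z))"
        "continuous_on (upper_half N \<inter> cball 0 (2 * R)) (\<lambda>z. gw (y + z))"
        "continuous_on (upper_half N \<inter> cball 0 (2 * R)) (\<lambda>z. a (y + z))"
        by (rule cont_translate[OF _ y R1(1)], rule cont_w cont_gw A3(2))+
      show "((\<lambda>t. w (y + t *\<^sub>R z)) has_real_derivative gw (y + t *\<^sub>R z) \<bullet> z) (at t)"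
        if "z \<in> upper_half N" "0 < t" "norm (t *\<^sub>R z) < 2 * R" for z t
        using that R1 by (intro ray_deriv[OF y]) auto
      show "(a y *v x) \<bullet> z = x \<bullet> (a y *v z)" for x z by (rule A.sym)
      show "0 \<le> (a y *v x) \<bullet> x" for x using A.lower[of x] by (rule order.trans[rotated]) simp
      show "a y *v (matrix_inv (a y) *v z) = z" for z by (rule A.inverse_mult)
      show "(norm z)\<^sup>2 / 2 \<le> z \<bullet> (matrix_inv (a y) *v z)" for z by (rule A.inverse_lower)
      show "norm (matrix_inv (a y) *v z) \<le> 2 * norm z" for z by (rule A.inverse_norm_le)
      show "(norm x)\<^sup>2 / 2 \<le> (a (y + z) *v x) \<bullet> x" if "z \<in> upper_half N \<inter> cball 0 R" for z x
        by (rule elliptic_matrix.lower[OF ell[OF that]])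
      show "norm (a (y + z) *v x) \<le> 2 * norm x" if "z \<in> upper_half N \<inter> cball 0 R" for z x
        by (rule elliptic_matrix.norm_le[OF ell[OF that]])
      show "norm (a (y + z) *v x - a y *v x) \<le> C * norm z powr \<gamma> * norm x" if z: "z \<in> upper_half N \<inter> cball 0 R" for z x
      proof -
        have "norm (y + z) \<le> r0" using z R norm_triangle_ineq[of y z] by simp
        moreover have "y + z \<in> upper_half N" "y \<in> upper_half N" using z y by (auto simp: upper_half_def)
        moreover have "norm y \<le> r0" using R by simp
        ultimately have "norm (a (y + z) *v x - a y *v x) \<le> C * dist (y + z) y powr \<gamma>0 * norm x" by (intro C)
        also have "dist (y + z) y = norm z" by (simp add: dist_norm)
        also have "C * norm z powr \<gamma>0 * norm x \<le> C * norm z powr \<gamma> * norm x"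
        proof (intro mult_right_mono mult_left_mono C(1) norm_ge_zero)
          have "norm z \<le> 1" using z R r0 norm_ge_zero[of y] by (simp only: Int_iff mem_cball_0) linarith
          then show "norm z powr \<gamma>0 \<le> norm z powr \<gamma>" using \<gamma> by (intro powr_mono') auto
        qed
        finally show ?thesis .
      qed
      show "(LINT z|lebesgue_on (upper_half N \<inter> cball 0 R). F (z \<bullet> (matrix_inv (a y) *v z)) * ((a (y + z) *v gw (y + z)) \<bullet> gw (y + z))
         + 2 * F' (z \<bullet> (matrix_inv (a y) *v z)) * w (y + z) * ((a (y + z) *v gw (y + z)) \<bullet> (matrix_inv (a y) *v z))) = 0"
        if "\<And>q. (F has_real_derivative F' q) (at q)" "continuous_on UNIV F'"
          "\<And>z. R / 2 \<le> norm z \<Longrightarrow> F (z \<bullet> (matrix_inv (a y) *v z)) = 0 \<and> F' (z \<bullet> (matrix_inv (a y) *v z)) = 0" for F F'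
        by (rule outer_variation[OF y R(1) R1(2) A.inverse_sym that])
      show "0 \<le> (LINT z|lebesgue_on (upper_half N \<inter> cball 0 R). F (z \<bullet> (matrix_inv (a y) *v z)) * l * ((a (y + z) *v gw (y + z)) \<bullet> gw (y + l *\<^sub>R z))
         + 2 * F' (z \<bullet> (matrix_inv (a y) *v z)) * w (y + l *\<^sub>R z) * ((a (y + z) *v gw (y + z)) \<bullet> (matrix_inv (a y) *v z)))"
        if "\<And>q. (F has_real_derivative F' q) (at q)" "continuous_on UNIV F'" "\<And>q. 0 \<le> F q"
          "\<And>z. R / 2 \<le> norm z \<Longrightarrow> F (z \<bullet> (matrix_inv (a y) *v z)) = 0 \<and> F' (z \<bullet> (matrix_inv (a y) *v z)) = 0"
          "1 \<le> l" "l \<le> 2" for F F' l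
        by (rule outer_variation_dilated[OF y R(1) R1(1) A.inverse_sym that])
    qed
  qed
  then show ?thesis by blast
qed

end

section \<open>Balls and annuli\<close>

text \<open>8320 = 4 * 2080 with 2080 = 2 * (16 + 4 * 256): here 256 is the Caccioppoli constant, 16
  and 4 come from the AM-GM splittings of the Euler identity, and the outer 4 from squaring the
  bound on the derivative of the cutoff. The summand 1 accounts for the annulus itself.\<close>

definition ball_constant :: real where "ball_constant = 8320 * step_bound\<^sup>2 + 1"

text \<open>The vanishing order sees only annuli, while the decay estimate needs the whole ball. The
  Euler identity on the cone bounds the mass in the ball by the gradient, and the Caccioppoli
  inequality returns the gradient to the annulus where the cutoff varies.\<close>

lemma (in cone_setting) ball_le_annulus:
  fixes w :: "real ^ 'm \<Rightarrow> real" and g :: "real ^ 'm \<Rightarrow> real ^ 'm" and a :: "real ^ 'm \<Rightarrow> real ^ 'm ^ 'm" and r :: real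
  assumes r: "R = 2 * r"
    and cw: "continuous_on hb w" and cg: "continuous_on hb g" and ca: "continuous_on hb a"
    and ray: "\<And>z t. z \<in> H \<Longrightarrow> 0 < t \<Longrightarrow> norm (t *\<^sub>R z) < R \<Longrightarrow>
      ((\<lambda>t. w (t *\<^sub>R z)) has_real_derivative g (t *\<^sub>R z) \<bullet> z) (at t)"
    and lower: "\<And>z x. z \<in> hb \<Longrightarrow> (norm x)\<^sup>2 / 2 \<le> (a z *v x) \<bullet> x"
    and upper: "\<And>z x. z \<in> hb \<Longrightarrow> norm (a z *v x) \<le> 2 * norm x"
    and outer: "\<And>F F'. (\<And>q. (F has_real_derivative F' q) (at q)) \<Longrightarrow> continuous_on UNIV F' \<Longrightarrow>
      (\<And>z :: real ^ 'm. norm z \<ge> R / 2 \<Longrightarrow> F (z \<bullet> z) = 0 \<and> F' (z \<bullet> z) = 0) \<Longrightarrow>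
      (LINT z|lebesgue_on hb. F (z \<bullet> z) * ((a z *v g z) \<bullet> g z) + 2 * F' (z \<bullet> z) * w z * ((a z *v g z) \<bullet> z)) = 0"
  shows "(LINT z|lebesgue_on (H \<inter> cball 0 r). (w z)\<^sup>2)
    \<le> ball_constant * (LINT z|lebesgue_on (H \<inter> {z. r / 2 \<le> norm z \<and> norm z \<le> r}). (w z)\<^sup>2)"
proof -
  have r0: "0 < r" using R_pos r by simp
  define E where "E s = step ((r\<^sup>2 - s) / (r\<^sup>2 / 2))" for s
  define E' where "E' s = - step1 ((r\<^sup>2 - s) / (r\<^sup>2 / 2)) / (r\<^sup>2 / 2)" for s
  define T where "T = H \<inter> {z. r / 2 \<le> norm z \<and> norm z \<le> r}"
  define B where "B = step_bound"
  have T: "compact T" "T \<subseteq> hb"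
  proof -
    have "T = (H \<inter> {z. r / 2 \<le> norm z}) \<inter> cball 0 r" by (auto simp: T_def)
    then show "compact T" by (auto intro!: closed_Int_compact closed_Int closed_H closed_Collect_le continuous_intros)
    show "T \<subseteq> hb" using r r0 by (auto simp: T_def)
  qed
  have dE: "(E has_real_derivative E' s) (at s)" for s
  proof -
    have "((\<lambda>s. (r\<^sup>2 - s) / (r\<^sup>2 / 2)) has_real_derivative - 1 / (r\<^sup>2 / 2)) (at s)"
      by (rule DERIV_cdivide) (auto intro!: derivative_eq_intros)
    from DERIV_chain2[OF step_deriv this] show ?thesis unfolding E_def[abs_def] E'_def by simp
  qed
  have cE': "continuous_on UNIV E'"
  proof -
    have "continuous_on UNIV (\<lambda>s. (r\<^sup>2 - s) * inverse (r\<^sup>2 / 2))" by (intro continuous_intros)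
    from continuous_on_compose2[OF step_cont(2)[of UNIV] this] show ?thesis
      unfolding E'_def[abs_def] divide_inverse by (intro continuous_on_mult continuous_on_minus continuous_on_const) auto
  qed
  have cE: "continuous_on UNIV E" using DERIV_isCont[OF dE] by (simp add: continuous_at_imp_continuous_on)
  have cz: "continuous_on A (\<lambda>z::real^'m. E (z \<bullet> z))" "continuous_on A (\<lambda>z::real^'m. E' (z \<bullet> z))" for A
    by (rule continuous_on_compose2[OF cE] continuous_on_compose2[OF cE'], intro continuous_intros, simp)+
  have Eoff: "E (z \<bullet> z) = 0 \<and> E' (z \<bullet> z) = 0" if "r \<le> norm z" for z :: "real ^ 'm"
  proof -
    have "r\<^sup>2 \<le> z \<bullet> z" using that r0 power_mono[of r "norm z" 2] by (simp add: power2_norm_eq_inner)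
    then have "(r\<^sup>2 - z \<bullet> z) / (r\<^sup>2 / 2) \<le> 0" using r0 by (intro divide_nonpos_pos) auto
    from step_0[OF this] show ?thesis by (simp add: E_def E'_def)
  qed
  have Eon: "E (z \<bullet> z) = 1 \<and> E' (z \<bullet> z) = 0" if "norm z \<le> r / 2" for z :: "real ^ 'm"
  proof -
    have "z \<bullet> z \<le> r\<^sup>2 / 4" using that power_mono[of "norm z" "r / 2" 2] by (simp add: power2_norm_eq_inner power_divide)
    then have "1 * (r\<^sup>2 / 2) \<le> r\<^sup>2 - z \<bullet> z" using zero_le_power2[of r] by linarith
    then have "1 \<le> (r\<^sup>2 - z \<bullet> z) / (r\<^sup>2 / 2)" using r0 by (subst pos_le_divide_eq) auto
    from step_1[OF this] show ?thesis by (simp add: E_def E'_def)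
  qed
  have E'b: "\<bar>E' s\<bar> \<le> 2 * B / r\<^sup>2" for s
    using step_bound(2)[of "(r\<^sup>2 - s) / (r\<^sup>2 / 2)"] r0 by (simp add: E'_def B_def abs_divide divide_right_mono)
  let ?I = "\<lambda>f. LINT z|lebesgue_on hb. f z"
  have int: "integrable (lebesgue_on hb) f" if "continuous_on hb f" for f :: "real ^ 'm \<Rightarrow> real"
    using that by (rule integrable_on_compact[OF compact_hb])
  define G where "G z = (E (z \<bullet> z))\<^sup>2 * (w z)\<^sup>2" for z
  define D where "D z = (E (z \<bullet> z))\<^sup>2 * (norm (g z))\<^sup>2" for z
  define M where "M z = (E' (z \<bullet> z))\<^sup>2 * (w z)\<^sup>2 * (norm z)\<^sup>2" for z
  define \<Gamma> where "\<Gamma> z = 4 * E (z \<bullet> z) * E' (z \<bullet> z) * (z \<bullet> z) * (w z)\<^sup>2 + 2 * (E (z \<bullet> z))\<^sup>2 * w z * (g z \<bullet> z)" for z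
  have c: "continuous_on hb G" "continuous_on hb D" "continuous_on hb M" "continuous_on hb \<Gamma>"
    unfolding G_def D_def M_def \<Gamma>_def by (intro continuous_intros cz cw cg)+
  have caccioppoli: "?I D \<le> 256 * ?I M"
  proof -
    define f where "f z = (E (z \<bullet> z))\<^sup>2 * ((a z *v g z) \<bullet> g z) + 2 * (2 * E (z \<bullet> z) * E' (z \<bullet> z)) * w z * ((a z *v g z) \<bullet> z)" for z
    have "?I f = 0" unfolding f_def
    proof (rule outer)
      show "((\<lambda>s. (E s)\<^sup>2) has_real_derivative 2 * E s * E' s) (at s)" for s
        using dE[of s] by (auto intro!: derivative_eq_intros)
      show "continuous_on UNIV (\<lambda>s. 2 * E s * E' s)" by (intro continuous_intros cE cE')
      show "(E (z \<bullet> z))\<^sup>2 = 0 \<and> 2 * E (z \<bullet> z) * E' (z \<bullet> z) = 0" if "R / 2 \<le> norm z" for z :: "real ^ 'm"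
        using Eoff[of z] that r by simp
    qed
    moreover have "?I (\<lambda>z. D z / 4 - 64 * M z) \<le> ?I f"
    proof (rule integral_mono)
      show "integrable (lebesgue_on hb) (\<lambda>z. D z / 4 - 64 * M z)"
        by (intro int continuous_intros c) auto
      show "integrable (lebesgue_on hb) f" unfolding f_def
        by (intro int continuous_intros cz cw cg ca)
      fix z assume "z \<in> space (lebesgue_on hb)"
      then have z: "z \<in> hb" by simp
      define X where "X = \<bar>E (z \<bullet> z)\<bar> * norm (g z)"
      define Y where "Y = \<bar>E' (z \<bullet> z)\<bar> * \<bar>w z\<bar> * norm z"
      have DX: "D z = X\<^sup>2" "M z = Y\<^sup>2" by (simp_all add: D_def M_def X_def Y_def power_mult_distrib)
      have "(E (z \<bullet> z))\<^sup>2 * ((norm (g z))\<^sup>2 / 2) \<le> (E (z \<bullet> z))\<^sup>2 * ((a z *v g z) \<bullet> g z)"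
        by (intro mult_left_mono lower[OF z]) simp
      then have 1: "X\<^sup>2 / 2 \<le> (E (z \<bullet> z))\<^sup>2 * ((a z *v g z) \<bullet> g z)" by (simp add: X_def power_mult_distrib)
      have "\<bar>(a z *v g z) \<bullet> z\<bar> \<le> (2 * norm (g z)) * norm z"
        using Cauchy_Schwarz_ineq2[of "a z *v g z" z] mult_right_mono[OF upper[OF z, of "g z"] norm_ge_zero[of z]] by linarith
      then have "4 * (\<bar>E (z \<bullet> z)\<bar> * \<bar>E' (z \<bullet> z)\<bar> * \<bar>w z\<bar>) * \<bar>(a z *v g z) \<bullet> z\<bar> \<le> 4 * (\<bar>E (z \<bullet> z)\<bar> * \<bar>E' (z \<bullet> z)\<bar> * \<bar>w z\<bar>) * ((2 * norm (g z)) * norm z)"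
        by (intro mult_left_mono) auto
      also have "\<dots> = 8 * (X * Y)" by (simp add: X_def Y_def)
      finally have "\<bar>2 * (2 * E (z \<bullet> z) * E' (z \<bullet> z)) * w z * ((a z *v g z) \<bullet> z)\<bar> \<le> 8 * (X * Y)"
        by (simp add: abs_mult mult_ac)
      moreover have "8 * (X * Y) \<le> X\<^sup>2 / 4 + 64 * Y\<^sup>2"
        using zero_le_power2[of "X / 2 - 8 * Y"] by (simp add: power2_eq_square algebra_simps)
      ultimately show "D z / 4 - 64 * M z \<le> f z"
        using 1 unfolding DX f_def by linarith
    qed
    moreover have "?I (\<lambda>z. D z / 4 - 64 * M z) = ?I D / 4 - 64 * ?I M"
      using int[OF c(2)] int[OF c(3)] by simp
    ultimately show ?thesis by simp
  qed
  have euler: "?I \<Gamma> = - real CARD('m) * ?I G"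
  proof (rule euler_identity[OF c(1) c(4)])
    show "G z = 0" "\<Gamma> z = 0" if "R / 2 \<le> norm z" for z using Eoff[of z] that r by (auto simp: G_def \<Gamma>_def)
    fix z t assume z: "z \<in> H" "0 < (t::real)"
    show "((\<lambda>t. G (t *\<^sub>R z)) has_real_derivative \<Gamma> (t *\<^sub>R z) / t) (at t)"
    proof (cases "norm (t *\<^sub>R z) < R")
      case True
      have "((\<lambda>t. t\<^sup>2 * (z \<bullet> z)) has_real_derivative 2 * t * (z \<bullet> z)) (at t)"
        by (auto intro!: derivative_eq_intros)
      from DERIV_chain2[OF dE this]
      have d1: "((\<lambda>t. E (t\<^sup>2 * (z \<bullet> z))) has_real_derivative E' (t\<^sup>2 * (z \<bullet> z)) * (2 * t * (z \<bullet> z))) (at t)" .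
      have "((\<lambda>t. (E (t\<^sup>2 * (z \<bullet> z)))\<^sup>2 * (w (t *\<^sub>R z))\<^sup>2) has_real_derivative
          (2 * E (t\<^sup>2 * (z \<bullet> z)) * (E' (t\<^sup>2 * (z \<bullet> z)) * (2 * t * (z \<bullet> z)))) * (w (t *\<^sub>R z))\<^sup>2
          + (2 * w (t *\<^sub>R z) * (g (t *\<^sub>R z) \<bullet> z)) * (E (t\<^sup>2 * (z \<bullet> z)))\<^sup>2) (at t)"
      proof (rule DERIV_mult)
        show "((\<lambda>t. (E (t\<^sup>2 * (z \<bullet> z)))\<^sup>2) has_real_derivative 2 * E (t\<^sup>2 * (z \<bullet> z)) * (E' (t\<^sup>2 * (z \<bullet> z)) * (2 * t * (z \<bullet> z)))) (at t)"
          using DERIV_power[OF d1, of 2] by (simp add: mult_ac)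
        show "((\<lambda>t. (w (t *\<^sub>R z))\<^sup>2) has_real_derivative 2 * w (t *\<^sub>R z) * (g (t *\<^sub>R z) \<bullet> z)) (at t)"
          using DERIV_power[OF ray[OF z True], of 2] by (simp add: mult_ac)
      qed
      moreover have "(2 * E (t\<^sup>2 * (z \<bullet> z)) * (E' (t\<^sup>2 * (z \<bullet> z)) * (2 * t * (z \<bullet> z)))) * (w (t *\<^sub>R z))\<^sup>2
          + (2 * w (t *\<^sub>R z) * (g (t *\<^sub>R z) \<bullet> z)) * (E (t\<^sup>2 * (z \<bullet> z)))\<^sup>2 = \<Gamma> (t *\<^sub>R z) / t"
        using z(2) by (simp add: \<Gamma>_def power2_eq_square field_simps)
      moreover have "(s *\<^sub>R z) \<bullet> (s *\<^sub>R z) = s\<^sup>2 * (z \<bullet> z)" for s by (simp add: power2_eq_square)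
      ultimately show ?thesis by (simp only: G_def)
    next
      case False
      have "((\<lambda>t. G (t *\<^sub>R z)) has_real_derivative 0) (at t)"
      proof (rule has_field_derivative_transform_within_open[of "\<lambda>_. 0" _ _ "{s. r < norm (s *\<^sub>R z)}"])
        show "open {s. r < norm (s *\<^sub>R z)}" by (intro open_Collect_less continuous_intros)
        show "0 = G (s *\<^sub>R z)" if "s \<in> {s. r < norm (s *\<^sub>R z)}" for s
          using Eoff[of "s *\<^sub>R z"] that unfolding G_def by simp
      qed (use False r r0 in auto)
      moreover have "\<Gamma> (t *\<^sub>R z) = 0" using Eoff[of "t *\<^sub>R z"] False r r0 unfolding \<Gamma>_def by simp
      ultimately show ?thesis by simp
    qed
  qed
  have "- ?I \<Gamma> \<le> ?I (\<lambda>z. G z / 2 + r\<^sup>2 * (16 * M z + 4 * D z))"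
    unfolding Bochner_Integration.integral_minus[symmetric]
  proof (rule integral_mono)
    show "integrable (lebesgue_on hb) (\<lambda>z. - \<Gamma> z)" "integrable (lebesgue_on hb) (\<lambda>z. G z / 2 + r\<^sup>2 * (16 * M z + 4 * D z))"
      by (intro int continuous_intros c; simp)+
    fix z :: "real ^ 'm"
    show "- \<Gamma> z \<le> G z / 2 + r\<^sup>2 * (16 * M z + 4 * D z)"
    proof (cases "r \<le> norm z")
      case True
      then show ?thesis using Eoff[OF True] by (simp add: \<Gamma>_def G_def M_def D_def)
    next
      case False
      define x where "x = \<bar>E (z \<bullet> z)\<bar> * \<bar>w z\<bar>"
      define b where "b = \<bar>E' (z \<bullet> z)\<bar> * \<bar>w z\<bar> * norm z"
      define d where "d = \<bar>E (z \<bullet> z)\<bar> * norm (g z)"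
      have eq: "G z = x\<^sup>2" "M z = b\<^sup>2" "D z = d\<^sup>2" by (simp_all add: G_def M_def D_def x_def b_def d_def power_mult_distrib)
      have "- \<Gamma> z \<le> \<bar>4 * E (z \<bullet> z) * E' (z \<bullet> z) * (z \<bullet> z) * (w z)\<^sup>2\<bar> + \<bar>2 * (E (z \<bullet> z))\<^sup>2 * w z * (g z \<bullet> z)\<bar>"
        unfolding \<Gamma>_def by linarith
      also have "\<bar>4 * E (z \<bullet> z) * E' (z \<bullet> z) * (z \<bullet> z) * (w z)\<^sup>2\<bar> = 4 * (x * (b * norm z))"
        by (simp add: abs_mult x_def b_def power2_eq_square power2_norm_eq_inner[symmetric])
      also have "\<bar>2 * (E (z \<bullet> z))\<^sup>2 * w z * (g z \<bullet> z)\<bar> \<le> 2 * (E (z \<bullet> z))\<^sup>2 * \<bar>w z\<bar> * (norm (g z) * norm z)"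
        unfolding abs_mult using Cauchy_Schwarz_ineq2[of "g z" z] by (simp add: mult_left_mono)
      also have "(E (z \<bullet> z))\<^sup>2 = \<bar>E (z \<bullet> z)\<bar> * \<bar>E (z \<bullet> z)\<bar>" by (simp add: power2_eq_square)
      also have "2 * (\<bar>E (z \<bullet> z)\<bar> * \<bar>E (z \<bullet> z)\<bar>) * \<bar>w z\<bar> * (norm (g z) * norm z) = 2 * (x * (d * norm z))"
        unfolding x_def d_def by (simp only: mult_ac)
      also have "4 * (x * (b * norm z)) \<le> x\<^sup>2 / 4 + 16 * (b * norm z)\<^sup>2"
        using zero_le_power2[of "x / 2 - 4 * (b * norm z)"] by (simp add: power2_eq_square algebra_simps)
      also have "2 * (x * (d * norm z)) \<le> x\<^sup>2 / 4 + 4 * (d * norm z)\<^sup>2"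
        using zero_le_power2[of "x / 2 - 2 * (d * norm z)"] by (simp add: power2_eq_square algebra_simps)
      finally have "- \<Gamma> z \<le> x\<^sup>2 / 2 + (16 * (b * norm z)\<^sup>2 + 4 * (d * norm z)\<^sup>2)" by simp
      moreover have nz: "(norm z)\<^sup>2 \<le> r\<^sup>2" using False by (intro power_mono) auto
      then have "(b * norm z)\<^sup>2 \<le> b\<^sup>2 * r\<^sup>2" "(d * norm z)\<^sup>2 \<le> d\<^sup>2 * r\<^sup>2"
        unfolding power_mult_distrib by (intro mult_left_mono zero_le_power2; assumption)+
      ultimately show ?thesis unfolding eq by (simp add: algebra_simps)
    qed
  qed
  also have "\<dots> = ?I G / 2 + r\<^sup>2 * (16 * ?I M + 4 * ?I D)"
    using int[OF c(1)] int[OF c(2)] int[OF c(3)] by simp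
  finally have "real CARD('m) * ?I G \<le> ?I G / 2 + r\<^sup>2 * (16 * ?I M + 4 * ?I D)" unfolding euler by simp
  moreover have "1 * ?I G \<le> real CARD('m) * ?I G"
    by (rule mult_right_mono) (auto simp: G_def Suc_leI)
  moreover have "r\<^sup>2 * (16 * ?I M + 4 * ?I D) \<le> r\<^sup>2 * (16 * ?I M + 4 * (256 * ?I M))"
    using caccioppoli by (intro mult_left_mono) auto
  ultimately have IG: "?I G \<le> 2080 * r\<^sup>2 * ?I M" by simp
  have cT: "continuous_on T (\<lambda>z. (w z)\<^sup>2)" by (intro continuous_intros continuous_on_subset[OF cw T(2)])
  define IT where "IT = (LINT z|lebesgue_on T. (w z)\<^sup>2)"
  have "?I M \<le> (LINT z|lebesgue_on T. (4 * B\<^sup>2 / r\<^sup>2) * (w z)\<^sup>2)"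
  proof (rule integral_compact_mono[OF compact_hb c(3) T(1)])
    show "continuous_on T (\<lambda>z. (4 * B\<^sup>2 / r\<^sup>2) * (w z)\<^sup>2)" by (intro continuous_intros cT)
    fix z
    show "indicator hb z * M z \<le> indicator T z * ((4 * B\<^sup>2 / r\<^sup>2) * (w z)\<^sup>2)"
    proof (cases "z \<in> T")
      case True
      then have z: "norm z \<le> r" by (simp add: T_def)
      have "(E' (z \<bullet> z))\<^sup>2 \<le> (2 * B / r\<^sup>2)\<^sup>2" using power_mono[OF E'b abs_ge_zero, of "z \<bullet> z" 2] by simp
      then have "(E' (z \<bullet> z))\<^sup>2 * (norm z)\<^sup>2 \<le> (2 * B / r\<^sup>2)\<^sup>2 * r\<^sup>2"
      proof (rule mult_mono)
        show "(norm z)\<^sup>2 \<le> r\<^sup>2" using z by (intro power_mono) auto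
      qed auto
      also have "\<dots> = 4 * B\<^sup>2 / r\<^sup>2" using r0 by (simp add: power2_eq_square field_simps)
      finally have "(E' (z \<bullet> z))\<^sup>2 * (norm z)\<^sup>2 * (w z)\<^sup>2 \<le> 4 * B\<^sup>2 / r\<^sup>2 * (w z)\<^sup>2" by (rule mult_right_mono) simp
      moreover have "z \<in> hb" using True T(2) by blast
      ultimately show ?thesis using True by (simp add: M_def mult_ac)
    next
      case False
      then have "z \<notin> H \<or> norm z \<le> r / 2 \<or> r \<le> norm z" by (auto simp: T_def)
      then have "z \<notin> H \<or> M z = 0" using Eon[of z] Eoff[of z] by (auto simp: M_def)
      then show ?thesis using False by auto
    qed
  qed
  also have "\<dots> = (4 * B\<^sup>2 / r\<^sup>2) * IT" by (simp add: IT_def)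
  finally have "2080 * r\<^sup>2 * ?I M \<le> 2080 * r\<^sup>2 * ((4 * B\<^sup>2 / r\<^sup>2) * IT)" by (intro mult_left_mono) auto
  also have "\<dots> = 8320 * B\<^sup>2 * IT" using r0 by simp
  finally have IG': "?I G \<le> 8320 * B\<^sup>2 * IT" using IG by linarith
  let ?Br = "H \<inter> cball 0 r"
  have Br: "compact ?Br" "?Br \<subseteq> hb" using r r0 closed_H by (auto intro: closed_Int_compact)
  have cBr: "continuous_on ?Br (\<lambda>z. (w z)\<^sup>2)" by (intro continuous_intros continuous_on_subset[OF cw Br(2)])
  have ib: "integrable lborel (\<lambda>z. indicator A z * f z)" if "compact A" "continuous_on A f" for A and f :: "real ^ 'm \<Rightarrow> real"
    using borel_integrable_compact[OF that] by (simp add: mult.commute)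
  have "(LINT z|lebesgue_on ?Br. (w z)\<^sup>2) = (LINT z|lborel. indicator ?Br z * (w z)\<^sup>2)"
    by (rule integral_lebesgue_on_lborel[OF Br(1) cBr])
  also have "\<dots> \<le> (LINT z|lborel. indicator hb z * G z + indicator T z * (w z)\<^sup>2)"
  proof (rule integral_mono[OF ib[OF Br(1) cBr]])
    show "integrable lborel (\<lambda>z. indicator hb z * G z + indicator T z * (w z)\<^sup>2)"
      by (intro Bochner_Integration.integrable_add ib compact_hb c T cT)
    fix z
    have G0: "0 \<le> G z" by (simp add: G_def)
    show "indicator ?Br z * (w z)\<^sup>2 \<le> indicator hb z * G z + indicator T z * (w z)\<^sup>2"
    proof (cases "z \<in> ?Br \<and> z \<notin> T")
      case True
      then have "norm z \<le> r / 2" by (auto simp: T_def)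
      then have "G z = (w z)\<^sup>2" using Eon[of z] by (simp add: G_def)
      then show ?thesis using True Br(2) by auto
    qed (use G0 in \<open>auto simp: indicator_def\<close>)
  qed
  also have "\<dots> = ?I G + IT"
    unfolding IT_def integral_lebesgue_on_lborel[OF compact_hb c(1)] integral_lebesgue_on_lborel[OF T(1) cT]
    by (rule Bochner_Integration.integral_add[OF ib[OF compact_hb c(1)] ib[OF T(1) cT]])
  also have "\<dots> \<le> ball_constant * IT" using IG' by (simp add: ball_constant_def B_def algebra_simps)
  finally show ?thesis by (simp add: IT_def T_def)
qed

context thin_obstacle_problem
begin

lemma ball_le_annulus_flat:
  assumes y: "y $ N = 0" and r: "0 < r" "norm y + 2 * r < 1"
  shows "(LINT z|lebesgue_on (upper_half N \<inter> cball 0 r). (w (y + z))\<^sup>2)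
    \<le> ball_constant * (LINT z|lebesgue_on (upper_half N \<inter> {z. r / 2 \<le> norm z \<and> norm z \<le> r}). (w (y + z))\<^sup>2)"
proof -
  have R: "0 < 2 * r" using r by simp
  have e: "elliptic_matrix (a (y + z))" if "z \<in> upper_half N \<inter> cball 0 (2 * r)" for z
    using translate_half[OF that y r(2)] by (rule elliptic)
  show ?thesis
  proof (rule cone_setting.ball_le_annulus[OF cone_upper_half[OF R] refl cont_translate[OF cont_w y r(2)]
        cont_translate[OF cont_gw y r(2)] cont_translate[OF A3(2) y r(2)]])
    show "((\<lambda>t. w (y + t *\<^sub>R z)) has_real_derivative gw (y + t *\<^sub>R z) \<bullet> z) (at t)"
      if "z \<in> upper_half N" "0 < t" "norm (t *\<^sub>R z) < 2 * r" for z t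
      using that r by (intro ray_deriv[OF y]) auto
    show "(norm x)\<^sup>2 / 2 \<le> (a (y + z) *v x) \<bullet> x" if "z \<in> upper_half N \<inter> cball 0 (2 * r)" for z x
      by (rule elliptic_matrix.lower[OF e[OF that]])
    show "norm (a (y + z) *v x) \<le> 2 * norm x" if "z \<in> upper_half N \<inter> cball 0 (2 * r)" for z x
      by (rule elliptic_matrix.norm_le[OF e[OF that]])
    show "(LINT z|lebesgue_on (upper_half N \<inter> cball 0 (2 * r)). F (z \<bullet> z) * ((a (y + z) *v gw (y + z)) \<bullet> gw (y + z))
      + 2 * F' (z \<bullet> z) * w (y + z) * ((a (y + z) *v gw (y + z)) \<bullet> z)) = 0"
      if "\<And>q. (F has_real_derivative F' q) (at q)" "continuous_on UNIV F'"
        "\<And>z :: real ^ ('n option). 2 * r / 2 \<le> norm z \<Longrightarrow> F (z \<bullet> z) = 0 \<and> F' (z \<bullet> z) = 0" for F F'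
      using outer_variation[OF y R r(2), of "mat 1" F F'] that by simp
  qed
qed

end

section \<open>Vanishing orders\<close>

lemma half_ball_borel: "half_ball x r \<in> sets borel"
proof -
  have "half_ball x r = upper_half None \<inter> ball x r" by (auto simp: half_ball_def upper_half_def dist_commute)
  then show ?thesis by (simp add: closed_upper_half borel_closed borel_open sets.Int)
qed

lemma half_annulus_lmeasurable: "half_annulus x r s \<in> lmeasurable"
proof -
  have "half_annulus x r s \<in> sets borel" unfolding half_annulus_def by (intro sets.Diff half_ball_borel)
  moreover have "half_annulus x r s \<subseteq> ball x s" by (auto simp: half_annulus_def half_ball_def dist_commute)
  ultimately show ?thesis by (intro fmeasurableI2[OF lmeasurable_ball]) auto
qed

lemma half_annulus_measure_le:
  fixes x :: "real ^ ('n::finite option)"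
  assumes "0 \<le> r"
  shows "measure lebesgue (half_annulus x s r) \<le> unit_ball_vol CARD('n option) * r ^ CARD('n option)"
proof -
  have "measure lebesgue (half_annulus x s r) \<le> measure lebesgue (ball x r)"
    by (rule measure_mono_fmeasurable)
      (auto simp: half_annulus_def half_ball_def dist_commute intro: half_annulus_lmeasurable[unfolded half_annulus_def half_ball_def, THEN fmeasurableD])
  then show ?thesis using assms by (simp add: content_ball)
qed

lemma half_annulus_measure_ge:
  fixes x :: "real ^ ('n::finite option)"
  assumes x: "x $ None = 0" and r: "0 < r"
  shows "unit_ball_vol CARD('n option) * (r / 8) ^ CARD('n option) \<le> measure lebesgue (half_annulus x (r / 2) r)"
proof -
  \<comment> \<open>Height \<open>3 / 4 * r\<close> is the middle of the annulus, with room
    \<open>r / 4\<close> on either side for the ball of radius \<open>r / 8\<close>.\<close>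
  let ?y = "x + (3 / 4 * r) *\<^sub>R axis None 1"
  have d: "dist ?y x = 3 / 4 * r" using r by (simp add: dist_norm norm_axis_1)
  have "ball ?y (r / 8) \<subseteq> half_annulus x (r / 2) r"
  proof
    fix z assume "z \<in> ball ?y (r / 8)"
    then have z: "dist ?y z < r / 8" by simp
    have "\<bar>(z - ?y) $ None\<bar> < r / 8"
      using component_le_norm_cart[of "z - ?y" None] z by (simp only: dist_norm norm_minus_commute)
    then have "\<bar>z $ None - 3 / 4 * r\<bar> < r / 8" using x by (simp add: axis_def)
    then have "0 \<le> z $ None" using r by linarith
    moreover have "dist z x < r" "r / 2 \<le> dist z x"
      using z d dist_triangle[of z x ?y] dist_triangle[of ?y x z] r by (simp_all add: dist_commute)
    ultimately show "z \<in> half_annulus x (r / 2) r" by (simp add: half_annulus_def half_ball_def)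
  qed
  then have "measure lebesgue (ball ?y (r / 8)) \<le> measure lebesgue (half_annulus x (r / 2) r)"
    by (intro measure_mono_fmeasurable half_annulus_lmeasurable) auto
  then show ?thesis using r by (simp add: content_ball)
qed

definition annulus_mean :: "(real ^ ('n::finite option) \<Rightarrow> real) \<Rightarrow> real ^ ('n option) \<Rightarrow> real \<Rightarrow> real"
  where "annulus_mean w x r = 1 / measure lebesgue (half_annulus x (r / 2) r) * (LINT z|lebesgue_on (half_annulus x (r / 2) r). (w z)\<^sup>2)"

lemma vanishing_order_eq:
  "vanishing_order w x = Limsup (at_right 0) (\<lambda>r. ereal_ln (sqrt (annulus_mean w x r)) / ereal (ln r))"
  by (simp add: vanishing_order_def annulus_mean_def)

lemma annulus_mean_nonneg: "0 \<le> annulus_mean w x r"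
  unfolding annulus_mean_def by (intro mult_nonneg_nonneg) auto

text \<open>A limit superior above \<open>k\<close> leaves arbitrarily small radii with quotient
  above \<open>k\<close>; since \<open>ln r < 0\<close>, clearing the denominator reverses the
  inequality into smallness of the mean. A zero mean is consistent with this: its quotient is plus
  infinity.\<close>

lemma less_vanishing_order:
  fixes w :: "real ^ ('n::finite option) \<Rightarrow> real" and k :: real
  assumes k: "ereal k < vanishing_order w x" and x: "x $ None = 0" and \<delta>: "0 < \<delta>"
  shows "\<exists>r. 0 < r \<and> r < \<delta> \<and> (LINT z|lebesgue_on (half_annulus x (r / 2) r). (w z)\<^sup>2)
    \<le> unit_ball_vol CARD('n option) * r powr (CARD('n option) + 2 * k)"
proof -
  let ?q = "\<lambda>r. ereal_ln (sqrt (annulus_mean w x r)) / ereal (ln r)"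
  have "\<not> (\<forall>\<^sub>F r in at_right 0. ?q r \<le> ereal k)"
    using k Limsup_bounded[of ?q "ereal k" "at_right 0"] unfolding vanishing_order_eq by fastforce
  moreover have "\<forall>\<^sub>F r in at_right 0. ?q r \<le> ereal k"
    if no: "\<And>r. 0 < r \<Longrightarrow> r < min \<delta> 1 \<Longrightarrow> ?q r \<le> ereal k"
    using no \<delta> by (intro eventually_at_rightI[of 0 "min \<delta> 1"]) auto
  ultimately obtain r where r: "0 < r" "r < \<delta>" "r < 1" "ereal k < ?q r" by (meson min_less_iff_conj not_le)
  define I where "I = (LINT z|lebesgue_on (half_annulus x (r / 2) r). (w z)\<^sup>2)"
  define m where "m = measure lebesgue (half_annulus x (r / 2) r)"
  have "0 < unit_ball_vol CARD('n option) * (r / 8) ^ CARD('n option)" using r by (intro mult_pos_pos zero_less_power) auto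
  with half_annulus_measure_ge[OF x r(1)] have m: "0 < m" unfolding m_def by (rule less_le_trans[rotated])
  have mean: "I = m * annulus_mean w x r" using m by (simp add: annulus_mean_def I_def m_def)
  have lnr: "ln r < 0" using r by simp
  have A: "annulus_mean w x r \<le> r powr (2 * k)"
  proof (cases "annulus_mean w x r = 0")
    case False
    define v where "v = annulus_mean w x r"
    have v: "0 < v" using False annulus_mean_nonneg[of w x r] by (simp add: v_def)
    have "ereal k < ereal (ln (sqrt v) / ln r)" using r(4) v lnr by (simp add: ereal_ln_def v_def[symmetric])
    then have "ln (sqrt v) < k * ln r" using lnr by (simp add: neg_less_divide_eq)
    then have "ln v < 2 * k * ln r" using v by (simp add: ln_sqrt)
    then have "v < exp (2 * k * ln r)" using v by (metis exp_less_mono exp_ln)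
    then show ?thesis using r by (simp add: powr_def v_def)
  qed simp
  have "I \<le> (unit_ball_vol CARD('n option) * r ^ CARD('n option)) * r powr (2 * k)"
    unfolding mean using A half_annulus_measure_le[of r x "r / 2"] r(1) annulus_mean_nonneg
    by (intro mult_mono) (auto simp: m_def)
  also have "\<dots> = unit_ball_vol CARD('n option) * r powr (CARD('n option) + 2 * k)"
    using r(1) by (simp add: powr_add powr_realpow[symmetric])
  finally show ?thesis using r(1,2) unfolding I_def by blast
qed

text \<open>A constant factor is negligible against \<open>ln r\<close>: below the radius
  \<open>r2\<close> it is absorbed at the cost of \<open>e\<close> in the order.\<close>

lemma vanishing_order_ge:
  fixes w :: "real ^ ('n::finite option) \<Rightarrow> real" and k C r1 :: real
  assumes x: "x $ None = 0" and r1: "0 < r1"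
    and I: "\<And>r. 0 < r \<Longrightarrow> r < r1 \<Longrightarrow> (LINT z|lebesgue_on (half_annulus x (r / 2) r). (w z)\<^sup>2) \<le> C * r powr (CARD('n option) + 2 * k)"
  shows "ereal k \<le> vanishing_order w x"
proof (rule ereal_le_epsilon2)
  fix e :: real assume e: "0 < e"
  define C' where "C' = max 1 (C * 8 ^ CARD('n option) / unit_ball_vol CARD('n option))"
  define r2 where "r2 = min (min r1 1) (C' powr (- 1 / (2 * e)))"
  have C': "1 \<le> C'" by (simp add: C'_def)
  have r2: "0 < r2" using r1 C' by (simp add: r2_def)
  have "ereal (k - e) \<le> vanishing_order w x"
    unfolding vanishing_order_eq
  proof (rule le_Limsup)
    have "ereal (k - e) \<le> ereal_ln (sqrt (annulus_mean w x r)) / ereal (ln r)" if r: "0 < r" "r < r2" for r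
    proof -
      have lnr: "ln r < 0" using r by (simp add: r2_def)
      define m where "m = measure lebesgue (half_annulus x (r / 2) r)"
      define \<omega> where "\<omega> = unit_ball_vol CARD('n option)"
      have \<omega>: "0 < \<omega>" by (simp add: \<omega>_def)
      have m: "\<omega> * (r / 8) ^ CARD('n option) \<le> m" unfolding m_def \<omega>_def by (rule half_annulus_measure_ge[OF x r(1)])
      have m0: "0 < \<omega> * (r / 8) ^ CARD('n option)" using \<omega> r by simp
      have "annulus_mean w x r = (LINT z|lebesgue_on (half_annulus x (r / 2) r). (w z)\<^sup>2) / m" by (simp add: annulus_mean_def m_def)
      also have "\<dots> \<le> (LINT z|lebesgue_on (half_annulus x (r / 2) r). (w z)\<^sup>2) / (\<omega> * (r / 8) ^ CARD('n option))"
        using m m0 by (intro divide_left_mono) auto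
      also have "\<dots> \<le> C * r powr (CARD('n option) + 2 * k) / (\<omega> * (r / 8) ^ CARD('n option))"
        using I[of r] r m0 by (intro divide_right_mono) (auto simp: r2_def)
      also have "\<dots> = (C * 8 ^ CARD('n option) / \<omega>) * r powr (2 * k)"
        using r \<omega> by (simp add: powr_add powr_realpow power_divide)
      also have "\<dots> \<le> C' * r powr (2 * k)" by (intro mult_right_mono) (simp_all add: C'_def \<omega>_def)
      finally have mean: "annulus_mean w x r \<le> C' * r powr (2 * k)" .
      have "r powr (2 * e) \<le> (C' powr (- 1 / (2 * e))) powr (2 * e)" using r e by (intro powr_mono2) (auto simp: r2_def)
      also have "\<dots> = C' powr (- 1)" using e unfolding powr_powr by simp
      also have "\<dots> = 1 / C'" using C' by (simp add: powr_minus_divide)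
      finally have "C' * r powr (2 * e) \<le> 1" using C' by (simp add: field_simps)
      then have "C' * r powr (2 * e) * r powr (2 * k - 2 * e) \<le> 1 * r powr (2 * k - 2 * e)" by (rule mult_right_mono) simp
      then have "C' * r powr (2 * k) \<le> r powr (2 * (k - e))" by (simp add: mult.assoc powr_add[symmetric] right_diff_distrib)
      with mean have A: "annulus_mean w x r \<le> r powr (2 * (k - e))" by linarith
      show ?thesis
      proof (cases "annulus_mean w x r = 0")
        case True
        then show ?thesis using lnr by (simp add: ereal_ln_def divide_ereal_def)
      next
        case False
        define v where "v = annulus_mean w x r"
        have v: "0 < v" using False annulus_mean_nonneg[of w x r] by (simp add: v_def)
        have "ln v \<le> ln (r powr (2 * (k - e)))" using A v by (intro ln_mono) (auto simp: v_def)
        also have "\<dots> = 2 * (k - e) * ln r" using r by (simp add: ln_powr)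
        finally have "ln v \<le> 2 * ((k - e) * ln r)" by (simp only: mult.assoc)
        moreover have "ln (sqrt v) = ln v / 2" using v by (simp add: ln_sqrt)
        ultimately have "ln (sqrt v) \<le> (k - e) * ln r" by linarith
        then have "k - e \<le> ln (sqrt v) / ln r" using lnr by (simp add: neg_le_divide_eq)
        then show ?thesis using v lnr by (simp add: ereal_ln_def v_def[symmetric])
      qed
    qed
    then show "\<forall>\<^sub>F r in at_right 0. ereal (k - e) \<le> ereal_ln (sqrt (annulus_mean w x r)) / ereal (ln r)"
      using r2 by (intro eventually_at_rightI[of 0 r2]) auto
  qed simp
  then show "ereal k \<le> vanishing_order w x + ereal e"
    by (cases "vanishing_order w x") auto
qed

lemma integral_translate_annulus:
  fixes f :: "real ^ ('n::finite option) \<Rightarrow> real" and \<rho>1 \<rho>2 :: real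
  assumes f: "continuous_on (half_ball 0 1) f" and y: "y $ None = 0" "norm y + \<rho>2 < 1"
  shows "(LINT z|lebesgue_on (upper_half None \<inter> {z. \<rho>1 \<le> norm z \<and> norm z \<le> \<rho>2}). f (y + z))
    = (LINT x|lebesgue_on (upper_half None \<inter> {x. \<rho>1 \<le> dist x y \<and> dist x y \<le> \<rho>2}). f x)"
    (is "?L = ?R")
    and "compact (upper_half None \<inter> {x. \<rho>1 \<le> dist x y \<and> dist x y \<le> \<rho>2})"
    and "upper_half None \<inter> {x. \<rho>1 \<le> dist x y \<and> dist x y \<le> \<rho>2} \<subseteq> half_ball 0 1"
proof -
  let ?K = "\<lambda>y::real ^ ('n option). upper_half None \<inter> {x. \<rho>1 \<le> dist x y \<and> dist x y \<le> \<rho>2}"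
  have cK: "compact (?K y)" for y :: "real ^ ('n option)"
  proof -
    have "?K y = (upper_half None \<inter> {x. \<rho>1 \<le> dist x y}) \<inter> cball y \<rho>2" by (auto simp: dist_commute)
    then show ?thesis by (auto intro!: closed_Int_compact closed_Int closed_upper_half closed_Collect_le continuous_intros)
  qed
  then show "compact (?K y)" .
  show sub: "?K y \<subseteq> half_ball 0 1"
  proof
    fix x assume x: "x \<in> ?K y"
    then have "norm x \<le> norm y + \<rho>2" using norm_triangle_ineq2[of x y] by (simp add: dist_norm)
    then show "x \<in> half_ball 0 1" using x y by (simp add: half_ball_def upper_half_def)
  qed
  have K0: "upper_half None \<inter> {z. \<rho>1 \<le> norm z \<and> norm z \<le> \<rho>2} = ?K 0" by auto
  have cf: "continuous_on (?K y) f" by (rule continuous_on_subset[OF f sub])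
  have "?R = \<bar>1\<bar> ^ DIM(real ^ ('n option)) * (LINT z|lebesgue_on (?K 0). f (y + 1 *\<^sub>R z))"
  proof (rule integral_affine_compact[OF _ cK cK cf])
    show "continuous_on (?K 0) (\<lambda>z. f (y + 1 *\<^sub>R z))"
      by (rule continuous_on_compose2[OF cf], intro continuous_intros) (use y in \<open>auto simp: upper_half_def dist_norm\<close>)
    show "indicator (?K y) (y + 1 *\<^sub>R z) * f (y + 1 *\<^sub>R z) = indicator (?K 0) z * f (y + 1 *\<^sub>R z)" for z
      using y by (simp add: indicator_def upper_half_def dist_norm)
  qed simp
  then show "?L = ?R" unfolding K0 by simp
qed

text \<open>The half annulus omits the outer sphere, a null set; the closed version is compact, as
  the integral lemmas require.\<close>

lemma half_annulus_integral:
  fixes f :: "real ^ ('n::finite option) \<Rightarrow> real" and \<rho> :: real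
  assumes f: "continuous_on (half_ball 0 1) f" and y: "y $ None = 0" "norm y + \<rho> < 1"
  shows "(LINT x|lebesgue_on (half_annulus y (\<rho> / 2) \<rho>). f x)
    = (LINT x|lebesgue_on (upper_half None \<inter> {x. \<rho> / 2 \<le> dist x y \<and> dist x y \<le> \<rho>}). f x)"
proof -
  let ?A = "half_annulus y (\<rho> / 2) \<rho>" and ?B = "upper_half None \<inter> {x. \<rho> / 2 \<le> dist x y \<and> dist x y \<le> \<rho>}"
  note B = integral_translate_annulus(2,3)[OF f y, of "\<rho> / 2"]
  have A: "?A \<in> sets lebesgue" using half_annulus_lmeasurable by (rule fmeasurableD)
  have n: "sphere y \<rho> \<in> null_sets lebesgue" using negligible_sphere by (simp add: negligible_iff_null_sets)
  have Bs: "?B \<in> sets lebesgue" using B(1) by (simp add: borel_compact)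
  have fB: "(\<lambda>x. indicator ?B x *\<^sub>R f x) \<in> borel_measurable lebesgue"
  proof (rule borel_measurable_integrable)
    show "integrable lebesgue (\<lambda>x. indicator ?B x *\<^sub>R f x)"
      using integrable_on_compact[OF B(1) continuous_on_subset[OF f B(2)]] Bs
      by (simp add: integrable_restrict_space)
  qed
  have eq: "indicator ?A x *\<^sub>R f x = indicator ?A x *\<^sub>R (indicator ?B x *\<^sub>R f x)" for x
    by (auto simp: indicator_def half_annulus_def half_ball_def upper_half_def)
  have "(LINT x|lebesgue. indicator ?A x *\<^sub>R f x) = (LINT x|lebesgue. indicator ?B x *\<^sub>R f x)"
  proof (rule integral_cong_AE)
    show "(\<lambda>x. indicator ?A x *\<^sub>R f x) \<in> borel_measurable lebesgue"
      unfolding eq by (intro borel_measurable_scaleR fB borel_measurable_indicator A)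
    show "AE x in lebesgue. indicator ?A x *\<^sub>R f x = indicator ?B x *\<^sub>R f x"
      using AE_not_in[OF n] by eventually_elim
        (auto simp: indicator_def half_annulus_def half_ball_def upper_half_def dist_commute)
  qed (rule fB)
  then show ?thesis using A Bs by (simp add: integral_restrict_space)
qed

section \<open>Semicontinuity of the vanishing order\<close>

context thin_obstacle_problem
begin

lemma cont_w2: "continuous_on (half_ball 0 1) (\<lambda>x. (w x)\<^sup>2)"
  by (intro continuous_intros cont_w)

lemma half_annulus_integral_translate:
  assumes "y $ N = 0" "norm y + \<rho> < 1"
  shows "(LINT x|lebesgue_on (half_annulus y (\<rho> / 2) \<rho>). (w x)\<^sup>2)
    = (LINT z|lebesgue_on (upper_half N \<inter> {z. \<rho> / 2 \<le> norm z \<and> norm z \<le> \<rho>}). (w (y + z))\<^sup>2)"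
  unfolding half_annulus_integral[OF cont_w2 assms] integral_translate_annulus[OF cont_w2 assms] ..

lemma w_bounded:
  assumes "r0 < 1"
  shows "\<exists>M\<ge>0. \<forall>x\<in>upper_half N \<inter> cball 0 r0. (w x)\<^sup>2 \<le> M"
proof -
  have "upper_half N \<inter> cball 0 r0 \<subseteq> half_ball 0 1" using assms by (auto simp: mem_half upper_half_def)
  moreover have "compact (upper_half N \<inter> cball 0 r0)" by (simp add: closed_upper_half closed_Int_compact)
  ultimately have "bounded ((\<lambda>x. (w x)\<^sup>2) ` (upper_half N \<inter> cball 0 r0))"
    by (intro compact_imp_bounded compact_continuous_image continuous_on_subset[OF cont_w2])
  then obtain M where "\<And>x. x \<in> upper_half N \<inter> cball 0 r0 \<Longrightarrow> \<bar>(w x)\<^sup>2\<bar> \<le> M"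
    unfolding bounded_iff by (metis imageI real_norm_def)
  then show ?thesis by (intro exI[of _ "max M 0"]) (auto simp: max.coboundedI1)
qed

lemma ball_mass_le:
  assumes y: "y $ N = 0" "norm y + R \<le> r0" and r0: "r0 < 1" and R: "0 \<le> R"
    and M: "\<And>x. x \<in> upper_half N \<inter> cball 0 r0 \<Longrightarrow> (w x)\<^sup>2 \<le> M" "0 \<le> M"
  shows "(LINT z|lebesgue_on (upper_half N \<inter> cball 0 R). (w (y + z))\<^sup>2) \<le> M * (unit_ball_vol CARD('n option) * R ^ CARD('n option))"
proof -
  have "(LINT z|lebesgue_on (upper_half N \<inter> cball 0 R). (w (y + z))\<^sup>2) \<le> (LINT z|lebesgue_on (cball (0 :: real ^ ('n option)) R). M)"
  proof (rule integral_compact_mono)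
    show "compact (upper_half N \<inter> cball 0 R)" by (simp add: closed_upper_half closed_Int_compact)
    show "continuous_on (upper_half N \<inter> cball 0 R) (\<lambda>z. (w (y + z))\<^sup>2)"
      using cont_translate[OF cont_w2 y(1), of R] y r0 by simp
    fix z :: "real ^ ('n option)"
    show "indicator (upper_half N \<inter> cball 0 R) z * (w (y + z))\<^sup>2 \<le> indicator (cball 0 R) z * M"
    proof (cases "z \<in> upper_half N \<inter> cball 0 R")
      case True
      then have "y + z \<in> upper_half N \<inter> cball 0 r0"
        using y norm_triangle_ineq[of y z] by (simp add: upper_half_def)
      then show ?thesis using M(1) True by simp
    qed (use M(2) in simp)
  qed auto
  also have "\<dots> = measure lebesgue (cball 0 R :: (real ^ ('n option)) set) * M"
    by (simp add: measure_restrict_space)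
  also have "\<dots> = M * (unit_ball_vol CARD('n option) * R ^ CARD('n option))"
    using R by (simp add: content_cball)
  finally show ?thesis .
qed

text \<open>Local boundedness of \<open>w\<close> suffices. The purpose is that every number above
  the order at a point is positive, as the dilation argument requires of
  \<open>\<kappa>\<close>.\<close>

lemma vanishing_order_nonneg:
  assumes x: "x \<in> flat_ball 1"
  shows "0 \<le> vanishing_order w x"
proof -
  have xN: "x $ N = 0" and x1: "norm x < 1" using x by (auto simp: flat_ball_def half_ball_def)
  define r0 where "r0 = (1 + norm x) / 2"
  have r0: "r0 < 1" "norm x < r0" using x1 by (auto simp: r0_def)
  obtain M where M: "0 \<le> M" "\<And>z. z \<in> upper_half N \<inter> cball 0 r0 \<Longrightarrow> (w z)\<^sup>2 \<le> M" using w_bounded[OF r0(1)] by blast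
  have "ereal 0 \<le> vanishing_order w x"
  proof (rule vanishing_order_ge[OF xN, of "r0 - norm x" w "M * unit_ball_vol CARD('n option)"])
    fix r assume r: "0 < r" "r < r0 - norm x"
    then have nr: "norm x + r < 1" using r0 by simp
    have "(LINT z|lebesgue_on (half_annulus x (r / 2) r). (w z)\<^sup>2) = (LINT z|lebesgue_on (upper_half N \<inter> {z. r / 2 \<le> norm z \<and> norm z \<le> r}). (w (x + z))\<^sup>2)"
      by (rule half_annulus_integral_translate[OF xN nr])
    also have "\<dots> \<le> (LINT z|lebesgue_on (upper_half N \<inter> cball 0 r). (w (x + z))\<^sup>2)"
    proof (rule integral_compact_mono)
      have e: "upper_half N \<inter> {z. r / 2 \<le> norm z \<and> norm z \<le> r} = upper_half N \<inter> {z. r / 2 \<le> dist z 0 \<and> dist z 0 \<le> r}" by simp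
      show "compact (upper_half N \<inter> {z. r / 2 \<le> norm z \<and> norm z \<le> r})"
        unfolding e by (rule integral_translate_annulus(2)[OF cont_w2]) (use nr r in \<open>auto intro: le_less_trans[rotated]\<close>)
      show "compact (upper_half N \<inter> cball 0 r)" by (simp add: closed_upper_half closed_Int_compact)
      show c: "continuous_on (upper_half N \<inter> cball 0 r) (\<lambda>z. (w (x + z))\<^sup>2)"
        by (rule cont_translate[OF cont_w2 xN nr])
      show "continuous_on (upper_half N \<inter> {z. r / 2 \<le> norm z \<and> norm z \<le> r}) (\<lambda>z. (w (x + z))\<^sup>2)"
        by (rule continuous_on_subset[OF c]) auto
    qed (auto simp: indicator_def)
    also have "\<dots> \<le> M * (unit_ball_vol CARD('n option) * r ^ CARD('n option))"
      by (rule ball_mass_le[OF xN _ r0(1) _ M(2,1)]) (use r in auto)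
    also have "r ^ CARD('n option) = r powr (real CARD('n option) + 2 * 0)"
      unfolding mult_zero_right add_0_right by (rule powr_realpow[OF r(1), symmetric])
    also have "M * (unit_ball_vol CARD('n option) * r powr (real CARD('n option) + 2 * 0)) =
      M * unit_ball_vol CARD('n option) * r powr (real CARD('n option) + 2 * 0)" by (rule mult.assoc[symmetric])
    finally show "(LINT z|lebesgue_on (half_annulus x (r / 2) r). (w z)\<^sup>2) \<le> \<dots>" .
  qed (use r0 in simp)
  then show ?thesis by (simp add: zero_ereal_def)
qed

text \<open>At each scale \<open>r\<close> a fresh point \<open>y\<close>, within
  \<open>r / 4\<close> of \<open>x0\<close>, and a radius \<open>\<rho>\<close> below
  \<open>r / 4\<close> are chosen. The decay around \<open>y\<close> from \<open>\<rho>\<close> up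
  to \<open>2 * r\<close> controls the annulus of radius \<open>r\<close> around \<open>x0\<close>,
  with a constant independent of both choices.\<close>

lemma vanishing_order_limit:
  fixes \<kappa> \<gamma> :: real
  assumes x0: "x0 \<in> flat_ball 1" and \<kappa>: "0 < \<kappa>" and \<gamma>: "0 < \<gamma>" "\<gamma> \<le> \<gamma>0"
    and freq: "\<And>e. 0 < e \<Longrightarrow> \<exists>y\<in>flat_ball 1. dist y x0 < e \<and> ereal \<kappa> < vanishing_order w y"
  shows "ereal (\<kappa> - \<gamma> / 2) \<le> vanishing_order w x0"
proof -
  let ?H = "upper_half N :: (real ^ ('n option)) set"
  define d where "d = real CARD('n option)"
  define \<omega> where "\<omega> = unit_ball_vol CARD('n option)"
  have \<omega>: "0 < \<omega>" by (simp add: \<omega>_def)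
  have x0N: "x0 $ N = 0" and x01: "norm x0 < 1" using x0 by (auto simp: flat_ball_def half_ball_def)
  define r0 where "r0 = (1 + norm x0) / 2"
  define R where "R = (1 - norm x0) / 8"
  have R: "0 < R" "R \<le> 1" "norm x0 + 3 * R \<le> r0" and r0: "r0 < 1" using x01 by (auto simp: R_def r0_def field_simps)
  obtain M where M: "0 \<le> M" "\<And>z. z \<in> ?H \<inter> cball 0 r0 \<Longrightarrow> (w z)\<^sup>2 \<le> M" using w_bounded[OF r0(1)] by blast
  obtain Ca where Ca: "\<And>y R. y $ N = 0 \<Longrightarrow> 0 < R \<Longrightarrow> norm y + 2 * R \<le> r0 \<Longrightarrow>
    dilation_setting ?H R (\<lambda>z. w (y + z)) (\<lambda>z. gw (y + z)) (\<lambda>z. a (y + z)) (a y) (matrix_inv (a y)) Ca \<gamma>"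
    using dilation_settings[OF r0 \<gamma>] by blast
  have card: "2 \<le> CARD('n option)" using zero_less_card_finite[where 'a='n] by simp
  obtain K b0 where K: "0 \<le> K" and decay: "\<And>H R w g a A P sb r \<rho>.
    dilation_setting (H :: (real ^ ('n option)) set) R w g a A P Ca \<gamma> \<Longrightarrow> R \<le> 1 \<Longrightarrow> sb + 6 \<le> ln (R\<^sup>2 / 8) \<Longrightarrow> sb \<le> b0 \<Longrightarrow>
    0 < r \<Longrightarrow> ln (r\<^sup>2 / 2) - 2 \<le> sb \<Longrightarrow> 0 < \<rho> \<Longrightarrow> ln (2 * \<rho>\<^sup>2) \<le> sb - 1 \<Longrightarrow>
    (LINT z|lebesgue_on (H \<inter> {z. r \<le> norm z \<and> norm z \<le> \<rho>}). (w z)\<^sup>2) \<le>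
      \<rho> powr (d + 2 * \<kappa> - \<gamma>) * (K * (r powr (- d - 2 * \<kappa>) * (LINT z|lebesgue_on (H \<inter> cball 0 r). (w z)\<^sup>2)
      + exp (- (d / 2 + \<kappa>) * (sb - 4)) * (LINT z|lebesgue_on (H \<inter> cball 0 R). (w z)\<^sup>2)))"
  proof -
    note D = dilation_decay[OF \<kappa> card \<gamma>(1), of Ca, folded d_def]
    from D obtain K b0 where K: "0 \<le> K" "\<forall>H R w g a A P sb r \<rho>.
      dilation_setting (H :: (real ^ ('n option)) set) R w g a A P Ca \<gamma> \<longrightarrow> R \<le> 1 \<longrightarrow> sb + 6 \<le> ln (R\<^sup>2 / 8) \<longrightarrow> sb \<le> b0 \<longrightarrow>
      0 < r \<longrightarrow> ln (r\<^sup>2 / 2) - 2 \<le> sb \<longrightarrow> 0 < \<rho> \<longrightarrow> ln (2 * \<rho>\<^sup>2) \<le> sb - 1 \<longrightarrow>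
      (LINT z|lebesgue_on (H \<inter> {z. r \<le> norm z \<and> norm z \<le> \<rho>}). (w z)\<^sup>2) \<le>
        \<rho> powr (d + 2 * \<kappa> - \<gamma>) * (K * (r powr (- d - 2 * \<kappa>) * (LINT z|lebesgue_on (H \<inter> cball 0 r). (w z)\<^sup>2)
        + exp (- (d / 2 + \<kappa>) * (sb - 4)) * (LINT z|lebesgue_on (H \<inter> cball 0 R). (w z)\<^sup>2)))"
      by (elim exE conjE)
    show thesis by (rule that[OF K(1)]) (rule K(2)[rule_format])
  qed
  define sb where "sb = min b0 (ln (R\<^sup>2 / 8) - 6)"
  have sb: "sb + 6 \<le> ln (R\<^sup>2 / 8)" "sb \<le> b0" by (auto simp: sb_def)
  define e where "e = exp (- (d / 2 + \<kappa>) * (sb - 4))"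
  define C where "C = 2 powr (d + 2 * \<kappa> - \<gamma>) * (K * (ball_constant * \<omega> + e * (M * (\<omega> * R ^ CARD('n option)))))"
  \<comment> \<open>The second bound gives \<open>ln (2 * (2 * r)\<^sup>2) \<le> sb - 1\<close>, the
    condition on the outer radius in the decay estimate.\<close>
  define r1 where "r1 = min (R / 2) (exp ((sb - 1) / 2) / 4)"
  have r1: "0 < r1" using R by (simp add: r1_def)
  show ?thesis
  proof (rule vanishing_order_ge[OF x0N r1])
    fix r assume r: "0 < r" "r < r1"
    have rR: "r < R / 2" using r by (simp add: r1_def)
    obtain y where y: "y \<in> flat_ball 1" "dist y x0 < min (r / 4) R" "ereal \<kappa> < vanishing_order w y"
      using freq[of "min (r / 4) R"] r R by auto
    have yN: "y $ N = 0" using y by (simp add: flat_ball_def)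
    have ny: "norm y \<le> norm x0 + R" using y(2) norm_triangle_ineq2[of y x0] by (simp add: dist_norm)
    have yR: "norm y + 2 * R \<le> r0" using ny R by linarith
    have "0 < min (r / 4) (exp (sb / 2))" using r by simp
    from less_vanishing_order[OF y(3) yN this] obtain \<rho> where \<rho>: "0 < \<rho>" "\<rho> < r / 4" "\<rho> < exp (sb / 2)"
      "(LINT z|lebesgue_on (half_annulus y (\<rho> / 2) \<rho>). (w z)\<^sup>2) \<le> \<omega> * \<rho> powr (d + 2 * \<kappa>)"
      unfolding \<omega>_def d_def by auto
    have y\<rho>: "norm y + 2 * \<rho> < 1" "norm y + \<rho> < 1" "norm y + 2 * r < 1" "norm y + R \<le> r0" using \<rho> rR yR r0 R r by auto
    have "(LINT z|lebesgue_on (?H \<inter> cball 0 \<rho>). (w (y + z))\<^sup>2)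
      \<le> ball_constant * (LINT z|lebesgue_on (?H \<inter> {z. \<rho> / 2 \<le> norm z \<and> norm z \<le> \<rho>}). (w (y + z))\<^sup>2)"
      by (rule ball_le_annulus_flat[OF yN \<rho>(1) y\<rho>(1)])
    also have "\<dots> \<le> ball_constant * (\<omega> * \<rho> powr (d + 2 * \<kappa>))"
      using \<rho>(4) unfolding half_annulus_integral_translate[OF yN y\<rho>(2)]
      by (rule mult_left_mono) (simp add: ball_constant_def)
    finally have small: "(LINT z|lebesgue_on (?H \<inter> cball 0 \<rho>). (w (y + z))\<^sup>2) \<le> ball_constant * (\<omega> * \<rho> powr (d + 2 * \<kappa>))" .
    have large: "(LINT z|lebesgue_on (?H \<inter> cball 0 R). (w (y + z))\<^sup>2) \<le> M * (\<omega> * R ^ CARD('n option))"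
      unfolding \<omega>_def by (rule ball_mass_le[OF yN y\<rho>(4) r0 _ M(2,1)]) (use R in simp)
    have "(LINT z|lebesgue_on (half_annulus x0 (r / 2) r). (w z)\<^sup>2)
      = (LINT x|lebesgue_on (?H \<inter> {x. r / 2 \<le> dist x x0 \<and> dist x x0 \<le> r}). (w x)\<^sup>2)"
      by (rule half_annulus_integral[OF cont_w2 x0N]) (use rR R r0 in linarith)
    \<comment> \<open>As \<open>y\<close> is within \<open>r / 4\<close> of \<open>x0\<close>,
      points at distance at least \<open>r / 2\<close> from \<open>x0\<close> stay farther than
      \<open>r / 4 > \<rho>\<close> from \<open>y\<close>, and points at distance at most
      \<open>r\<close> stay within \<open>2 * r\<close>.\<close>
    also have "\<dots> \<le> (LINT x|lebesgue_on (?H \<inter> {x. \<rho> \<le> dist x y \<and> dist x y \<le> 2 * r}). (w x)\<^sup>2)"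
    proof (rule integral_compact_mono)
      have x0r: "norm x0 + r < 1" using rR R r0 by linarith
      note A = integral_translate_annulus(2,3)[OF cont_w2 x0N x0r, of "r / 2"]
      note B = integral_translate_annulus(2,3)[OF cont_w2 yN y\<rho>(3), of \<rho>]
      show "compact (?H \<inter> {x. r / 2 \<le> dist x x0 \<and> dist x x0 \<le> r})" "compact (?H \<inter> {x. \<rho> \<le> dist x y \<and> dist x y \<le> 2 * r})"
        by (rule A B)+
      show "continuous_on (?H \<inter> {x. r / 2 \<le> dist x x0 \<and> dist x x0 \<le> r}) (\<lambda>x. (w x)\<^sup>2)"
        "continuous_on (?H \<inter> {x. \<rho> \<le> dist x y \<and> dist x y \<le> 2 * r}) (\<lambda>x. (w x)\<^sup>2)"
        by (rule continuous_on_subset[OF cont_w2 A(2)] continuous_on_subset[OF cont_w2 B(2)])+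
      fix x
      show "indicator (?H \<inter> {x. r / 2 \<le> dist x x0 \<and> dist x x0 \<le> r}) x * (w x)\<^sup>2
        \<le> indicator (?H \<inter> {x. \<rho> \<le> dist x y \<and> dist x y \<le> 2 * r}) x * (w x)\<^sup>2"
      proof (cases "x \<in> ?H \<inter> {x. r / 2 \<le> dist x x0 \<and> dist x x0 \<le> r}")
        case True
        then have "\<rho> \<le> dist x y \<and> dist x y \<le> 2 * r"
          using y(2) \<rho>(2) dist_triangle[of x x0 y] dist_triangle[of x y x0] by (simp add: dist_commute)
        then show ?thesis using True by simp
      qed simp
    qed
    also have "\<dots> = (LINT z|lebesgue_on (?H \<inter> {z. \<rho> \<le> norm z \<and> norm z \<le> 2 * r}). (w (y + z))\<^sup>2)"
      by (rule integral_translate_annulus(1)[OF cont_w2 yN y\<rho>(3), symmetric])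
    also have "\<dots> \<le> (2 * r) powr (d + 2 * \<kappa> - \<gamma>) * (K * (\<rho> powr (- d - 2 * \<kappa>) * (LINT z|lebesgue_on (?H \<inter> cball 0 \<rho>). (w (y + z))\<^sup>2)
      + e * (LINT z|lebesgue_on (?H \<inter> cball 0 R). (w (y + z))\<^sup>2)))"
      unfolding e_def
    proof (rule decay[OF Ca[OF yN R(1) yR] R(2) sb \<rho>(1)])
      have "\<rho>\<^sup>2 \<le> (exp (sb / 2))\<^sup>2" using \<rho> by (intro power_mono) auto
      also have "\<dots> = exp sb" by (simp add: exp_double[symmetric])
      finally have "\<rho>\<^sup>2 / 2 \<le> exp sb" using exp_ge_zero[of sb] by linarith
      then have "ln (\<rho>\<^sup>2 / 2) \<le> ln (exp sb)" using \<rho> by (intro ln_mono) auto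
      then show "ln (\<rho>\<^sup>2 / 2) - 2 \<le> sb" by simp
      have "(2 * r)\<^sup>2 \<le> (exp ((sb - 1) / 2) / 2)\<^sup>2" using r by (intro power_mono) (auto simp: r1_def)
      also have "\<dots> = exp (sb - 1) / 4" by (simp add: power_divide exp_double[symmetric])
      finally have "2 * (2 * r)\<^sup>2 \<le> exp (sb - 1)" using exp_ge_zero[of "sb - 1"] by linarith
      then have "ln (2 * (2 * r)\<^sup>2) \<le> ln (exp (sb - 1))" using r by (intro ln_mono) auto
      then show "ln (2 * (2 * r)\<^sup>2) \<le> sb - 1" by simp
    qed (use r in simp)
    also have "\<dots> \<le> (2 * r) powr (d + 2 * \<kappa> - \<gamma>) * (K * (\<rho> powr (- d - 2 * \<kappa>) * (ball_constant * (\<omega> * \<rho> powr (d + 2 * \<kappa>)))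
      + e * (M * (\<omega> * R ^ CARD('n option)))))"
      using small large K by (intro mult_left_mono add_mono) (auto simp: e_def)
    \<comment> \<open>The uncontrolled radius \<open>\<rho>\<close> drops out: the smallness at
      \<open>y\<close> is of exactly the power by which the decay estimate divides.\<close>
    also have "\<rho> powr (- d - 2 * \<kappa>) * (ball_constant * (\<omega> * \<rho> powr (d + 2 * \<kappa>))) = ball_constant * \<omega>"
    proof -
      have "\<rho> powr (- d - 2 * \<kappa>) * \<rho> powr (d + 2 * \<kappa>) = 1" using \<rho>(1) by (simp add: powr_add[symmetric])
      moreover have "\<rho> powr (- d - 2 * \<kappa>) * (ball_constant * (\<omega> * \<rho> powr (d + 2 * \<kappa>)))
        = ball_constant * \<omega> * (\<rho> powr (- d - 2 * \<kappa>) * \<rho> powr (d + 2 * \<kappa>))" by (simp only: mult_ac)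
      ultimately show ?thesis by simp
    qed
    also have "(2 * r) powr (d + 2 * \<kappa> - \<gamma>) * (K * (ball_constant * \<omega> + e * (M * (\<omega> * R ^ CARD('n option)))))
      = C * r powr (d + 2 * \<kappa> - \<gamma>)"
      using r by (simp add: C_def powr_mult)
    also have "d + 2 * \<kappa> - \<gamma> = CARD('n option) + 2 * (\<kappa> - \<gamma> / 2)" by (simp add: d_def)
    finally show "(LINT z|lebesgue_on (half_annulus x0 (r / 2) r). (w z)\<^sup>2) \<le> C * r powr (CARD('n option) + 2 * (\<kappa> - \<gamma> / 2))" .
  qed
qed

theorem upper_semicontinuous_vanishing_order: "upper_semicontinuous_on (flat_ball 1) (vanishing_order w)"
  unfolding upper_semicontinuous_on_def
proof (intro ballI allI impI)
  fix x0 c assume x0: "x0 \<in> flat_ball 1" and c: "vanishing_order w x0 < c"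
  show "\<forall>\<^sub>F y in at x0 within flat_ball 1. vanishing_order w y < c"
  proof (rule ccontr)
    assume "\<not> ?thesis"
    then have freq: "\<exists>y\<in>flat_ball 1. dist y x0 < e \<and> c \<le> vanishing_order w y" if "0 < e" for e
      using that unfolding eventually_at by (metis linorder_not_less)
    have nn: "0 \<le> vanishing_order w x0" by (rule vanishing_order_nonneg[OF x0])
    then obtain k0 where k0: "vanishing_order w x0 = ereal k0" "0 \<le> k0"
      using c by (cases "vanishing_order w x0") auto
    obtain \<kappa> where \<kappa>: "ereal k0 < ereal \<kappa>" "ereal \<kappa> < c" using ereal_dense2[OF c] k0 by auto
    \<comment> \<open>With \<open>\<gamma> \<le> \<kappa> - k0\<close> the bound
      \<open>\<kappa> - \<gamma> / 2\<close> obtained at the limit point still exceeds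
      \<open>k0\<close>.\<close>
    define \<gamma> where "\<gamma> = min \<gamma>0 (\<kappa> - k0)"
    have "ereal (\<kappa> - \<gamma> / 2) \<le> vanishing_order w x0"
    proof (rule vanishing_order_limit[OF x0])
      show "0 < \<kappa>" "0 < \<gamma>" "\<gamma> \<le> \<gamma>0" using k0 \<kappa> gamma0 by (auto simp: \<gamma>_def)
      show "\<exists>y\<in>flat_ball 1. dist y x0 < e \<and> ereal \<kappa> < vanishing_order w y" if "0 < e" for e
        using freq[OF that] \<kappa>(2) less_le_trans by blast
    qed
    then have "\<kappa> - \<gamma> / 2 \<le> k0" by (simp add: k0)
    moreover have "\<gamma> \<le> \<kappa> - k0" by (simp add: \<gamma>_def)
    ultimately show False using \<kappa>(1) by simp
  qed
qed

end

theorem proposition4p2: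
  fixes a :: "real ^ ('n::finite option) \<Rightarrow> real ^ ('n option) ^ ('n option)"
    and w :: "real ^ ('n option) \<Rightarrow> real"
    and p :: ereal
    and \<alpha> :: real
  assumes A0: "in_Lp 2 (half_ball 0 1) w" "L2_norm_on (half_ball 0 1) w = 1"
    and A1: "\<forall>x\<in>flat_ball 1. \<forall>i. a x $ Some i $ None = 0"
    and A2: "\<forall>x\<in>half_ball 0 1. transpose (a x) = a x"
      "\<forall>x\<in>half_ball 0 1. \<forall>\<mu>. eigenvalue_of (a x) \<mu> \<longrightarrow> 1 / 2 \<le> \<mu> \<and> \<mu> \<le> 2"
    and p: "ereal (real CARD('n) + 1) < p"
    and A3: "\<forall>i j. in_W1p p (interior (half_ball 0 1)) (\<lambda>x. a x $ i $ j)"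
      \<comment> \<open>\<open>a\<close> is the continuous representative, which exists since \<open>p > n + 1\<close>\<close>
      "continuous_on (half_ball 0 1) a"
    and A4: "a 0 = mat 1"
    and W: "0 < \<alpha>" "\<alpha> \<le> 1 / 2" "C1_holder_locally \<alpha> (half_ball 0 1) w"
    and solution: "thin_obstacle_solution a w"
  shows "upper_semicontinuous_on (flat_ball 1) (vanishing_order w)"
proof -
  interpret thin_obstacle_problem a w p \<alpha>
    by unfold_locales (rule A1 A2 p A3 W solution)+
  show ?thesis by (rule upper_semicontinuous_vanishing_order)
qed

end
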